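(* Let $(G,\cdot,\circ)$ be a simply connected Lie skew brace, and let $(\mathfrak{g},[\,,\,]_{\cdot},[\,,\,]_{\circ},\triangleright)$ be its associated post-Lie algebra. Let $\mathfrak{i}\subseteq\mathfrak{g}$ be an ideal of the post-Lie algebra, and assume that the quotient post-Lie algebra $\mathfrak{g}/\mathfrak{i}$ is trivial. Then there exist a connected simply connected abelian Lie group $A$ (written additively) and a Lie skew brace homomorphism $$\varphi:(G,\cdot,\circ)\to(A,+,+)$$ such that $\ker(\varphi_{*e})=\mathfrak{i}$, where $\varphi_{*e}$ is the differential of $\varphi$ at the identity. Moreover, if $K:=\ker\varphi$ and $I:=K_e$ is the identity component of $K$, then $I$ is a connected closed ideal of $(G,\cdot,\circ)$ and $\operatorname{Lie}(I)=\mathfrak{i}$. In particular, if $0\neq\mathfrak{i}\neq\mathfrak{g}$, then $(G,\cdot,\circ)$ is not simple.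
   Context: A Lie skew brace $(G,\cdot,\circ)$ is a (finite-dimensional, real) smooth manifold $G$ endowed with two Lie group structures $(G,\cdot)$ and $(G,\circ)$ such that $g\circ(h\cdot k)=(g\circ h)\cdot g^{-1}\cdot(g\circ k)$ for all $g,h,k\in G$, where $g^{-1}$ is the inverse with respect to $\cdot$. It is simply connected if the manifold $G$ is connected and simply connected. The two groups share the same identity $e$. Its lambda-action is the smooth group homomorphism $\lambda:(G,\circ)\to\operatorname{Aut}(G,\cdot)$, $\lambda_g(h):=g^{-1}\cdot(g\circ h)$. A Lie skew brace homomorphism is a smooth map that is a group homomorphism for both structures; $(A,+,+)$ denotes the Lie skew brace with both group laws equal to $+$. An ideal of a connected Lie skew brace $(G,\cdot,\circ)$ is a connected Lie subgroup $I\le G$ that is closed in $G$, normal in $(G,\cdot)$, normal in $(G,\circ)$, and satisfies $\lambda_g(I)=I$ for every $g\in G$. The Lie skew brace is simple if its only ideals are $\{e\}$ and $G$. A post-Lie algebra is a quadruple $(\mathfrak{g},[\,,\,]_{\cdot},[\,,\,]_{\circ},\triangleright)$ where $(\mathfrak{g},[\,,\,]_{\cdot})$ and $(\mathfrak{g},[\,,\,]_{\circ})$ are Lie algebras on the same finite-dimensional real vector space and $\triangleright:\mathfrak{g}\times\mathfrak{g}\to\mathfrak{g}$ is bilinear with, for all $x,y,z$: $[x,y]_{\circ}-[x,y]_{\cdot}=x\triangleright y-y\triangleright x$; $x\triangleright[y,z]_{\cdot}=[x\triangleright y,z]_{\cdot}+[y,x\triangleright z]_{\cdot}$; $[x,y]_{\circ}\triangleright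 z=x\triangleright(y\triangleright z)-y\triangleright(x\triangleright z)$. It is trivial if $[\,,\,]_{\cdot}=[\,,\,]_{\circ}=\triangleright=0$. An ideal of it is a vector subspace $\mathfrak{i}$ with $[\mathfrak{g},\mathfrak{i}]_{\cdot}\subseteq\mathfrak{i}$, $\mathfrak{g}\triangleright\mathfrak{i}\subseteq\mathfrak{i}$, $\mathfrak{i}\triangleright\mathfrak{g}\subseteq\mathfrak{i}$ (then also $[\mathfrak{g},\mathfrak{i}]_{\circ}\subseteq\mathfrak{i}$, and $\mathfrak{g}/\mathfrak{i}$ inherits a quotient post-Lie structure). The post-Lie algebra associated with a connected Lie skew brace $(G,\cdot,\circ)$ is $\mathfrak{g}=T_eG$ with $[\,,\,]_{\cdot}$ and $[\,,\,]_{\circ}$ the Lie brackets of $\operatorname{Lie}(G,\cdot)$ and $\operatorname{Lie}(G,\circ)$, and $x\triangleright y:=\lambda_{*e}(x)(y)$, i.e. $x\triangleright y=\frac{d}{dt}\big|_{t=0}(\lambda_{\gamma(t)})_{*e}(y)$ for any smooth curve $\gamma$ in $G$ with $\gamma(0)=e$, $\gamma'(0)=x$. *)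

theory Defs
  imports "HOL-Analysis.Analysis" "HOL-Algebra.Coset"
begin

section \<open>Smooth functions on open subsets of a linear subspace\<close>

text \<open>
  The model spaces of manifolds are linear subspaces \<open>V\<close> of a Euclidean space, so that a
  single type accommodates manifolds of every dimension from \<open>0\<close> up to its own dimension.
  Below, \<open>S\<close> is an open subset of \<open>V\<close>.  The derivative \<open>D x\<close> within \<open>S\<close> is then
  determined on \<open>V\<close> (only), and only its values on \<open>V\<close> are used.
\<close>

primrec Ck_on :: "nat \<Rightarrow> 'e::euclidean_space set \<Rightarrow> 'e set \<Rightarrow> ('e \<Rightarrow> 'f::euclidean_space) \<Rightarrow> bool" where
  "Ck_on 0 V S f \<longleftrightarrow> continuous_on S f"
| "Ck_on (Suc k) V S f \<longleftrightarrow>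
     (\<exists>D. (\<forall>x\<in>S. (f has_derivative D x) (at x within S)) \<and>
          (\<forall>v\<in>V. Ck_on k V S (\<lambda>x. D x v)))"

definition smooth_on :: "'e::euclidean_space set \<Rightarrow> 'e set \<Rightarrow> ('e \<Rightarrow> 'f::euclidean_space) \<Rightarrow> bool" where
  "smooth_on V S f \<longleftrightarrow> (\<forall>k. Ck_on k V S f)"


section \<open>Smooth manifolds and smooth maps\<close>

record ('a, 'e) mfd =
  mtop :: "'a topology"
  model :: "'e set"
  atlas :: "('a set \<times> ('a \<Rightarrow> 'e)) set"

abbreviation points :: "('a, 'e) mfd \<Rightarrow> 'a set" where
  "points M \<equiv> topspace (mtop M)"

definition chart :: "'a topology \<Rightarrow> 'e::euclidean_space set \<Rightarrow> 'a set \<Rightarrow> ('a \<Rightarrow> 'e) \<Rightarrow> bool" where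
  "chart X V U \<kappa> \<longleftrightarrow>
     openin X U \<and> openin (top_of_set V) (\<kappa> ` U) \<and>
     homeomorphic_map (subtopology X U) (top_of_set (\<kappa> ` U)) \<kappa>"

definition smooth_manifold :: "('a, 'e::euclidean_space) mfd \<Rightarrow> bool" where
  "smooth_manifold M \<longleftrightarrow>
     subspace (model M) \<and> Hausdorff_space (mtop M) \<and> second_countable (mtop M) \<and>
     (\<forall>(U, \<kappa>)\<in>atlas M. chart (mtop M) (model M) U \<kappa>) \<and>
     (\<Union>(U, \<kappa>)\<in>atlas M. U) = points M \<and>
     (\<forall>(U, \<kappa>)\<in>atlas M. \<forall>(W, \<psi>)\<in>atlas M.
        smooth_on (model M) (\<kappa> ` (U \<inter> W)) (\<psi> \<circ> inv_into U \<kappa>))"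

text \<open>Smoothness at \<open>p\<close> means smoothness on a neighbourhood of \<open>p\<close>.\<close>

definition smooth_at ::
    "('a, 'e::euclidean_space) mfd \<Rightarrow> ('b, 'f::euclidean_space) mfd \<Rightarrow> ('a \<Rightarrow> 'b) \<Rightarrow> 'a \<Rightarrow> bool" where
  "smooth_at M N f p \<longleftrightarrow>
     (\<exists>(U, \<kappa>)\<in>atlas M. \<exists>(W, \<psi>)\<in>atlas N. \<exists>Q.
        openin (mtop M) Q \<and> p \<in> Q \<and> Q \<subseteq> U \<and> f ` Q \<subseteq> W \<and>
        smooth_on (model M) (\<kappa> ` Q) (\<psi> \<circ> f \<circ> inv_into U \<kappa>))"

definition smooth_map ::
    "('a, 'e::euclidean_space) mfd \<Rightarrow> ('b, 'f::euclidean_space) mfd \<Rightarrow> ('a \<Rightarrow> 'b) \<Rightarrow> bool" where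
  "smooth_map M N f \<longleftrightarrow> f ` points M \<subseteq> points N \<and> (\<forall>p\<in>points M. smooth_at M N f p)"

definition real_line :: "(real, real) mfd" where
  "real_line = \<lparr>mtop = euclidean, model = UNIV, atlas = {(UNIV, \<lambda>t. t)}\<rparr>"

definition prod_mfd ::
    "('a, 'e::euclidean_space) mfd \<Rightarrow> ('b, 'f::euclidean_space) mfd \<Rightarrow> ('a \<times> 'b, 'e \<times> 'f) mfd" where
  "prod_mfd M N =
     \<lparr>mtop = prod_topology (mtop M) (mtop N),
      model = model M \<times> model N,
      atlas = {(U \<times> W, map_prod \<kappa> \<psi>) | U \<kappa> W \<psi>. (U, \<kappa>) \<in> atlas M \<and> (W, \<psi>) \<in> atlas N}\<rparr>"

text \<open>The library's \<^const>\<open>simply_connected\<close>, transferred verbatim from subsets of a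
  topological-space type to abstract topologies.\<close>

definition simply_connected_space :: "'a topology \<Rightarrow> bool" where
  "simply_connected_space X \<longleftrightarrow>
     (\<forall>p q. pathin X p \<and> p 1 = p 0 \<and> pathin X q \<and> q 1 = q 0 \<longrightarrow>
        homotopic_with (\<lambda>r. r 1 = r 0) (top_of_set {0..1}) X p q)"


section \<open>Tangent vectors\<close>

text \<open>
  A tangent vector is an equivalence class of curves, represented by the functional
  \<open>f \<mapsto> (f \<circ> \<gamma>)'(0)\<close> on the functions that are smooth near the base point.  The functional
  is extended by \<open>0\<close> to all other functions, which makes the representation unique.
  The type below serves to give functionals their pointwise vector space structure.
\<close>

typedef 'a functional = "UNIV :: (('a \<Rightarrow> real) \<Rightarrow> real) set"
  morphisms app Functional by simp

setup_lifting type_definition_functional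

instantiation functional :: (type) real_vector
begin
lift_definition zero_functional :: "'a functional" is "\<lambda>f. 0" .
lift_definition plus_functional :: "'a functional \<Rightarrow> 'a functional \<Rightarrow> 'a functional"
  is "\<lambda>x y f. x f + y f" .
lift_definition minus_functional :: "'a functional \<Rightarrow> 'a functional \<Rightarrow> 'a functional"
  is "\<lambda>x y f. x f - y f" .
lift_definition uminus_functional :: "'a functional \<Rightarrow> 'a functional" is "\<lambda>x f. - x f" .
lift_definition scaleR_functional :: "real \<Rightarrow> 'a functional \<Rightarrow> 'a functional"
  is "\<lambda>c x f. c * x f" .
instance
  by standard (transfer; simp add: fun_eq_iff algebra_simps)+
end

definition local_functional ::
    "('a, 'e::euclidean_space) mfd \<Rightarrow> 'a \<Rightarrow> (('a \<Rightarrow> real) \<Rightarrow> real) \<Rightarrow> 'a functional" where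
  "local_functional M p x = Functional (\<lambda>f. if smooth_at M real_line f p then x f else 0)"

definition velocity :: "('a, 'e::euclidean_space) mfd \<Rightarrow> (real \<Rightarrow> 'a) \<Rightarrow> 'a functional" where
  "velocity M \<gamma> = local_functional M (\<gamma> 0) (\<lambda>f. deriv (\<lambda>t. f (\<gamma> t)) 0)"

definition tangent_space :: "('a, 'e::euclidean_space) mfd \<Rightarrow> 'a \<Rightarrow> 'a functional set" where
  "tangent_space M p = {velocity M \<gamma> | \<gamma>. smooth_at real_line M \<gamma> 0 \<and> \<gamma> 0 = p}"

definition differential ::
    "('a, 'e::euclidean_space) mfd \<Rightarrow> ('b, 'f::euclidean_space) mfd \<Rightarrow> ('a \<Rightarrow> 'b) \<Rightarrow> 'a \<Rightarrow>
     'a functional \<Rightarrow> 'b functional" where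
  "differential M N \<phi> p x = local_functional N (\<phi> p) (\<lambda>f. app x (f \<circ> \<phi>))"


section \<open>Lie groups\<close>

definition lie_group :: "('a, 'e::euclidean_space) mfd \<Rightarrow> 'a monoid \<Rightarrow> bool" where
  "lie_group M G \<longleftrightarrow>
     smooth_manifold M \<and> group G \<and> carrier G = points M \<and>
     smooth_map (prod_mfd M M) M (\<lambda>(g, h). g \<otimes>\<^bsub>G\<^esub> h) \<and>
     smooth_map M M (\<lambda>g. inv\<^bsub>G\<^esub> g)"

text \<open>A vector field assigns to a point a tangent vector; \<open>X q f\<close> below is \<open>(X f)(q)\<close>.\<close>

definition field_bracket ::
    "('a, 'e::euclidean_space) mfd \<Rightarrow> ('a \<Rightarrow> 'a functional) \<Rightarrow> ('a \<Rightarrow> 'a functional) \<Rightarrow>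
     'a \<Rightarrow> 'a functional" where
  "field_bracket M X Y p =
     local_functional M p
       (\<lambda>f. app (X p) (\<lambda>q. app (Y q) f) - app (Y p) (\<lambda>q. app (X q) f))"

definition left_invariant_field ::
    "('a, 'e::euclidean_space) mfd \<Rightarrow> 'a monoid \<Rightarrow> 'a functional \<Rightarrow> 'a \<Rightarrow> 'a functional" where
  "left_invariant_field M G x g = differential M M (\<lambda>h. g \<otimes>\<^bsub>G\<^esub> h) \<one>\<^bsub>G\<^esub> x"

definition lie_bracket ::
    "('a, 'e::euclidean_space) mfd \<Rightarrow> 'a monoid \<Rightarrow> 'a functional \<Rightarrow> 'a functional \<Rightarrow> 'a functional" where
  "lie_bracket M G x y =
     field_bracket M (left_invariant_field M G x) (left_invariant_field M G y) \<one>\<^bsub>G\<^esub>"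

text \<open>
  A Lie subgroup is an immersed submanifold \<open>N\<close> whose points form a subgroup and which is a
  Lie group in its own right.  Its topology may be finer than the subspace topology.
\<close>

definition lie_subgroup :: "('a, 'e::euclidean_space) mfd \<Rightarrow> 'a monoid \<Rightarrow> ('a, 'e) mfd \<Rightarrow> bool" where
  "lie_subgroup M G N \<longleftrightarrow>
     subgroup (points N) G \<and> lie_group N (G\<lparr>carrier := points N\<rparr>) \<and>
     smooth_map N M (\<lambda>g. g) \<and>
     (\<forall>p\<in>points N. inj_on (differential N M (\<lambda>g. g) p) (tangent_space N p))"

text \<open>The Lie algebra of a Lie subgroup, as a subset of that of the ambient group.\<close>

definition lie_of_subgroup ::
    "('a, 'e::euclidean_space) mfd \<Rightarrow> 'a monoid \<Rightarrow> ('a, 'e) mfd \<Rightarrow> 'a functional set" where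
  "lie_of_subgroup M G N = differential N M (\<lambda>g. g) \<one>\<^bsub>G\<^esub> ` tangent_space N \<one>\<^bsub>G\<^esub>"


section \<open>Lie skew braces\<close>

text \<open>Throughout, \<open>G\<close> is the group \<open>(G,\<cdot>)\<close> and \<open>H\<close> is the group \<open>(G,\<circ>)\<close>.\<close>

definition lie_skew_brace :: "('a, 'e::euclidean_space) mfd \<Rightarrow> 'a monoid \<Rightarrow> 'a monoid \<Rightarrow> bool" where
  "lie_skew_brace M G H \<longleftrightarrow>
     lie_group M G \<and> lie_group M H \<and>
     (\<forall>g\<in>points M. \<forall>h\<in>points M. \<forall>k\<in>points M.
        g \<otimes>\<^bsub>H\<^esub> (h \<otimes>\<^bsub>G\<^esub> k) = (g \<otimes>\<^bsub>H\<^esub> h) \<otimes>\<^bsub>G\<^esub> inv\<^bsub>G\<^esub> g \<otimes>\<^bsub>G\<^esub> (g \<otimes>\<^bsub>H\<^esub> k))"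

definition simply_connected_mfd :: "('a, 'e::euclidean_space) mfd \<Rightarrow> bool" where
  "simply_connected_mfd M \<longleftrightarrow> connected_space (mtop M) \<and> simply_connected_space (mtop M)"

definition lambda_action :: "'a monoid \<Rightarrow> 'a monoid \<Rightarrow> 'a \<Rightarrow> 'a \<Rightarrow> 'a" where
  "lambda_action G H g h = inv\<^bsub>G\<^esub> g \<otimes>\<^bsub>G\<^esub> (g \<otimes>\<^bsub>H\<^esub> h)"

definition lie_skew_brace_hom ::
    "('a, 'e::euclidean_space) mfd \<Rightarrow> 'a monoid \<Rightarrow> 'a monoid \<Rightarrow>
     ('b, 'f::euclidean_space) mfd \<Rightarrow> 'b monoid \<Rightarrow> 'b monoid \<Rightarrow> ('a \<Rightarrow> 'b) \<Rightarrow> bool" where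
  "lie_skew_brace_hom M G H M' G' H' \<phi> \<longleftrightarrow> smooth_map M M' \<phi> \<and> \<phi> \<in> hom G G' \<and> \<phi> \<in> hom H H'"

text \<open>\<open>N\<close> is the manifold structure of the Lie subgroup underlying the ideal.\<close>

definition lie_skew_brace_ideal_mfd ::
    "('a, 'e::euclidean_space) mfd \<Rightarrow> 'a monoid \<Rightarrow> 'a monoid \<Rightarrow> ('a, 'e) mfd \<Rightarrow> bool" where
  "lie_skew_brace_ideal_mfd M G H N \<longleftrightarrow>
     lie_subgroup M G N \<and> lie_subgroup M H N \<and> connected_space (mtop N) \<and>
     closedin (mtop M) (points N) \<and>
     normal (points N) G \<and> normal (points N) H \<and>
     (\<forall>g\<in>points M. lambda_action G H g ` points N = points N)"

definition lie_skew_brace_ideal ::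
    "('a, 'e::euclidean_space) mfd \<Rightarrow> 'a monoid \<Rightarrow> 'a monoid \<Rightarrow> 'a set \<Rightarrow> bool" where
  "lie_skew_brace_ideal M G H I \<longleftrightarrow>
     (\<exists>N. points N = I \<and> lie_skew_brace_ideal_mfd M G H N)"

definition simple_lie_skew_brace ::
    "('a, 'e::euclidean_space) mfd \<Rightarrow> 'a monoid \<Rightarrow> 'a monoid \<Rightarrow> bool" where
  "simple_lie_skew_brace M G H \<longleftrightarrow>
     (\<forall>I. lie_skew_brace_ideal M G H I \<longrightarrow> I = {\<one>\<^bsub>G\<^esub>} \<or> I = points M)"


section \<open>Post-Lie algebras\<close>

record 'v post_lie =
  space :: "'v set"
  dot_bracket :: "'v \<Rightarrow> 'v \<Rightarrow> 'v"
  circ_bracket :: "'v \<Rightarrow> 'v \<Rightarrow> 'v"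
  tri :: "'v \<Rightarrow> 'v \<Rightarrow> 'v"

definition bilinear_map_on :: "'v::real_vector set \<Rightarrow> ('v \<Rightarrow> 'v \<Rightarrow> 'v) \<Rightarrow> bool" where
  "bilinear_map_on V m \<longleftrightarrow>
     (\<forall>x\<in>V. \<forall>y\<in>V. m x y \<in> V) \<and>
     (\<forall>x\<in>V. \<forall>y\<in>V. \<forall>z\<in>V. m (x + y) z = m x z + m y z \<and> m z (x + y) = m z x + m z y) \<and>
     (\<forall>c. \<forall>x\<in>V. \<forall>y\<in>V. m (c *\<^sub>R x) y = c *\<^sub>R m x y \<and> m x (c *\<^sub>R y) = c *\<^sub>R m x y)"

definition lie_algebra_on :: "'v::real_vector set \<Rightarrow> ('v \<Rightarrow> 'v \<Rightarrow> 'v) \<Rightarrow> bool" where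
  "lie_algebra_on V br \<longleftrightarrow>
     subspace V \<and> bilinear_map_on V br \<and> (\<forall>x\<in>V. br x x = 0) \<and>
     (\<forall>x\<in>V. \<forall>y\<in>V. \<forall>z\<in>V. br x (br y z) + br y (br z x) + br z (br x y) = 0)"

text \<open>
  The axioms of a post-Lie algebra.  They hold for the structure associated with a
  Lie skew brace, so they are not needed as a hypothesis there.
\<close>

definition post_lie_algebra :: "'v::real_vector post_lie \<Rightarrow> bool" where
  "post_lie_algebra P \<longleftrightarrow>
     (\<exists>B. finite B \<and> span B = space P) \<and>
     lie_algebra_on (space P) (dot_bracket P) \<and> lie_algebra_on (space P) (circ_bracket P) \<and>
     bilinear_map_on (space P) (tri P) \<and>
     (\<forall>x\<in>space P. \<forall>y\<in>space P.
        circ_bracket P x y - dot_bracket P x y = tri P x y - tri P y x) \<and>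
     (\<forall>x\<in>space P. \<forall>y\<in>space P. \<forall>z\<in>space P.
        tri P x (dot_bracket P y z) = dot_bracket P (tri P x y) z + dot_bracket P y (tri P x z) \<and>
        tri P (circ_bracket P x y) z = tri P x (tri P y z) - tri P y (tri P x z))"

definition post_lie_ideal :: "'v::real_vector post_lie \<Rightarrow> 'v set \<Rightarrow> bool" where
  "post_lie_ideal P \<ii> \<longleftrightarrow>
     subspace \<ii> \<and> \<ii> \<subseteq> space P \<and>
     (\<forall>x\<in>space P. \<forall>a\<in>\<ii>. dot_bracket P x a \<in> \<ii> \<and> tri P x a \<in> \<ii> \<and> tri P a x \<in> \<ii>)"

text \<open>The elements of the quotient are the cosets of \<open>\<ii>\<close>; its zero element is \<open>\<ii>\<close> itself.\<close>

definition quotient_op :: "('v::real_vector \<Rightarrow> 'v \<Rightarrow> 'v) \<Rightarrow> 'v set \<Rightarrow> 'v set \<Rightarrow> 'v set \<Rightarrow> 'v set" where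
  "quotient_op m \<ii> A B = (\<Union>x\<in>A. \<Union>y\<in>B. (+) (m x y) ` \<ii>)"

definition quotient_post_lie :: "'v::real_vector post_lie \<Rightarrow> 'v set \<Rightarrow> 'v set post_lie" where
  "quotient_post_lie P \<ii> =
     \<lparr>space = (\<lambda>x. (+) x ` \<ii>) ` space P,
      dot_bracket = quotient_op (dot_bracket P) \<ii>,
      circ_bracket = quotient_op (circ_bracket P) \<ii>,
      tri = quotient_op (tri P) \<ii>\<rparr>"

text \<open>The argument \<open>z\<close> is the zero vector of \<open>P\<close>, which need not be the \<open>0\<close> of a type class.\<close>

definition trivial_post_lie :: "'v \<Rightarrow> 'v post_lie \<Rightarrow> bool" where
  "trivial_post_lie z P \<longleftrightarrow>
     (\<forall>x\<in>space P. \<forall>y\<in>space P. dot_bracket P x y = z \<and> circ_bracket P x y = z \<and> tri P x y = z)"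

text \<open>
  The operation \<open>x \<triangleright> y\<close>, that is the derivative of \<open>g \<mapsto> (\<lambda>\<^sub>g)\<^sub>*\<^sub>e y\<close> at \<open>e\<close> in the direction
  \<open>x\<close>, computed on each test function \<open>f\<close>: if \<open>x\<close> is the velocity of \<open>\<gamma>\<close>, then the right-hand
  side is the derivative at \<open>t = 0\<close> of \<open>((\<lambda>\<^bsub>\<gamma>(t)\<^esub>)\<^sub>*\<^sub>e y) f\<close>.
\<close>

definition brace_tri ::
    "('a, 'e::euclidean_space) mfd \<Rightarrow> 'a monoid \<Rightarrow> 'a monoid \<Rightarrow>
     'a functional \<Rightarrow> 'a functional \<Rightarrow> 'a functional" where
  "brace_tri M G H x y =
     local_functional M \<one>\<^bsub>G\<^esub>
       (\<lambda>f. app x (\<lambda>g. app (differential M M (lambda_action G H g) \<one>\<^bsub>G\<^esub> y) f))"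

definition associated_post_lie ::
    "('a, 'e::euclidean_space) mfd \<Rightarrow> 'a monoid \<Rightarrow> 'a monoid \<Rightarrow> 'a functional post_lie" where
  "associated_post_lie M G H =
     \<lparr>space = tangent_space M \<one>\<^bsub>G\<^esub>,
      dot_bracket = lie_bracket M G,
      circ_bracket = lie_bracket M H,
      tri = brace_tri M G H\<rparr>"

end

theory Submission
  imports Defs
begin

text \<open>
  Let \<open>l\<close> be the projection of \<open>\<gg>\<close> onto a complement \<open>C\<close> of the ideal \<open>\<ii>\<close>.  As the quotient by
  \<open>\<ii>\<close> is trivial, \<open>l\<close> vanishes on all brackets \<open>[x, y]\<close> of \<open>(G,\<cdot>)\<close> and on all \<open>x \<triangleright> y\<close>.

  The first property says that the left-invariant \<open>C\<close>-valued 1-form on \<open>(G,\<cdot>)\<close> with value \<open>l\<close> at the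
  identity is closed.  A primitive of it near the identity (\<open>poincare_lemma\<close>) is a local homomorphism
  (\<open>local_homomorphism_exists\<close>).  The increments of a local homomorphism can be summed along fine
  subdivisions of a path, and on a simply connected group the sum depends on the end points only.
  This extends it to a homomorphism \<open>\<phi>\<close> of \<open>(G,\<cdot>)\<close> to \<open>C\<close> with differential \<open>l\<close>
  (\<open>extend_local_homomorphism\<close>, \<open>homomorphism_exists\<close>).

  The second property says that the differential of \<open>\<phi> \<circ> \<lambda>\<^sub>g\<close> at the identity, as a function of \<open>g\<close>,
  has derivative zero at the identity, and then everywhere since \<open>\<lambda>\<close> is an action of \<open>(G,\<circ>)\<close>.  So
  \<open>\<phi> \<circ> \<lambda>\<^sub>g\<close> and \<open>\<phi>\<close> are homomorphisms on a connected group with the same differential, hence equal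
  (\<open>lam_invariant\<close>), and \<open>\<phi> (g \<circ> h) = \<phi> (g \<cdot> \<lambda>\<^sub>g h) = \<phi> g + \<phi> h\<close>.

  The differential of \<open>\<phi>\<close> is onto \<open>C\<close> with kernel \<open>\<ii>\<close>.  By the inverse function theorem a
  neighbourhood of the identity in the kernel is parametrised by a ball of \<open>\<ii>\<close> (\<open>slice_exists\<close>), and
  the left translates of this slice are charts of the identity component \<open>I\<close>.  Its topology is the
  subspace topology and its charts extend smoothly to open sets of \<open>G\<close>, so both group structures
  restrict to it (\<open>smooth_into_L\<close>, \<open>ideal_L\<close>), and its tangent space at the identity is \<open>\<ii>\<close>
  (\<open>lie_of_subgroup_L\<close>).  If \<open>I\<close> is trivial then \<open>\<ii> = 0\<close>; if \<open>I = G\<close> then \<open>\<phi> = 0\<close> and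
  \<open>\<ii> = \<gg>\<close>.

  The model spaces are linear subspaces \<open>V\<close> of a Euclidean space.  Composition with the orthogonal
  projection onto \<open>V\<close> turns functions on open subsets of \<open>V\<close> into functions on open subsets of the whole
  space (\<open>Ck_on_proj\<close>), so that all calculus takes place there.  In a chart a tangent vector is
  an element of \<open>V\<close> (\<open>tangent_space_eq\<close>), and the bracket and \<open>\<triangleright>\<close> are mixed second derivatives of
  the multiplication and of the lambda-action (\<open>iterated_derivative\<close>).
\<close>

section \<open>Calculus of smooth functions on open sets\<close>

abbreviation fderiv :: "('e::euclidean_space \<Rightarrow> 'f::euclidean_space) \<Rightarrow> 'e \<Rightarrow> 'e \<Rightarrow> 'f" where
  "fderiv f x \<equiv> frechet_derivative f (at x)"

(* Unfolded only by hand: as a rewrite rule it would expand smoothness into nested existentials. *)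
declare Ck_on.simps(2) [simp del]

lemma fderiv_eq: "(f has_derivative f') (at x) \<Longrightarrow> fderiv f x = f'"
  by (rule frechet_derivative_at[symmetric])

lemma Ck_on_cong:
  assumes "\<And>x. x \<in> S \<Longrightarrow> f x = g x" "Ck_on k V S f"
  shows "Ck_on k V S g"
proof (cases k)
  case 0
  with assms show ?thesis by (simp cong: continuous_on_cong)
next
  case (Suc j)
  with assms(2) obtain D where D: "\<forall>x\<in>S. (f has_derivative D x) (at x within S)"
      "\<forall>v\<in>V. Ck_on j V S (\<lambda>x. D x v)" by (auto simp: Ck_on.simps(2))
  have "(g has_derivative D x) (at x within S)" if "x \<in> S" for x
    by (rule has_derivative_transform[OF that _ D(1)[rule_format, OF that]]) (simp add: assms(1))
  with D(2) show ?thesis unfolding Suc Ck_on.simps by blast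
qed

lemma Ck_on_subset: "Ck_on k V S f \<Longrightarrow> T \<subseteq> S \<Longrightarrow> Ck_on k V T f"
proof (induction k arbitrary: f)
  case 0
  then show ?case using continuous_on_subset by auto
next
  case (Suc k)
  then obtain D where D: "\<forall>x\<in>S. (f has_derivative D x) (at x within S)"
      "\<forall>v\<in>V. Ck_on k V S (\<lambda>x. D x v)" by (auto simp: Ck_on.simps(2))
  have "(f has_derivative D x) (at x within T)" if "x \<in> T" for x
    using D(1) that Suc.prems(2) has_derivative_subset by blast
  moreover have "Ck_on k V T (\<lambda>x. D x v)" if "v \<in> V" for v
    using D(2) that Suc.prems(2) Suc.IH by blast
  ultimately show ?case unfolding Ck_on.simps by blast
qed

lemma Ck_on_lower: "Ck_on (Suc k) V S f \<Longrightarrow> Ck_on k V S f"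
proof (induction k arbitrary: f)
  case 0
  then obtain D where "\<And>x. x \<in> S \<Longrightarrow> (f has_derivative D x) (at x within S)" by (auto simp: Ck_on.simps(2))
  then have "continuous (at x within S) f" if "x \<in> S" for x
    using has_derivative_continuous that by blast
  then show ?case by (simp add: continuous_on_eq_continuous_within)
next
  case (Suc k)
  obtain D where D: "\<forall>x\<in>S. (f has_derivative D x) (at x within S)"
      "\<forall>v\<in>V. Ck_on (Suc k) V S (\<lambda>x. D x v)"
    using Suc.prems unfolding Ck_on.simps(2)[of "Suc k"] by blast
  have "\<forall>v\<in>V. Ck_on k V S (\<lambda>x. D x v)"
    using D(2) Suc.IH by blast
  with D(1) show ?case
    unfolding Ck_on.simps(2)[of k] by blast
qed

text \<open>On an open set of the whole space the derivative is unique, so the existential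
  quantifier in \<^const>\<open>Ck_on\<close> can be replaced by the Frechet derivative.\<close>

lemma Ck_on_SucI:
  assumes "open S" "\<And>x. x \<in> S \<Longrightarrow> (f has_derivative D x) (at x)"
    "\<And>v. Ck_on k UNIV S (\<lambda>x. D x v)"
  shows "Ck_on (Suc k) UNIV S f"
proof -
  have "\<forall>x\<in>S. (f has_derivative D x) (at x within S)"
  proof 
    fix x assume "x \<in> S"
    then show "(f has_derivative D x) (at x within S)"
      using assms(2) has_derivative_at_withinI by blast
  qed
  moreover have "\<forall>v\<in>UNIV. Ck_on k UNIV S (\<lambda>x. D x v)"
    by (intro ballI assms(3))
  ultimately have "(\<forall>x\<in>S. (f has_derivative D x) (at x within S)) \<and> (\<forall>v\<in>UNIV. Ck_on k UNIV S (\<lambda>x. D x v))"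
    by (intro conjI)
  then have "\<exists>D. (\<forall>x\<in>S. (f has_derivative D x) (at x within S)) \<and> (\<forall>v\<in>UNIV. Ck_on k UNIV S (\<lambda>x. D x v))"
    by (rule exI[where P="\<lambda>D. (\<forall>x\<in>S. (f has_derivative D x) (at x within S)) \<and> (\<forall>v\<in>UNIV. Ck_on k UNIV S (\<lambda>x. D x v))"])
  then show ?thesis by (subst Ck_on.simps(2))
qed

lemma Ck_on_SucD:
  assumes "open S" "Ck_on (Suc k) UNIV S f"
  shows "x \<in> S \<Longrightarrow> (f has_derivative fderiv f x) (at x)"
    and "Ck_on k UNIV S (\<lambda>x. fderiv f x v)"
proof -
  obtain D where D: "\<forall>x\<in>S. (f has_derivative D x) (at x within S)"
      "\<forall>v\<in>UNIV. Ck_on k UNIV S (\<lambda>x. D x v)"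
    using assms(2)[unfolded Ck_on.simps(2)] by (elim exE conjE)
  have D': "(f has_derivative D x) (at x)" if "x \<in> S" for x
    using D(1)[rule_format, OF that] at_within_open[OF that assms(1)] by simp
  have *: "D x = fderiv f x" if "x \<in> S" for x
    using fderiv_eq[OF D'[OF that]] by (rule sym)
  show "(f has_derivative fderiv f x) (at x)" if "x \<in> S"
    using D'[OF that] *[OF that] by simp
  show "Ck_on k UNIV S (\<lambda>x. fderiv f x v)"
    using D(2)[rule_format, OF UNIV_I, of v] by (rule Ck_on_cong[rotated]) (simp add: *)
qed

lemma Ck_on_const: "open S \<Longrightarrow> Ck_on k UNIV S (\<lambda>x. c)"
proof (induction k arbitrary: c)
  case (Suc k)
  show ?case
    by (rule Ck_on_SucI[where D="\<lambda>_ _. 0"]) (use Suc in \<open>auto intro: Suc.IH\<close>)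
qed simp

lemma Ck_on_linear: "open S \<Longrightarrow> bounded_linear L \<Longrightarrow> Ck_on k UNIV S L"
proof (cases k)
  case 0
  assume "bounded_linear L"
  then show ?thesis using 0 by (simp add: linear_continuous_on)
next
  case (Suc j)
  assume "open S" "bounded_linear L"
  then show ?thesis unfolding Suc
    by (intro Ck_on_SucI[where D="\<lambda>_. L"]) (auto intro: bounded_linear_imp_has_derivative Ck_on_const)
qed

lemma Ck_on_add:
  "open S \<Longrightarrow> Ck_on k UNIV S f \<Longrightarrow> Ck_on k UNIV S g \<Longrightarrow> Ck_on k UNIV S (\<lambda>x. f x + g x)"
proof (induction k arbitrary: f g)
  case 0
  then show ?case by (simp add: continuous_on_add)
next
  case (Suc k)
  note f = Ck_on_SucD[OF Suc.prems(1,2)] and g = Ck_on_SucD[OF Suc.prems(1,3)]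
  show ?case
  proof (rule Ck_on_SucI[OF Suc.prems(1)])
    show "((\<lambda>x. f x + g x) has_derivative (\<lambda>v. fderiv f x v + fderiv g x v)) (at x)"
      if "x \<in> S" for x using f(1) g(1) that by (intro has_derivative_add)
    show "Ck_on k UNIV S (\<lambda>x. fderiv f x v + fderiv g x v)" for v
      by (rule Suc.IH[OF Suc.prems(1) f(2) g(2)])
  qed
qed

lemma Ck_on_sum:
  "open S \<Longrightarrow> (\<And>i. i \<in> I \<Longrightarrow> Ck_on k UNIV S (f i)) \<Longrightarrow> Ck_on k UNIV S (\<lambda>x. \<Sum>i\<in>I. f i x)"
  by (induction I rule: infinite_finite_induct) (auto intro!: Ck_on_const Ck_on_add)

lemma Ck_on_linear_comp:
  "open S \<Longrightarrow> bounded_linear L \<Longrightarrow> Ck_on k UNIV S f \<Longrightarrow> Ck_on k UNIV S (\<lambda>x. L (f x))"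
proof (induction k arbitrary: f)
  case 0
  then show ?case by (simp add: bounded_linear.continuous_on)
next
  case (Suc k)
  note f = Ck_on_SucD[OF Suc.prems(1,3)]
  show ?case
  proof (rule Ck_on_SucI[OF Suc.prems(1)])
    show "((\<lambda>x. L (f x)) has_derivative (\<lambda>v. L (fderiv f x v))) (at x)" if "x \<in> S" for x
      by (rule bounded_linear.has_derivative[OF Suc.prems(2) f(1)[OF that]])
    show "Ck_on k UNIV S (\<lambda>x. L (fderiv f x v))" for v
      by (rule Suc.IH[OF Suc.prems(1,2) f(2)])
  qed
qed

lemma Ck_on_bilinear:
  assumes "bounded_bilinear m"
  shows "open S \<Longrightarrow> Ck_on k UNIV S f \<Longrightarrow> Ck_on k UNIV S g \<Longrightarrow> Ck_on k UNIV S (\<lambda>x. m (f x) (g x))"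
proof (induction k arbitrary: f g)
  case 0
  then show ?case using bounded_bilinear.continuous_on[OF assms] by auto
next
  case (Suc k)
  note f = Ck_on_SucD[OF Suc.prems(1,2)] and g = Ck_on_SucD[OF Suc.prems(1,3)]
  show ?case
  proof (rule Ck_on_SucI[OF Suc.prems(1)])
    show "((\<lambda>x. m (f x) (g x)) has_derivative (\<lambda>v. m (f x) (fderiv g x v) + m (fderiv f x v) (g x))) (at x)"
      if "x \<in> S" for x by (rule bounded_bilinear.FDERIV[OF assms f(1)[OF that] g(1)[OF that]])
    show "Ck_on k UNIV S (\<lambda>x. m (f x) (fderiv g x v) + m (fderiv f x v) (g x))" for v
      by (intro Ck_on_add Suc.IH Suc.prems(1) f(2) g(2) Ck_on_lower[OF Suc.prems(2)]
            Ck_on_lower[OF Suc.prems(3)])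
  qed
qed

lemma linear_basis_expansion:
  fixes L :: "'a::euclidean_space \<Rightarrow> 'b::real_vector"
  assumes "linear L" shows "L x = (\<Sum>b\<in>Basis. (x \<bullet> b) *\<^sub>R L b)"
proof -
  have "L x = L (\<Sum>b\<in>Basis. (x \<bullet> b) *\<^sub>R b)" by (simp add: euclidean_representation)
  also have "\<dots> = (\<Sum>b\<in>Basis. (x \<bullet> b) *\<^sub>R L b)"
    using assms by (simp add: linear_sum linear_scale)
  finally show ?thesis .
qed

text \<open>The derivative of \<open>g \<circ> f\<close> is \<open>\<Sum>b. (f' v \<bullet> b) g' b\<close>; expanding in a basis brings the
  induction hypothesis to bear on the partial derivatives of \<open>g\<close>.\<close>

lemma Ck_on_compose:
  "open S \<Longrightarrow> open T \<Longrightarrow> f ` S \<subseteq> T \<Longrightarrow> Ck_on k UNIV S f \<Longrightarrow> Ck_on k UNIV T g \<Longrightarrow>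
   Ck_on k UNIV S (\<lambda>x. g (f x))"
proof (induction k arbitrary: g)
  case 0
  then show ?case using continuous_on_compose2[of T g S f] by auto
next
  case (Suc k)
  have f: "(f has_derivative fderiv f x) (at x)" if "x \<in> S" for x
    using Ck_on_SucD Suc.prems that by blast
  have g: "(g has_derivative fderiv g x) (at x)" if "x \<in> T" for x
    using Ck_on_SucD Suc.prems that by blast
  have "Ck_on k UNIV S (\<lambda>x. \<Sum>b\<in>Basis. (fderiv f x v \<bullet> b) *\<^sub>R fderiv g (f x) b)" for v
  proof (intro Ck_on_sum Ck_on_bilinear[OF bounded_bilinear_scaleR])
    fix b :: 'b
    show "Ck_on k UNIV S (\<lambda>x. fderiv f x v \<bullet> b)"
      using Suc.prems by (intro Ck_on_linear_comp[OF _ bounded_linear_inner_left] Ck_on_SucD)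
    show "Ck_on k UNIV S (\<lambda>x. fderiv g (f x) b)"
      using Suc.prems by (intro Suc.IH Ck_on_SucD(2)) (auto dest: Ck_on_lower)
  qed (use Suc.prems in auto)
  moreover have "(\<Sum>b\<in>Basis. (fderiv f x v \<bullet> b) *\<^sub>R fderiv g (f x) b) = fderiv g (f x) (fderiv f x v)"
    if "x \<in> S" for x v
    using linear_basis_expansion[of "fderiv g (f x)"] g[of "f x"] that Suc.prems(3)
    by (metis bounded_linear.linear has_derivative_bounded_linear image_subset_iff)
  ultimately have *: "Ck_on k UNIV S (\<lambda>x. fderiv g (f x) (fderiv f x v))" for v
    by (rule Ck_on_cong[rotated])
  show ?case
  proof (rule Ck_on_SucI[where D="\<lambda>x v. fderiv g (f x) (fderiv f x v)"])
    show "((\<lambda>x. g (f x)) has_derivative (\<lambda>v. fderiv g (f x) (fderiv f x v))) (at x)" if "x \<in> S" for x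
      using has_derivative_compose[OF f g] that Suc.prems(3) by blast
  qed (use Suc.prems * in auto)
qed

lemma Ck_on_local:
  assumes "open S" "\<And>x. x \<in> S \<Longrightarrow> \<exists>T. open T \<and> x \<in> T \<and> Ck_on k UNIV T f"
  shows "Ck_on k UNIV S f"
  using assms(2)
proof (induction k arbitrary: f)
  case 0
  then show ?case using assms(1)
    by (meson Ck_on.simps(1) continuous_at_imp_continuous_on continuous_on_eq_continuous_at)
next
  case (Suc k)
  show ?case
  proof (rule Ck_on_SucI[where D="fderiv f"])
    show "(f has_derivative fderiv f x) (at x)" if "x \<in> S" for x
      using Suc.prems[OF that] Ck_on_SucD(1) by blast
    show "Ck_on k UNIV S (\<lambda>x. fderiv f x v)" for v
    proof (rule Suc.IH)
      fix x assume "x \<in> S"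
      then obtain T where "open T" "x \<in> T" "Ck_on (Suc k) UNIV T f"
        using Suc.prems by blast
      then show "\<exists>T. open T \<and> x \<in> T \<and> Ck_on k UNIV T (\<lambda>x. fderiv f x v)"
        using Ck_on_SucD(2) by blast
    qed
  qed (rule assms(1))
qed

subsection \<open>Smoothness near a point\<close>

text \<open>The manifolds below are handled through functions on the whole model space that are
  smooth only near the point in question; all later calculus is about this notion.\<close>

definition smooth_near :: "('e::euclidean_space \<Rightarrow> 'f::euclidean_space) \<Rightarrow> 'e \<Rightarrow> bool" where
  "smooth_near f x \<longleftrightarrow> (\<exists>S. open S \<and> x \<in> S \<and> smooth_on UNIV S f)"

lemma smooth_nearI: "open S \<Longrightarrow> x \<in> S \<Longrightarrow> (\<And>k. Ck_on k UNIV S f) \<Longrightarrow> smooth_near f x"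
  by (auto simp: smooth_near_def smooth_on_def)

lemma smooth_nearE:
  assumes "smooth_near f x"
  obtains S where "open S" "x \<in> S" "\<And>k. Ck_on k UNIV S f"
  using assms by (auto simp: smooth_near_def smooth_on_def)

lemma smooth_on_iff_near: "open S \<Longrightarrow> smooth_on UNIV S f \<longleftrightarrow> (\<forall>x\<in>S. smooth_near f x)"
  unfolding smooth_near_def smooth_on_def by (metis Ck_on_local)

lemma eventually_smooth_near: "smooth_near f x \<Longrightarrow> \<forall>\<^sub>F y in nhds x. smooth_near f y"
  by (metis smooth_near_def eventually_nhds)

lemma smooth_near_cong:
  assumes "smooth_near f x" "\<forall>\<^sub>F y in nhds x. f y = g y"
  shows "smooth_near g x"
proof -
  obtain S where S: "open S" "x \<in> S" "\<And>k. Ck_on k UNIV S f" by (meson assms(1) smooth_nearE)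
  obtain T where T: "open T" "x \<in> T" "\<And>y. y \<in> T \<Longrightarrow> f y = g y"
    using assms(2) by (auto simp: eventually_nhds)
  have "Ck_on k UNIV (S \<inter> T) g" for k
    by (rule Ck_on_cong[OF _ Ck_on_subset[OF S(3)]]) (use T in auto)
  with S T show ?thesis by (intro smooth_nearI[of "S \<inter> T"]) auto
qed

lemma smooth_near_deriv:
  assumes "smooth_near f x"
  shows "(f has_derivative fderiv f x) (at x)" "smooth_near (\<lambda>y. fderiv f y v) x"
proof -
  obtain S where S: "open S" "x \<in> S" "\<And>k. Ck_on k UNIV S f" by (meson assms smooth_nearE)
  show "(f has_derivative fderiv f x) (at x)"
    using Ck_on_SucD(1) S by blast
  show "smooth_near (\<lambda>y. fderiv f y v) x"
    using S(1,2) Ck_on_SucD(2)[OF S(1) S(3)] by (rule smooth_nearI)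
qed

lemma smooth_near_linear_fderiv: "smooth_near f x \<Longrightarrow> linear (fderiv f x)"
  using smooth_near_deriv(1) has_derivative_linear by blast

lemma smooth_near_cont: "smooth_near f x \<Longrightarrow> isCont f x"
  by (meson has_derivative_continuous smooth_near_deriv(1))

lemma smooth_near_tendsto: "smooth_near f x \<Longrightarrow> filterlim f (nhds (f x)) (nhds x)"
  using smooth_near_cont isCont_def tendsto_at_iff_tendsto_nhds by blast

lemma smooth_near_const: "smooth_near (\<lambda>x. c) x"
  by (rule smooth_nearI[of UNIV]) (auto intro: Ck_on_const)

lemma smooth_near_linear: "bounded_linear L \<Longrightarrow> smooth_near L x"
  by (rule smooth_nearI[of UNIV]) (auto intro: Ck_on_linear)

lemma smooth_near_id: "smooth_near (\<lambda>x. x) x"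
  by (simp add: smooth_near_linear)

lemma smooth_near_add: "smooth_near f x \<Longrightarrow> smooth_near g x \<Longrightarrow> smooth_near (\<lambda>y. f y + g y) x"
proof (elim smooth_nearE)
  fix S T assume "open S" "x \<in> S" "\<And>k. Ck_on k UNIV S f" "open T" "x \<in> T" "\<And>k. Ck_on k UNIV T g"
  then show "smooth_near (\<lambda>y. f y + g y) x"
    by (intro smooth_nearI[of "S \<inter> T"] Ck_on_add) (auto intro: Ck_on_subset)
qed

lemma smooth_near_compose:
  assumes "smooth_near f x" "smooth_near g (f x)"
  shows "smooth_near (\<lambda>y. g (f y)) x"
proof -
  obtain S where S: "open S" "x \<in> S" "\<And>k. Ck_on k UNIV S f" by (meson assms smooth_nearE)
  obtain T where T: "open T" "f x \<in> T" "\<And>k. Ck_on k UNIV T g" by (meson assms smooth_nearE)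
  have "continuous_on S f" using S(3)[of 0] by simp
  then have "open (f -` T \<inter> S)" using S(1) T(1)
    by (simp add: continuous_on_open_vimage)
  then have "Ck_on k UNIV (f -` T \<inter> S) (\<lambda>y. g (f y))" for k
    by (rule Ck_on_compose[OF _ T(1) _ Ck_on_subset[OF S(3)] T(3)]) auto
  with \<open>open (f -` T \<inter> S)\<close> show ?thesis
    using S(2) T(2) by (intro smooth_nearI[of "f -` T \<inter> S"]) auto
qed

lemma smooth_near_compose_linear:
  "bounded_linear L \<Longrightarrow> smooth_near f x \<Longrightarrow> smooth_near (\<lambda>y. L (f y)) x"
  by (rule smooth_near_compose[OF _ smooth_near_linear])

lemma smooth_near_minus: "smooth_near f x \<Longrightarrow> smooth_near g x \<Longrightarrow> smooth_near (\<lambda>y. f y - g y) x"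
  using smooth_near_add[of f x "\<lambda>y. - g y"] smooth_near_compose_linear[of uminus g x]
  by (simp add: bounded_linear_minus bounded_linear_ident)

lemma smooth_near_Pair:
  assumes "smooth_near f x" "smooth_near g x"
  shows "smooth_near (\<lambda>y. (f y, g y)) x"
proof -
  have "smooth_near (\<lambda>y. (f y, 0) + (0, g y)) x"
    using assms
    by (intro smooth_near_add smooth_near_compose_linear[of "\<lambda>v. (v, 0)"]
          smooth_near_compose_linear[of "\<lambda>v. (0, v)"] bounded_linear_Pair)
       (auto intro: bounded_linear_ident bounded_linear_zero)
  then show ?thesis by simp
qed

lemma smooth_near_fst: "smooth_near f x \<Longrightarrow> smooth_near (\<lambda>y. fst (f y)) x"
  by (rule smooth_near_compose_linear[OF bounded_linear_fst])

lemma smooth_near_snd: "smooth_near f x \<Longrightarrow> smooth_near (\<lambda>y. snd (f y)) x"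
  by (rule smooth_near_compose_linear[OF bounded_linear_snd])

lemma smooth_near_of_deriv:
  assumes "open S" "\<And>x. x \<in> S \<Longrightarrow> (f has_derivative D x) (at x)"
    "\<And>x v. x \<in> S \<Longrightarrow> smooth_near (\<lambda>y. D y v) x" "x \<in> S"
  shows "smooth_near f x"
proof (rule smooth_nearI[of S])
  have "Ck_on k UNIV S (\<lambda>y. D y v)" for k v
    using assms smooth_on_iff_near[OF assms(1), of "\<lambda>y. D y v"] by (auto simp: smooth_on_def)
  then have "Ck_on (Suc k) UNIV S f" for k
    using assms by (intro Ck_on_SucI[where D=D])
  then show "Ck_on k UNIV S f" for k by (rule Ck_on_lower)
qed (use assms in auto)

lemma fderiv_cong:
  assumes "\<forall>\<^sub>F y in nhds x. f y = g y"
  shows "fderiv f x = fderiv g x"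
proof -
  have *: "(k has_derivative D) (at x)"
    if "\<forall>\<^sub>F y in nhds x. h y = k y" "(h has_derivative D) (at x)"
    for h k :: "'a \<Rightarrow> 'b" and D
    using that has_derivative_transform_within_open[of h D x UNIV] unfolding eventually_nhds by blast
  moreover have "\<forall>\<^sub>F y in nhds x. g y = f y"
    using assms by eventually_elim simp
  ultimately have "(f has_derivative D) (at x) \<longleftrightarrow> (g has_derivative D) (at x)" for D
    using assms by blast
  then show ?thesis by (simp add: frechet_derivative_def)
qed

lemma fderiv_compose:
  assumes "smooth_near f x" "smooth_near g (f x)"
  shows "fderiv (\<lambda>y. g (f y)) x v = fderiv g (f x) (fderiv f x v)"
  using has_derivative_compose[OF smooth_near_deriv(1)[OF assms(1)] smooth_near_deriv(1)[OF assms(2)]]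
  by (simp add: fderiv_eq)

lemma fderiv_linear: "bounded_linear L \<Longrightarrow> fderiv L x v = L v"
  using bounded_linear_imp_has_derivative[of L "at x"] by (simp add: fderiv_eq)

lemma fderiv_compose_linear:
  "bounded_linear L \<Longrightarrow> smooth_near f x \<Longrightarrow> fderiv (\<lambda>y. L (f y)) x v = L (fderiv f x v)"
  using fderiv_compose[of f x L v] smooth_near_linear fderiv_linear by metis

lemma fderiv_add:
  "smooth_near f x \<Longrightarrow> smooth_near g x \<Longrightarrow> fderiv (\<lambda>y. f y + g y) x v = fderiv f x v + fderiv g x v"
  using has_derivative_add[OF smooth_near_deriv(1) smooth_near_deriv(1), of f x g] by (simp add: fderiv_eq)

lemma fderiv_minus:
  "smooth_near f x \<Longrightarrow> smooth_near g x \<Longrightarrow> fderiv (\<lambda>y. f y - g y) x v = fderiv f x v - fderiv g x v"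
  using has_derivative_diff[OF smooth_near_deriv(1) smooth_near_deriv(1), of f x g] by (simp add: fderiv_eq)

lemma fderiv_const: "fderiv (\<lambda>y. c) x v = 0"
  by (simp add: fderiv_eq[OF has_derivative_const])

lemma fderiv_Pair:
  "smooth_near f x \<Longrightarrow> smooth_near g x \<Longrightarrow> fderiv (\<lambda>y. (f y, g y)) x v = (fderiv f x v, fderiv g x v)"
  using has_derivative_Pair[OF smooth_near_deriv(1) smooth_near_deriv(1), of f x g] by (simp add: fderiv_eq)

lemma fderiv_line:
  assumes "smooth_near f x"
  shows "((\<lambda>t. f (x + t *\<^sub>R v)) has_vector_derivative fderiv f x v) (at 0)"
proof -
  have "((\<lambda>t. x + t *\<^sub>R v) has_derivative (\<lambda>t. t *\<^sub>R v)) (at 0)"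
    by (auto intro!: derivative_eq_intros)
  moreover have "(f has_derivative fderiv f x) (at (x + 0 *\<^sub>R v))"
    using assms smooth_near_deriv by simp
  ultimately have "((\<lambda>t. f (x + t *\<^sub>R v)) has_derivative (\<lambda>t. fderiv f x (t *\<^sub>R v))) (at 0)"
    by (rule has_derivative_compose)
  then show ?thesis using smooth_near_linear_fderiv[OF assms]
    by (simp add: has_vector_derivative_def linear_scale)
qed

subsection \<open>Orthogonal projections\<close>

definition proj :: "'e::euclidean_space set \<Rightarrow> 'e \<Rightarrow> 'e" where
  "proj V x = (SOME y. y \<in> V \<and> (\<forall>w\<in>V. (x - y) \<bullet> w = 0))"

context
  fixes V :: "'e::euclidean_space set"
  assumes V: "subspace V"
begin

lemma proj_ex: "\<exists>y. y \<in> V \<and> (\<forall>w\<in>V. (x - y) \<bullet> w = 0)"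
proof -
  obtain y z where "y \<in> span V" "\<And>w. w \<in> span V \<Longrightarrow> orthogonal z w" "x = y + z"
    using orthogonal_subspace_decomp_exists by blast
  then show ?thesis using V by (intro exI[of _ y]) (auto simp: orthogonal_def span_eq_iff[THEN iffD2])
qed

lemma proj_in: "proj V x \<in> V" and proj_orth: "w \<in> V \<Longrightarrow> (x - proj V x) \<bullet> w = 0"
  using someI_ex[OF proj_ex, of x] by (auto simp: proj_def)

lemma proj_unique: assumes "y \<in> V" "\<And>w. w \<in> V \<Longrightarrow> (x - y) \<bullet> w = 0" shows "proj V x = y"
proof -
  have "proj V x - y \<in> V" using assms V proj_in by (simp add: subspace_diff)
  then have "(x - y) \<bullet> (proj V x - y) - (x - proj V x) \<bullet> (proj V x - y) = 0"
    using assms proj_orth by simp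
  then have "(proj V x - y) \<bullet> (proj V x - y) = 0" by (simp add: inner_diff_left)
  then show ?thesis by simp
qed

lemma proj_id: "x \<in> V \<Longrightarrow> proj V x = x"
  by (rule proj_unique) auto

lemma bounded_linear_proj: "bounded_linear (proj V)"
proof -
  have "proj V (x + y) = proj V x + proj V y" for x y
    using V proj_in proj_orth
    by (intro proj_unique) (auto simp: subspace_add add_diff_add inner_add_left)
  moreover have "proj V (c *\<^sub>R x) = c *\<^sub>R proj V x" for c x
    using V proj_in proj_orth
    by (intro proj_unique) (auto simp: subspace_scale scaleR_diff_right[symmetric])
  ultimately show ?thesis
    by (intro linear_conv_bounded_linear[THEN iffD1] linearI)
qed

lemmas proj_linear = bounded_linear.linear[OF bounded_linear_proj]
lemmas proj_add = linear_add[OF proj_linear]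
lemmas proj_diff = linear_diff[OF proj_linear]
lemmas proj_zero = linear_0[OF proj_linear]

lemma smooth_near_proj: "smooth_near (proj V) x"
  by (rule smooth_near_linear[OF bounded_linear_proj])

lemma continuous_on_proj: "continuous_on A (proj V)"
  by (rule linear_continuous_on[OF bounded_linear_proj])

lemma open_vimage_proj: "openin (top_of_set V) S \<Longrightarrow> open (proj V -` S)"
proof -
  assume "openin (top_of_set V) S"
  then obtain T where "open T" "S = V \<inter> T" by (auto simp: openin_open)
  moreover have "proj V -` (V \<inter> T) = proj V -` T" using proj_in by auto
  ultimately show ?thesis using continuous_on_proj[of UNIV]
    by (simp add: continuous_on_open_vimage)
qed

text \<open>A function with values in \<open>V\<close> equals its own projection to \<open>V\<close>, hence so does its
  derivative.\<close>

lemma fderiv_in_subspace: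
  assumes "smooth_near f x" "\<forall>\<^sub>F y in nhds x. f y \<in> V"
  shows "fderiv f x v \<in> V"
proof -
  have "\<forall>\<^sub>F y in nhds x. f y = proj V (f y)"
    using assms(2) by eventually_elim (simp add: proj_id)
  then have "fderiv f x v = proj V (fderiv f x v)"
    using fderiv_compose_linear[OF bounded_linear_proj assms(1)] fderiv_cong by metis
  then show ?thesis using proj_in by metis
qed

text \<open>Composing with the projection turns smoothness on an open subset of the subspace \<open>V\<close>
  into smoothness on an open subset of the whole space.\<close>

lemma Ck_on_proj:
  assumes "openin (top_of_set V) S"
  shows "Ck_on k V S f \<longleftrightarrow> Ck_on k UNIV (proj V -` S) (\<lambda>x. f (proj V x))"
proof -
  have SV: "S \<subseteq> V" using assms openin_subset by fastforce
  have 1: "Ck_on k V S f \<Longrightarrow> Ck_on k UNIV (proj V -` S) (\<lambda>x. f (proj V x))" for k f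
  proof (induction k arbitrary: f)
    case 0
    then have "continuous_on S f" by simp
    then have "continuous_on (proj V -` S) (\<lambda>x. f (proj V x))"
      by (rule continuous_on_compose2[OF _ continuous_on_proj]) auto
    then show ?case by simp
  next
    case (Suc k)
    then obtain D where D: "\<forall>x\<in>S. (f has_derivative D x) (at x within S)"
        "\<forall>v\<in>V. Ck_on k V S (\<lambda>x. D x v)" by (auto simp: Ck_on.simps(2))
    have "((\<lambda>x. f (proj V x)) has_derivative (\<lambda>v. D (proj V x) (proj V v))) (at x)"
      if "proj V x \<in> S" for x
    proof -
      have "((\<lambda>x. f (proj V x)) has_derivative (\<lambda>v. D (proj V x) (proj V v))) (at x within proj V -` S)"
        using D(1) that
        by (intro has_derivative_in_compose2[of S f D "proj V" _ x "proj V"])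
           (auto intro: bounded_linear_imp_has_derivative bounded_linear_proj)
      moreover have "at x within proj V -` S = at x"
        using open_vimage_proj[OF assms] that by (intro at_within_open) auto
      ultimately show ?thesis by simp
    qed
    moreover have "Ck_on k UNIV (proj V -` S) (\<lambda>x. D (proj V x) (proj V v))" for v
      by (rule Suc.IH[OF D(2)[rule_format, OF proj_in]])
    ultimately show ?case
      using open_vimage_proj[OF assms] by (intro Ck_on_SucI[where D="\<lambda>x v. D (proj V x) (proj V v)"]) simp_all
  qed
  have 2: "Ck_on k UNIV T F \<Longrightarrow> S \<subseteq> T \<Longrightarrow> Ck_on k V S F" for k T F
  proof (induction k arbitrary: F)
    case 0
    then show ?case using continuous_on_subset by auto
  next
    case (Suc k)
    then obtain D where D: "\<forall>x\<in>T. (F has_derivative D x) (at x within T)"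
        "\<forall>v. Ck_on k UNIV T (\<lambda>x. D x v)" by (auto simp: Ck_on.simps(2))
    have "(F has_derivative D x) (at x within S)" if "x \<in> S" for x
      using D(1) that Suc.prems(2) has_derivative_subset by blast
    moreover have "Ck_on k V S (\<lambda>x. D x v)" for v
      using D(2) Suc.prems(2) Suc.IH by blast
    ultimately show ?case unfolding Ck_on.simps by blast
  qed
  show ?thesis
  proof
    assume "Ck_on k UNIV (proj V -` S) (\<lambda>x. f (proj V x))"
    moreover have "S \<subseteq> proj V -` S" using SV proj_id by auto
    ultimately have "Ck_on k V S (\<lambda>x. f (proj V x))" by (rule 2)
    then show "Ck_on k V S f"
      by (rule Ck_on_cong[rotated]) (use SV proj_id in auto)
  qed (rule 1)
qed

lemma smooth_on_iff_near_proj: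
  assumes "openin (top_of_set V) S"
  shows "smooth_on V S f \<longleftrightarrow> (\<forall>x\<in>S. smooth_near (\<lambda>y. f (proj V y)) x)"
proof -
  have SV: "S \<subseteq> V" using assms openin_subset by fastforce
  have "smooth_on V S f \<longleftrightarrow> smooth_on UNIV (proj V -` S) (\<lambda>x. f (proj V x))"
    unfolding smooth_on_def by (intro iff_allI Ck_on_proj assms)
  also have "\<dots> \<longleftrightarrow> (\<forall>x\<in>proj V -` S. smooth_near (\<lambda>y. f (proj V y)) x)"
    by (rule smooth_on_iff_near[OF open_vimage_proj[OF assms]])
  also have "\<dots> \<longleftrightarrow> (\<forall>x\<in>S. smooth_near (\<lambda>y. f (proj V y)) x)" (is "_ \<longleftrightarrow> ?R")
  proof
    assume R: ?R
    show "\<forall>x\<in>proj V -` S. smooth_near (\<lambda>y. f (proj V y)) x"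
    proof
      fix x assume "x \<in> proj V -` S"
      then have "smooth_near (\<lambda>y. f (proj V y)) (proj V x)" using R by auto
      then have "smooth_near (\<lambda>y. f (proj V (proj V y))) x"
        by (rule smooth_near_compose[OF smooth_near_proj])
      then show "smooth_near (\<lambda>y. f (proj V y)) x" by (simp add: proj_id proj_in)
    qed
  qed (use SV proj_id in auto)
  finally show ?thesis .
qed

end

lemma proj_Times:
  assumes "subspace V" "subspace W"
  shows "proj (V \<times> W) = map_prod (proj V) (proj W)"
proof
  fix x :: "'a \<times> 'b"
  show "proj (V \<times> W) x = map_prod (proj V) (proj W) x"
    using assms by (intro proj_unique subspace_Times) 
      (auto simp: map_prod_def split_beta proj_in inner_prod_def proj_orth)
qed

lemma proj_UNIV: "proj UNIV x = x"
  by (simp add: proj_id)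

section \<open>Second derivatives, closed forms and local inverses\<close>

lemma fderiv_line_at:
  assumes "smooth_near f (x + s *\<^sub>R v)"
  shows "((\<lambda>t. f (x + t *\<^sub>R v)) has_vector_derivative fderiv f (x + s *\<^sub>R v) v) (at s)"
proof -
  have "((\<lambda>t. x + t *\<^sub>R v) has_derivative (\<lambda>t. t *\<^sub>R v)) (at s)"
    by (auto intro!: derivative_eq_intros)
  then have "((\<lambda>t. f (x + t *\<^sub>R v)) has_derivative (\<lambda>t. fderiv f (x + s *\<^sub>R v) (t *\<^sub>R v))) (at s)"
    using smooth_near_deriv(1)[OF assms] by (rule has_derivative_compose)
  then show ?thesis
    by (simp add: has_vector_derivative_def linear_scale[OF smooth_near_linear_fderiv[OF assms]])
qed

text \<open>The mean value theorem, applied in each of the two directions.  The left-hand side is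
  symmetric in \<open>v\<close> and \<open>w\<close>, which makes the second derivative symmetric in the limit.\<close>

lemma mixed_difference:
  fixes f :: "'e::euclidean_space \<Rightarrow> real"
  assumes h: "0 < h"
    and sm: "\<And>s t. 0 \<le> s \<Longrightarrow> s \<le> h \<Longrightarrow> 0 \<le> t \<Longrightarrow> t \<le> h \<Longrightarrow> smooth_near f (x + s *\<^sub>R v + t *\<^sub>R w)"
  shows "\<exists>s t. 0 < s \<and> s < h \<and> 0 < t \<and> t < h \<and>
    f (x + h *\<^sub>R v + h *\<^sub>R w) - f (x + h *\<^sub>R v) - f (x + h *\<^sub>R w) + f x =
    h * h * fderiv (\<lambda>y. fderiv f y v) (x + s *\<^sub>R v + t *\<^sub>R w) w"
proof -
  have "((\<lambda>s. f (x + s *\<^sub>R v + h *\<^sub>R w) - f (x + s *\<^sub>R v)) has_real_derivative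
      fderiv f (x + s *\<^sub>R v + h *\<^sub>R w) v - fderiv f (x + s *\<^sub>R v) v) (at s)"
    if "0 \<le> s" "s \<le> h" for s
  proof -
    have "smooth_near f ((x + h *\<^sub>R w) + s *\<^sub>R v)" "smooth_near f (x + s *\<^sub>R v)"
      using sm[of s h] sm[of s 0] that h by (auto simp: algebra_simps)
    note this[THEN fderiv_line_at]
    from has_vector_derivative_diff[OF this] show ?thesis
      by (simp add: has_real_derivative_iff_has_vector_derivative algebra_simps)
  qed
  from MVT2[OF h this] obtain s where s: "0 < s" "s < h"
      "f (x + h *\<^sub>R v + h *\<^sub>R w) - f (x + h *\<^sub>R v) - (f (x + h *\<^sub>R w) - f x)
        = h * (fderiv f (x + s *\<^sub>R v + h *\<^sub>R w) v - fderiv f (x + s *\<^sub>R v) v)"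
    by auto
  have "((\<lambda>t. fderiv f (x + s *\<^sub>R v + t *\<^sub>R w) v) has_real_derivative
      fderiv (\<lambda>y. fderiv f y v) (x + s *\<^sub>R v + t *\<^sub>R w) w) (at t)"
    if "0 \<le> t" "t \<le> h" for t
    using fderiv_line_at[OF smooth_near_deriv(2)[OF sm[of s t]], of v] s that
    by (simp add: has_real_derivative_iff_has_vector_derivative)
  from MVT2[OF h this] obtain t where t: "0 < t" "t < h"
      "fderiv f (x + s *\<^sub>R v + h *\<^sub>R w) v - fderiv f (x + s *\<^sub>R v) v
        = h * fderiv (\<lambda>y. fderiv f y v) (x + s *\<^sub>R v + t *\<^sub>R w) w"
    by auto
  show ?thesis
    using s t by (intro exI[of _ s] exI[of _ t]) (simp add: algebra_simps)
qed

lemma fderiv_symmetric_real: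
  fixes f :: "'e::euclidean_space \<Rightarrow> real"
  assumes "smooth_near f x"
  shows "fderiv (\<lambda>y. fderiv f y v) x w = fderiv (\<lambda>y. fderiv f y w) x v"
proof (rule ccontr)
  define A where "A = (\<lambda>y. fderiv (\<lambda>y. fderiv f y v) y w)"
  define B where "B = (\<lambda>y. fderiv (\<lambda>y. fderiv f y w) y v)"
  assume "\<not> ?thesis"
  then have d: "dist (A x) (B x) > 0" by (simp add: A_def B_def)
  have A: "(A \<longlongrightarrow> A x) (nhds x)" and B: "(B \<longlongrightarrow> B x) (nhds x)"
    unfolding A_def B_def by (intro smooth_near_tendsto smooth_near_deriv assms)+
  have "\<forall>\<^sub>F y in nhds x. dist (A y) (A x) < dist (A x) (B x) / 2"
    "\<forall>\<^sub>F y in nhds x. dist (B y) (B x) < dist (A x) (B x) / 2"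
    by (rule tendstoD[OF A half_gt_zero[OF d]], rule tendstoD[OF B half_gt_zero[OF d]])
  moreover note eventually_smooth_near[OF assms]
  ultimately have "\<forall>\<^sub>F y in nhds x. smooth_near f y \<and> dist (A y) (A x) < dist (A x) (B x) / 2 \<and>
      dist (B y) (B x) < dist (A x) (B x) / 2" by eventually_elim simp
  then obtain e where e: "e > 0" "\<And>y. dist y x < e \<Longrightarrow> smooth_near f y \<and>
      dist (A y) (A x) < dist (A x) (B x) / 2 \<and> dist (B y) (B x) < dist (A x) (B x) / 2"
    by (auto simp: eventually_nhds_metric)
  define h where "h = e / (2 * (norm v + norm w + 1))"
  have n: "norm v + norm w + 1 > 0" by (smt (verit) norm_ge_zero)
  have h: "h > 0" using e n by (simp add: h_def)
  have near: "dist (x + s *\<^sub>R v + t *\<^sub>R w) x < e" if "0 \<le> s" "s \<le> h" "0 \<le> t" "t \<le> h" for s t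
  proof -
    have "dist (x + s *\<^sub>R v + t *\<^sub>R w) x = norm (s *\<^sub>R v + t *\<^sub>R w)" by (simp add: dist_norm)
    also have "\<dots> \<le> s * norm v + t * norm w"
      using that norm_triangle_ineq[of "s *\<^sub>R v" "t *\<^sub>R w"] by simp
    also have "\<dots> \<le> h * norm v + h * norm w"
      using that by (intro add_mono mult_right_mono) auto
    also have "\<dots> \<le> h * (norm v + norm w + 1)" using h by (simp add: algebra_simps)
    also have "\<dots> = e / 2" using n by (simp add: h_def field_simps)
    finally show ?thesis using e by simp
  qed
  have near': "dist (x + s *\<^sub>R w + t *\<^sub>R v) x < e" if "0 \<le> s" "s \<le> h" "0 \<le> t" "t \<le> h" for s t
    using near[of t s] that by (simp add: algebra_simps)
  obtain s t where st: "0 < s" "s < h" "0 < t" "t < h"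
    "f (x + h *\<^sub>R v + h *\<^sub>R w) - f (x + h *\<^sub>R v) - f (x + h *\<^sub>R w) + f x =
      h * h * A (x + s *\<^sub>R v + t *\<^sub>R w)"
    using mixed_difference[OF h, of f x v w] near e unfolding A_def by blast
  obtain s' t' where st': "0 < s'" "s' < h" "0 < t'" "t' < h"
    "f (x + h *\<^sub>R w + h *\<^sub>R v) - f (x + h *\<^sub>R w) - f (x + h *\<^sub>R v) + f x =
      h * h * B (x + s' *\<^sub>R w + t' *\<^sub>R v)"
    using mixed_difference[OF h, of f x w v] near' e unfolding B_def by blast
  have "x + h *\<^sub>R w + h *\<^sub>R v = x + h *\<^sub>R v + h *\<^sub>R w" by simp
  with st(5) st'(5) h have "A (x + s *\<^sub>R v + t *\<^sub>R w) = B (x + s' *\<^sub>R w + t' *\<^sub>R v)"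
    by (smt (verit, best) mult_cancel_left mult_pos_pos)
  moreover have "dist (A (x + s *\<^sub>R v + t *\<^sub>R w)) (A x) < dist (A x) (B x) / 2"
    using e(2)[OF near] st by simp
  moreover have "dist (B (x + s' *\<^sub>R w + t' *\<^sub>R v)) (B x) < dist (A x) (B x) / 2"
    using e(2)[OF near'] st' by simp
  ultimately show False by (simp add: dist_real_def) argo
qed

lemma fderiv_symmetric:
  assumes "smooth_near f x"
  shows "fderiv (\<lambda>y. fderiv f y v) x w = fderiv (\<lambda>y. fderiv f y w) x v"
proof (rule euclidean_eqI)
  fix b :: 'b
  note bl = bounded_linear_inner_left[of b]
  have *: "fderiv (\<lambda>y. fderiv f y v) x w \<bullet> b = fderiv (\<lambda>y. fderiv (\<lambda>z. f z \<bullet> b) y v) x w" for v w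
  proof -
    have "\<forall>\<^sub>F y in nhds x. fderiv (\<lambda>z. f z \<bullet> b) y v = fderiv f y v \<bullet> b"
      using eventually_smooth_near[OF assms] by eventually_elim (rule fderiv_compose_linear[OF bl])
    from fderiv_cong[OF this] show ?thesis
      using fderiv_compose_linear[OF bl smooth_near_deriv(2)[OF assms], of v w] by simp
  qed
  have "smooth_near (\<lambda>z. f z \<bullet> b) x"
    by (rule smooth_near_compose_linear[OF bl assms])
  from fderiv_symmetric_real[OF this, of v w]
  show "fderiv (\<lambda>y. fderiv f y v) x w \<bullet> b = fderiv (\<lambda>y. fderiv f y w) x v \<bullet> b"
    by (simp only: *)
qed

text \<open>The primitive of a closed 1-form on a ball is its integral along rays,
  \<open>f x = \<integral> \<omega> (a + t (x - a)) (x - a) dt\<close>.  Differentiating under the integral sign and using that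
  \<open>\<omega>\<close> is closed, the integrand of \<open>f' v\<close> becomes the \<open>t\<close>-derivative of
  \<open>t \<omega> (a + t (x - a)) v\<close>.\<close>

lemma poincare_lemma:
  fixes \<omega> :: "'e::euclidean_space \<Rightarrow> 'e \<Rightarrow> 'f::euclidean_space"
  assumes lin: "\<And>x. x \<in> ball a r \<Longrightarrow> linear (\<omega> x)"
    and smooth: "\<And>x v. x \<in> ball a r \<Longrightarrow> smooth_near (\<lambda>y. \<omega> y v) x"
    and closed: "\<And>x v w. x \<in> ball a r \<Longrightarrow> fderiv (\<lambda>y. \<omega> y v) x w = fderiv (\<lambda>y. \<omega> y w) x v"
  shows "\<exists>f. f a = 0 \<and> (\<forall>x\<in>ball a r. (f has_derivative \<omega> x) (at x))"
proof -
  (* \<Phi> x t is the derivative of the integrand g _ t at x. *)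
  define z where "z x t = a + t *\<^sub>R (x - a)" for x and t :: real
  define g where "g x t = (\<Sum>b\<in>Basis. ((x - a) \<bullet> b) *\<^sub>R \<omega> (z x t) b)" for x t
  define \<Phi> where "\<Phi> x t v = (\<Sum>b\<in>Basis. ((x - a) \<bullet> b) *\<^sub>R fderiv (\<lambda>y. \<omega> y b) (z x t) (t *\<^sub>R v)
      + (v \<bullet> b) *\<^sub>R \<omega> (z x t) b)" for x t v
  have z: "z x t \<in> ball a r" if "x \<in> ball a r" "t \<in> cbox 0 1" for x t
  proof -
    have "dist a (z x t) = t * dist a x" using that by (simp add: z_def dist_norm norm_minus_commute)
    also have "\<dots> \<le> dist a x" using that by (intro mult_left_le_one_le) auto
    finally show ?thesis using that by simp
  qed
  have zc: "continuous_on A (\<lambda>(x, t). z x t)" for A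
    unfolding z_def split_beta by (intro continuous_intros)
  have cont: "continuous_on (ball a r \<times> cbox 0 1) (\<lambda>(x, t). F (z x t))"
    if "\<And>x. x \<in> ball a r \<Longrightarrow> smooth_near F x" for F :: "'e \<Rightarrow> 'f"
  proof -
    have "continuous_on (ball a r) F"
      using that smooth_near_cont continuous_at_imp_continuous_on by blast
    moreover have "(\<lambda>(x, t). z x t) ` (ball a r \<times> cbox 0 1) \<subseteq> ball a r"
      using z by (auto simp del: mem_ball)
    ultimately have "continuous_on (ball a r \<times> cbox 0 1) (\<lambda>p. F (case p of (x, t) \<Rightarrow> z x t))"
      by (rule continuous_on_compose2[OF _ zc])
    then show ?thesis by (simp add: split_beta)
  qed
  have der: "((\<lambda>x. g x t) has_derivative \<Phi> x t) (at x)" if "x \<in> ball a r" "t \<in> cbox 0 1" for x t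
  proof -
    have zd: "((\<lambda>x. z x t) has_derivative (\<lambda>v. t *\<^sub>R v)) (at x)"
      unfolding z_def by (auto intro!: derivative_eq_intros)
    have "((\<lambda>x. \<omega> (z x t) b) has_derivative (\<lambda>v. fderiv (\<lambda>y. \<omega> y b) (z x t) (t *\<^sub>R v))) (at x)" for b
      using zd smooth_near_deriv(1)[OF smooth[OF z[OF that]]] by (rule has_derivative_compose)
    moreover have "((\<lambda>x. (x - a) \<bullet> b) has_derivative (\<lambda>v. v \<bullet> b)) (at x)" for b
      by (auto intro!: derivative_eq_intros)
    ultimately show ?thesis
      unfolding g_def \<Phi>_def by (intro has_derivative_sum has_derivative_scaleR)
  qed
  have bl: "bounded_linear (\<Phi> x t)" if "x \<in> ball a r" "t \<in> cbox 0 1" for x t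
    using der[OF that] by (rule has_derivative_bounded_linear)
  define fx where "fx x t = Blinfun (\<Phi> x t)" for x t
  have fx: "blinfun_apply (fx x t) = \<Phi> x t" if "x \<in> ball a r" "t \<in> cbox 0 1" for x t
    using bl[OF that] by (simp add: fx_def bounded_linear_Blinfun_apply)
  have lin': "linear (fderiv (\<lambda>y. \<omega> y b) x)" if "x \<in> ball a r" for x b
    by (rule smooth_near_linear_fderiv[OF smooth[OF that]])
  have cont\<Phi>: "continuous_on (ball a r \<times> cbox 0 1) (\<lambda>(x, t). \<Phi> x t v)" for v
  proof -
    have 1: "continuous_on (ball a r \<times> cbox 0 1) (\<lambda>(x, t). fderiv (\<lambda>y. \<omega> y b) (z x t) v)" for b
      by (rule cont) (rule smooth_near_deriv(2)[OF smooth])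
    have 2: "continuous_on (ball a r \<times> cbox 0 1) (\<lambda>(x, t). \<omega> (z x t) b)" for b
      by (rule cont) (rule smooth)
    have "continuous_on (ball a r \<times> cbox 0 1) (\<lambda>p. \<Sum>b\<in>Basis.
        ((fst p - a) \<bullet> b) *\<^sub>R snd p *\<^sub>R fderiv (\<lambda>y. \<omega> y b) (z (fst p) (snd p)) v
        + (v \<bullet> b) *\<^sub>R \<omega> (z (fst p) (snd p)) b)"
      (is "continuous_on _ ?F")
      by (intro continuous_intros 1[unfolded split_beta] 2[unfolded split_beta])
    moreover have *: "\<Phi> x t v = (\<Sum>b\<in>Basis. ((x - a) \<bullet> b) *\<^sub>R t *\<^sub>R fderiv (\<lambda>y. \<omega> y b) (z x t) v
        + (v \<bullet> b) *\<^sub>R \<omega> (z x t) b)" if "x \<in> ball a r" "t \<in> cbox 0 1" for x t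
      unfolding \<Phi>_def using linear_scale[OF lin'[OF z[OF that]]] by simp
    moreover have "?F p = (case p of (x, t) \<Rightarrow> \<Phi> x t v)" if "p \<in> ball a r \<times> cbox 0 1" for p
      using *[of "fst p" "snd p"] that by (auto simp: split_beta simp del: mem_ball)
    ultimately show ?thesis
      by (simp cong: continuous_on_cong)
  qed
  have contfx: "continuous_on (ball a r \<times> cbox 0 1) (\<lambda>(x, t). fx x t)"
  proof (rule continuous_on_blinfun_componentwise)
    fix i :: 'e
    show "continuous_on (ball a r \<times> cbox 0 1) (\<lambda>p. blinfun_apply (case p of (x, t) \<Rightarrow> fx x t) i)"
      by (rule continuous_on_eq[OF cont\<Phi>[of i]]) (auto simp: fx)
  qed
  have slice: "continuous_on (cbox 0 1) (\<lambda>t. F x t)"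
    if "continuous_on (ball a r \<times> cbox 0 1) (\<lambda>(x, t). F x t)" "x \<in> ball a r"
    for F :: "'e \<Rightarrow> real \<Rightarrow> 'g::topological_space" and x
  proof -
    have "continuous_on (cbox 0 1) (\<lambda>t::real. (x, t))" by (intro continuous_intros)
    moreover have "Pair x ` cbox 0 1 \<subseteq> ball a r \<times> cbox 0 1" using that(2) by auto
    ultimately show ?thesis using continuous_on_compose2[OF that(1)] by fastforce
  qed
  have gint: "g x integrable_on cbox 0 1" if "x \<in> ball a r" for x
  proof (rule integrable_continuous)
    have 2: "continuous_on (cbox 0 1) (\<lambda>t. \<omega> (z x t) b)" for b
      by (rule slice[OF cont that]) (rule smooth)
    show "continuous_on (cbox 0 1) (g x)"
      unfolding g_def by (intro continuous_intros 2)
  qed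
  define f where "f x = integral (cbox 0 1) (g x)" for x
  have "(f has_derivative \<omega> x) (at x)" if x: "x \<in> ball a r" for x
  proof -
    have "(f has_derivative blinfun_apply (integral (cbox 0 1) (fx x))) (at x within ball a r)"
      unfolding f_def
    proof (rule leibniz_rule[OF _ gint contfx x convex_ball])
      show "((\<lambda>x. g x t) has_derivative blinfun_apply (fx y t)) (at y within ball a r)"
        if "y \<in> ball a r" "t \<in> cbox 0 1" for y t
        using der[OF that] fx[OF that] has_derivative_at_withinI by simp
    qed
    then have D: "(f has_derivative blinfun_apply (integral (cbox 0 1) (fx x))) (at x)"
      using at_within_open[OF x open_ball] by simp
    have fxint: "fx x integrable_on cbox 0 1"
      by (rule integrable_continuous[OF slice[OF contfx x]])
    have "blinfun_apply (integral (cbox 0 1) (fx x)) v = \<omega> x v" for v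
    proof -
      have "blinfun_apply (integral (cbox 0 1) (fx x)) v = integral (cbox 0 1) (\<lambda>t. fx x t v)"
        using integral_linear[OF fxint blinfun.bounded_linear_left[of v]] by (simp add: o_def)
      also have "\<dots> = integral (cbox 0 1) (\<lambda>t. \<Phi> x t v)"
        by (rule integral_cong) (simp only: fx[OF x])
      also have "\<dots> = 1 *\<^sub>R \<omega> (z x 1) v - 0 *\<^sub>R \<omega> (z x 0) v"
        unfolding cbox_interval
      proof (intro integral_unique fundamental_theorem_of_calculus)
        fix t :: real assume t: "t \<in> {0..1}"
        have zb: "z x t \<in> ball a r" using z[OF x] t by simp
        have \<Phi>: "\<Phi> x t v = t *\<^sub>R fderiv (\<lambda>y. \<omega> y v) (z x t) (x - a) + 1 *\<^sub>R \<omega> (z x t) v"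
        proof -
          have "fderiv (\<lambda>y. \<omega> y b) (z x t) (t *\<^sub>R v) = t *\<^sub>R fderiv (\<lambda>y. \<omega> y v) (z x t) b" for b
            using closed[OF zb, of b v] linear_scale[OF lin'[OF zb]] by simp
          then have "\<Phi> x t v = t *\<^sub>R (\<Sum>b\<in>Basis. ((x - a) \<bullet> b) *\<^sub>R fderiv (\<lambda>y. \<omega> y v) (z x t) b)
              + (\<Sum>b\<in>Basis. (v \<bullet> b) *\<^sub>R \<omega> (z x t) b)"
            by (simp add: \<Phi>_def sum.distrib scaleR_sum_right mult.commute)
          then show ?thesis
            using linear_basis_expansion[OF lin'[OF zb, of v], of "x - a"]
              linear_basis_expansion[OF lin[OF zb], of v] by simp
        qed
        have "((\<lambda>t. \<omega> (a + t *\<^sub>R (x - a)) v) has_vector_derivative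
            fderiv (\<lambda>y. \<omega> y v) (a + t *\<^sub>R (x - a)) (x - a)) (at t)"
          by (rule fderiv_line_at) (use smooth zb in \<open>simp add: z_def\<close>)
        then have "((\<lambda>t. \<omega> (z x t) v) has_vector_derivative fderiv (\<lambda>y. \<omega> y v) (z x t) (x - a)) (at t within {0..1})"
          unfolding z_def by (rule has_vector_derivative_at_within)
        from has_vector_derivative_scaleR[OF DERIV_ident this]
        show "((\<lambda>t. t *\<^sub>R \<omega> (z x t) v) has_vector_derivative \<Phi> x t v) (at t within {0..1})"
          unfolding \<Phi> by simp
      qed simp
      also have "\<dots> = \<omega> x v" by (simp add: z_def)
      finally show ?thesis .
    qed
    then have "blinfun_apply (integral (cbox 0 1) (fx x)) = \<omega> x" by blast
    with D show ?thesis by simp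
  qed
  moreover have "g a = (\<lambda>t. 0)" by (simp add: g_def fun_eq_iff)
  then have "f a = 0" by (simp add: f_def)
  ultimately show ?thesis by blast
qed

text \<open>The inverses \<open>B\<close> of a smooth family \<open>A\<close> of linear maps satisfy \<open>d B = - B (d A) B\<close>, so
  \<open>B\<close> gains one derivative at a time by induction.  The uniform bound on \<open>B\<close> is what gives
  the first derivative.\<close>

lemma smooth_inverse_family:
  fixes A B :: "'e::euclidean_space \<Rightarrow> 'f::euclidean_space \<Rightarrow> 'f"
  assumes S: "open S"
    and lin: "\<And>x. x \<in> S \<Longrightarrow> linear (A x)"
    and smooth: "\<And>x v. x \<in> S \<Longrightarrow> smooth_near (\<lambda>y. A y v) x"
    and AB: "\<And>x v. x \<in> S \<Longrightarrow> A x (B x v) = v" and BA: "\<And>x v. x \<in> S \<Longrightarrow> B x (A x v) = v"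
    and bound: "\<And>x v. x \<in> S \<Longrightarrow> norm (B x v) \<le> 2 * norm v"
  shows "x \<in> S \<Longrightarrow> smooth_near (\<lambda>y. B y v) x"
proof -
  have linB: "linear (B x)" if "x \<in> S" for x
  proof (rule linearI)
    note L = lin[OF that] and AB = AB[OF that] and BA = BA[OF that]
    show "B x (u + v) = B x u + B x v" for u v
      by (metis AB BA linear_add[OF L])
    show "B x (c *\<^sub>R u) = c *\<^sub>R B x u" for c u
      by (metis AB BA linear_scale[OF L])
  qed
  have diff: "B y v - B x v = - B y (A y (B x v) - A x (B x v))" if "x \<in> S" "y \<in> S" for x y v
    using AB[OF that(1)] BA[OF that(2)] linear_diff[OF linB[OF that(2)]] by simp
  have evS: "\<forall>\<^sub>F y in at x. y \<in> S" if "x \<in> S" for x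
    using S that by (rule eventually_at_in_open')
  have contB: "((\<lambda>y. B y v) \<longlongrightarrow> B x v) (at x)" if "x \<in> S" for x v
  proof -
    have "((\<lambda>y. A y (B x v)) \<longlongrightarrow> A x (B x v)) (at x)"
      using smooth_near_cont[OF smooth[OF that]] by (simp add: isCont_def)
    then have lim: "((\<lambda>y. 2 * norm (A y (B x v) - A x (B x v))) \<longlongrightarrow> 0) (at x)"
      using tendsto_mult_right_zero[OF tendsto_norm_zero[OF LIM_zero]] by blast
    have "((\<lambda>y. B y v - B x v) \<longlongrightarrow> 0) (at x)"
      by (rule Lim_null_comparison[OF _ lim])
        (use evS[OF that] in eventually_elim, use bound diff that in simp)
    then show ?thesis by (rule LIM_zero_cancel)
  qed
  have der: "((\<lambda>y. B y v) has_derivative (\<lambda>h. - B x (fderiv (\<lambda>y. A y (B x v)) x h))) (at x)"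
    if "x \<in> S" for x v
  proof -
    define \<phi> where "\<phi> y = A y (B x v)" for y
    define L where "L = fderiv \<phi> x"
    have sm: "smooth_near \<phi> x" unfolding \<phi>_def by (rule smooth[OF that])
    have \<phi>: "(\<phi> has_derivative L) (at x)"
      unfolding L_def by (rule smooth_near_deriv(1)[OF sm])
    have linL: "linear L" using \<phi> by (rule has_derivative_linear)
    define R where "R y = norm (\<phi> y - \<phi> x - L (y - x)) / norm (y - x)" for y
    have R: "(R \<longlongrightarrow> 0) (at x)" using \<phi> unfolding R_def has_derivative_iff_norm by simp
    define Q where "Q y = (\<Sum>b\<in>Basis. norm (B y (L b) - B x (L b)))" for y
    have Q: "(Q \<longlongrightarrow> 0) (at x)" unfolding Q_def
    proof (rule tendsto_null_sum)
      show "((\<lambda>y. norm (B y (L b) - B x (L b))) \<longlongrightarrow> 0) (at x)" for b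
        by (rule tendsto_norm_zero[OF LIM_zero[OF contB[OF that]]])
    qed
    have lim: "((\<lambda>y. 2 * R y + Q y) \<longlongrightarrow> 0) (at x)"
      using tendsto_add[OF tendsto_mult_right_zero[OF R] Q] by simp
    have est: "norm (norm (B y v - B x v - (- B x (L (y - x)))) / norm (y - x)) \<le> 2 * R y + Q y"
      if y: "y \<in> S" "y \<noteq> x" for y
    proof -
      have 1: "B y v - B x v - (- B x (L (y - x)))
          = - B y (\<phi> y - \<phi> x - L (y - x)) - (B y (L (y - x)) - B x (L (y - x)))"
        using diff[OF \<open>x \<in> S\<close> y(1), of v] linear_diff[OF linB[OF y(1)]] by (simp add: \<phi>_def)
      have 2: "B y (L (y - x)) - B x (L (y - x)) = (\<Sum>b\<in>Basis. ((y - x) \<bullet> b) *\<^sub>R (B y (L b) - B x (L b)))"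
        using linear_basis_expansion[OF linear_compose[OF linL linB[OF y(1)]], of "y - x"]
          linear_basis_expansion[OF linear_compose[OF linL linB[OF \<open>x \<in> S\<close>]], of "y - x"]
        by (simp add: o_def scaleR_diff_right sum_subtractf)
      have "norm (B y (L (y - x)) - B x (L (y - x))) \<le> (\<Sum>b\<in>Basis. \<bar>(y - x) \<bullet> b\<bar> * norm (B y (L b) - B x (L b)))"
        unfolding 2 by (rule order_trans[OF norm_sum]) simp
      also have "\<dots> \<le> (\<Sum>b\<in>Basis. norm (y - x) * norm (B y (L b) - B x (L b)))"
        by (intro sum_mono mult_right_mono Basis_le_norm) auto
      also have "\<dots> = norm (y - x) * Q y" by (simp add: Q_def sum_distrib_left)
      finally have 3: "norm (B y (L (y - x)) - B x (L (y - x))) \<le> norm (y - x) * Q y" .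
      have "norm (B y v - B x v - (- B x (L (y - x))))
          \<le> norm (B y (\<phi> y - \<phi> x - L (y - x))) + norm (B y (L (y - x)) - B x (L (y - x)))"
        unfolding 1 by (rule order_trans[OF norm_triangle_ineq4]) simp
      also have "\<dots> \<le> 2 * norm (\<phi> y - \<phi> x - L (y - x)) + norm (y - x) * Q y"
        by (rule add_mono[OF bound[OF y(1)] 3])
      also have "\<dots> = norm (y - x) * (2 * R y + Q y)"
        using y(2) by (simp add: R_def field_simps)
      finally show ?thesis using y(2) by (simp add: divide_le_eq mult.commute)
    qed
    have "((\<lambda>y. norm (B y v - B x v - (- B x (L (y - x)))) / norm (y - x)) \<longlongrightarrow> 0) (at x)"
    proof (rule Lim_null_comparison[OF _ lim])
      show "\<forall>\<^sub>F y in at x. norm (norm (B y v - B x v - (- B x (L (y - x)))) / norm (y - x)) \<le> 2 * R y + Q y"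
        using evS[OF that] eventually_at_topological[of "\<lambda>y. y \<noteq> x" x UNIV] est
        unfolding eventually_at_filter by (auto elim!: eventually_mono)
    qed
    moreover have "bounded_linear (\<lambda>h. - B x (L h))"
      using linear_compose[OF linL linB[OF that]]
      by (intro bounded_linear_minus) (simp add: o_def linear_conv_bounded_linear)
    ultimately show ?thesis
      unfolding has_derivative_iff_norm L_def \<phi>_def by simp
  qed
  have Ck: "Ck_on k UNIV S (\<lambda>x. B x v)" for k v
  proof (induction k arbitrary: v)
    case 0
    then show ?case
      using contB S by (simp add: continuous_on_eq_continuous_at isCont_def)
  next
    case (Suc k)
    show ?case
    proof (rule Ck_on_SucI[OF S der])
      fix h
      define q where "q c x = fderiv (\<lambda>y. A y c) x h" for c x
      have q: "Ck_on k UNIV S (\<lambda>x. q c x \<bullet> d)" for c d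
      proof -
        have "smooth_on UNIV S (\<lambda>x. q c x)"
          unfolding smooth_on_iff_near[OF S] q_def using smooth_near_deriv(2)[OF smooth] by blast
        then show ?thesis
          unfolding smooth_on_def using Ck_on_linear_comp[OF S bounded_linear_inner_left] by blast
      qed
      have "Ck_on k UNIV S (\<lambda>x. B x v \<bullet> c)" for c
        by (rule Ck_on_linear_comp[OF S bounded_linear_inner_left Suc.IH])
      then have "Ck_on k UNIV S (\<lambda>x. - (\<Sum>c\<in>Basis. \<Sum>d\<in>Basis. (B x v \<bullet> c) *\<^sub>R (q c x \<bullet> d) *\<^sub>R B x d))"
        by (intro Ck_on_linear_comp[OF S bounded_linear_minus[OF bounded_linear_ident]]
            Ck_on_sum[OF S] Ck_on_bilinear[OF bounded_bilinear_scaleR S] q Suc.IH)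
      then show "Ck_on k UNIV S (\<lambda>x. - B x (fderiv (\<lambda>y. A y (B x v)) x h))"
      proof (rule Ck_on_cong[rotated])
        fix x assume x: "x \<in> S"
        have "\<forall>\<^sub>F y in nhds x. A y (B x v) = (\<Sum>c\<in>Basis. (B x v \<bullet> c) *\<^sub>R A y c)"
          using eventually_nhds_in_open[OF S x] by eventually_elim (rule linear_basis_expansion[OF lin])
        then have "fderiv (\<lambda>y. A y (B x v)) x = fderiv (\<lambda>y. \<Sum>c\<in>Basis. (B x v \<bullet> c) *\<^sub>R A y c) x"
          by (rule fderiv_cong)
        also have "\<dots> = (\<lambda>h. \<Sum>c\<in>Basis. (B x v \<bullet> c) *\<^sub>R fderiv (\<lambda>y. A y c) x h)"
          by (intro fderiv_eq has_derivative_sum has_derivative_scaleR_right smooth_near_deriv(1)[OF smooth[OF x]])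
        finally have "fderiv (\<lambda>y. A y (B x v)) x h = (\<Sum>c\<in>Basis. (B x v \<bullet> c) *\<^sub>R q c x)"
          by (simp add: q_def)
        then have "B x (fderiv (\<lambda>y. A y (B x v)) x h) = (\<Sum>c\<in>Basis. (B x v \<bullet> c) *\<^sub>R B x (q c x))"
          using linB[OF x] by (simp add: linear_sum linear_scale)
        also have "\<dots> = (\<Sum>c\<in>Basis. \<Sum>d\<in>Basis. (B x v \<bullet> c) *\<^sub>R (q c x \<bullet> d) *\<^sub>R B x d)"
          by (subst linear_basis_expansion[OF linB[OF x], of "q _ x"]) (simp add: scaleR_sum_right)
        finally show "- (\<Sum>c\<in>Basis. \<Sum>d\<in>Basis. (B x v \<bullet> c) *\<^sub>R (q c x \<bullet> d) *\<^sub>R B x d)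
            = - B x (fderiv (\<lambda>y. A y (B x v)) x h)" by simp
      qed
    qed
  qed
  show "x \<in> S \<Longrightarrow> smooth_near (\<lambda>y. B y v) x"
    by (rule smooth_nearI[OF S _ Ck])
qed

text \<open>The derivative of the local inverse \<open>\<Psi>\<close> at \<open>y\<close> is \<open>(\<Phi>' (\<Psi> y))\<inverse>\<close>, so each degree of
  smoothness of \<open>\<Psi>\<close> yields the next.  The domain is chosen where \<open>\<Phi>'\<close> is within distance 1/2
  of the identity, so that the inverses of \<open>\<Phi>'\<close> are bounded by 2.\<close>

lemma smooth_local_inverse:
  fixes \<Phi> :: "'e::euclidean_space \<Rightarrow> 'e"
  assumes sm: "smooth_near \<Phi> a" and id: "\<And>v. fderiv \<Phi> a v = v" and N: "open N" "a \<in> N"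
  obtains S T \<Psi> where "open S" "a \<in> S" "S \<subseteq> N" "open T" "\<Phi> a \<in> T" "homeomorphism S T \<Phi> \<Psi>"
    "\<And>y. y \<in> T \<Longrightarrow> smooth_near \<Psi> y" "\<And>v. fderiv \<Psi> (\<Phi> a) v = v"
proof -
  obtain S0 where S0: "open S0" "a \<in> S0" "\<And>x. x \<in> S0 \<Longrightarrow> smooth_near \<Phi> x"
    using eventually_smooth_near[OF sm] by (auto simp: eventually_nhds)
  define D where "D x = Blinfun (fderiv \<Phi> x)" for x
  have bl: "bounded_linear (fderiv \<Phi> x)" if "x \<in> S0" for x
    using smooth_near_deriv(1)[OF S0(3)[OF that]] by (rule has_derivative_bounded_linear)
  have D: "blinfun_apply (D x) = fderiv \<Phi> x" if "x \<in> S0" for x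
    by (simp add: D_def bounded_linear_Blinfun_apply bl[OF that])
  have contD: "continuous_on S0 D"
  proof (rule continuous_on_blinfun_componentwise)
    fix i :: 'e
    have "continuous_on S0 (\<lambda>x. fderiv \<Phi> x i)"
      using smooth_near_cont[OF smooth_near_deriv(2)[OF S0(3)]] continuous_at_imp_continuous_on by blast
    then show "continuous_on S0 (\<lambda>x. blinfun_apply (D x) i)"
      by (rule continuous_on_eq) (simp add: D)
  qed
  have Da: "D a = id_blinfun" by (rule blinfun_eqI) (simp add: D S0(2) id)
  define U where "U = S0 \<inter> D -` ball id_blinfun (1/2) \<inter> N"
  have U: "open U" unfolding U_def
    using contD S0(1) N by (intro open_Int continuous_open_preimage) auto
  have aU: "a \<in> U" using S0 Da N by (simp add: U_def)
  obtain S T \<Psi> g' where inv: "open S" "S \<subseteq> U" "a \<in> S" "open T" "\<Phi> a \<in> T" "homeomorphism S T \<Phi> \<Psi>"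
    "\<And>y. y \<in> T \<Longrightarrow> (\<Psi> has_derivative g' y) (at y)"
    "\<And>y. y \<in> T \<Longrightarrow> g' y = inv_into UNIV (blinfun_apply (D (\<Psi> y)))"
    "\<And>y. y \<in> T \<Longrightarrow> bij (blinfun_apply (D (\<Psi> y)))"
  proof (rule inverse_function_theorem[OF U, of \<Phi> D a id_blinfun])
    show "(\<Phi> has_derivative blinfun_apply (D x)) (at x)" if "x \<in> U" for x
      using smooth_near_deriv(1)[OF S0(3)] D that by (simp add: U_def)
    show "continuous_on U D" by (rule continuous_on_subset[OF contD]) (auto simp: U_def)
    show "id_blinfun o\<^sub>L D a = id_blinfun" by (rule blinfun_eqI) (simp add: Da)
  qed (rule aU, rule that)
  define A where "A x = fderiv \<Phi> x" for x
  define B where "B x = inv_into UNIV (A x)" for x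
  have \<Psi>S: "\<Psi> y \<in> S" and \<Phi>\<Psi>: "\<Phi> (\<Psi> y) = y" if "y \<in> T" for y
    using inv(6) that by (auto simp: homeomorphism_def)
  have \<Psi>\<Phi>: "\<Psi> (\<Phi> x) = x" and \<Phi>T: "\<Phi> x \<in> T" if "x \<in> S" for x
    using inv(6) that by (auto simp: homeomorphism_def)
  have SS0: "x \<in> S0" if "x \<in> S" for x using inv(2) that by (auto simp: U_def)
  have bijA: "bij (A x)" if "x \<in> S" for x
    using inv(9)[OF \<Phi>T[OF that]] \<Psi>\<Phi>[OF that] D[OF SS0[OF that]] by (simp add: A_def)
  have smB: "smooth_near (\<lambda>y. B y v) x" if "x \<in> S" for x v
  proof (rule smooth_inverse_family[OF inv(1) _ _ _ _ _ that])
    fix x assume x: "x \<in> S"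
    show "linear (A x)" unfolding A_def by (rule smooth_near_linear_fderiv[OF S0(3)[OF SS0[OF x]]])
    show "smooth_near (\<lambda>y. A y v) x" for v
      unfolding A_def by (rule smooth_near_deriv(2)[OF S0(3)[OF SS0[OF x]]])
    show AB: "A x (B x v) = v" for v
      using bijA[OF x] by (simp add: B_def bij_def surj_f_inv_f)
    show "B x (A x v) = v" for v
      using bijA[OF x] by (simp add: B_def bij_def)
    show "norm (B x v) \<le> 2 * norm v" for v
    proof -
      have "norm (D x - id_blinfun) \<le> 1/2"
        using inv(2) x by (auto simp: U_def dist_norm norm_minus_commute)
      then have "norm ((D x - id_blinfun) (B x v)) \<le> 1/2 * norm (B x v)"
        by (meson norm_blinfun mult_right_mono norm_ge_zero order_trans)
      moreover have "(D x - id_blinfun) (B x v) = v - B x v"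
        using AB[of v] D[OF SS0[OF x]] by (simp add: blinfun.diff_left A_def)
      moreover have "norm (B x v) \<le> norm v + norm (v - B x v)"
        by (metis norm_triangle_sub norm_minus_commute add.commute)
      ultimately show ?thesis by simp
    qed
  qed
  have g': "g' y = B (\<Psi> y)" if "y \<in> T" for y
    using inv(8)[OF that] D[OF SS0[OF \<Psi>S[OF that]]] by (simp add: A_def B_def)
  have der: "(\<Psi> has_derivative B (\<Psi> y)) (at y)" if "y \<in> T" for y
    using inv(7)[OF that] g'[OF that] by simp
  have "Ck_on k UNIV T \<Psi>" for k
  proof (induction k)
    case 0
    then show ?case using inv(6) by (simp add: homeomorphism_def)
  next
    case (Suc k)
    show ?case
    proof (rule Ck_on_SucI[OF inv(4) der])
      fix v
      have "smooth_on UNIV S (\<lambda>x. B x v)"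
        using smB by (simp add: smooth_on_iff_near[OF inv(1)])
      then have B: "Ck_on k UNIV S (\<lambda>x. B x v)" by (simp add: smooth_on_def)
      have "\<Psi> ` T \<subseteq> S" using \<Psi>S by auto
      then show "Ck_on k UNIV T (\<lambda>y. B (\<Psi> y) v)"
        by (rule Ck_on_compose[OF inv(4,1) _ Suc.IH B])
    qed
  qed
  then have sm\<Psi>: "smooth_near \<Psi> y" if "y \<in> T" for y
    using smooth_nearI[OF inv(4) that] by blast
  have "B a (A a v) = v" for v
    using bijA[OF inv(3)] by (simp add: B_def bij_def)
  moreover have "A a v = v" for v by (simp add: A_def id)
  moreover have "fderiv \<Psi> (\<Phi> a) = B a"
    using fderiv_eq[OF der[OF inv(5)]] \<Psi>\<Phi>[OF inv(3)] by simp
  ultimately have "fderiv \<Psi> (\<Phi> a) v = v" for v by simp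
  with inv sm\<Psi> show ?thesis by (intro that[of S T \<Psi>]) (auto simp: U_def)
qed

section \<open>Extending local homomorphisms along paths\<close>

locale topological_group = group G for G (structure) +
  fixes X :: "'a topology"
  assumes carrier_eq: "carrier G = topspace X"
    and continuous_mult: "continuous_map (prod_topology X X) X (\<lambda>(x, y). x \<otimes> y)"
    and continuous_inv: "continuous_map X X (\<lambda>x. inv x)"
begin

lemma continuous_mult_comp:
  assumes "continuous_map Y X f" "continuous_map Y X g"
  shows "continuous_map Y X (\<lambda>y. f y \<otimes> g y)"
proof -
  have "continuous_map Y (prod_topology X X) (\<lambda>y. (f y, g y))"
    using assms by (simp add: continuous_map_pairedI)
  from continuous_map_compose[OF this continuous_mult] show ?thesis by (simp add: o_def)
qed

lemma continuous_inv_comp: "continuous_map Y X f \<Longrightarrow> continuous_map Y X (\<lambda>y. inv (f y))"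
  using continuous_map_compose[OF _ continuous_inv] by (simp add: o_def)

lemma continuous_translation: "g \<in> carrier G \<Longrightarrow> continuous_map X X (\<lambda>x. g \<otimes> x)"
  by (intro continuous_mult_comp) (auto simp: carrier_eq)

text \<open>The pairs \<open>(z, z')\<close> with \<open>K z\<inverse> K z'\<close> outside \<open>W\<close> form a compact set that avoids the
  diagonal, so the distance has a positive minimum on it.\<close>

lemma uniform_continuity:
  fixes K :: "'m::metric_space \<Rightarrow> 'a"
  assumes "compact S" "continuous_map (top_of_set S) X K" "openin X W" "\<one> \<in> W"
  shows "\<exists>\<epsilon>>0. \<forall>z\<in>S. \<forall>z'\<in>S. dist z z' < \<epsilon> \<longrightarrow> inv (K z) \<otimes> K z' \<in> W"
proof -
  define F where "F = (\<lambda>p. inv (K (fst p)) \<otimes> K (snd p))"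
  have K: "K z \<in> carrier G" if "z \<in> S" for z
    using assms(2) that by (auto simp: continuous_map_def carrier_eq)
  have F: "continuous_map (top_of_set (S \<times> S)) X F"
    unfolding F_def
  proof (intro continuous_mult_comp continuous_inv_comp)
    have "continuous_map (top_of_set (S \<times> S)) (top_of_set S) fst"
      "continuous_map (top_of_set (S \<times> S)) (top_of_set S) snd"
      by (auto simp: continuous_on_fst continuous_on_snd)
    from continuous_map_compose[OF this(1) assms(2)] continuous_map_compose[OF this(2) assms(2)]
    show "continuous_map (top_of_set (S \<times> S)) X (\<lambda>p. K (fst p))"
      "continuous_map (top_of_set (S \<times> S)) X (\<lambda>p. K (snd p))" by (simp_all add: o_def)
  qed
  define B where "B = {p \<in> S \<times> S. F p \<notin> W}"
  have "closedin (top_of_set (S \<times> S)) {p \<in> topspace (top_of_set (S \<times> S)). F p \<in> topspace X - W}"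
    by (rule closedin_continuous_map_preimage[OF F]) (simp add: assms(3) closedin_diff)
  moreover have "{p \<in> topspace (top_of_set (S \<times> S)). F p \<in> topspace X - W} = B"
    using F by (auto simp: B_def continuous_map_def)
  ultimately have B: "compact B"
    using closedin_compact compact_Times[OF assms(1,1)] by metis
  show ?thesis
  proof (cases "B = {}")
    case True
    then show ?thesis by (intro exI[of _ 1]) (auto simp: B_def F_def)
  next
    case False
    have "continuous_on B (\<lambda>p. dist (fst p) (snd p))" by (intro continuous_intros)
    from continuous_attains_inf[OF B False this]
    obtain p where p: "p \<in> B" "\<And>q. q \<in> B \<Longrightarrow> dist (fst p) (snd p) \<le> dist (fst q) (snd q)" by auto
    have "fst p \<noteq> snd p"
    proof
      assume "fst p = snd p"
      then have "F p = \<one>" using p(1) K by (auto simp: F_def B_def)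
      then show False using p(1) assms(4) by (simp add: B_def)
    qed
    then have "dist (fst p) (snd p) > 0" by simp
    moreover have "inv (K z) \<otimes> K z' \<in> W" if "z \<in> S" "z' \<in> S" "dist z z' < dist (fst p) (snd p)" for z z'
    proof (rule ccontr)
      assume "\<not> ?thesis"
      then have "(z, z') \<in> B" using that by (simp add: B_def F_def)
      from p(2)[OF this] that(3) show False by simp
    qed
    ultimately show ?thesis by blast
  qed
qed

end

definition path_join :: "(real \<Rightarrow> 'a) \<Rightarrow> (real \<Rightarrow> 'a) \<Rightarrow> real \<Rightarrow> 'a" where
  "path_join p q = (\<lambda>t. if t \<le> 1 / 2 then p (2 * t) else q (2 * t - 1))"

definition path_reverse :: "(real \<Rightarrow> 'a) \<Rightarrow> real \<Rightarrow> 'a" where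
  "path_reverse p = (\<lambda>t. p (1 - t))"

lemma pathin_path_join:
  assumes "pathin X p" "pathin X q" "p 1 = q 0"
  shows "pathin X (path_join p q)"
proof -
  let ?T01 = "top_of_set {0..1::real}"
  let ?g = "\<lambda>x. if x \<le> 1/2 then (p \<circ> (\<lambda>t. 2 * t)) x else (q \<circ> (\<lambda>t. 2 * t -1)) x"
  note pq = assms(1,2)[unfolded pathin_def]
  have "continuous_map ?T01 X ?g"
  proof (intro continuous_map_cases_le continuous_map_compose, force, force)
    show "continuous_map (subtopology ?T01 {x \<in> topspace ?T01. x \<le> 1/2}) ?T01 ((*) 2)"
      by (auto simp: continuous_map_in_subtopology continuous_map_from_subtopology)
    have "continuous_map (subtopology (top_of_set {0..1}) {x. 0 \<le> x \<and> x \<le> 1 \<and> 1 \<le> x * 2})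
             euclideanreal (\<lambda>t. 2 * t - 1)"
      by (intro continuous_intros) (force intro: continuous_map_from_subtopology)
    then show "continuous_map (subtopology ?T01 {x \<in> topspace ?T01. 1/2 \<le> x}) ?T01 (\<lambda>t. 2 * t - 1)"
      by (force simp: continuous_map_in_subtopology)
    show "(p \<circ> (*) 2) x = (q \<circ> (\<lambda>t. 2 * t - 1)) x" if "x \<in> topspace ?T01" "x = 1/2" for x
    proof -
      have "2 * x = 1" using that by simp
      then show ?thesis using assms(3) by simp
    qed
  qed (use pq in simp_all)
  moreover have "?g = path_join p q" by (simp add: path_join_def fun_eq_iff)
  ultimately show ?thesis by (simp add: pathin_def)
qed

lemma pathin_path_reverse:
  assumes "pathin X p" shows "pathin X (path_reverse p)"
proof -
  have "continuous_map (top_of_set {0..1}) (top_of_set {0..1::real}) (\<lambda>t. 1 - t)"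
    by (auto intro!: continuous_intros)
  from continuous_map_compose[OF this assms[unfolded pathin_def]]
  show ?thesis by (simp add: pathin_def path_reverse_def o_def)
qed

text \<open>For \<open>x\<close>, \<open>y\<close> in \<open>W\<close> the hypothesis on quotients is the homomorphism law: put
  \<open>y = x z\<close>.  In this form it says that \<open>h (p\<inverse> q)\<close> is a cocycle in nearby points
  \<open>p\<close>, \<open>q\<close>, and it is additive along chains of points however far they lead.\<close>

locale local_homomorphism = topological_group +
  fixes W :: "'a set" and h :: "'a \<Rightarrow> 'v::real_vector"
  assumes W_open: "openin X W" and one_W: "\<one> \<in> W"
    and h_quotient: "\<lbrakk>x \<in> W; y \<in> W\<rbrakk> \<Longrightarrow> h (inv x \<otimes> y) = h y - h x"
begin

definition increment :: "'a \<Rightarrow> 'a \<Rightarrow> 'v" where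
  "increment p q = h (inv p \<otimes> q)"

definition path_sum :: "nat \<Rightarrow> (real \<Rightarrow> 'a) \<Rightarrow> 'v" where
  "path_sum n \<gamma> = (\<Sum>i<n. increment (\<gamma> (i / n)) (\<gamma> (Suc i / n)))"

definition fine_grid :: "(real \<Rightarrow> 'a) \<Rightarrow> nat \<Rightarrow> bool" where
  "fine_grid \<gamma> n \<longleftrightarrow> n \<ge> 1 \<and> \<gamma> ` {0..1} \<subseteq> carrier G \<and>
     (\<forall>s\<in>{0..1}. \<forall>t\<in>{0..1}. \<bar>s - t\<bar> \<le> 1 / n \<longrightarrow> inv (\<gamma> s) \<otimes> \<gamma> t \<in> W)"

lemma h_one: "h \<one> = 0"
  using h_quotient[OF one_W one_W] by simp

lemma increment_refl: "p \<in> carrier G \<Longrightarrow> increment p p = 0"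
  by (simp add: increment_def h_one)

lemma increment_cocycle:
  assumes "p \<in> carrier G" "q \<in> carrier G" "r \<in> carrier G" "inv p \<otimes> q \<in> W" "inv p \<otimes> r \<in> W"
  shows "increment q r = increment p r - increment p q"
proof -
  have "inv (inv p \<otimes> q) \<otimes> (inv p \<otimes> r) = inv q \<otimes> r"
    using assms(1-3) by (simp add: inv_mult_group m_assoc[symmetric]) (simp add: m_assoc)
  then show ?thesis using h_quotient[OF assms(4,5)] by (simp add: increment_def)
qed

lemma increment_sym:
  assumes "p \<in> carrier G" "q \<in> carrier G" "inv p \<otimes> q \<in> W"
  shows "increment q p = - increment p q"
  using increment_cocycle[OF assms(1,2,1,3)] assms one_W by (simp add: increment_refl)

lemma increment_translate:
  assumes "g \<in> carrier G" "p \<in> carrier G" "q \<in> carrier G"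
  shows "inv (g \<otimes> p) \<otimes> (g \<otimes> q) = inv p \<otimes> q"
  using assms by (simp add: inv_mult_group m_assoc[symmetric]) (simp add: m_assoc)

lemma fine_exists:
  assumes "pathin X \<gamma>" shows "\<exists>N. \<forall>n\<ge>N. fine_grid \<gamma> n"
proof -
  obtain \<epsilon> where \<epsilon>: "\<epsilon> > 0" "\<And>s t. s \<in> {0..1} \<Longrightarrow> t \<in> {0..1} \<Longrightarrow> dist s t < \<epsilon> \<Longrightarrow> inv (\<gamma> s) \<otimes> \<gamma> t \<in> W"
    using uniform_continuity[OF compact_Icc assms[unfolded pathin_def] W_open one_W] by blast
  obtain m where "inverse (real (Suc m)) < \<epsilon>" using reals_Archimedean[OF \<epsilon>(1)] by blast
  then obtain N where N: "N > 0" "1 / real N < \<epsilon>"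
    using that[of "Suc m"] by (simp add: inverse_eq_divide)
  have "fine_grid \<gamma> n" if "n \<ge> N" for n
  proof -
    have "1 / real n \<le> 1 / real N" using N that by (simp add: frac_le)
    moreover have "\<gamma> ` {0..1} \<subseteq> carrier G"
      using path_image_subset_topspace[OF assms] carrier_eq by auto
    ultimately show ?thesis using N that \<epsilon>(2) by (auto simp: fine_grid_def dist_real_def)
  qed
  then show ?thesis by blast
qed

lemma fine_mem: "fine_grid \<gamma> n \<Longrightarrow> t \<in> {0..1} \<Longrightarrow> \<gamma> t \<in> carrier G"
  by (auto simp: fine_grid_def)

text \<open>By the cocycle identity the increments inside one interval of the coarser subdivision
  telescope.\<close>

lemma path_sum_refine:
  assumes f: "fine_grid \<gamma> n" and m: "m \<ge> 1"
  shows "path_sum (n * m) \<gamma> = path_sum n \<gamma>"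
proof -
  have n: "n \<ge> 1" using f by (simp add: fine_grid_def)
  define p where "p k = \<gamma> (real k / real (n * m))" for k
  have "path_sum (n * m) \<gamma> = (\<Sum>k<n*m. increment (p k) (p (Suc k)))"
    by (simp add: path_sum_def p_def)
  also have "\<dots> = (\<Sum>i<n. \<Sum>k=i*m..<i*m+m. increment (p k) (p (Suc k)))"
    by (rule sum.nat_group[symmetric])
  also have "\<dots> = (\<Sum>i<n. increment (\<gamma> (i / n)) (\<gamma> (Suc i / n)))"
  proof (rule sum.cong[OF refl])
    fix i assume "i \<in> {..<n}"
    then have i: "i < n" by simp
    have pi: "p (i * m) = \<gamma> (i / n)" "p (i * m + m) = \<gamma> (Suc i / n)"
    proof -
      have "real (i * m) / real (n * m) = i / n" "real (i * m + m) / real (n * m) = Suc i / n"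
        using m n by (simp_all add: field_simps)
      then show "p (i * m) = \<gamma> (i / n)" "p (i * m + m) = \<gamma> (Suc i / n)" by (simp_all only: p_def)
    qed
    have t: "real k / real (n * m) \<in> {0..1}" if "k \<in> {i*m..i*m+m}" for k
    proof -
      have "k \<le> Suc i * m" using that by simp
      also have "\<dots> \<le> n * m" using i by (intro mult_right_mono) auto
      finally have "real k \<le> real (n * m)" by (rule of_nat_mono)
      then show ?thesis using m n by (simp add: divide_le_eq)
    qed
    have c: "p k \<in> carrier G" if "k \<in> {i*m..i*m+m}" for k
      using fine_mem[OF f t[OF that]] by (simp add: p_def)
    have near: "inv (p (i * m)) \<otimes> p k \<in> W" if k: "k \<in> {i*m..i*m+m}" for k
    proof -
      have "real (i * m) / real (n * m) - real k / real (n * m) = (real (i * m) - real k) / real (n * m)"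
        by (simp add: diff_divide_distrib)
      moreover have "\<bar>real (i * m) - real k\<bar> \<le> real m"
      proof -
        have "real (i * m) \<le> real k" "real k \<le> real (i * m + m)"
          using k by (auto intro: of_nat_mono simp del: of_nat_mult of_nat_add)
        then show ?thesis by (simp add: abs_le_iff)
      qed
      ultimately have "\<bar>real (i * m) / real (n * m) - real k / real (n * m)\<bar> \<le> real m / real (n * m)"
        by (simp only: abs_divide abs_of_nat divide_right_mono of_nat_0_le_iff)
      also have "\<dots> = 1 / real n" using m by simp
      finally show ?thesis
        using f t[of "i * m"] t[OF k] unfolding fine_grid_def p_def by auto
    qed
    have "(\<Sum>k=i*m..<i*m+m. increment (p k) (p (Suc k)))
        = (\<Sum>k=i*m..<i*m+m. increment (p (i*m)) (p (Suc k)) - increment (p (i*m)) (p k))"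
      by (intro sum.cong refl increment_cocycle c near) auto
    also have "\<dots> = increment (p (i*m)) (p (i*m+m)) - increment (p (i*m)) (p (i*m))"
      by (rule sum_Suc_diff') simp
    finally show "(\<Sum>k=i*m..<i*m+m. increment (p k) (p (Suc k))) = increment (\<gamma> (i / n)) (\<gamma> (Suc i / n))"
      using pi c[of "i*m"] by (simp add: increment_refl)
  qed
  finally show ?thesis by (simp add: path_sum_def)
qed

definition path_integral :: "(real \<Rightarrow> 'a) \<Rightarrow> 'v" where
  "path_integral \<gamma> = path_sum (SOME n. fine_grid \<gamma> n) \<gamma>"

lemma path_integral_eq: assumes "fine_grid \<gamma> n" shows "path_integral \<gamma> = path_sum n \<gamma>"
proof -
  define m where "m = (SOME n. fine_grid \<gamma> n)"
  have m: "fine_grid \<gamma> m" unfolding m_def using assms by (rule someI)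
  have "path_sum m \<gamma> = path_sum (m * n) \<gamma>"
    using path_sum_refine[OF m, of n] assms by (simp add: fine_grid_def)
  also have "\<dots> = path_sum n \<gamma>"
    using path_sum_refine[OF assms, of m] m by (simp add: fine_grid_def mult.commute)
  finally show ?thesis by (simp add: path_integral_def m_def)
qed

text \<open>Cut the square into a fine grid.  Two neighbouring rows form a ladder, and by the cocycle
  identity the increments along its two sides differ by the increments along the first and the last
  rung.  These agree because the rows are loops.\<close>

lemma path_sum_homotopic:
  fixes K :: "real \<times> real \<Rightarrow> 'a"
  assumes K: "continuous_map (top_of_set ({0..1} \<times> {0..1})) X K"
    and loop: "\<And>s. s \<in> {0..1} \<Longrightarrow> K (s, 1) = K (s, 0)"
  shows "\<exists>N\<ge>1. \<forall>n\<ge>N. path_sum n (\<lambda>t. K (0, t)) = path_sum n (\<lambda>t. K (1, t))"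
proof -
  obtain \<epsilon> where \<epsilon>: "\<epsilon> > 0" "\<And>z z'. z \<in> {0..1} \<times> {0..1} \<Longrightarrow> z' \<in> {0..1} \<times> {0..1} \<Longrightarrow>
      dist z z' < \<epsilon> \<Longrightarrow> inv (K z) \<otimes> K z' \<in> W"
    using uniform_continuity[OF compact_Times[OF compact_Icc compact_Icc] K W_open one_W] by blast
  have Kc: "K z \<in> carrier G" if "z \<in> {0..1} \<times> {0..1}" for z
    using K that by (auto simp: continuous_map_def carrier_eq)
  obtain m where "inverse (real (Suc m)) < \<epsilon> / 2" using reals_Archimedean[of "\<epsilon> / 2"] \<epsilon>(1) by auto
  then obtain N where N: "N > 0" "1 / real N < \<epsilon> / 2"
    using that[of "Suc m"] by (simp add: inverse_eq_divide)
  have "path_sum n (\<lambda>t. K (0, t)) = path_sum n (\<lambda>t. K (1, t))" if n: "n \<ge> N" for n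
  proof -
    have n0: "n \<ge> 1" using N n by simp
    have "1 / real n \<le> 1 / real N" using N n by (simp add: frac_le)
    then have nn: "2 / real n < \<epsilon>" using N(2) by simp
    define P where "P k i = K (real k / n, real i / n)" for k i
    have sq: "(real k / n, real i / n) \<in> {0..1} \<times> {0..1}" if "k \<le> n" "i \<le> n" for k i
      using that n0 by simp
    have close: "inv (P k i) \<otimes> P k' i' \<in> W"
      if "k \<le> n" "i \<le> n" "k' \<le> n" "i' \<le> n" "k' \<le> Suc k" "k \<le> k'" "i' \<le> Suc i" "i \<le> i'" for k i k' i'
    proof -
      have "dist (real k / n, real i / n) (real k' / n, real i' / n)
          \<le> \<bar>real k / n - real k' / n\<bar> + \<bar>real i / n - real i' / n\<bar>"
        unfolding dist_prod_def dist_real_def by (simp add: sqrt_sum_squares_le_sum_abs)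
      also have "\<bar>real k / n - real k' / n\<bar> = (real k' - real k) / n"
        using that by (simp add: diff_divide_distrib[symmetric] divide_le_0_iff)
      also have "\<bar>real i / n - real i' / n\<bar> = (real i' - real i) / n"
        using that by (simp add: diff_divide_distrib[symmetric] divide_le_0_iff)
      also have "(real k' - real k) / n \<le> 1 / n"
        using that by (intro divide_right_mono) auto
      also have "(real i' - real i) / n \<le> 1 / n"
        using that by (intro divide_right_mono) auto
      finally have "dist (real k / n, real i / n) (real k' / n, real i' / n) < \<epsilon>" using nn by simp
      then show ?thesis unfolding P_def using \<epsilon>(2) sq that by blast
    qed
    have Pc: "P k i \<in> carrier G" if "k \<le> n" "i \<le> n" for k i
      unfolding P_def using Kc sq that by blast
    define S where "S k = (\<Sum>i<n. increment (P k i) (P k (Suc i)))" for k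
    have step: "S (Suc k) = S k" if k: "k < n" for k
    proof -
      define d where "d i = increment (P k i) (P (Suc k) i)" for i
      have ladder: "increment (P (Suc k) i) (P (Suc k) (Suc i)) - increment (P k i) (P k (Suc i)) = d (Suc i) - d i"
        if i: "i < n" for i
      proof -
        have "increment (P (Suc k) i) (P (Suc k) (Suc i))
            = increment (P k i) (P (Suc k) (Suc i)) - increment (P k i) (P (Suc k) i)"
          using k i by (intro increment_cocycle Pc close) auto
        moreover have "increment (P k (Suc i)) (P (Suc k) (Suc i))
            = increment (P k i) (P (Suc k) (Suc i)) - increment (P k i) (P k (Suc i))"
          using k i by (intro increment_cocycle Pc close) auto
        ultimately show ?thesis by (simp add: d_def)
      qed
      have "S (Suc k) - S k = (\<Sum>i<n. d (Suc i) - d i)"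
        unfolding S_def sum_subtractf[symmetric] by (intro sum.cong refl ladder) simp
      also have "\<dots> = d n - d 0" by (rule sum_lessThan_telescope)
      also have "d n = d 0"
        using loop[of "real k / n"] loop[of "real (Suc k) / n"] k n0 by (simp add: d_def P_def)
      finally show ?thesis by simp
    qed
    have "S k = S 0" if "k \<le> n" for k
      using that by (induction k) (auto simp: step)
    from this[of n] show ?thesis
      using n0 by (simp add: S_def P_def path_sum_def)
  qed
  with N show ?thesis by (intro exI[of _ N]) auto
qed

lemma path_sum_const: "a \<in> carrier G \<Longrightarrow> path_sum n (\<lambda>t. a) = 0"
  by (simp add: path_sum_def increment_refl)

lemma path_sum_join:
  assumes "p 1 = q 0" "n \<ge> 1"
  shows "path_sum (2 * n) (path_join p q) = path_sum n p + path_sum n q"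
proof -
  define r where "r = path_join p q"
  have r1: "r (real i / real (2 * n)) = p (real i / real n)" if "i \<le> n" for i
    using that assms(2) by (simp add: r_def path_join_def field_simps)
  have r2: "r (real (n + i) / real (2 * n)) = q (real i / real n)" for i
  proof (cases "i = 0")
    case True
    then show ?thesis using assms by (simp add: r_def path_join_def)
  next
    case False
    have "2 * (real (n + i) / real (2 * n)) - 1 = real i / real n"
      using assms(2) by (simp add: field_simps)
    moreover have "\<not> real (n + i) / real (2 * n) \<le> 1 / 2"
      using assms(2) False by (simp add: field_simps)
    ultimately show ?thesis by (simp add: r_def path_join_def)
  qed
  define f where "f i = increment (r (real i / real (2 * n))) (r (real (Suc i) / real (2 * n)))" for i
  have "path_sum (2 * n) r = (\<Sum>i<2*n. f i)" by (simp add: path_sum_def f_def)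
  also have "\<dots> = (\<Sum>i<n+n. f i)" by (simp add: mult_2)
  also have "(\<Sum>i<n+m. f i) = (\<Sum>i<n. f i) + (\<Sum>i<m. f (n + i))" for m
    by (induction m) (simp_all add: add.assoc)
  also have "(\<Sum>i<n. f i) = path_sum n p"
    unfolding path_sum_def by (intro sum.cong refl) (simp only: f_def r1 Suc_leI less_imp_le lessThan_iff)
  also have "(\<Sum>i<n. f (n + i)) = path_sum n q"
    unfolding path_sum_def by (intro sum.cong refl) (simp only: f_def r2 add_Suc_right[symmetric])
  finally show ?thesis by (simp add: r_def)
qed

lemma path_sum_reverse:
  assumes "fine_grid p n"
  shows "path_sum n (path_reverse p) = - path_sum n p"
proof -
  have n: "n \<ge> 1" using assms by (simp add: fine_grid_def)
  have "path_sum n (path_reverse p) = (\<Sum>i<n. increment (p (real (n - i) / n)) (p (real (n - Suc i) / n)))"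
    unfolding path_sum_def path_reverse_def
  proof (intro sum.cong refl)
    fix i assume "i \<in> {..<n}"
    then have "1 - real i / n = real (n - i) / n" "1 - real (Suc i) / n = real (n - Suc i) / n"
      using n by (simp_all add: field_simps of_nat_diff)
    then show "increment (p (1 - real i / n)) (p (1 - real (Suc i) / n)) =
       increment (p (real (n - i) / n)) (p (real (n - Suc i) / n))" by simp
  qed
  also have "\<dots> = (\<Sum>i<n. increment (p (real (Suc i) / n)) (p (real i / n)))"
    by (subst sum.nat_diff_reindex[symmetric]) (intro sum.cong refl, simp add: Suc_diff_Suc)
  also have "\<dots> = (\<Sum>i<n. - increment (p (real i / n)) (p (real (Suc i) / n)))"
  proof (intro sum.cong refl increment_sym)
    fix i assume i: "i \<in> {..<n}"
    have 01: "real i / n \<in> {0..1}" "real (Suc i) / n \<in> {0..1}" using i by auto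
    show "p (real i / n) \<in> carrier G" "p (real (Suc i) / n) \<in> carrier G"
      by (rule fine_mem[OF assms 01(1)], rule fine_mem[OF assms 01(2)])
    have "\<bar>real i / n - real (Suc i) / n\<bar> \<le> 1 / n" by (simp add: diff_divide_distrib[symmetric])
    then show "inv (p (real i / n)) \<otimes> p (real (Suc i) / n) \<in> W"
      using assms 01 unfolding fine_grid_def by blast
  qed
  finally show ?thesis by (simp add: path_sum_def sum_negf)
qed

lemma path_sum_loop:
  assumes sc: "simply_connected_space X" and p: "pathin X p" "p 1 = p 0"
  shows "\<exists>N. \<forall>n\<ge>N. path_sum n p = 0"
proof -
  have p0: "p 0 \<in> topspace X" using p(1) by (rule path_start_in_topspace)
  have "homotopic_with (\<lambda>r. r 1 = r 0) (top_of_set {0..1}) X p (\<lambda>t. p 0)"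
    using sc p p0 unfolding simply_connected_space_def by simp
  then obtain k :: "real \<times> real \<Rightarrow> 'a" where k: "continuous_map (prod_topology (top_of_set {0..1}) (top_of_set {0..1})) X k"
    "\<And>x. k (0, x) = p x" "\<And>x. k (1, x) = p 0" "\<And>t. t \<in> {0..1} \<Longrightarrow> k (t, 1) = k (t, 0)"
    unfolding homotopic_with_def by blast
  have "continuous_map (top_of_set ({0..1} \<times> {0..1})) X k"
    using k(1) by (simp add: subtopology_Times[symmetric] prod_topology_euclidean)
  from path_sum_homotopic[OF this k(4)] k(2,3) path_sum_const[of "p 0"] p0 carrier_eq
  show ?thesis by auto
qed

lemma path_integral_unique:
  assumes sc: "simply_connected_space X"
    and p: "pathin X p" and q: "pathin X q" and ends: "p 0 = q 0" "p 1 = q 1"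
  shows "path_integral p = path_integral q"
proof -
  have loop: "pathin X (path_join p (path_reverse q))" "(path_join p (path_reverse q)) 1 = (path_join p (path_reverse q)) 0"
    using pathin_path_join[OF p pathin_path_reverse[OF q]] ends
    by (simp_all add: path_reverse_def path_join_def)
  obtain N1 where N1: "\<And>n. n \<ge> N1 \<Longrightarrow> fine_grid p n" using fine_exists[OF p] by blast
  obtain N2 where N2: "\<And>n. n \<ge> N2 \<Longrightarrow> fine_grid q n" using fine_exists[OF q] by blast
  obtain N3 where N3: "\<And>n. n \<ge> N3 \<Longrightarrow> path_sum n (path_join p (path_reverse q)) = 0"
    using path_sum_loop[OF sc loop] by blast
  define n where "n = N1 + N2 + N3 + 1"
  have "path_sum (2 * n) (path_join p (path_reverse q)) = path_sum n p + path_sum n (path_reverse q)"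
    using ends by (intro path_sum_join) (auto simp: path_reverse_def n_def)
  also have "\<dots> = path_sum n p - path_sum n q"
    using path_sum_reverse[OF N2, of n] by (simp add: n_def)
  also have "\<dots> = path_integral p - path_integral q"
    using path_integral_eq[OF N1, of n] path_integral_eq[OF N2, of n] by (simp add: n_def)
  finally show ?thesis using N3[of "2 * n"] by (simp add: n_def)
qed

lemma path_integral_translate:
  assumes p: "pathin X p" and g: "g \<in> carrier G"
  shows "path_integral (\<lambda>t. g \<otimes> p t) = path_integral p"
proof -
  obtain n where n: "fine_grid p n" using fine_exists[OF p] by blast
  have tr: "inv (g \<otimes> p s) \<otimes> (g \<otimes> p t) = inv (p s) \<otimes> p t" if "s \<in> {0..1}" "t \<in> {0..1}" for s t
    using increment_translate[OF g] fine_mem[OF n] that by blast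
  have n': "fine_grid (\<lambda>t. g \<otimes> p t) n"
    using n g by (auto simp: fine_grid_def tr)
  have "path_sum n (\<lambda>t. g \<otimes> p t) = path_sum n p"
    unfolding path_sum_def increment_def by (intro sum.cong refl arg_cong[of _ _ h] tr) auto
  then show ?thesis by (simp add: path_integral_eq[OF n] path_integral_eq[OF n'])
qed

lemma path_integral_join:
  assumes p: "pathin X p" and q: "pathin X q" and ends: "p 1 = q 0"
  shows "path_integral (path_join p q) = path_integral p + path_integral q"
proof -
  obtain N1 where N1: "\<And>n. n \<ge> N1 \<Longrightarrow> fine_grid p n" using fine_exists[OF p] by blast
  obtain N2 where N2: "\<And>n. n \<ge> N2 \<Longrightarrow> fine_grid q n" using fine_exists[OF q] by blast
  obtain N3 where N3: "\<And>n. n \<ge> N3 \<Longrightarrow> fine_grid (path_join p q) n"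
    using fine_exists[OF pathin_path_join[OF p q ends]] by blast
  define n where "n = N1 + N2 + N3 + 1"
  have "path_sum (2 * n) (path_join p q) = path_sum n p + path_sum n q"
    using ends by (intro path_sum_join) (auto simp: n_def)
  then show ?thesis
    using path_integral_eq[OF N1, of n] path_integral_eq[OF N2, of n] path_integral_eq[OF N3, of "2 * n"]
    by (simp add: n_def)
qed

lemma path_integral_local:
  assumes p: "pathin X p" and "p ` {0..1} \<subseteq> W"
  shows "path_integral p = h (p 1) - h (p 0)"
proof -
  obtain n where n: "fine_grid p n" using fine_exists[OF p] by blast
  have n1: "n \<ge> 1" using n by (simp add: fine_grid_def)
  have W: "p (real i / n) \<in> W" if "i \<le> n" for i
    using assms(2) that n1 by (auto simp: image_subset_iff)
  have "path_sum n p = (\<Sum>i<n. h (p (real (Suc i) / n)) - h (p (real i / n)))"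
    unfolding path_sum_def increment_def by (intro sum.cong refl h_quotient W) auto
  also have "\<dots> = h (p (real n / n)) - h (p (real 0 / n))"
    by (rule sum_lessThan_telescope)
  finally show ?thesis using n1 by (simp add: path_integral_eq[OF n])
qed

text \<open>The value at \<open>x\<close> is the sum of the increments along any path from the identity to \<open>x\<close>.
  It is additive because a path to \<open>y\<close>, translated by \<open>x\<close>, continues a path to \<open>x\<close>.\<close>

theorem extend_local_homomorphism:
  assumes sc: "simply_connected_space X" and pc: "path_connected_space X"
  shows "\<exists>\<phi>. (\<forall>x\<in>carrier G. \<forall>y\<in>carrier G. \<phi> (x \<otimes> y) = \<phi> x + \<phi> y) \<and>
    (\<forall>p. pathin X p \<and> p 0 = \<one> \<and> p ` {0..1} \<subseteq> W \<longrightarrow> \<phi> (p 1) = h (p 1))"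
proof -
  define path_to where "path_to x = (SOME p. pathin X p \<and> p 0 = \<one> \<and> p 1 = x)" for x
  define \<phi> where "\<phi> x = path_integral (path_to x)" for x
  have path_to: "pathin X (path_to x)" "path_to x 0 = \<one>" "path_to x 1 = x" if "x \<in> carrier G" for x
  proof -
    have "\<exists>p. pathin X p \<and> p 0 = \<one> \<and> p 1 = x"
      using pc that unfolding path_connected_space_def carrier_eq[symmetric] by blast
    from someI_ex[OF this] show "pathin X (path_to x)" "path_to x 0 = \<one>" "path_to x 1 = x"
      unfolding path_to_def by auto
  qed
  have \<phi>: "\<phi> (p 1) = path_integral p" if "pathin X p" "p 0 = \<one>" for p
  proof -
    have "p 1 \<in> carrier G" using path_finish_in_topspace[OF that(1)] by (simp add: carrier_eq)
    from path_to[OF this] that show ?thesis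
      unfolding \<phi>_def by (intro path_integral_unique sc) auto
  qed
  have "\<phi> (x \<otimes> y) = \<phi> x + \<phi> y" if x: "x \<in> carrier G" and y: "y \<in> carrier G" for x y
  proof -
    define q where "q = (\<lambda>t. x \<otimes> path_to y t)"
    have q: "pathin X q"
      using continuous_map_compose[OF path_to(1)[OF y, unfolded pathin_def] continuous_translation[OF x]]
      by (simp add: q_def pathin_def o_def)
    have q01: "path_to x 1 = q 0" "q 1 = x \<otimes> y"
      using path_to[OF x] path_to[OF y] x by (simp_all add: q_def)
    have "\<phi> ((path_join (path_to x) q) 1) = path_integral (path_join (path_to x) q)"
      using path_to[OF x] by (intro \<phi> pathin_path_join q q01) (auto simp: path_join_def)
    moreover have "(path_join (path_to x) q) 1 = x \<otimes> y" using q01 by (simp add: path_join_def)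
    ultimately show ?thesis
      using path_integral_join[OF path_to(1)[OF x] q q01(1)]
        path_integral_translate[OF path_to(1)[OF y] x]
      by (simp add: \<phi>_def q_def)
  qed
  moreover have "\<phi> (p 1) = h (p 1)" if "pathin X p" "p 0 = \<one>" "p ` {0..1} \<subseteq> W" for p
    using \<phi>[OF that(1,2)] path_integral_local[OF that(1,3)] that(2) h_one by simp
  ultimately show ?thesis by blast
qed

end

section \<open>Smooth maps in charts\<close>

text \<open>The part of the axioms of a manifold on which the calculus of smooth maps rests; it is
  visibly inherited by products.\<close>

definition smooth_atlas :: "('a, 'e::euclidean_space) mfd \<Rightarrow> bool" where
  "smooth_atlas M \<longleftrightarrow>
     subspace (model M) \<and>
     (\<forall>(U, \<kappa>)\<in>atlas M. openin (mtop M) U \<and> inj_on \<kappa> U \<and>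
        (\<forall>Q. openin (mtop M) Q \<and> Q \<subseteq> U \<longrightarrow> openin (top_of_set (model M)) (\<kappa> ` Q)) \<and>
        (\<forall>S. open S \<longrightarrow> openin (mtop M) {q \<in> U. \<kappa> q \<in> S})) \<and>
     (\<Union>(U, \<kappa>)\<in>atlas M. U) = points M \<and>
     (\<forall>(U, \<kappa>)\<in>atlas M. \<forall>(W, \<psi>)\<in>atlas M.
        smooth_on (model M) (\<kappa> ` (U \<inter> W)) (\<psi> \<circ> inv_into U \<kappa>))"

lemma chart_imp:
  assumes "chart X V U \<kappa>"
  shows "openin X U" "inj_on \<kappa> U" "\<And>Q. openin X Q \<Longrightarrow> Q \<subseteq> U \<Longrightarrow> openin (top_of_set V) (\<kappa> ` Q)"
    "\<And>S. open S \<Longrightarrow> openin X {q \<in> U. \<kappa> q \<in> S}"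
proof -
  have U: "openin X U" and kU: "openin (top_of_set V) (\<kappa> ` U)"
    and h: "homeomorphic_map (subtopology X U) (top_of_set (\<kappa> ` U)) \<kappa>"
    using assms by (auto simp: chart_def)
  have tU: "topspace (subtopology X U) = U" using openin_subset[OF U] by auto
  show "openin X U" by fact
  show "inj_on \<kappa> U" using h tU homeomorphic_imp_injective_map by metis
  show "openin (top_of_set V) (\<kappa> ` Q)" if "openin X Q" "Q \<subseteq> U" for Q
  proof -
    have "openin (subtopology X U) Q" using that by (simp add: openin_open_subtopology[OF U])
    then have "openin (top_of_set (\<kappa> ` U)) (\<kappa> ` Q)"
      using homeomorphic_imp_open_map[OF h] by (simp add: open_map_def)
    then show ?thesis using kU openin_trans by blast
  qed
  show "openin X {q \<in> U. \<kappa> q \<in> S}" if "open S" for S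
  proof -
    have "continuous_map (subtopology X U) euclidean \<kappa>"
      using homeomorphic_imp_continuous_map[OF h] by (simp add: continuous_map_in_subtopology)
    from openin_continuous_map_preimage[OF this, of S] that
    have "openin (subtopology X U) {q \<in> U. \<kappa> q \<in> S}" unfolding tU by simp
    then show ?thesis by (simp add: openin_open_subtopology[OF U])
  qed
qed

lemma chartI:
  assumes "openin X U" "inj_on \<kappa> U"
    "\<And>Q. openin X Q \<Longrightarrow> Q \<subseteq> U \<Longrightarrow> openin (top_of_set V) (\<kappa> ` Q)"
    "\<And>S. open S \<Longrightarrow> openin X {q \<in> U. \<kappa> q \<in> S}"
  shows "chart X V U \<kappa>"
proof -
  have tU: "topspace (subtopology X U) = U" using openin_subset[OF assms(1)] by auto
  have kU: "openin (top_of_set V) (\<kappa> ` U)" using assms by blast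
  have "continuous_map (subtopology X U) euclidean \<kappa>"
    unfolding continuous_map_def using assms(4) tU
    by (simp add: openin_open_subtopology[OF assms(1)])
  then have "continuous_map (subtopology X U) (top_of_set (\<kappa> ` U)) \<kappa>"
    using tU by (simp add: continuous_map_in_subtopology)
  moreover have "open_map (subtopology X U) (top_of_set (\<kappa> ` U)) \<kappa>"
    unfolding open_map_def
  proof (intro allI impI)
    fix Q assume "openin (subtopology X U) Q"
    then have Q: "openin X Q" "Q \<subseteq> U" by (simp_all add: openin_open_subtopology[OF assms(1)])
    have "openin (top_of_set V) (\<kappa> ` Q)" by (rule assms(3)[OF Q])
    moreover have "\<kappa> ` U \<subseteq> V" using kU openin_imp_subset by blast
    moreover have "\<kappa> ` Q \<subseteq> \<kappa> ` U" using Q by blast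
    ultimately show "openin (top_of_set (\<kappa> ` U)) (\<kappa> ` Q)"
      using openin_subset_trans by metis
  qed
  ultimately have "homeomorphic_map (subtopology X U) (top_of_set (\<kappa> ` U)) \<kappa>"
    unfolding homeomorphic_eq_everything_map
    using tU assms(2) by (auto intro: bijective_open_imp_closed_map)
  then show ?thesis using assms(1) kU by (simp add: chart_def)
qed

lemma smooth_manifold_imp_atlas: "smooth_manifold M \<Longrightarrow> smooth_atlas M"
proof -
  assume M: "smooth_manifold M"
  have *: "openin (mtop M) U \<and> inj_on \<kappa> U \<and>
        (\<forall>Q. openin (mtop M) Q \<and> Q \<subseteq> U \<longrightarrow> openin (top_of_set (model M)) (\<kappa> ` Q)) \<and>
        (\<forall>S. open S \<longrightarrow> openin (mtop M) {q \<in> U. \<kappa> q \<in> S})"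
    if c: "(U, \<kappa>) \<in> atlas M" for U \<kappa>
  proof -
    have "\<forall>(U, \<kappa>)\<in>atlas M. chart (mtop M) (model M) U \<kappa>"
      using M[unfolded smooth_manifold_def, THEN conjunct2, THEN conjunct2, THEN conjunct2, THEN conjunct1] .
    from chart_imp[OF bspec[OF this c, unfolded split_conv]] show ?thesis by simp
  qed
  have **: "subspace (model M)" "(\<Union>(U, \<kappa>)\<in>atlas M. U) = points M"
     "\<forall>(U, \<kappa>)\<in>atlas M. \<forall>(W, \<psi>)\<in>atlas M.
        smooth_on (model M) (\<kappa> ` (U \<inter> W)) (\<psi> \<circ> inv_into U \<kappa>)"
    by (rule M[unfolded smooth_manifold_def, THEN conjunct1],
        rule M[unfolded smooth_manifold_def, THEN conjunct2, THEN conjunct2, THEN conjunct2, THEN conjunct2, THEN conjunct1],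
        rule M[unfolded smooth_manifold_def, THEN conjunct2, THEN conjunct2, THEN conjunct2, THEN conjunct2, THEN conjunct2])
  show ?thesis
    unfolding smooth_atlas_def
  proof (intro conjI ballI **)
    fix x assume "x \<in> atlas M"
    moreover obtain U \<kappa> where x: "x = (U, \<kappa>)" by (cases x)
    ultimately have c: "(U, \<kappa>) \<in> atlas M" by simp
    show "case x of (U, \<kappa>) \<Rightarrow> openin (mtop M) U \<and> inj_on \<kappa> U \<and>
        (\<forall>Q. openin (mtop M) Q \<and> Q \<subseteq> U \<longrightarrow> openin (top_of_set (model M)) (\<kappa> ` Q)) \<and>
        (\<forall>S. open S \<longrightarrow> openin (mtop M) {q \<in> U. \<kappa> q \<in> S})"
      unfolding x split_conv by (rule *[OF c])
  next
    fix x assume "x \<in> atlas M"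
    then show "case x of (U, \<kappa>) \<Rightarrow> \<forall>(W, \<psi>)\<in>atlas M.
        smooth_on (model M) (\<kappa> ` (U \<inter> W)) (\<psi> \<circ> inv_into U \<kappa>)"
      by (rule bspec[OF **(3)])
  qed
qed

text \<open>The inverse of a chart, precomposed with the projection onto the model space: this makes it
  smooth on an open subset of the whole space.\<close>

definition param :: "('a, 'e::euclidean_space) mfd \<Rightarrow> 'a set \<Rightarrow> ('a \<Rightarrow> 'e) \<Rightarrow> 'e \<Rightarrow> 'a" where
  "param M U \<kappa> y = inv_into U \<kappa> (proj (model M) y)"

text \<open>Continuity of a map at a point that need only be defined near that point.\<close>

definition cont_at :: "'a topology \<Rightarrow> 'b topology \<Rightarrow> ('a \<Rightarrow> 'b) \<Rightarrow> 'a \<Rightarrow> bool" where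
  "cont_at X Y f p \<longleftrightarrow> p \<in> topspace X \<and> f p \<in> topspace Y \<and>
     (\<forall>B. openin Y B \<and> f p \<in> B \<longrightarrow> (\<exists>Q. openin X Q \<and> p \<in> Q \<and> f ` Q \<subseteq> B))"

lemma cont_atD:
  assumes "cont_at X Y f p" "openin Y B" "f p \<in> B"
  obtains Q where "openin X Q" "p \<in> Q" "f ` Q \<subseteq> B"
  using assms by (auto simp: cont_at_def)

lemma cont_at_compose:
  assumes f: "cont_at X Y f p" and g: "cont_at Y Z g (f p)"
  shows "cont_at X Z (\<lambda>x. g (f x)) p"
  unfolding cont_at_def
proof (intro conjI allI impI)
  fix B assume B: "openin Z B \<and> g (f p) \<in> B"
  obtain R where R: "openin Y R" "f p \<in> R" "g ` R \<subseteq> B" using cont_atD[OF g] B by metis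
  obtain Q where "openin X Q" "p \<in> Q" "f ` Q \<subseteq> R" using cont_atD[OF f R(1,2)] by metis
  then show "\<exists>Q. openin X Q \<and> p \<in> Q \<and> (\<lambda>x. g (f x)) ` Q \<subseteq> B" using R by (intro exI[of _ Q]) auto
qed (use assms in \<open>auto simp: cont_at_def\<close>)

lemma cont_at_of_continuous_map:
  assumes "continuous_map X Y f" "p \<in> topspace X" shows "cont_at X Y f p"
  unfolding cont_at_def
proof (intro conjI allI impI)
  fix B assume B: "openin Y B \<and> f p \<in> B"
  then show "\<exists>Q. openin X Q \<and> p \<in> Q \<and> f ` Q \<subseteq> B"
    using openin_continuous_map_preimage[OF assms(1), of B] assms(2)
    by (intro exI[of _ "{x \<in> topspace X. f x \<in> B}"]) auto
qed (use assms in \<open>auto simp: continuous_map_def\<close>)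

lemma continuous_map_of_cont_at:
  assumes "\<And>p. p \<in> topspace X \<Longrightarrow> cont_at X Y f p"
  shows "continuous_map X Y f"
  unfolding continuous_map_def
proof (intro conjI allI impI)
  show "f \<in> topspace X \<rightarrow> topspace Y" using assms by (auto simp: cont_at_def)
  fix B assume B: "openin Y B"
  show "openin X {x \<in> topspace X. f x \<in> B}"
  proof (subst openin_subopen, intro ballI)
    fix x assume x: "x \<in> {x \<in> topspace X. f x \<in> B}"
    obtain Q where "openin X Q" "x \<in> Q" "f ` Q \<subseteq> B" using cont_atD[OF assms[of x] B] x by auto
    then show "\<exists>T. openin X T \<and> x \<in> T \<and> T \<subseteq> {x \<in> topspace X. f x \<in> B}"
      using openin_subset[of X Q] by (intro exI[of _ Q]) auto
  qed
qed

lemma openin_prod_topologyE: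
  assumes "openin (prod_topology X Y) Q" "(p, q) \<in> Q"
  obtains A B where "openin X A" "openin Y B" "p \<in> A" "q \<in> B" "A \<times> B \<subseteq> Q"
  using openin_prod_topology_alt[THEN iffD1, rule_format, OF assms] by (elim exE conjE)

lemma cont_at_pair:
  assumes f: "cont_at X Y f p" and g: "cont_at X Z g p"
  shows "cont_at X (prod_topology Y Z) (\<lambda>x. (f x, g x)) p"
  unfolding cont_at_def
proof (intro conjI allI impI)
  fix B assume "openin (prod_topology Y Z) B \<and> (f p, g p) \<in> B"
  then obtain C D where CD: "openin Y C" "openin Z D" "f p \<in> C" "g p \<in> D" "C \<times> D \<subseteq> B"
    using openin_prod_topologyE by metis
  obtain Q where Q: "openin X Q" "p \<in> Q" "f ` Q \<subseteq> C" using cont_atD[OF f CD(1,3)] by metis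
  obtain R where R: "openin X R" "p \<in> R" "g ` R \<subseteq> D" using cont_atD[OF g CD(2,4)] by metis
  show "\<exists>Q. openin X Q \<and> p \<in> Q \<and> (\<lambda>x. (f x, g x)) ` Q \<subseteq> B"
    using Q R CD(5) by (intro exI[of _ "Q \<inter> R"]) auto
qed (use assms in \<open>auto simp: cont_at_def\<close>)

subsection \<open>Facts about a single chart\<close>

context
  fixes M :: "('a, 'e::euclidean_space) mfd" and U \<kappa>
  assumes M: "smooth_atlas M" and c: "(U, \<kappa>) \<in> atlas M"
begin

lemma model_subspace: "subspace (model M)"
  using M by (simp add: smooth_atlas_def)

lemma chart_open: "openin (mtop M) U" and chart_inj: "inj_on \<kappa> U"
  and chart_image_open: "openin (mtop M) Q \<Longrightarrow> Q \<subseteq> U \<Longrightarrow> openin (top_of_set (model M)) (\<kappa> ` Q)"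
  and chart_preimage_open: "open S \<Longrightarrow> openin (mtop M) {q \<in> U. \<kappa> q \<in> S}"
proof -
  have "\<forall>(U, \<kappa>)\<in>atlas M. openin (mtop M) U \<and> inj_on \<kappa> U \<and>
        (\<forall>Q. openin (mtop M) Q \<and> Q \<subseteq> U \<longrightarrow> openin (top_of_set (model M)) (\<kappa> ` Q)) \<and>
        (\<forall>S. open S \<longrightarrow> openin (mtop M) {q \<in> U. \<kappa> q \<in> S})"
    using M[unfolded smooth_atlas_def, THEN conjunct2, THEN conjunct1] .
  from bspec[OF this c, unfolded split_conv]
  have "openin (mtop M) U \<and> inj_on \<kappa> U \<and>
        (\<forall>Q. openin (mtop M) Q \<and> Q \<subseteq> U \<longrightarrow> openin (top_of_set (model M)) (\<kappa> ` Q)) \<and>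
        (\<forall>S. open S \<longrightarrow> openin (mtop M) {q \<in> U. \<kappa> q \<in> S})" .
  then show "openin (mtop M) U" "inj_on \<kappa> U"
    "openin (mtop M) Q \<Longrightarrow> Q \<subseteq> U \<Longrightarrow> openin (top_of_set (model M)) (\<kappa> ` Q)"
    "open S \<Longrightarrow> openin (mtop M) {q \<in> U. \<kappa> q \<in> S}" by blast+
qed

lemma chart_subset: "p \<in> U \<Longrightarrow> p \<in> points M"
  using chart_open openin_subset by blast

lemma chart_in_model: "p \<in> U \<Longrightarrow> \<kappa> p \<in> model M"
  using chart_image_open[OF chart_open subset_refl] openin_imp_subset by blast

lemma param_chart: "p \<in> U \<Longrightarrow> param M U \<kappa> (\<kappa> p) = p"
  using chart_inj chart_in_model by (simp add: param_def proj_id[OF model_subspace])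

lemma chart_param:
  assumes "proj (model M) y \<in> \<kappa> ` U"
  shows "param M U \<kappa> y \<in> U" "\<kappa> (param M U \<kappa> y) = proj (model M) y"
  using assms by (simp_all add: param_def inv_into_into f_inv_into_f)

lemma proj_chart: "p \<in> U \<Longrightarrow> proj (model M) (\<kappa> p) = \<kappa> p"
  using chart_in_model by (simp add: proj_id[OF model_subspace])

lemma param_proj: "param M U \<kappa> (proj (model M) y) = param M U \<kappa> y"
  by (simp add: param_def proj_id[OF model_subspace] proj_in[OF model_subspace])

lemma open_param_domain: "open (proj (model M) -` (\<kappa> ` U))"
  by (rule open_vimage_proj[OF model_subspace chart_image_open[OF chart_open subset_refl]])

lemma eventually_param_in:
  assumes "proj (model M) y \<in> \<kappa> ` U" "openin (mtop M) Q" "param M U \<kappa> y \<in> Q"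
  shows "\<forall>\<^sub>F z in nhds y. proj (model M) z \<in> \<kappa> ` U \<and> param M U \<kappa> z \<in> Q"
proof -
  have "openin (mtop M) (Q \<inter> U)" using assms(2) chart_open by blast
  then have "open (proj (model M) -` (\<kappa> ` (Q \<inter> U)))"
    by (intro open_vimage_proj[OF model_subspace chart_image_open]) auto
  moreover have "proj (model M) y \<in> \<kappa> ` (Q \<inter> U)"
    using chart_param[OF assms(1)] assms(3) by (metis IntI image_eqI)
  moreover have "proj (model M) z \<in> \<kappa> ` U \<and> param M U \<kappa> z \<in> Q"
    if z: "z \<in> proj (model M) -` (\<kappa> ` (Q \<inter> U))" for z
  proof -
    obtain q where q: "q \<in> Q" "q \<in> U" "proj (model M) z = \<kappa> q" using z by auto
    then have "param M U \<kappa> z = q" using param_chart param_proj by metis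
    with q show ?thesis by auto
  qed
  ultimately show ?thesis
    unfolding eventually_nhds by (intro exI[of _ "proj (model M) -` (\<kappa> ` (Q \<inter> U))"]) auto
qed

lemma eventually_param_near:
  assumes "openin (mtop M) Q" "p \<in> Q" "p \<in> U"
  shows "\<forall>\<^sub>F z in nhds (\<kappa> p). proj (model M) z \<in> \<kappa> ` U \<and> param M U \<kappa> z \<in> Q"
  using assms by (intro eventually_param_in) (auto simp: proj_chart param_chart)

lemma chart_nbhd:
  assumes "\<forall>\<^sub>F z in nhds (\<kappa> p). P z" "p \<in> U"
  obtains Q where "openin (mtop M) Q" "p \<in> Q" "Q \<subseteq> U" "\<And>q. q \<in> Q \<Longrightarrow> P (\<kappa> q)"
proof -
  obtain S where S: "open S" "\<kappa> p \<in> S" "\<And>z. z \<in> S \<Longrightarrow> P z"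
    using assms(1) by (auto simp: eventually_nhds)
  show ?thesis
    by (rule that[of "{q \<in> U. \<kappa> q \<in> S}"]) (use S assms(2) chart_preimage_open in auto)
qed

lemma transition_smooth:
  assumes c': "(U', \<kappa>') \<in> atlas M" and p: "p \<in> U" "p \<in> U'"
  shows "smooth_near (\<lambda>y. \<kappa>' (param M U \<kappa> y)) (\<kappa> p)"
proof -
  have tr: "\<forall>(U, \<kappa>)\<in>atlas M. \<forall>(W, \<psi>)\<in>atlas M.
      smooth_on (model M) (\<kappa> ` (U \<inter> W)) (\<psi> \<circ> inv_into U \<kappa>)"
    and op: "\<forall>(U, \<kappa>)\<in>atlas M. openin (mtop M) U \<and> inj_on \<kappa> U \<and>
        (\<forall>Q. openin (mtop M) Q \<and> Q \<subseteq> U \<longrightarrow> openin (top_of_set (model M)) (\<kappa> ` Q)) \<and>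
        (\<forall>S. open S \<longrightarrow> openin (mtop M) {q \<in> U. \<kappa> q \<in> S})"
    by (rule M[unfolded smooth_atlas_def, THEN conjunct2, THEN conjunct2, THEN conjunct2],
        rule M[unfolded smooth_atlas_def, THEN conjunct2, THEN conjunct1])
  have "openin (mtop M) U'" using bspec[OF op c', unfolded split_conv] by (elim conjE)
  then have "openin (top_of_set (model M)) (\<kappa> ` (U \<inter> U'))"
    using chart_open by (intro chart_image_open) auto
  moreover have "smooth_on (model M) (\<kappa> ` (U \<inter> U')) (\<kappa>' \<circ> inv_into U \<kappa>)"
    using bspec[OF bspec[OF tr c, unfolded split_conv] c', unfolded split_conv] .
  ultimately have "\<forall>x\<in>\<kappa> ` (U \<inter> U'). smooth_near (\<lambda>y. (\<kappa>' \<circ> inv_into U \<kappa>) (proj (model M) y)) x"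
    using smooth_on_iff_near_proj[OF model_subspace] by blast
  then show ?thesis using p by (auto simp: param_def o_def)
qed

lemma smooth_on_chart:
  assumes "openin (mtop M) Q" "Q \<subseteq> U"
  shows "smooth_on (model M) (\<kappa> ` Q) (F \<circ> inv_into U \<kappa>) \<longleftrightarrow>
    (\<forall>q\<in>Q. smooth_near (\<lambda>y. F (param M U \<kappa> y)) (\<kappa> q))"
  unfolding smooth_on_iff_near_proj[OF model_subspace chart_image_open[OF assms]]
  by (simp add: param_def)

end

lemma point_in_chart:
  assumes "smooth_atlas M" "p \<in> points M"
  obtains U \<kappa> where "(U, \<kappa>) \<in> atlas M" "p \<in> U"
  using assms unfolding smooth_atlas_def by blast

subsection \<open>Smooth maps\<close>

text \<open>The definition asks for smoothness on a neighbourhood of \<open>p\<close>; this is smoothness near the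
  single point \<open>\<kappa> p\<close>.\<close>

lemma smooth_at_iff_near:
  assumes M: "smooth_atlas M"
  shows "smooth_at M N f p \<longleftrightarrow>
    (\<exists>U \<kappa> W \<psi> Q. (U, \<kappa>) \<in> atlas M \<and> (W, \<psi>) \<in> atlas N \<and> openin (mtop M) Q \<and> p \<in> Q \<and> Q \<subseteq> U \<and>
      f ` Q \<subseteq> W \<and> smooth_near (\<lambda>y. \<psi> (f (param M U \<kappa> y))) (\<kappa> p))" (is "_ \<longleftrightarrow> ?R")
proof
  assume "smooth_at M N f p"
  then obtain U \<kappa> W \<psi> Q where *: "(U, \<kappa>) \<in> atlas M" "(W, \<psi>) \<in> atlas N" "openin (mtop M) Q"
    "p \<in> Q" "Q \<subseteq> U" "f ` Q \<subseteq> W" "smooth_on (model M) (\<kappa> ` Q) ((\<psi> \<circ> f) \<circ> inv_into U \<kappa>)"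
    unfolding smooth_at_def by blast
  from *(7) have "smooth_near (\<lambda>y. (\<psi> \<circ> f) (param M U \<kappa> y)) (\<kappa> p)"
    using smooth_on_chart[OF M *(1,3,5)] *(4) by blast
  then have "smooth_near (\<lambda>y. \<psi> (f (param M U \<kappa> y))) (\<kappa> p)" by simp
  with *(1-6) show ?R by blast
next
  assume ?R
  then obtain U \<kappa> W \<psi> Q where *: "(U, \<kappa>) \<in> atlas M" "(W, \<psi>) \<in> atlas N" "openin (mtop M) Q"
    "p \<in> Q" "Q \<subseteq> U" "f ` Q \<subseteq> W" "smooth_near (\<lambda>y. \<psi> (f (param M U \<kappa> y))) (\<kappa> p)" by blast
  obtain R where R: "openin (mtop M) R" "p \<in> R" "R \<subseteq> U"
      "\<And>q. q \<in> R \<Longrightarrow> smooth_near (\<lambda>y. \<psi> (f (param M U \<kappa> y))) (\<kappa> q)"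
    by (rule chart_nbhd[OF M *(1) eventually_smooth_near[OF *(7)]]) (use * in auto)
  have QR: "openin (mtop M) (Q \<inter> R)" "Q \<inter> R \<subseteq> U" using *(3,5) R by auto
  have "smooth_on (model M) (\<kappa> ` (Q \<inter> R)) ((\<psi> \<circ> f) \<circ> inv_into U \<kappa>)"
    by (rule smooth_on_chart[OF M *(1) QR, where F = "\<psi> \<circ> f", THEN iffD2]) (use R(4) in auto)
  moreover have "f ` (Q \<inter> R) \<subseteq> W" "p \<in> Q \<inter> R" using * R by auto
  ultimately show "smooth_at M N f p"
    unfolding smooth_at_def using *(1,2) QR by blast
qed

lemma smooth_at_points:
  assumes "smooth_atlas M" "smooth_atlas N" "smooth_at M N f p"
  shows "p \<in> points M" "f p \<in> points N"
proof -
  obtain U \<kappa> W \<psi> Q where *: "(U, \<kappa>) \<in> atlas M" "(W, \<psi>) \<in> atlas N" "p \<in> Q" "Q \<subseteq> U" "f ` Q \<subseteq> W"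
    using assms(3) unfolding smooth_at_iff_near[OF assms(1)] by blast
  show "p \<in> points M" using chart_subset[OF assms(1) *(1)] * by blast
  show "f p \<in> points N" using chart_subset[OF assms(2) *(2)] * by blast
qed

lemma smooth_at_cont:
  assumes M: "smooth_atlas M" and N: "smooth_atlas N" and f: "smooth_at M N f p"
  shows "cont_at (mtop M) (mtop N) f p"
  unfolding cont_at_def
proof (intro conjI allI impI smooth_at_points[OF assms])
  fix B assume B: "openin (mtop N) B \<and> f p \<in> B"
  obtain U \<kappa> W \<psi> Q where *: "(U, \<kappa>) \<in> atlas M" "(W, \<psi>) \<in> atlas N" "openin (mtop M) Q"
    "p \<in> Q" "Q \<subseteq> U" "f ` Q \<subseteq> W" "smooth_near (\<lambda>y. \<psi> (f (param M U \<kappa> y))) (\<kappa> p)"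
    using f unfolding smooth_at_iff_near[OF M] by blast
  have pU: "p \<in> U" using * by auto
  have "openin (mtop N) (B \<inter> W)" using B chart_open[OF N *(2)] by blast
  then have "openin (top_of_set (model N)) (\<psi> ` (B \<inter> W))"
    by (rule chart_image_open[OF N *(2)]) simp
  then obtain S where S: "open S" "\<psi> ` (B \<inter> W) = model N \<inter> S" by (auto simp: openin_open)
  have fp: "f p \<in> B \<inter> W" using B * by auto
  then have "\<psi> (f (param M U \<kappa> (\<kappa> p))) \<in> S"
    using param_chart[OF M *(1) pU] S(2) by auto
  then have "\<forall>\<^sub>F y in nhds (\<kappa> p). \<psi> (f (param M U \<kappa> y)) \<in> S"
    using smooth_near_tendsto[OF *(7)] S(1) topological_tendstoD by fastforce
  then obtain R where R: "openin (mtop M) R" "p \<in> R" "R \<subseteq> U"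
      "\<And>q. q \<in> R \<Longrightarrow> \<psi> (f (param M U \<kappa> (\<kappa> q))) \<in> S"
    by (rule chart_nbhd[OF M *(1)]) (use pU in auto)
  have "f q \<in> B" if "q \<in> Q \<inter> R" for q
  proof -
    have q: "q \<in> U" "f q \<in> W" using that * by auto
    have "\<psi> (f q) \<in> S" using R(4)[of q] that param_chart[OF M *(1) q(1)] by simp
    then have "\<psi> (f q) \<in> \<psi> ` (B \<inter> W)" using S(2) chart_in_model[OF N *(2) q(2)] by auto
    then show ?thesis using q(2) inj_onD[OF chart_inj[OF N *(2)]] by blast
  qed
  then show "\<exists>Q. openin (mtop M) Q \<and> p \<in> Q \<and> f ` Q \<subseteq> B"
    using *(3,4) R(1,2) by (intro exI[of _ "Q \<inter> R"]) auto
qed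

text \<open>Independence of the charts, which is what the smooth transition maps are for.  Continuity at
  \<open>p\<close> has to be stated because, in the charts alone, \<open>f\<close> might leave the domain \<open>W\<close>.\<close>

lemma smooth_at_charts:
  assumes M: "smooth_atlas M" and N: "smooth_atlas N"
    and c: "(U, \<kappa>) \<in> atlas M" "p \<in> U" and d: "(W, \<psi>) \<in> atlas N" "f p \<in> W"
  shows "smooth_at M N f p \<longleftrightarrow>
    cont_at (mtop M) (mtop N) f p \<and> smooth_near (\<lambda>y. \<psi> (f (param M U \<kappa> y))) (\<kappa> p)"
proof
  assume f: "smooth_at M N f p"
  obtain U0 \<kappa>0 W0 \<psi>0 Q where *: "(U0, \<kappa>0) \<in> atlas M" "(W0, \<psi>0) \<in> atlas N" "openin (mtop M) Q"
    "p \<in> Q" "Q \<subseteq> U0" "f ` Q \<subseteq> W0" "smooth_near (\<lambda>y. \<psi>0 (f (param M U0 \<kappa>0 y))) (\<kappa>0 p)"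
    using f unfolding smooth_at_iff_near[OF M] by blast
  have pU0: "p \<in> U0" "f p \<in> W0" using * by auto
  note pc = param_chart[OF M c(1) c(2)] param_chart[OF M *(1) pU0(1)]
  have 1: "smooth_near (\<lambda>y. \<kappa>0 (param M U \<kappa> y)) (\<kappa> p)"
    by (rule transition_smooth[OF M c(1) *(1) c(2) pU0(1)])
  have 2: "smooth_near (\<lambda>y. \<psi>0 (f (param M U0 \<kappa>0 (\<kappa>0 (param M U \<kappa> y))))) (\<kappa> p)"
    by (rule smooth_near_compose[OF 1]) (use *(7) pc in simp)
  have 3: "smooth_near (\<lambda>y. \<psi> (param N W0 \<psi>0 y)) (\<psi>0 (f p))"
    by (rule transition_smooth[OF N *(2) d(1) pU0(2) d(2)])
  have 4: "smooth_near (\<lambda>y. \<psi> (param N W0 \<psi>0 (\<psi>0 (f (param M U0 \<kappa>0 (\<kappa>0 (param M U \<kappa> y))))))) (\<kappa> p)"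
    by (rule smooth_near_compose[OF 2]) (use 3 pc in simp)
  have "smooth_near (\<lambda>y. \<psi> (f (param M U \<kappa> y))) (\<kappa> p)"
  proof (rule smooth_near_cong[OF 4])
    show "\<forall>\<^sub>F y in nhds (\<kappa> p). \<psi> (param N W0 \<psi>0 (\<psi>0 (f (param M U0 \<kappa>0 (\<kappa>0 (param M U \<kappa> y))))))
        = \<psi> (f (param M U \<kappa> y))"
      using eventually_param_near[OF M c(1) *(3) *(4) c(2)]
    proof eventually_elim
      case (elim y)
      then have q: "param M U \<kappa> y \<in> U0" "f (param M U \<kappa> y) \<in> W0" using *(5,6) by auto
      show ?case
        by (simp add: param_chart[OF M *(1) q(1)] param_chart[OF N *(2) q(2)])
    qed
  qed
  with smooth_at_cont[OF M N f]
  show "cont_at (mtop M) (mtop N) f p \<and> smooth_near (\<lambda>y. \<psi> (f (param M U \<kappa> y))) (\<kappa> p)" by simp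
next
  assume *: "cont_at (mtop M) (mtop N) f p \<and> smooth_near (\<lambda>y. \<psi> (f (param M U \<kappa> y))) (\<kappa> p)"
  obtain Q where Q: "openin (mtop M) Q" "p \<in> Q" "f ` Q \<subseteq> W"
    using cont_atD[OF conjunct1[OF *] chart_open[OF N d(1)] d(2)] by metis
  have "openin (mtop M) (Q \<inter> U)" using Q(1) chart_open[OF M c(1)] by blast
  moreover have "p \<in> Q \<inter> U" "Q \<inter> U \<subseteq> U" "f ` (Q \<inter> U) \<subseteq> W" using Q c by auto
  ultimately show "smooth_at M N f p"
    unfolding smooth_at_iff_near[OF M] using c(1) d(1) * by blast
qed

lemma smooth_at_compose:
  assumes M: "smooth_atlas M" and N: "smooth_atlas N" and L: "smooth_atlas L"
    and f: "smooth_at M N f p" and g: "smooth_at N L g (f p)"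
  shows "smooth_at M L (\<lambda>x. g (f x)) p"
proof -
  obtain U \<kappa> where c: "(U, \<kappa>) \<in> atlas M" "p \<in> U"
    using point_in_chart[OF M smooth_at_points(1)[OF M N f]] by metis
  obtain W \<psi> where d: "(W, \<psi>) \<in> atlas N" "f p \<in> W"
    using point_in_chart[OF N smooth_at_points(2)[OF M N f]] by metis
  obtain Z \<xi> where e: "(Z, \<xi>) \<in> atlas L" "g (f p) \<in> Z"
    using point_in_chart[OF L smooth_at_points(2)[OF N L g]] by metis
  have f': "cont_at (mtop M) (mtop N) f p" "smooth_near (\<lambda>y. \<psi> (f (param M U \<kappa> y))) (\<kappa> p)"
    using f smooth_at_charts[where f=f, OF M N c d] by auto
  have g': "cont_at (mtop N) (mtop L) g (f p)" "smooth_near (\<lambda>y. \<xi> (g (param N W \<psi> y))) (\<psi> (f p))"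
    using g smooth_at_charts[where f=g, OF N L d e] by auto
  have "smooth_near (\<lambda>y. \<xi> (g (param N W \<psi> (\<psi> (f (param M U \<kappa> y)))))) (\<kappa> p)"
    by (rule smooth_near_compose[OF f'(2)]) (use g'(2) param_chart[OF M c] in simp)
  moreover obtain Q where Q: "openin (mtop M) Q" "p \<in> Q" "f ` Q \<subseteq> W"
    using cont_atD[OF f'(1) chart_open[OF N d(1)] d(2)] by metis
  have "\<forall>\<^sub>F y in nhds (\<kappa> p). \<xi> (g (param N W \<psi> (\<psi> (f (param M U \<kappa> y))))) = \<xi> (g (f (param M U \<kappa> y)))"
    using eventually_param_near[OF M c(1) Q(1,2) c(2)]
  proof eventually_elim
    case (elim y)
    then have "f (param M U \<kappa> y) \<in> W" using Q by auto
    then show ?case by (simp add: param_chart[OF N d(1)])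
  qed
  ultimately have "smooth_near (\<lambda>y. \<xi> (g (f (param M U \<kappa> y)))) (\<kappa> p)" by (rule smooth_near_cong)
  with cont_at_compose[OF f'(1) g'(1)] show ?thesis
    using smooth_at_charts[where f="\<lambda>x. g (f x)", OF M L c e] by simp
qed

lemma smooth_at_cong:
  assumes M: "smooth_atlas M" and f: "smooth_at M N f p"
    and R: "openin (mtop M) R" "p \<in> R" "\<And>q. q \<in> R \<Longrightarrow> f q = g q"
  shows "smooth_at M N g p"
proof -
  obtain U \<kappa> W \<psi> Q where *: "(U, \<kappa>) \<in> atlas M" "(W, \<psi>) \<in> atlas N" "openin (mtop M) Q"
    "p \<in> Q" "Q \<subseteq> U" "f ` Q \<subseteq> W" "smooth_near (\<lambda>y. \<psi> (f (param M U \<kappa> y))) (\<kappa> p)"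
    using f unfolding smooth_at_iff_near[OF M] by blast
  have "p \<in> U" using * by auto
  have "smooth_near (\<lambda>y. \<psi> (g (param M U \<kappa> y))) (\<kappa> p)"
    by (rule smooth_near_cong[OF *(7)])
      (use eventually_param_near[OF M *(1) R(1,2) \<open>p \<in> U\<close>] in eventually_elim, simp add: R(3))
  moreover have "openin (mtop M) (Q \<inter> R)" "p \<in> Q \<inter> R" "Q \<inter> R \<subseteq> U" using * R by auto
  moreover have "g ` (Q \<inter> R) \<subseteq> W" using *(6) R(3) by fastforce
  ultimately show ?thesis unfolding smooth_at_iff_near[OF M] using *(1,2) by blast
qed

lemma smooth_at_const:
  assumes M: "smooth_atlas M" and N: "smooth_atlas N" and "p \<in> points M" "a \<in> points N"
  shows "smooth_at M N (\<lambda>x. a) p"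
proof -
  obtain U \<kappa> where c: "(U, \<kappa>) \<in> atlas M" "p \<in> U" using point_in_chart[OF M assms(3)] by metis
  obtain W \<psi> where d: "(W, \<psi>) \<in> atlas N" "a \<in> W" using point_in_chart[OF N assms(4)] by metis
  have "cont_at (mtop M) (mtop N) (\<lambda>x. a) p"
    using assms by (intro cont_at_of_continuous_map) auto
  then show ?thesis using smooth_at_charts[where f="\<lambda>x. a", OF M N c d] by (simp add: smooth_near_const)
qed

lemma smooth_at_ident:
  assumes M: "smooth_atlas M" and "p \<in> points M"
  shows "smooth_at M M (\<lambda>x. x) p"
proof -
  obtain U \<kappa> where c: "(U, \<kappa>) \<in> atlas M" "p \<in> U" using point_in_chart[OF M assms(2)] by metis
  show ?thesis
    using smooth_at_charts[OF M M c c(1), of "\<lambda>x. x"] c transition_smooth[OF M c(1) c(1) c(2) c(2)]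
      cont_at_of_continuous_map[OF continuous_map_id assms(2)] by (simp add: id_def)
qed

subsection \<open>Products\<close>

lemma atlas_prodI:
  "(U, \<kappa>) \<in> atlas M \<Longrightarrow> (W, \<psi>) \<in> atlas N \<Longrightarrow> (U \<times> W, map_prod \<kappa> \<psi>) \<in> atlas (prod_mfd M N)"
  by (auto simp: prod_mfd_def)

lemma param_prod:
  assumes M: "smooth_atlas M" and N: "smooth_atlas N"
    and c: "(U, \<kappa>) \<in> atlas M" "(W, \<psi>) \<in> atlas N"
    and "proj (model M) y \<in> \<kappa> ` U" "proj (model N) z \<in> \<psi> ` W"
  shows "param (prod_mfd M N) (U \<times> W) (map_prod \<kappa> \<psi>) (y, z) = (param M U \<kappa> y, param N W \<psi> z)"
proof -
  note V = model_subspace[OF M c(1)] model_subspace[OF N c(2)]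
  note p = chart_param[OF M c(1) assms(5)] chart_param[OF N c(2) assms(6)]
  have "inj_on (map_prod \<kappa> \<psi>) (U \<times> W)"
    by (rule map_prod_inj_on[OF chart_inj[OF M c(1)] chart_inj[OF N c(2)]])
  then have "inv_into (U \<times> W) (map_prod \<kappa> \<psi>) (map_prod \<kappa> \<psi> (param M U \<kappa> y, param N W \<psi> z))
      = (param M U \<kappa> y, param N W \<psi> z)"
    by (rule inv_into_f_f) (use p in auto)
  moreover have "model (prod_mfd M N) = model M \<times> model N" by (simp add: prod_mfd_def)
  ultimately show ?thesis
    using p by (simp add: param_def[of "prod_mfd M N"] proj_Times[OF V])
qed

lemma eventually_param_prod:
  assumes M: "smooth_atlas M" and N: "smooth_atlas N"
    and c: "(U, \<kappa>) \<in> atlas M" "p \<in> U" and d: "(W, \<psi>) \<in> atlas N" "q \<in> W"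
  shows "\<forall>\<^sub>F z in nhds (\<kappa> p, \<psi> q).
    param (prod_mfd M N) (U \<times> W) (map_prod \<kappa> \<psi>) z = (param M U \<kappa> (fst z), param N W \<psi> (snd z))"
proof -
  have 1: "\<forall>\<^sub>F y in nhds (\<kappa> p). proj (model M) y \<in> \<kappa> ` U"
    using eventually_param_near[OF M c(1) chart_open[OF M c(1)] c(2) c(2)] by eventually_elim simp
  have 2: "\<forall>\<^sub>F y in nhds (\<psi> q). proj (model N) y \<in> \<psi> ` W"
    using eventually_param_near[OF N d(1) chart_open[OF N d(1)] d(2) d(2)] by eventually_elim simp
  have "\<forall>\<^sub>F z in nhds (\<kappa> p, \<psi> q). proj (model M) (fst z) \<in> \<kappa> ` U \<and> proj (model N) (snd z) \<in> \<psi> ` W"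
    unfolding nhds_prod using eventually_prodI[OF 1 2] by eventually_elim simp
  then show ?thesis
    by eventually_elim (metis param_prod[OF M N c(1) d(1)] prod.collapse)
qed

lemma smooth_atlas_prod:
  assumes M: "smooth_atlas M" and N: "smooth_atlas N"
  shows "smooth_atlas (prod_mfd M N)"
proof -
  note [simp] = prod_mfd_def
  have op: "openin (prod_topology (mtop M) (mtop N)) (U \<times> W)"
    if "(U, \<kappa>) \<in> atlas M" "(W, \<psi>) \<in> atlas N" for U \<kappa> W \<psi>
    using chart_open[OF M that(1)] chart_open[OF N that(2)] by (simp add: openin_prod_Times_iff)
  have im: "openin (top_of_set (model M \<times> model N)) (map_prod \<kappa> \<psi> ` Q)"
    if c: "(U, \<kappa>) \<in> atlas M" and d: "(W, \<psi>) \<in> atlas N"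
      and Q: "openin (prod_topology (mtop M) (mtop N)) Q" "Q \<subseteq> U \<times> W" for U \<kappa> W \<psi> Q
  proof (subst openin_subopen, intro ballI)
    fix z assume "z \<in> map_prod \<kappa> \<psi> ` Q"
    then obtain p q where pq: "(p, q) \<in> Q" "z = (\<kappa> p, \<psi> q)" by auto
    then obtain A B where AB: "openin (mtop M) A" "openin (mtop N) B" "p \<in> A" "q \<in> B" "A \<times> B \<subseteq> Q"
      using openin_prod_topologyE[OF Q(1)] by metis
    have "A \<subseteq> U" "B \<subseteq> W" using AB Q(2) by auto
    then have "openin (top_of_set (model M \<times> model N)) (\<kappa> ` A \<times> \<psi> ` B)"
      using chart_image_open[OF M c AB(1)] chart_image_open[OF N d AB(2)] by (intro openin_Times)
    moreover have "\<kappa> ` A \<times> \<psi> ` B \<subseteq> map_prod \<kappa> \<psi> ` Q"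
    proof
      fix x assume "x \<in> \<kappa> ` A \<times> \<psi> ` B"
      then obtain a b where "a \<in> A" "b \<in> B" "x = map_prod \<kappa> \<psi> (a, b)" by auto
      then show "x \<in> map_prod \<kappa> \<psi> ` Q" using AB(5) by blast
    qed
    ultimately show "\<exists>T. openin (top_of_set (model M \<times> model N)) T \<and> z \<in> T \<and> T \<subseteq> map_prod \<kappa> \<psi> ` Q"
      using AB pq by (intro exI[of _ "\<kappa> ` A \<times> \<psi> ` B"]) auto
  qed
  have pre: "openin (prod_topology (mtop M) (mtop N)) {x \<in> U \<times> W. map_prod \<kappa> \<psi> x \<in> S}"
    if c: "(U, \<kappa>) \<in> atlas M" and d: "(W, \<psi>) \<in> atlas N" and S: "open S" for U \<kappa> W \<psi> S
    unfolding openin_prod_topology_alt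
  proof (intro allI impI)
    fix p q assume "(p, q) \<in> {x \<in> U \<times> W. map_prod \<kappa> \<psi> x \<in> S}"
    then have pq: "p \<in> U" "q \<in> W" "(\<kappa> p, \<psi> q) \<in> S" by auto
    obtain A B where "open A" "open B" "(\<kappa> p, \<psi> q) \<in> A \<times> B" "A \<times> B \<subseteq> S"
      using open_prod_elim[OF S pq(3)] by blast
    then show "\<exists>A B. openin (mtop M) A \<and> openin (mtop N) B \<and> p \<in> A \<and> q \<in> B \<and>
        A \<times> B \<subseteq> {x \<in> U \<times> W. map_prod \<kappa> \<psi> x \<in> S}"
      using pq chart_preimage_open[OF M c, of A] chart_preimage_open[OF N d, of B]
      by (intro exI[of _ "{q \<in> U. \<kappa> q \<in> A}"] exI[of _ "{q \<in> W. \<psi> q \<in> B}"]) auto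
  qed
  have inj: "inj_on (map_prod \<kappa> \<psi>) (U \<times> W)"
    if "(U, \<kappa>) \<in> atlas M" "(W, \<psi>) \<in> atlas N" for U \<kappa> W \<psi>
    by (rule map_prod_inj_on[OF chart_inj[OF M that(1)] chart_inj[OF N that(2)]])
  have tr: "smooth_on (model M \<times> model N) (map_prod \<kappa> \<psi> ` (U \<times> W \<inter> U' \<times> W'))
      (map_prod \<kappa>' \<psi>' \<circ> inv_into (U \<times> W) (map_prod \<kappa> \<psi>))"
    if c: "(U, \<kappa>) \<in> atlas M" and d: "(W, \<psi>) \<in> atlas N"
      and c': "(U', \<kappa>') \<in> atlas M" and d': "(W', \<psi>') \<in> atlas N" for U \<kappa> W \<psi> U' \<kappa>' W' \<psi>'
  proof -
    have V: "subspace (model M \<times> model N)"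
      by (intro subspace_Times model_subspace[OF M c] model_subspace[OF N d])
    have "openin (top_of_set (model M \<times> model N)) (map_prod \<kappa> \<psi> ` (U \<times> W \<inter> U' \<times> W'))"
      using op[OF c d] op[OF c' d'] by (intro im[OF c d]) auto
    moreover have "smooth_near (\<lambda>y. (map_prod \<kappa>' \<psi>' \<circ> inv_into (U \<times> W) (map_prod \<kappa> \<psi>)) (proj (model M \<times> model N) y)) z"
      if z: "z \<in> map_prod \<kappa> \<psi> ` (U \<times> W \<inter> U' \<times> W')" for z
    proof -
      obtain p q where pq: "p \<in> U" "p \<in> U'" "q \<in> W" "q \<in> W'" "z = (\<kappa> p, \<psi> q)" using z by auto
      have "smooth_near (\<lambda>y. \<kappa>' (param M U \<kappa> (fst y))) (\<kappa> p, \<psi> q)"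
        by (rule smooth_near_compose[OF smooth_near_fst[OF smooth_near_id]])
          (simp add: transition_smooth[OF M c c' pq(1,2)])
      moreover have "smooth_near (\<lambda>y. \<psi>' (param N W \<psi> (snd y))) (\<kappa> p, \<psi> q)"
        by (rule smooth_near_compose[OF smooth_near_snd[OF smooth_near_id]])
          (simp add: transition_smooth[OF N d d' pq(3,4)])
      ultimately have "smooth_near (\<lambda>y. (\<kappa>' (param M U \<kappa> (fst y)), \<psi>' (param N W \<psi> (snd y)))) (\<kappa> p, \<psi> q)"
        by (rule smooth_near_Pair)
      then have "smooth_near (\<lambda>y. map_prod \<kappa>' \<psi>' (param (prod_mfd M N) (U \<times> W) (map_prod \<kappa> \<psi>) y)) (\<kappa> p, \<psi> q)"
        by (rule smooth_near_cong)
          (use eventually_param_prod[OF M N c pq(1) d pq(3)] in eventually_elim, simp del: prod_mfd_def)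
      then show ?thesis unfolding pq(5) param_def by simp
    qed
    ultimately show ?thesis using smooth_on_iff_near_proj[OF V] by blast
  qed
  have cover: "(\<Union>(U, \<kappa>)\<in>atlas (prod_mfd M N). U) = points (prod_mfd M N)"
  proof (intro equalityI subsetI)
    fix x assume "x \<in> (\<Union>(U, \<kappa>)\<in>atlas (prod_mfd M N). U)"
    then obtain U \<kappa> W \<psi> where "(U, \<kappa>) \<in> atlas M" "(W, \<psi>) \<in> atlas N" "x \<in> U \<times> W" by auto
    then show "x \<in> points (prod_mfd M N)"
      using chart_subset[OF M] chart_subset[OF N] by (auto simp: mem_Times_iff)
  next
    fix x assume "x \<in> points (prod_mfd M N)"
    then have x: "fst x \<in> points M" "snd x \<in> points N" by auto
    obtain U \<kappa> where c: "(U, \<kappa>) \<in> atlas M" "fst x \<in> U" using point_in_chart[OF M x(1)] by metis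
    obtain W \<psi> where d: "(W, \<psi>) \<in> atlas N" "snd x \<in> W" using point_in_chart[OF N x(2)] by metis
    show "x \<in> (\<Union>(U, \<kappa>)\<in>atlas (prod_mfd M N). U)"
      by (rule UN_I[OF atlas_prodI[OF c(1) d(1)]]) (use c d in \<open>simp add: mem_Times_iff\<close>)
  qed
  have V: "subspace (model (prod_mfd M N))"
    using M N by (simp add: smooth_atlas_def subspace_Times)
  show ?thesis
    unfolding smooth_atlas_def
  proof (intro conjI V cover ballI)
    fix x assume "x \<in> atlas (prod_mfd M N)"
    then obtain U \<kappa> W \<psi> where x: "x = (U \<times> W, map_prod \<kappa> \<psi>)" and c: "(U, \<kappa>) \<in> atlas M" and d: "(W, \<psi>) \<in> atlas N"
      by auto
    show "case x of (U, \<kappa>) \<Rightarrow> openin (mtop (prod_mfd M N)) U \<and> inj_on \<kappa> U \<and>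
      (\<forall>Q. openin (mtop (prod_mfd M N)) Q \<and> Q \<subseteq> U \<longrightarrow> openin (top_of_set (model (prod_mfd M N))) (\<kappa> ` Q)) \<and>
      (\<forall>S. open S \<longrightarrow> openin (mtop (prod_mfd M N)) {q \<in> U. \<kappa> q \<in> S})"
      unfolding x split_conv using op[OF c d] inj[OF c d] im[OF c d] pre[OF c d] by simp
    show "case x of (U, \<kappa>) \<Rightarrow> \<forall>(W, \<psi>)\<in>atlas (prod_mfd M N).
      smooth_on (model (prod_mfd M N)) (\<kappa> ` (U \<inter> W)) (\<psi> \<circ> inv_into U \<kappa>)"
      unfolding x split_conv
    proof (intro ballI)
      fix y assume "y \<in> atlas (prod_mfd M N)"
      then obtain U' \<kappa>' W' \<psi>' where y: "y = (U' \<times> W', map_prod \<kappa>' \<psi>')" "(U', \<kappa>') \<in> atlas M" "(W', \<psi>') \<in> atlas N"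
        by auto
      show "case y of (W', \<psi>') \<Rightarrow> smooth_on (model (prod_mfd M N)) (map_prod \<kappa> \<psi> ` (U \<times> W \<inter> W'))
          (\<psi>' \<circ> inv_into (U \<times> W) (map_prod \<kappa> \<psi>))"
        unfolding y(1) split_conv using tr[OF c d y(2,3)] by simp
    qed
  qed
qed

lemma smooth_at_pair:
  assumes K: "smooth_atlas K" and M: "smooth_atlas M" and N: "smooth_atlas N"
    and f: "smooth_at K M f p" and g: "smooth_at K N g p"
  shows "smooth_at K (prod_mfd M N) (\<lambda>x. (f x, g x)) p"
proof -
  obtain Z \<xi> where e: "(Z, \<xi>) \<in> atlas K" "p \<in> Z"
    using point_in_chart[OF K smooth_at_points(1)[OF K M f]] by metis
  obtain U \<kappa> where c: "(U, \<kappa>) \<in> atlas M" "f p \<in> U"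
    using point_in_chart[OF M smooth_at_points(2)[OF K M f]] by metis
  obtain W \<psi> where d: "(W, \<psi>) \<in> atlas N" "g p \<in> W"
    using point_in_chart[OF N smooth_at_points(2)[OF K N g]] by metis
  have "cont_at (mtop K) (mtop (prod_mfd M N)) (\<lambda>x. (f x, g x)) p"
    using cont_at_pair[OF smooth_at_cont[OF K M f] smooth_at_cont[OF K N g]] by (simp add: prod_mfd_def)
  moreover have "smooth_near (\<lambda>y. map_prod \<kappa> \<psi> (f (param K Z \<xi> y), g (param K Z \<xi> y))) (\<xi> p)"
  proof -
    have "smooth_near (\<lambda>y. \<kappa> (f (param K Z \<xi> y))) (\<xi> p)" "smooth_near (\<lambda>y. \<psi> (g (param K Z \<xi> y))) (\<xi> p)"
      using f g smooth_at_charts[where f=f, OF K M e c] smooth_at_charts[where f=g, OF K N e d] by simp_all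
    from smooth_near_Pair[OF this] show ?thesis by simp
  qed
  ultimately show ?thesis
    using smooth_at_charts[OF K smooth_atlas_prod[OF M N] e atlas_prodI[OF c(1) d(1)], of "\<lambda>x. (f x, g x)"] c d
    by simp
qed

lemma smooth_at_fst:
  assumes M: "smooth_atlas M" and N: "smooth_atlas N" and "p \<in> points M" "q \<in> points N"
  shows "smooth_at (prod_mfd M N) M fst (p, q)" and "smooth_at (prod_mfd M N) N snd (p, q)"
proof -
  obtain U \<kappa> where c: "(U, \<kappa>) \<in> atlas M" "p \<in> U" using point_in_chart[OF M assms(3)] by metis
  obtain W \<psi> where d: "(W, \<psi>) \<in> atlas N" "q \<in> W" using point_in_chart[OF N assms(4)] by metis
  have pq: "(p, q) \<in> U \<times> W" "map_prod \<kappa> \<psi> (p, q) = (\<kappa> p, \<psi> q)" using c d by auto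
  note P = smooth_atlas_prod[OF M N] and ch = atlas_prodI[OF c(1) d(1)]
  note ev = eventually_param_prod[OF M N c d]
  have top: "(p, q) \<in> topspace (prod_topology (mtop M) (mtop N))" using assms by simp
  have m: "mtop (prod_mfd M N) = prod_topology (mtop M) (mtop N)" by (simp add: prod_mfd_def)
  have "smooth_near (\<lambda>y. \<kappa> (param M U \<kappa> (fst y))) (\<kappa> p, \<psi> q)"
    by (rule smooth_near_compose[OF smooth_near_fst[OF smooth_near_id]])
      (simp add: transition_smooth[OF M c(1) c(1) c(2) c(2)])
  then have "smooth_near (\<lambda>y. \<kappa> (fst (param (prod_mfd M N) (U \<times> W) (map_prod \<kappa> \<psi>) y))) (\<kappa> p, \<psi> q)"
    by (rule smooth_near_cong) (use ev in eventually_elim, simp)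
  then show "smooth_at (prod_mfd M N) M fst (p, q)"
    using smooth_at_charts[OF P M ch pq(1) c(1), of fst] c(2) pq(2)
      cont_at_of_continuous_map[OF continuous_map_fst top] m by simp
  have "smooth_near (\<lambda>y. \<psi> (param N W \<psi> (snd y))) (\<kappa> p, \<psi> q)"
    by (rule smooth_near_compose[OF smooth_near_snd[OF smooth_near_id]])
      (simp add: transition_smooth[OF N d(1) d(1) d(2) d(2)])
  then have "smooth_near (\<lambda>y. \<psi> (snd (param (prod_mfd M N) (U \<times> W) (map_prod \<kappa> \<psi>) y))) (\<kappa> p, \<psi> q)"
    by (rule smooth_near_cong) (use ev in eventually_elim, simp)
  then show "smooth_at (prod_mfd M N) N snd (p, q)"
    using smooth_at_charts[OF P N ch pq(1) d(1), of snd] d(2) pq(2)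
      cont_at_of_continuous_map[OF continuous_map_snd top] m by simp
qed

subsection \<open>Linear subspaces as manifolds\<close>

definition flat :: "'e::euclidean_space set \<Rightarrow> ('e, 'e) mfd" where
  "flat C = \<lparr>mtop = top_of_set C, model = C, atlas = {(C, \<lambda>x. x)}\<rparr>"

lemma real_line_flat: "real_line = flat UNIV"
  by (simp add: real_line_def flat_def)

context
  fixes C :: "'e::euclidean_space set" assumes C: "subspace C"
begin

lemma smooth_manifold_flat: "smooth_manifold (flat C)"
proof -
  have "chart (top_of_set C) C C (\<lambda>x. x)"
  proof (rule chartI)
    fix S :: "'e set" assume "open S"
    moreover have "{q \<in> C. q \<in> S} = C \<inter> S" by auto
    ultimately show "openin (top_of_set C) {q \<in> C. q \<in> S}" by (simp add: openin_open_Int)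
  qed simp_all
  moreover have "smooth_on C C (\<lambda>x. inv_into C (\<lambda>x. x) x)"
    unfolding smooth_on_iff_near_proj[OF C openin_subtopology_self]
  proof
    have "inv_into C (\<lambda>x. x) (proj C y) = proj C y" for y
      using inv_into_f_f[of "\<lambda>x. x" C "proj C y"] proj_in[OF C, of y] by simp
    then show "smooth_near (\<lambda>y. inv_into C (\<lambda>x. x) (proj C y)) x" for x
      using smooth_near_proj[OF C] by simp
  qed
  moreover have "second_countable (top_of_set C)"
  proof (rule second_countable_subtopology)
    obtain B :: "'e set set" where B: "countable B" "topological_basis B"
      using ex_countable_basis by blast
    show "second_countable (euclidean :: 'e topology)"
      unfolding second_countable_def
    proof (intro exI[of _ B] conjI ballI allI impI)
      show "countable B" by (rule B(1))
      show "openin euclidean A" if "A \<in> B" for A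
        using topological_basis_open[OF B(2) that] by simp
      fix A :: "'e set" and x assume "openin euclidean A \<and> x \<in> A"
      then show "\<exists>A'\<in>B. x \<in> A' \<and> A' \<subseteq> A"
        using topological_basisE[OF B(2), of A x] by (metis open_openin)
    qed
  qed
  ultimately show ?thesis
    using C by (simp add: smooth_manifold_def flat_def Hausdorff_space_subtopology o_def)
qed

lemma smooth_atlas_flat: "smooth_atlas (flat C)"
  by (rule smooth_manifold_imp_atlas[OF smooth_manifold_flat])

lemma flat_simps: "mtop (flat C) = top_of_set C" "model (flat C) = C" "(C, \<lambda>x. x) \<in> atlas (flat C)"
  by (simp_all add: flat_def)

lemma param_flat: "param (flat C) C (\<lambda>x. x) y = proj C y"
  using inv_into_f_f[of "\<lambda>x. x" C "proj C y"] proj_in[OF C, of y] by (simp add: param_def flat_simps)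

text \<open>A map into a linear subspace is continuous as soon as it is smooth in a chart.\<close>

lemma smooth_at_to_flat:
  assumes M: "smooth_atlas M" and c: "(U, \<kappa>) \<in> atlas M" "p \<in> U"
    and R: "openin (mtop M) R" "p \<in> R" "f ` R \<subseteq> C"
  shows "smooth_at M (flat C) f p \<longleftrightarrow> smooth_near (\<lambda>y. f (param M U \<kappa> y)) (\<kappa> p)"
proof -
  have "f p \<in> C" using R by auto
  have "cont_at (mtop M) (top_of_set C) f p" if sm: "smooth_near (\<lambda>y. f (param M U \<kappa> y)) (\<kappa> p)"
    unfolding cont_at_def
  proof (intro conjI allI impI)
    show "p \<in> points M" by (rule chart_subset[OF M c])
    show "f p \<in> topspace (top_of_set C)" using \<open>f p \<in> C\<close> by simp
    fix B assume B: "openin (top_of_set C) B \<and> f p \<in> B"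
    then obtain S where S: "open S" "B = C \<inter> S" by (auto simp: openin_open)
    have "f (param M U \<kappa> (\<kappa> p)) \<in> S" using B S param_chart[OF M c] by auto
    then have "\<forall>\<^sub>F y in nhds (\<kappa> p). f (param M U \<kappa> y) \<in> S"
      using smooth_near_tendsto[OF sm] S(1) topological_tendstoD by fastforce
    then obtain Q where Q: "openin (mtop M) Q" "p \<in> Q" "Q \<subseteq> U" "\<And>q. q \<in> Q \<Longrightarrow> f (param M U \<kappa> (\<kappa> q)) \<in> S"
      by (rule chart_nbhd[OF M c(1)]) (use c in auto)
    have "f q \<in> B" if "q \<in> Q \<inter> R" for q
    proof -
      have "q \<in> U" using that Q by auto
      then have "f q \<in> S" using Q(4)[of q] that param_chart[OF M c(1)] by simp
      then show ?thesis using S R that by auto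
    qed
    then show "\<exists>Q. openin (mtop M) Q \<and> p \<in> Q \<and> f ` Q \<subseteq> B"
      using Q R by (intro exI[of _ "Q \<inter> R"]) auto
  qed
  then show ?thesis
    using smooth_at_charts[OF M smooth_atlas_flat c flat_simps(3), of f] \<open>f p \<in> C\<close> by (auto simp: flat_simps)
qed

lemma smooth_at_from_flat:
  assumes N: "smooth_atlas N" and "x \<in> C" and d: "(W, \<psi>) \<in> atlas N" "g x \<in> W"
  shows "smooth_at (flat C) N g x \<longleftrightarrow>
    cont_at (top_of_set C) (mtop N) g x \<and> smooth_near (\<lambda>y. \<psi> (g (proj C y))) x"
  using smooth_at_charts[OF smooth_atlas_flat N flat_simps(3) assms(2) d(1), of g] d(2)
  by (simp add: flat_simps param_flat)

end

abbreviation euclid :: "('e::euclidean_space, 'e) mfd" where "euclid \<equiv> flat UNIV"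

lemma smooth_atlas_euclid: "smooth_atlas (euclid :: ('e::euclidean_space, 'e) mfd)"
  by (rule smooth_atlas_flat) simp

lemma smooth_at_to_euclid:
  assumes M: "smooth_atlas M" and c: "(U, \<kappa>) \<in> atlas M" "p \<in> U"
  shows "smooth_at M euclid f p \<longleftrightarrow> smooth_near (\<lambda>y. f (param M U \<kappa> y)) (\<kappa> p)"
  by (rule smooth_at_to_flat[OF _ M c chart_open[OF M c(1)] c(2)]) auto

lemma smooth_at_euclid:
  fixes f :: "'e::euclidean_space \<Rightarrow> 'f::euclidean_space"
  shows "smooth_at euclid euclid f x \<longleftrightarrow> smooth_near f x"
  using smooth_at_to_euclid[OF smooth_atlas_euclid, of UNIV "\<lambda>x. x" x f]
  by (simp add: flat_simps param_flat proj_UNIV)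

lemma smooth_at_from_euclid:
  assumes N: "smooth_atlas N" and d: "(W, \<psi>) \<in> atlas N" "g x \<in> W"
  shows "smooth_at euclid N g x \<longleftrightarrow> cont_at euclidean (mtop N) g x \<and> smooth_near (\<lambda>y. \<psi> (g y)) x"
  using smooth_at_from_flat[OF _ N _ d(1), of UNIV x g] d(2) by (simp add: proj_UNIV)

lemma smooth_at_chart:
  assumes M: "smooth_atlas M" and c: "(U, \<kappa>) \<in> atlas M" "p \<in> U"
  shows "smooth_at M euclid \<kappa> p"
  unfolding smooth_at_to_euclid[OF assms] by (rule transition_smooth[OF M c(1) c(1) c(2) c(2)])

lemma smooth_at_param:
  assumes M: "smooth_atlas M" and c: "(U, \<kappa>) \<in> atlas M" and y: "proj (model M) y \<in> \<kappa> ` U"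
  shows "smooth_at euclid M (param M U \<kappa>) y"
proof -
  note p = chart_param[OF M c y]
  have "cont_at euclidean (mtop M) (param M U \<kappa>) y"
    unfolding cont_at_def
  proof (intro conjI allI impI)
    show "param M U \<kappa> y \<in> points M" by (rule chart_subset[OF M c p(1)])
    fix B assume "openin (mtop M) B \<and> param M U \<kappa> y \<in> B"
    then have "\<forall>\<^sub>F z in nhds y. proj (model M) z \<in> \<kappa> ` U \<and> param M U \<kappa> z \<in> B"
      by (intro eventually_param_in[OF M c y]) simp_all
    then have "\<forall>\<^sub>F z in nhds y. param M U \<kappa> z \<in> B"
      by (rule eventually_mono) simp
    then show "\<exists>Q. openin euclidean Q \<and> y \<in> Q \<and> param M U \<kappa> ` Q \<subseteq> B"
      by (auto simp: eventually_nhds)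
  qed simp
  moreover have "smooth_near (\<lambda>z. \<kappa> (param M U \<kappa> z)) y"
  proof (rule smooth_near_cong[OF smooth_near_proj[OF model_subspace[OF M c]]])
    show "\<forall>\<^sub>F z in nhds y. proj (model M) z = \<kappa> (param M U \<kappa> z)"
      using eventually_param_in[OF M c y chart_open[OF M c] p(1)]
      by eventually_elim (simp add: chart_param[OF M c])
  qed
  ultimately show ?thesis using smooth_at_from_euclid[OF M c, of "param M U \<kappa>"] p by simp
qed

section \<open>Tangent vectors in charts\<close>

lemma app_local_functional:
  "app (local_functional M p x) f = (if smooth_at M real_line f p then x f else 0)"
  by (simp add: local_functional_def Functional_inverse)

lemma functional_eqI: "(\<And>f. app x f = app y f) \<Longrightarrow> x = y"
  by (metis app_inject ext)

lemma app_add: "app (x + y) f = app x f + app y f"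
  by (simp add: plus_functional.rep_eq)

lemma app_scaleR: "app (c *\<^sub>R x) f = c * app x f"
  by (simp add: scaleR_functional.rep_eq)

text \<open>The tangent vector at \<open>p\<close> whose coordinates in the chart \<open>\<kappa>\<close> are \<open>v\<close>.\<close>

definition coord_vector ::
    "('a, 'e::euclidean_space) mfd \<Rightarrow> 'a set \<Rightarrow> ('a \<Rightarrow> 'e) \<Rightarrow> 'a \<Rightarrow> 'e \<Rightarrow> 'a functional" where
  "coord_vector M U \<kappa> p v = local_functional M p (\<lambda>f. fderiv (\<lambda>y. f (param M U \<kappa> y)) (\<kappa> p) v)"

lemma smooth_at_neighbourhood:
  assumes "smooth_at M N f p"
  obtains R where "openin (mtop M) R" "p \<in> R" "\<And>q. q \<in> R \<Longrightarrow> smooth_at M N f q"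
proof -
  obtain U \<kappa> W \<psi> Q where *: "(U, \<kappa>) \<in> atlas M" "(W, \<psi>) \<in> atlas N" "openin (mtop M) Q"
    "p \<in> Q" "Q \<subseteq> U" "f ` Q \<subseteq> W" "smooth_on (model M) (\<kappa> ` Q) (\<psi> \<circ> f \<circ> inv_into U \<kappa>)"
    using assms unfolding smooth_at_def by blast
  have "smooth_at M N f q" if "q \<in> Q" for q
    unfolding smooth_at_def using * that by blast
  with * that show ?thesis by blast
qed

context
  fixes M :: "('a, 'e::euclidean_space) mfd" and U \<kappa> p
  assumes M: "smooth_atlas M" and c: "(U, \<kappa>) \<in> atlas M" and pU: "p \<in> U"
begin

lemma smooth_at_real_line: "smooth_at M real_line f p \<longleftrightarrow> smooth_near (\<lambda>y. f (param M U \<kappa> y)) (\<kappa> p)"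
  unfolding real_line_flat by (rule smooth_at_to_euclid[OF M c pU])

lemma app_coord_vector:
  "smooth_at M real_line f p \<Longrightarrow>
    app (coord_vector M U \<kappa> p v) f = fderiv (\<lambda>y. f (param M U \<kappa> y)) (\<kappa> p) v"
  by (simp add: coord_vector_def app_local_functional)

lemma coord_vector_add:
  "coord_vector M U \<kappa> p (v + w) = coord_vector M U \<kappa> p v + coord_vector M U \<kappa> p w"
  by (rule functional_eqI)
    (auto simp: app_add coord_vector_def app_local_functional smooth_at_real_line
      linear_add[OF smooth_near_linear_fderiv])

lemma coord_vector_scaleR:
  "coord_vector M U \<kappa> p (r *\<^sub>R v) = r *\<^sub>R coord_vector M U \<kappa> p v"
  by (rule functional_eqI)
    (auto simp: app_scaleR coord_vector_def app_local_functional smooth_at_real_line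
      linear_scale[OF smooth_near_linear_fderiv])

lemma coord_vector_zero: "coord_vector M U \<kappa> p 0 = 0"
  using coord_vector_scaleR[of 0 0] by simp

lemma fderiv_chart_param: "fderiv (\<lambda>y. \<kappa> (param M U \<kappa> y)) (\<kappa> p) v = proj (model M) v"
proof -
  have "\<forall>\<^sub>F y in nhds (\<kappa> p). \<kappa> (param M U \<kappa> y) = proj (model M) y"
    using eventually_param_near[OF M c chart_open[OF M c] pU pU]
    by eventually_elim (simp add: chart_param[OF M c])
  then show ?thesis
    using fderiv_cong fderiv_linear[OF bounded_linear_proj[OF model_subspace[OF M c]]] by metis
qed

lemma smooth_at_chart_component: "smooth_at M real_line (\<lambda>q. \<kappa> q \<bullet> b) p"
  unfolding smooth_at_real_line
  by (rule smooth_near_compose_linear[OF bounded_linear_inner_left transition_smooth[OF M c c pU pU]])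

lemma app_chart_component:
  assumes "v \<in> model M"
  shows "app (coord_vector M U \<kappa> p v) (\<lambda>q. \<kappa> q \<bullet> b) = v \<bullet> b"
  unfolding app_coord_vector[OF smooth_at_chart_component]
    fderiv_compose_linear[OF bounded_linear_inner_left transition_smooth[OF M c c pU pU]]
    fderiv_chart_param
  by (simp add: proj_id[OF model_subspace[OF M c] assms])

text \<open>The coordinates of a tangent vector are read off by applying it to the components of the
  chart.\<close>

lemma coords_of_local_functional:
  assumes "local_functional M p \<Psi> = coord_vector M U \<kappa> p w" "w \<in> model M"
  shows "w \<bullet> b = \<Psi> (\<lambda>q. \<kappa> q \<bullet> b)"
  using app_chart_component[OF assms(2), of b] assms(1)[symmetric] smooth_at_chart_component[of b]
  by (simp add: app_local_functional)

lemma inj_on_coord_vector: "inj_on (coord_vector M U \<kappa> p) (model M)"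
proof (rule inj_onI)
  fix v w assume "v \<in> model M" "w \<in> model M" "coord_vector M U \<kappa> p v = coord_vector M U \<kappa> p w"
  then have "v \<bullet> b = w \<bullet> b" for b using app_chart_component by metis
  then show "v = w" by (subst euclidean_eq_iff) blast
qed

text \<open>A curve \<open>\<gamma>\<close> has the coordinates \<open>(\<kappa> \<circ> \<gamma>)'(0)\<close>; conversely \<open>v\<close> is realised by the
  straight line through \<open>\<kappa> p\<close> in the chart.\<close>

lemma tangent_space_eq: "tangent_space M p = coord_vector M U \<kappa> p ` model M"
proof (intro equalityI subsetI)
  note V = model_subspace[OF M c]
  fix x assume "x \<in> tangent_space M p"
  then obtain \<gamma> where \<gamma>: "smooth_at real_line M \<gamma> 0" "\<gamma> 0 = p" "x = velocity M \<gamma>"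
    by (auto simp: tangent_space_def)
  have "\<gamma> 0 \<in> U" using \<gamma>(2) pU by simp
  have g: "cont_at euclidean (mtop M) \<gamma> 0" "smooth_near (\<lambda>t. \<kappa> (\<gamma> t)) 0"
    using \<gamma>(1) smooth_at_from_euclid[where g=\<gamma>, OF M c \<open>\<gamma> 0 \<in> U\<close>] by (simp_all add: real_line_flat)
  obtain Q where Q: "openin euclidean Q" "0 \<in> Q" "\<gamma> ` Q \<subseteq> U"
    using cont_atD[OF g(1) chart_open[OF M c] \<open>\<gamma> 0 \<in> U\<close>] by metis
  then have ev: "\<forall>\<^sub>F t in nhds 0. \<gamma> t \<in> U" by (auto simp: eventually_nhds)
  define v where "v = fderiv (\<lambda>t. \<kappa> (\<gamma> t)) 0 1"
  have "v \<in> model M" unfolding v_def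
    by (rule fderiv_in_subspace[OF V g(2)])
      (use ev in eventually_elim, rule chart_in_model[OF M c])
  moreover have "x = coord_vector M U \<kappa> p v"
  proof (rule functional_eqI)
    fix f
    show "app x f = app (coord_vector M U \<kappa> p v) f"
    proof (cases "smooth_at M real_line f p")
      case True
      then have sm: "smooth_near (\<lambda>y. f (param M U \<kappa> y)) (\<kappa> (\<gamma> 0))" by (simp add: smooth_at_real_line \<gamma>(2))
      have e: "\<forall>\<^sub>F t in nhds 0. f (param M U \<kappa> (\<kappa> (\<gamma> t))) = f (\<gamma> t)"
        using ev by eventually_elim (simp add: param_chart[OF M c])
      have s: "smooth_near (\<lambda>t. f (\<gamma> t)) 0"
        by (rule smooth_near_cong[OF smooth_near_compose[OF g(2) sm] e])
      have "((\<lambda>t. f (\<gamma> t)) has_vector_derivative fderiv (\<lambda>t. f (\<gamma> t)) 0 1) (at 0)"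
        using fderiv_line[OF s, of 1] by simp
      then have "deriv (\<lambda>t. f (\<gamma> t)) 0 = fderiv (\<lambda>t. f (\<gamma> t)) 0 1"
        by (intro DERIV_imp_deriv) (simp add: has_real_derivative_iff_has_vector_derivative)
      also have "\<dots> = fderiv (\<lambda>t. f (param M U \<kappa> (\<kappa> (\<gamma> t)))) 0 1" using fderiv_cong[OF e] by simp
      also have "\<dots> = fderiv (\<lambda>y. f (param M U \<kappa> y)) (\<kappa> (\<gamma> 0)) v"
        unfolding v_def by (rule fderiv_compose[OF g(2) sm])
      finally show ?thesis
        using True \<gamma> by (simp add: velocity_def app_local_functional app_coord_vector)
    qed (simp add: \<gamma> velocity_def coord_vector_def app_local_functional)
  qed
  ultimately show "x \<in> coord_vector M U \<kappa> p ` model M" by blast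
next
  fix x assume "x \<in> coord_vector M U \<kappa> p ` model M"
  then obtain v where v: "v \<in> model M" "x = coord_vector M U \<kappa> p v" by blast
  define l where "l t = \<kappa> p + t *\<^sub>R v" for t :: real
  define \<gamma> where "\<gamma> t = param M U \<kappa> (l t)" for t
  have \<gamma>0: "\<gamma> 0 = p" by (simp add: \<gamma>_def l_def param_chart[OF M c pU])
  have l: "smooth_near l 0" unfolding l_def
    by (intro smooth_near_add smooth_near_const smooth_near_linear bounded_linear_scaleR_left)
  have "smooth_at euclid M (param M U \<kappa>) (l 0)"
    by (rule smooth_at_param[OF M c]) (simp add: l_def proj_chart[OF M c pU] pU)
  then have "smooth_at real_line M \<gamma> 0"
    unfolding \<gamma>_def real_line_flat
    using smooth_at_compose[OF smooth_atlas_euclid smooth_atlas_euclid M _, of l 0 "param M U \<kappa>"] l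
    by (simp add: smooth_at_euclid)
  moreover have "x = velocity M \<gamma>"
  proof (rule functional_eqI)
    fix f
    show "app x f = app (velocity M \<gamma>) f"
    proof (cases "smooth_at M real_line f p")
      case True
      then have sm: "smooth_near (\<lambda>y. f (param M U \<kappa> y)) (\<kappa> p)" by (simp add: smooth_at_real_line)
      have "((\<lambda>t. f (\<gamma> t)) has_vector_derivative fderiv (\<lambda>y. f (param M U \<kappa> y)) (\<kappa> p) v) (at 0)"
        using fderiv_line[OF sm, of v] by (simp add: \<gamma>_def l_def)
      then have "deriv (\<lambda>t. f (\<gamma> t)) 0 = fderiv (\<lambda>y. f (param M U \<kappa> y)) (\<kappa> p) v"
        by (intro DERIV_imp_deriv) (simp add: has_real_derivative_iff_has_vector_derivative)
      then show ?thesis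
        using True by (simp add: v(2) velocity_def app_local_functional app_coord_vector \<gamma>0)
    qed (simp add: v(2) \<gamma>0 velocity_def coord_vector_def app_local_functional)
  qed
  ultimately show "x \<in> tangent_space M p" using \<gamma>0 by (auto simp: tangent_space_def)
qed

lemma differential_coord_vector:
  assumes N: "smooth_atlas N" and f: "smooth_at M N f p" and d: "(W, \<psi>) \<in> atlas N" "f p \<in> W"
  shows "differential M N f p (coord_vector M U \<kappa> p v) =
    coord_vector N W \<psi> (f p) (fderiv (\<lambda>y. \<psi> (f (param M U \<kappa> y))) (\<kappa> p) v)"
proof (rule functional_eqI)
  fix h
  have f': "cont_at (mtop M) (mtop N) f p" "smooth_near (\<lambda>y. \<psi> (f (param M U \<kappa> y))) (\<kappa> p)"
    using f smooth_at_charts[where f=f, OF M N c pU d] by auto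
  show "app (differential M N f p (coord_vector M U \<kappa> p v)) h =
    app (coord_vector N W \<psi> (f p) (fderiv (\<lambda>y. \<psi> (f (param M U \<kappa> y))) (\<kappa> p) v)) h"
  proof (cases "smooth_at N real_line h (f p)")
    case True
    then have sm: "smooth_near (\<lambda>y. h (param N W \<psi> y)) (\<psi> (f p))"
      unfolding real_line_flat smooth_at_to_euclid[OF N d] .
    have hf: "smooth_at M real_line (h \<circ> f) p"
      using smooth_at_compose[OF M N smooth_atlas_euclid f] True by (simp add: real_line_flat o_def)
    obtain Q where Q: "openin (mtop M) Q" "p \<in> Q" "f ` Q \<subseteq> W"
      using cont_atD[OF f'(1) chart_open[OF N d(1)] d(2)] by metis
    have "\<forall>\<^sub>F y in nhds (\<kappa> p). (h \<circ> f) (param M U \<kappa> y) = h (param N W \<psi> (\<psi> (f (param M U \<kappa> y))))"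
      using eventually_param_near[OF M c Q(1,2) pU]
    proof eventually_elim
      case (elim y)
      then have "f (param M U \<kappa> y) \<in> W" using Q by auto
      then show ?case by (simp add: param_chart[OF N d(1)])
    qed
    then have "fderiv (\<lambda>y. (h \<circ> f) (param M U \<kappa> y)) (\<kappa> p) v
        = fderiv (\<lambda>y. h (param N W \<psi> (\<psi> (f (param M U \<kappa> y))))) (\<kappa> p) v"
      using fderiv_cong by metis
    also have "\<dots> = fderiv (\<lambda>y. h (param N W \<psi> y)) (\<psi> (f p)) (fderiv (\<lambda>y. \<psi> (f (param M U \<kappa> y))) (\<kappa> p) v)"
      using fderiv_compose[OF f'(2), of "\<lambda>y. h (param N W \<psi> y)" v] sm param_chart[OF M c pU] by simp
    finally show ?thesis
      using True by (simp add: differential_def coord_vector_def[of N] app_local_functional app_coord_vector[OF hf])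
  qed (simp add: differential_def coord_vector_def[of N] app_local_functional)
qed

end

subsection \<open>Mixed derivatives of a binary operation\<close>

definition mixed_deriv :: "('e::euclidean_space \<times> 'e \<Rightarrow> 'f::euclidean_space) \<Rightarrow> 'e \<Rightarrow> 'e \<Rightarrow> 'e \<Rightarrow> 'f" where
  "mixed_deriv F a u v = fderiv (\<lambda>z. fderiv F z (0, v)) (a, a) (u, 0)"

lemma mixed_deriv_inner:
  assumes "smooth_near F (a, a)"
  shows "mixed_deriv (\<lambda>z. F z \<bullet> b) a u v = mixed_deriv F a u v \<bullet> b"
proof -
  note bl = bounded_linear_inner_left[of b]
  have "\<forall>\<^sub>F z in nhds (a, a). fderiv (\<lambda>z. F z \<bullet> b) z (0, v) = fderiv F z (0, v) \<bullet> b"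
    using eventually_smooth_near[OF assms] by eventually_elim (rule fderiv_compose_linear[OF bl])
  from fderiv_cong[OF this] show ?thesis
    unfolding mixed_deriv_def using fderiv_compose_linear[OF bl smooth_near_deriv(2)[OF assms]] by simp
qed

lemma fderiv_partial_snd:
  assumes "smooth_near F (x, y)"
  shows "smooth_near (\<lambda>y. F (x, y)) y" "fderiv (\<lambda>y. F (x, y)) y v = fderiv F (x, y) (0, v)"
proof -
  have 1: "smooth_near (\<lambda>y. (x, y)) y" by (intro smooth_near_Pair smooth_near_const smooth_near_id)
  show "smooth_near (\<lambda>y. F (x, y)) y" by (rule smooth_near_compose[OF 1 assms])
  show "fderiv (\<lambda>y. F (x, y)) y v = fderiv F (x, y) (0, v)"
    using fderiv_compose[OF 1 assms, of v]
    by (simp add: fderiv_Pair[OF smooth_near_const smooth_near_id] fderiv_const fderiv_linear[OF bounded_linear_ident])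
qed

lemma fderiv_partial_fst:
  assumes "smooth_near F (x, y)"
  shows "smooth_near (\<lambda>x. F (x, y)) x" "fderiv (\<lambda>x. F (x, y)) x v = fderiv F (x, y) (v, 0)"
proof -
  have 1: "smooth_near (\<lambda>x. (x, y)) x" by (intro smooth_near_Pair smooth_near_const smooth_near_id)
  show "smooth_near (\<lambda>x. F (x, y)) x" by (rule smooth_near_compose[OF 1 assms])
  show "fderiv (\<lambda>x. F (x, y)) x v = fderiv F (x, y) (v, 0)"
    using fderiv_compose[OF 1 assms, of v]
    by (simp add: fderiv_Pair[OF smooth_near_id smooth_near_const] fderiv_const fderiv_linear[OF bounded_linear_ident])
qed

lemma smooth_at_op:
  assumes K: "smooth_atlas K" and M: "smooth_atlas M" and M': "smooth_atlas M'" and N: "smooth_atlas N"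
    and f: "smooth_at K M f x" and g: "smooth_at K M' g x"
    and m: "smooth_at (prod_mfd M M') N (\<lambda>(x, y). m x y) (f x, g x)"
  shows "smooth_at K N (\<lambda>x. m (f x) (g x)) x"
  using smooth_at_compose[OF K smooth_atlas_prod[OF M M'] N smooth_at_pair[OF K M M' f g] m] by simp

context
  fixes M :: "('a, 'e::euclidean_space) mfd" and U \<kappa> e and m :: "'a \<Rightarrow> 'a \<Rightarrow> 'a"
  assumes M: "smooth_atlas M" and c: "(U, \<kappa>) \<in> atlas M" and eU: "e \<in> U"
    and m: "smooth_at (prod_mfd M M) M (\<lambda>(x, y). m x y) (e, e)" and mee: "m e e = e"
begin

lemma smooth_at_op_param:
  "smooth_at euclid M (\<lambda>z. m (param M U \<kappa> (fst z)) (param M U \<kappa> (snd z))) (\<kappa> e, \<kappa> e)"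
proof (rule smooth_at_op[where f = "\<lambda>z. param M U \<kappa> (fst z)" and g = "\<lambda>z. param M U \<kappa> (snd z)",
      OF smooth_atlas_euclid M M M])
  have p: "smooth_at euclid M (param M U \<kappa>) (\<kappa> e)"
    by (rule smooth_at_param[OF M c]) (simp add: proj_chart[OF M c eU] eU)
  show "smooth_at euclid M (\<lambda>z. param M U \<kappa> (fst z)) (\<kappa> e, \<kappa> e)"
    by (rule smooth_at_compose[OF smooth_atlas_euclid smooth_atlas_euclid M, of fst])
      (simp_all add: p smooth_at_euclid smooth_near_fst smooth_near_id)
  show "smooth_at euclid M (\<lambda>z. param M U \<kappa> (snd z)) (\<kappa> e, \<kappa> e)"
    by (rule smooth_at_compose[OF smooth_atlas_euclid smooth_atlas_euclid M, of snd])
      (simp_all add: p smooth_at_euclid smooth_near_snd smooth_near_id)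
qed (simp add: m param_chart[OF M c eU])

lemma smooth_near_op:
  assumes "smooth_at M euclid f e"
  shows "smooth_near (\<lambda>z. f (m (param M U \<kappa> (fst z)) (param M U \<kappa> (snd z)))) (\<kappa> e, \<kappa> e)"
  using smooth_at_compose[OF smooth_atlas_euclid M smooth_atlas_euclid smooth_at_op_param, of f] assms
  by (simp add: smooth_at_euclid param_chart[OF M c eU] mee)

text \<open>Differentiating first in the second and then in the first factor: this is the common form of
  the bracket of left-invariant fields (for \<open>m\<close> the multiplication) and of the operation
  \<open>\<triangleright>\<close> (for \<open>m\<close> the lambda-action).\<close>

lemma iterated_derivative:
  fixes v :: 'e
  assumes f: "smooth_at M real_line f e"
  defines "\<Theta> \<equiv> \<lambda>g. app (differential M M (m g) e (coord_vector M U \<kappa> e v)) f"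
  shows "smooth_at M real_line \<Theta> e"
    and "app (coord_vector M U \<kappa> e u) \<Theta> =
      mixed_deriv (\<lambda>z. f (m (param M U \<kappa> (fst z)) (param M U \<kappa> (snd z)))) (\<kappa> e) u v"
proof -
  define F where "F z = f (m (param M U \<kappa> (fst z)) (param M U \<kappa> (snd z)))" for z
  have F: "smooth_near F (\<kappa> e, \<kappa> e)"
    unfolding F_def using smooth_near_op f by (simp add: real_line_flat)
  obtain R where R: "openin (mtop M) R" "e \<in> R" "\<And>q. q \<in> R \<Longrightarrow> smooth_at M real_line f q"
    using smooth_at_neighbourhood[OF f] by metis
  have ct: "cont_at euclidean (mtop M) (\<lambda>z. m (param M U \<kappa> (fst z)) (param M U \<kappa> (snd z))) (\<kappa> e, \<kappa> e)"
    using smooth_at_cont[OF smooth_atlas_euclid M smooth_at_op_param] by (simp add: flat_def)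
  obtain Q where Q: "open Q" "(\<kappa> e, \<kappa> e) \<in> Q"
      "(\<lambda>z. m (param M U \<kappa> (fst z)) (param M U \<kappa> (snd z))) ` Q \<subseteq> R"
    using cont_atD[OF ct R(1)] R(2) mee param_chart[OF M c eU] by (metis fst_conv snd_conv open_openin)
  have slice: "((\<lambda>y. (y, \<kappa> e)) \<longlongrightarrow> (\<kappa> e, \<kappa> e)) (nhds (\<kappa> e))"
    by (intro tendsto_Pair tendsto_const) (simp add: filterlim_def)
  have "\<forall>\<^sub>F z in nhds (\<kappa> e, \<kappa> e). smooth_near F z \<and> z \<in> Q"
    using eventually_smooth_near[OF F] eventually_nhds_in_open[OF Q(1,2)] by eventually_elim simp
  then have "\<forall>\<^sub>F y in nhds (\<kappa> e). smooth_near F (y, \<kappa> e) \<and> (y, \<kappa> e) \<in> Q"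
    using slice by (rule eventually_compose_filterlim)
  then have ev: "\<forall>\<^sub>F y in nhds (\<kappa> e). fderiv F (y, \<kappa> e) (0, v) = \<Theta> (param M U \<kappa> y)"
  proof eventually_elim
    case (elim y)
    define g where "g = param M U \<kappa> y"
    have "m g e \<in> R" using elim Q(3) param_chart[OF M c eU] unfolding g_def by force
    then have fg: "smooth_at M real_line f (m g e)" by (rule R(3))
    have F': "(\<lambda>z. (f \<circ> m g) (param M U \<kappa> z)) = (\<lambda>z. F (y, z))" by (simp add: F_def g_def)
    have "smooth_near (\<lambda>z. F (y, z)) (\<kappa> e)" using elim by (blast intro: fderiv_partial_snd)
    then have fm: "smooth_at M real_line (f \<circ> m g) e"
      unfolding smooth_at_real_line[OF M c eU] F' .
    have "\<Theta> g = fderiv (\<lambda>z. F (y, z)) (\<kappa> e) v"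
      unfolding \<Theta>_def differential_def app_local_functional app_coord_vector[OF M c eU fm] F'
      using fg by simp
    also have "\<dots> = fderiv F (y, \<kappa> e) (0, v)" using elim by (blast intro: fderiv_partial_snd)
    finally show ?case by (simp add: g_def)
  qed
  note D = smooth_near_deriv(2)[OF F, of "(0, v)"]
  have sm: "smooth_near (\<lambda>y. \<Theta> (param M U \<kappa> y)) (\<kappa> e)"
    by (rule smooth_near_cong[OF fderiv_partial_fst(1)[OF D] ev])
  then show \<Theta>: "smooth_at M real_line \<Theta> e" unfolding smooth_at_real_line[OF M c eU] .
  show "app (coord_vector M U \<kappa> e u) \<Theta> =
      mixed_deriv (\<lambda>z. f (m (param M U \<kappa> (fst z)) (param M U \<kappa> (snd z)))) (\<kappa> e) u v"
    unfolding app_coord_vector[OF M c eU \<Theta>] fderiv_cong[OF ev, symmetric] fderiv_partial_fst(2)[OF D]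
    by (simp add: mixed_deriv_def F_def[abs_def])
qed

lemma iterated_derivative_component:
  "app (coord_vector M U \<kappa> e u) (\<lambda>g. app (differential M M (m g) e (coord_vector M U \<kappa> e v)) (\<lambda>q. \<kappa> q \<bullet> b)) =
   mixed_deriv (\<lambda>z. \<kappa> (m (param M U \<kappa> (fst z)) (param M U \<kappa> (snd z)))) (\<kappa> e) u v \<bullet> b"
  unfolding iterated_derivative(2)[OF smooth_at_chart_component[OF M c eU]]
  by (rule mixed_deriv_inner[OF smooth_near_op[OF smooth_at_chart[OF M c eU]]])

end

section \<open>Local homomorphisms from closed invariant forms\<close>

lemma fderiv_cong_at: "\<forall>\<^sub>F y in nhds x. f y = g y \<Longrightarrow> fderiv f x v = fderiv g x v"
  by (simp add: fderiv_cong)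

lemma locally_constant_imp_constant:
  assumes "connected_space X"
    and "\<And>x. x \<in> topspace X \<Longrightarrow> \<exists>Q. openin X Q \<and> x \<in> Q \<and> (\<forall>y\<in>Q. F y = F x)"
    and "x \<in> topspace X" "y \<in> topspace X"
  shows "F x = F y"
proof -
  have op: "openin X {z \<in> topspace X. F z \<in> A}" for A
  proof (subst openin_subopen, intro ballI)
    fix z assume z: "z \<in> {z \<in> topspace X. F z \<in> A}"
    then obtain Q where Q: "openin X Q" "z \<in> Q" "\<forall>y\<in>Q. F y = F z" using assms(2) by blast
    have "y \<in> {z \<in> topspace X. F z \<in> A}" if "y \<in> Q" for y
      using z openin_subset[OF Q(1)] that bspec[OF Q(3) that] by auto
    with Q(1,2) show "\<exists>T. openin X T \<and> z \<in> T \<and> T \<subseteq> {z \<in> topspace X. F z \<in> A}" by blast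
  qed
  define T where "T = {z \<in> topspace X. F z \<in> {F x}}"
  have "topspace X - T = {z \<in> topspace X. F z \<in> - {F x}}" by (auto simp: T_def)
  then have "openin X T" "closedin X T"
    using op[of "{F x}"] op[of "- {F x}"] by (auto simp: T_def closedin_def)
  then have "T = {} \<or> T = topspace X" using assms(1) connected_space_clopen_in by blast
  moreover have "x \<in> T" using assms(3) by (simp add: T_def)
  ultimately have "y \<in> T" using assms(4) by auto
  then show ?thesis by (simp add: T_def)
qed

lemma (in topological_group) openin_translate:
  assumes "openin X W" "g \<in> carrier G"
  shows "openin X {y \<in> topspace X. inv g \<otimes> y \<in> W}"
  by (rule openin_continuous_map_preimage[OF continuous_translation assms(1)]) (use assms in auto)

text \<open>By translation the points reachable from the identity form an open and closed set.\<close>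

lemma (in topological_group) path_connected_of_local_paths:
  assumes conn: "connected_space X" and W: "openin X W" "\<one> \<in> W"
    and paths: "\<And>x. x \<in> W \<Longrightarrow> path_component_of X \<one> x"
  shows "path_connected_space X"
proof -
  have trans: "path_component_of X g y" if g: "g \<in> carrier G" "y \<in> topspace X" "inv g \<otimes> y \<in> W" for g y
  proof -
    obtain p where p: "pathin X p" "p 0 = \<one>" "p 1 = inv g \<otimes> y"
      using paths[OF g(3)] by (auto simp: path_component_of_def)
    have "pathin X (\<lambda>t. g \<otimes> p t)"
      using continuous_map_compose[OF p(1)[unfolded pathin_def] continuous_translation[OF g(1)]]
      by (simp add: pathin_def o_def)
    moreover have "g \<otimes> p 0 = g" "g \<otimes> p 1 = y"
      using p g by (simp_all add: m_assoc[symmetric] carrier_eq[symmetric])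
    ultimately show ?thesis unfolding path_component_of_def by blast
  qed
  have loc: "\<exists>Q. openin X Q \<and> x \<in> Q \<and> (\<forall>y\<in>Q. path_component_of X \<one> y = path_component_of X \<one> x)"
    if x: "x \<in> topspace X" for x
  proof (intro exI conjI ballI)
    have xc: "x \<in> carrier G" using x by (simp add: carrier_eq)
    show "openin X {y \<in> topspace X. inv x \<otimes> y \<in> W}" by (rule openin_translate[OF W(1) xc])
    show "x \<in> {y \<in> topspace X. inv x \<otimes> y \<in> W}" using x xc W(2) by simp
    fix y assume "y \<in> {y \<in> topspace X. inv x \<otimes> y \<in> W}"
    then have "path_component_of X x y" using trans[OF xc] by simp
    then show "path_component_of X \<one> y = path_component_of X \<one> x"
      by (metis path_component_of_sym path_component_of_trans)
  qed
  have one: "\<one> \<in> topspace X" using carrier_eq one_closed by blast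
  have all: "path_component_of X \<one> y" if "y \<in> topspace X" for y
    using locally_constant_imp_constant[OF conn loc one that] one
    by (simp add: path_component_of_refl)
  show ?thesis
    unfolding path_connected_space_def
  proof (intro ballI)
    fix x y assume "x \<in> topspace X" "y \<in> topspace X"
    then have "path_component_of X x y"
      using all by (meson path_component_of_sym path_component_of_trans)
    then show "\<exists>g. pathin X g \<and> g 0 = x \<and> g 1 = y" by (simp add: path_component_of_def)
  qed
qed

text \<open>The product rule for \<open>\<omega> (\<theta> y) (\<tau> y)\<close>, which is linear in the second argument of
  \<open>\<omega>\<close>.\<close>

lemma fderiv_linear_family:
  fixes \<omega> :: "'e::euclidean_space \<Rightarrow> 'g::euclidean_space \<Rightarrow> 'f::euclidean_space"
    and \<theta> :: "'d::euclidean_space \<Rightarrow> 'e"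
  assumes lin: "\<forall>\<^sub>F y in nhds (\<theta> x). linear (\<omega> y)"
    and sm: "\<And>u. smooth_near (\<lambda>y. \<omega> y u) (\<theta> x)"
    and \<theta>: "smooth_near \<theta> x" and \<tau>: "smooth_near \<tau> x"
  shows "fderiv (\<lambda>y. \<omega> (\<theta> y) (\<tau> y)) x w =
    fderiv (\<lambda>z. \<omega> z (\<tau> x)) (\<theta> x) (fderiv \<theta> x w) + \<omega> (\<theta> x) (fderiv \<tau> x w)"
proof -
  have lin0: "linear (\<omega> (\<theta> x))" using lin by (rule eventually_nhds_x_imp_x)
  have "\<forall>\<^sub>F y in nhds x. linear (\<omega> (\<theta> y))"
    by (rule eventually_compose_filterlim[OF lin smooth_near_tendsto[OF \<theta>]])
  then have "\<forall>\<^sub>F y in nhds x. \<omega> (\<theta> y) (\<tau> y) = (\<Sum>b\<in>Basis. (\<tau> y \<bullet> b) *\<^sub>R \<omega> (\<theta> y) b)"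
    by eventually_elim (rule linear_basis_expansion)
  then have "fderiv (\<lambda>y. \<omega> (\<theta> y) (\<tau> y)) x = fderiv (\<lambda>y. \<Sum>b\<in>Basis. (\<tau> y \<bullet> b) *\<^sub>R \<omega> (\<theta> y) b) x"
    by (rule fderiv_cong)
  also have "\<dots> = (\<lambda>w. \<Sum>b\<in>Basis. (\<tau> x \<bullet> b) *\<^sub>R fderiv (\<lambda>z. \<omega> z b) (\<theta> x) (fderiv \<theta> x w)
      + (fderiv \<tau> x w \<bullet> b) *\<^sub>R \<omega> (\<theta> x) b)"
  proof (intro fderiv_eq has_derivative_sum has_derivative_scaleR)
    fix b
    show "((\<lambda>y. \<tau> y \<bullet> b) has_derivative (\<lambda>w. fderiv \<tau> x w \<bullet> b)) (at x)"
      by (rule bounded_linear.has_derivative[OF bounded_linear_inner_left smooth_near_deriv(1)[OF \<tau>]])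
    show "((\<lambda>y. \<omega> (\<theta> y) b) has_derivative (\<lambda>w. fderiv (\<lambda>z. \<omega> z b) (\<theta> x) (fderiv \<theta> x w))) (at x)"
      using smooth_near_deriv(1)[OF \<theta>] smooth_near_deriv(1)[OF sm] by (rule has_derivative_compose)
  qed
  finally have 1: "fderiv (\<lambda>y. \<omega> (\<theta> y) (\<tau> y)) x w =
      (\<Sum>b\<in>Basis. (\<tau> x \<bullet> b) *\<^sub>R fderiv (\<lambda>z. \<omega> z b) (\<theta> x) (fderiv \<theta> x w)) + \<omega> (\<theta> x) (fderiv \<tau> x w)"
    using linear_basis_expansion[OF lin0, of "fderiv \<tau> x w"] by (simp add: sum.distrib)
  have "\<forall>\<^sub>F z in nhds (\<theta> x). \<omega> z (\<tau> x) = (\<Sum>b\<in>Basis. (\<tau> x \<bullet> b) *\<^sub>R \<omega> z b)"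
    using lin by eventually_elim (rule linear_basis_expansion)
  then have "fderiv (\<lambda>z. \<omega> z (\<tau> x)) (\<theta> x) = fderiv (\<lambda>z. \<Sum>b\<in>Basis. (\<tau> x \<bullet> b) *\<^sub>R \<omega> z b) (\<theta> x)"
    by (rule fderiv_cong)
  also have "\<dots> = (\<lambda>w. \<Sum>b\<in>Basis. (\<tau> x \<bullet> b) *\<^sub>R fderiv (\<lambda>z. \<omega> z b) (\<theta> x) w)"
    by (intro fderiv_eq has_derivative_sum has_derivative_scaleR_right smooth_near_deriv(1)[OF sm])
  finally show ?thesis using 1 by simp
qed

lemma nhds_prod_ball:
  fixes x :: "'b::metric_space"
  assumes "\<forall>\<^sub>F z in nhds (x, x). P z"
  obtains r where "r > 0" "\<And>y z. y \<in> ball x r \<Longrightarrow> z \<in> ball x r \<Longrightarrow> P (y, z)"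
proof -
  obtain e where e: "e > 0" "\<And>z. dist z (x, x) < e \<Longrightarrow> P z"
    using assms by (auto simp: eventually_nhds_metric)
  have "P (y, z)" if "y \<in> ball x (e/2)" "z \<in> ball x (e/2)" for y z
  proof (rule e(2))
    have "dist (y, z) (x, x) \<le> dist y x + dist z x"
      unfolding dist_prod_def by (simp add: sqrt_sum_squares_le_sum)
    then show "dist (y, z) (x, x) < e" using that by (simp add: dist_commute)
  qed
  with e(1) that[of "e/2"] show ?thesis by simp
qed

lemma fderiv_diagonal:
  fixes F :: "'b::euclidean_space \<times> 'b \<Rightarrow> 'c::euclidean_space"
  assumes F: "smooth_near F (x, x)"
  shows "fderiv (\<lambda>y. F (y, y)) x v = fderiv F (x, x) (v, 0) + fderiv F (x, x) (0, v)"
proof -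
  have 1: "smooth_near (\<lambda>y. (y, y)) x" by (intro smooth_near_Pair smooth_near_id)
  have "fderiv (\<lambda>y. F (y, y)) x v = fderiv F (x, x) (v, v)"
    using fderiv_compose[OF 1 F, of v]
    by (simp add: fderiv_Pair[OF smooth_near_id smooth_near_id] fderiv_linear[OF bounded_linear_ident])
  also have "\<dots> = fderiv F (x, x) ((v, 0) + (0, v))" by simp
  finally show ?thesis by (simp only: linear_add[OF smooth_near_linear_fderiv[OF F]])
qed

lemma eventually_ball_near:
  assumes "\<And>y. y \<in> ball x r \<Longrightarrow> P y" "y \<in> ball x r"
  shows "\<forall>\<^sub>F y in nhds y. P y"
  using eventually_nhds_in_open[OF open_ball assms(2)] by eventually_elim (rule assms(1))

locale lie_group_chart =
  fixes M :: "('a, 'e::euclidean_space) mfd" and G :: "'a monoid" (structure) and U \<kappa>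
  assumes lie: "lie_group M G" and c: "(U, \<kappa>) \<in> atlas M" and one_U: "\<one> \<in> U"
begin

abbreviation "\<sigma> \<equiv> param M U \<kappa>"
abbreviation "a \<equiv> \<kappa> \<one>"
abbreviation "V \<equiv> model M"

lemma M: "smooth_atlas M"
  using lie smooth_manifold_imp_atlas by (auto simp: lie_group_def)

lemma V: "subspace V"
  by (rule model_subspace[OF M c])

lemma is_group: "group G" and points_eq: "points M = carrier G"
  using lie by (auto simp: lie_group_def)

lemma smooth_mult: "x \<in> carrier G \<Longrightarrow> y \<in> carrier G \<Longrightarrow> smooth_at (prod_mfd M M) M (\<lambda>(x, y). x \<otimes> y) (x, y)"
  using lie unfolding lie_group_def smooth_map_def by (auto simp: prod_mfd_def)

lemma smooth_inv: "x \<in> carrier G \<Longrightarrow> smooth_at M M (\<lambda>x. inv x) x"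
  using lie unfolding lie_group_def smooth_map_def by auto

lemma topological_group: "topological_group G (mtop M)"
proof -
  interpret group G by (rule is_group)
  have "continuous_map (prod_topology (mtop M) (mtop M)) (mtop M) (\<lambda>(x, y). x \<otimes> y)"
  proof (rule continuous_map_of_cont_at)
    fix z assume "z \<in> topspace (prod_topology (mtop M) (mtop M))"
    then have "smooth_at (prod_mfd M M) M (\<lambda>(x, y). x \<otimes> y) z"
      using smooth_mult points_eq by (cases z) auto
    from smooth_at_cont[OF smooth_atlas_prod[OF M M] M this]
    show "cont_at (prod_topology (mtop M) (mtop M)) (mtop M) (\<lambda>(x, y). x \<otimes> y) z"
      by (simp add: prod_mfd_def)
  qed
  moreover have "continuous_map (mtop M) (mtop M) (\<lambda>x. inv x)"
    by (rule continuous_map_of_cont_at)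
      (use smooth_at_cont[OF M M smooth_inv] points_eq in auto)
  ultimately show ?thesis
    using points_eq by unfold_locales auto
qed

sublocale topological_group G "mtop M"
  by (rule topological_group)

lemma smooth_at_mult:
  assumes "smooth_atlas K" "smooth_at K M f x" "smooth_at K M g x"
  shows "smooth_at K M (\<lambda>x. f x \<otimes> g x) x"
proof (rule smooth_at_op[where f=f and g=g, OF assms(1) M M M assms(2,3) smooth_mult])
  show "f x \<in> carrier G" "g x \<in> carrier G"
    using smooth_at_points(2)[OF assms(1) M assms(2)] smooth_at_points(2)[OF assms(1) M assms(3)]
    by (simp_all add: points_eq)
qed

lemma smooth_at_inv:
  assumes "smooth_atlas K" "smooth_at K M f x"
  shows "smooth_at K M (\<lambda>x. inv (f x)) x"
  using smooth_at_compose[OF assms(1) M M assms(2) smooth_inv]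
    smooth_at_points(2)[OF assms(1) M assms(2)] by (simp add: points_eq)

lemma smooth_at_translation:
  assumes "g \<in> carrier G" "x \<in> carrier G"
  shows "smooth_at M M (\<lambda>x. g \<otimes> x) x" "smooth_at M M (\<lambda>x. x \<otimes> g) x"
  using assms smooth_at_const[OF M M, of x g] smooth_at_ident[OF M, of x]
  by (auto intro!: smooth_at_mult[OF M] simp: points_eq)

definition divc :: "'e \<times> 'e \<Rightarrow> 'e" where
  "divc z = \<kappa> (inv (\<sigma> (fst z)) \<otimes> \<sigma> (snd z))"

definition mulc :: "'e \<times> 'e \<Rightarrow> 'e" where
  "mulc z = \<kappa> (\<sigma> (fst z) \<otimes> \<sigma> (snd z))"

lemma \<sigma>_a: "\<sigma> a = \<one>"
  by (rule param_chart[OF M c one_U])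

lemma a_V: "a \<in> V" by (rule chart_in_model[OF M c one_U])

lemma smooth_div: "smooth_at (prod_mfd M M) M (\<lambda>(x, y). inv x \<otimes> y) (\<one>, \<one>)"
proof -
  have P: "smooth_atlas (prod_mfd M M)" by (rule smooth_atlas_prod[OF M M])
  have "smooth_at (prod_mfd M M) M fst (\<one>, \<one>)" "smooth_at (prod_mfd M M) M snd (\<one>, \<one>)"
    by (rule smooth_at_fst[OF M M]; simp add: points_eq)+
  from smooth_at_mult[OF P smooth_at_inv[OF P this(1)] this(2)]
  show ?thesis by (simp add: case_prod_unfold)
qed

lemma smooth_near_divc: "smooth_near divc (a, a)"
  using smooth_near_op[OF M c one_U smooth_div _ smooth_at_chart[OF M c one_U]]
  unfolding divc_def by simp

lemma smooth_near_mulc: "smooth_near mulc (a, a)"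
  using smooth_near_op[OF M c one_U smooth_mult _ smooth_at_chart[OF M c one_U]]
  unfolding mulc_def by simp

definition quotient_in_chart :: "'e \<times> 'e \<Rightarrow> bool" where
  "quotient_in_chart z \<longleftrightarrow> smooth_near divc z \<and> proj V (fst z) \<in> \<kappa> ` U \<and> proj V (snd z) \<in> \<kappa> ` U \<and>
     inv (\<sigma> (fst z)) \<otimes> \<sigma> (snd z) \<in> U"

lemma eventually_quotient_in_chart: "\<forall>\<^sub>F z in nhds (a, a). quotient_in_chart z"
proof -
  have ev: "\<forall>\<^sub>F y in nhds a. proj V y \<in> \<kappa> ` U"
    using eventually_param_near[OF M c chart_open[OF M c] one_U one_U] by eventually_elim simp
  have 1: "\<forall>\<^sub>F z in nhds (a, a). proj V (fst z) \<in> \<kappa> ` U \<and> proj V (snd z) \<in> \<kappa> ` U"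
    unfolding nhds_prod using eventually_prodI[OF ev ev] by eventually_elim simp
  have ct: "cont_at euclidean (mtop M) (\<lambda>z. inv (\<sigma> (fst z)) \<otimes> \<sigma> (snd z)) (a, a)"
    using smooth_at_cont[OF smooth_atlas_euclid M smooth_at_op_param[OF M c one_U smooth_div]]
    by (simp add: flat_def)
  obtain Q where Q: "openin euclidean Q" "(a, a) \<in> Q" "(\<lambda>z. inv (\<sigma> (fst z)) \<otimes> \<sigma> (snd z)) ` Q \<subseteq> U"
  proof -
    have "inv (\<sigma> (fst (a, a))) \<otimes> \<sigma> (snd (a, a)) \<in> U" by (simp add: \<sigma>_a one_U)
    from cont_atD[OF ct chart_open[OF M c] this] that show ?thesis by metis
  qed
  have "\<forall>\<^sub>F z in nhds (a, a). z \<in> Q" using Q eventually_nhds_in_open by auto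
  then show ?thesis
    using 1 eventually_smooth_near[OF smooth_near_divc]
    by eventually_elim (use Q(3) in \<open>auto simp: quotient_in_chart_def\<close>)
qed

lemma quotient_in_chartD:
  assumes "quotient_in_chart (x, y)"
  shows "\<sigma> x \<in> carrier G" "\<sigma> y \<in> carrier G" "\<sigma> (divc (x, y)) = inv (\<sigma> x) \<otimes> \<sigma> y" "divc (x, y) \<in> V"
proof -
  have p: "\<sigma> x \<in> U" "\<sigma> y \<in> U" using assms chart_param(1)[OF M c] by (auto simp: quotient_in_chart_def)
  then show "\<sigma> x \<in> carrier G" "\<sigma> y \<in> carrier G" using chart_subset[OF M c] points_eq by blast+
  have q: "inv (\<sigma> x) \<otimes> \<sigma> y \<in> U" using assms by (simp add: quotient_in_chart_def)
  show "\<sigma> (divc (x, y)) = inv (\<sigma> x) \<otimes> \<sigma> y"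
    using param_chart[OF M c q] by (simp add: divc_def)
  show "divc (x, y) \<in> V" using chart_in_model[OF M c q] by (simp add: divc_def)
qed

text \<open>Left translation by \<open>x\<close> does not change quotients: \<open>(x\<inverse> y)\<inverse> (x\<inverse> z) = y\<inverse> z\<close>.
  All invariance of forms below is this identity.\<close>

lemma divc_divc:
  assumes "quotient_in_chart (x, y)" "quotient_in_chart (x, z)"
  shows "divc (divc (x, y), divc (x, z)) = divc (y, z)"
proof -
  note p = quotient_in_chartD[OF assms(1)] quotient_in_chartD[OF assms(2)]
  have "inv (inv (\<sigma> x) \<otimes> \<sigma> y) \<otimes> (inv (\<sigma> x) \<otimes> \<sigma> z) = inv (\<sigma> y) \<otimes> \<sigma> z"
    using p(1,2,6) by (simp add: inv_mult_group m_assoc[symmetric]) (simp add: m_assoc)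
  then show ?thesis using p(3,7) by (simp add: divc_def)
qed

lemma divc_refl: "quotient_in_chart (x, x) \<Longrightarrow> divc (x, x) = a"
  using quotient_in_chartD(1)[of x x] by (simp add: divc_def)

lemma quotient_in_chart_aa: "quotient_in_chart (a, a)" using eventually_quotient_in_chart by (rule eventually_nhds_x_imp_x)

text \<open>Near the identity \<open>divc (a, y)\<close> is the projection of \<open>y\<close>, and \<open>divc (y, y)\<close> is constant.
  This gives the two partial derivatives of \<open>divc\<close> at the identity.\<close>

lemma fderiv_divc_snd: "\<forall>\<^sub>F y in nhds a. fderiv divc (a, y) (0, v) = proj V v"
proof -
  obtain r where r: "r > 0" "\<And>y z. y \<in> ball a r \<Longrightarrow> z \<in> ball a r \<Longrightarrow> quotient_in_chart (y, z)"
    using nhds_prod_ball[OF eventually_quotient_in_chart] by metis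
  have eq: "divc (a, y) = proj V y" if "y \<in> ball a r" for y
  proof -
    have g: "quotient_in_chart (a, y)" using r that by simp
    then show ?thesis
      using quotient_in_chartD(2)[OF g] chart_param(2)[OF M c, of y] by (simp add: divc_def \<sigma>_a quotient_in_chart_def)
  qed
  have "fderiv divc (a, y) (0, v) = proj V v" if y: "y \<in> ball a r" for y
  proof -
    have sm: "smooth_near divc (a, y)" using r y by (simp add: quotient_in_chart_def)
    have "fderiv (\<lambda>y. divc (a, y)) y v = fderiv (proj V) y v"
      by (rule fderiv_cong_at[OF eventually_ball_near[OF eq y]])
    then show ?thesis
      using fderiv_partial_snd(2)[OF sm] fderiv_linear[OF bounded_linear_proj[OF V]] by simp
  qed
  then show ?thesis by (rule eventually_ball_near[of a r]) (simp_all add: r)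
qed

lemma fderiv_divc_snd_a: "fderiv divc (a, a) (0, v) = proj V v"
  using fderiv_divc_snd by (rule eventually_nhds_x_imp_x)

lemma fderiv_divc_fst_a: "fderiv divc (a, a) (v, 0) = - proj V v"
proof -
  obtain r where r: "r > 0" "\<And>y z. y \<in> ball a r \<Longrightarrow> z \<in> ball a r \<Longrightarrow> quotient_in_chart (y, z)"
    using nhds_prod_ball[OF eventually_quotient_in_chart] by metis
  have "divc (y, y) = a" if "y \<in> ball a r" for y using r that divc_refl by simp
  then have "\<forall>\<^sub>F y in nhds a. divc (y, y) = a"
    by (rule eventually_ball_near[of a r]) (simp_all add: r)
  then have "fderiv (\<lambda>y. divc (y, y)) a v = fderiv (\<lambda>y. a) a v"
    by (rule fderiv_cong_at)
  then show ?thesis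
    using fderiv_diagonal[OF smooth_near_divc, of v] fderiv_divc_snd_a[of v]
    by (simp add: fderiv_const eq_neg_iff_add_eq_0)
qed

text \<open>From \<open>x y = (x\<inverse>)\<inverse> y\<close>, as inversion has derivative \<open>-1\<close> at the identity.\<close>

lemma mixed_deriv_divc:
  "mixed_deriv mulc a u v = - mixed_deriv divc a (proj V u) v"
proof -
  note D = smooth_near_deriv(2)[OF smooth_near_divc, of "(0, v)"]
  obtain r where r: "r > 0" "\<And>y z. y \<in> ball a r \<Longrightarrow> z \<in> ball a r \<Longrightarrow> quotient_in_chart (y, z)"
    using nhds_prod_ball[OF eventually_quotient_in_chart] by metis
  define \<iota> where "\<iota> y = divc (y, a)" for y
  have \<iota>: "smooth_near \<iota> a" and \<iota>': "fderiv \<iota> a u = - proj V u"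
    using fderiv_partial_fst[OF smooth_near_divc] fderiv_divc_fst_a by (simp_all add: \<iota>_def[abs_def])
  have \<iota>a: "\<iota> a = a" using divc_refl[OF quotient_in_chart_aa] by (simp add: \<iota>_def)
  have eq: "mulc (y, z) = divc (\<iota> y, z)" if "y \<in> ball a r" "z \<in> ball a r" for y z
  proof -
    have g: "quotient_in_chart (y, a)" using r that by simp
    show ?thesis
      using quotient_in_chartD[OF g] by (simp add: mulc_def divc_def[of "(_, z)"] \<iota>_def \<sigma>_a)
  qed
  have pair: "((\<lambda>y. (\<iota> y, a)) \<longlongrightarrow> (a, a)) (nhds a)"
    using smooth_near_tendsto[OF \<iota>] \<iota>a by (intro tendsto_Pair tendsto_const) simp
  have "\<forall>\<^sub>F y in nhds a. smooth_near divc (\<iota> y, a)"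
    by (rule eventually_compose_filterlim[OF eventually_smooth_near[OF smooth_near_divc] pair])
  moreover have "\<forall>\<^sub>F y in nhds a. smooth_near mulc (y, a)"
    by (rule eventually_compose_filterlim[OF eventually_smooth_near[OF smooth_near_mulc]])
      (intro tendsto_Pair tendsto_const, simp add: filterlim_def)
  moreover have "\<forall>\<^sub>F y in nhds a. y \<in> ball a r" by (rule eventually_nhds_in_open) (use r in auto)
  ultimately have "\<forall>\<^sub>F y in nhds a. fderiv mulc (y, a) (0, v) = fderiv divc (\<iota> y, a) (0, v)"
  proof eventually_elim
    case (elim y)
    have "\<forall>\<^sub>F z in nhds a. mulc (y, z) = divc (\<iota> y, z)"
      by (rule eventually_ball_near[OF eq]) (use elim r in auto)
    then have "fderiv (\<lambda>z. mulc (y, z)) a v = fderiv (\<lambda>z. divc (\<iota> y, z)) a v"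
      by (rule fderiv_cong_at)
    then show ?case using fderiv_partial_snd(2) elim by metis
  qed
  then have "fderiv (\<lambda>y. fderiv mulc (y, a) (0, v)) a u = fderiv (\<lambda>y. fderiv divc (\<iota> y, a) (0, v)) a u"
    by (rule fderiv_cong_at)
  also have "\<dots> = fderiv (\<lambda>y. fderiv divc (y, a) (0, v)) (\<iota> a) (fderiv \<iota> a u)"
    by (rule fderiv_compose[OF \<iota>]) (simp add: \<iota>a fderiv_partial_fst(1)[OF D])
  also have "\<dots> = fderiv (\<lambda>z. fderiv divc z (0, v)) (a, a) (- proj V u, 0)"
    unfolding \<iota>a \<iota>' by (rule fderiv_partial_fst(2)[OF D])
  also have "\<dots> = - mixed_deriv divc a (proj V u) v"
    unfolding mixed_deriv_def using linear_neg[OF smooth_near_linear_fderiv[OF D], of "(proj V u, 0)"] by simp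
  finally show ?thesis
    using fderiv_partial_fst(2)[OF smooth_near_deriv(2)[OF smooth_near_mulc], of "(0, v)" u]
    by (simp add: mixed_deriv_def)
qed

text \<open>The hypothesis says that \<open>l\<close> kills the Lie bracket, whose coordinates are the antisymmetric
  part of the mixed derivative of the multiplication.  The left-invariant 1-form \<open>\<omega>\<close> with value
  \<open>l\<close> at the identity is then closed at the identity, and by left invariance (and symmetry of the
  second derivative of left translations) on a ball around it.  Its primitive \<open>f\<close> is a local
  homomorphism, as \<open>y \<mapsto> f (x\<inverse> y)\<close> is another primitive of \<open>\<omega>\<close>.\<close>

theorem local_homomorphism_exists:
  fixes l :: "'e \<Rightarrow> 'e"
  assumes l: "bounded_linear l"
    and sym: "\<And>u v. u \<in> V \<Longrightarrow> v \<in> V \<Longrightarrow> l (mixed_deriv mulc a u v) = l (mixed_deriv mulc a v u)"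
  shows "\<exists>h W. openin (mtop M) W \<and> \<one> \<in> W \<and>
    (\<forall>x\<in>W. \<forall>y\<in>W. h (inv x \<otimes> y) = h y - (h x :: 'e)) \<and>
    (\<forall>x\<in>W. \<exists>p. pathin (mtop M) p \<and> p 0 = \<one> \<and> p 1 = x \<and> p ` {0..1} \<subseteq> W) \<and>
    smooth_at M euclid h \<one> \<and> (\<forall>v. fderiv (\<lambda>y. h (\<sigma> y)) a v = l (proj V v))"
proof -
  obtain r where r: "r > 0" "\<And>y z. y \<in> ball a r \<Longrightarrow> z \<in> ball a r \<Longrightarrow> quotient_in_chart (y, z)"
    using nhds_prod_ball[OF eventually_quotient_in_chart] by metis
  have shrink: "\<exists>s. 0 < s \<and> s \<le> r' \<and> (\<forall>y\<in>ball a s. \<forall>z\<in>ball a s. divc (y, z) \<in> ball a r')"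
    if "r' > 0" for r'
  proof -
    have "\<forall>\<^sub>F z in nhds (a, a). divc z \<in> ball a r'"
      using smooth_near_tendsto[OF smooth_near_divc] divc_refl[OF quotient_in_chart_aa] that
      by (intro topological_tendstoD[of divc a]) auto
    then obtain s where "s > 0" "\<And>y z. y \<in> ball a s \<Longrightarrow> z \<in> ball a s \<Longrightarrow> divc (y, z) \<in> ball a r'"
      using nhds_prod_ball[where P = "\<lambda>z. divc z \<in> ball a r'"] by metis
    then show ?thesis using that by (intro exI[of _ "min s r'"]) auto
  qed
  obtain s where s: "0 < s" "s \<le> r" "\<And>y z. y \<in> ball a s \<Longrightarrow> z \<in> ball a s \<Longrightarrow> divc (y, z) \<in> ball a r"
    using shrink[OF r(1)] by blast
  obtain t where t: "0 < t" "t \<le> s" "\<And>y z. y \<in> ball a t \<Longrightarrow> z \<in> ball a t \<Longrightarrow> divc (y, z) \<in> ball a s"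
    using shrink[OF s(1)] by blast
  have sr: "y \<in> ball a s \<Longrightarrow> y \<in> ball a r" and ts: "y \<in> ball a t \<Longrightarrow> y \<in> ball a s" for y
    using s(2) t(2) by auto
  have smd: "smooth_near divc (y, z)" if "y \<in> ball a r" "z \<in> ball a r" for y z
    using r(2)[OF that] by (simp add: quotient_in_chart_def)
  have a_ball: "a \<in> ball a r" "a \<in> ball a s" "a \<in> ball a t" using r s t by simp_all
  define D where "D v z = fderiv divc z (0, v)" for v z
  define \<omega> where "\<omega> y v = l (D v (y, y))" for y v
  have smD: "smooth_near (D v) (y, z)" if "y \<in> ball a r" "z \<in> ball a r" for v y z
    unfolding D_def by (rule smooth_near_deriv(2)[OF smd[OF that]])
  have diag: "smooth_near (\<lambda>y. (y, y)) x" for x :: 'e by (intro smooth_near_Pair smooth_near_id)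
  have smDD: "smooth_near (\<lambda>y. D v (y, y)) y" if "y \<in> ball a r" for v y
    by (rule smooth_near_compose[OF diag smD[OF that that]])
  have sm\<omega>: "smooth_near (\<lambda>y. \<omega> y v) y" if "y \<in> ball a r" for v y
    unfolding \<omega>_def by (rule smooth_near_compose_linear[OF l smDD[OF that]])
  have lin\<omega>: "linear (\<omega> y)" if "y \<in> ball a r" for y
  proof -
    have "linear (\<lambda>v. fderiv divc (y, y) (0, v))"
      using linear_compose[of "\<lambda>v. (0, v)" "fderiv divc (y, y)"]
        smooth_near_linear_fderiv[OF smd[OF that that]]
      by (simp add: o_def linear_iff)
    from linear_compose[OF this bounded_linear.linear[OF l]]
    show ?thesis by (simp add: \<omega>_def[abs_def] D_def o_def)
  qed
  (* Invariance of \<omega> under the left translation by the inverse of x. *)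
  have invariant: "\<omega> y v = \<omega> (divc (x, y)) (D v (x, y))"
    if x: "x \<in> ball a s" and y: "y \<in> ball a s" for x y v
  proof -
    let ?x = "divc (x, y)"
    have xr: "?x \<in> ball a r" by (rule s(3)[OF x y])
    have sm1: "smooth_near divc (x, y)" by (rule smd[OF sr[OF x] sr[OF y]])
    have eq: "divc (y, z) = divc (?x, divc (x, z))" if "z \<in> ball a s" for z
      using divc_divc[OF r(2) r(2)] x y that sr by metis
    have "fderiv (\<lambda>z. divc (y, z)) y v = fderiv (\<lambda>z. divc (?x, divc (x, z))) y v"
      by (rule fderiv_cong_at[OF eventually_ball_near[OF eq y]])
    also have "\<dots> = fderiv (\<lambda>z. divc (?x, z)) ?x (fderiv (\<lambda>z. divc (x, z)) y v)"
      by (rule fderiv_compose[OF fderiv_partial_snd(1)[OF sm1] fderiv_partial_snd(1)[OF smd[OF xr xr]]])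
    finally have "fderiv divc (y, y) (0, v) = fderiv divc (?x, ?x) (0, fderiv divc (x, y) (0, v))"
      using fderiv_partial_snd(2)[OF sm1] fderiv_partial_snd(2)[OF smd[OF xr xr]]
        fderiv_partial_snd(2)[OF smd[OF sr[OF y] sr[OF y]]] by simp
    then show ?thesis by (simp add: \<omega>_def D_def)
  qed
  (* Only the mixed second derivative of divc survives at the identity, as divc (a, _) is linear. *)
  have K: "fderiv (\<lambda>y. \<omega> y v) a w = l (mixed_deriv divc a w v)" for v w
  proof -
    have "fderiv (\<lambda>y. D v (y, y)) a w = fderiv (D v) (a, a) (w, 0) + fderiv (D v) (a, a) (0, w)"
      by (rule fderiv_diagonal[OF smD]) (use a_ball in auto)
    moreover have "fderiv (D v) (a, a) (0, w) = fderiv (\<lambda>y. proj V v) a w"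
      using fderiv_partial_snd(2)[OF smD[OF a_ball(1,1)], of v w] fderiv_cong[OF fderiv_divc_snd, of v]
      by (simp add: D_def)
    ultimately show ?thesis
      unfolding \<omega>_def fderiv_compose_linear[OF l smDD[OF a_ball(1)]]
      by (simp add: fderiv_const mixed_deriv_def D_def[abs_def])
  qed
  have K_sym: "fderiv (\<lambda>y. \<omega> y v) a w = fderiv (\<lambda>y. \<omega> y w) a v" if "v \<in> V" "w \<in> V" for v w
    using sym[OF that] mixed_deriv_divc[of v w] mixed_deriv_divc[of w v] that
      linear_neg[OF bounded_linear.linear[OF l]]
    by (simp add: K proj_id[OF V])
  have closed: "fderiv (\<lambda>y. \<omega> y v) x w = fderiv (\<lambda>y. \<omega> y w) x v" if x: "x \<in> ball a s" for x v w
  proof -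
    (* \<theta> is the translation that moves x to the identity. *)
    define \<theta> where "\<theta> y = divc (x, y)" for y
    have sm1: "smooth_near divc (x, x)" by (rule smd[OF sr[OF x] sr[OF x]])
    have \<theta>: "smooth_near \<theta> x" unfolding \<theta>_def by (rule fderiv_partial_snd(1)[OF sm1])
    have \<theta>x: "\<theta> x = a" unfolding \<theta>_def by (rule divc_refl[OF r(2)[OF sr[OF x] sr[OF x]]])
    have Dth: "D v (x, y) = fderiv \<theta> y v" if "y \<in> ball a s" for v y
      unfolding \<theta>_def D_def using fderiv_partial_snd(2)[OF smd[OF sr[OF x] sr[OF that]], of v] by simp
    have \<theta>V: "fderiv \<theta> x u \<in> V" for u
      by (rule fderiv_in_subspace[OF V \<theta> eventually_ball_near[OF _ x]])
        (use quotient_in_chartD(4)[OF r(2)] x sr in \<open>simp add: \<theta>_def\<close>)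
    have main: "fderiv (\<lambda>y. \<omega> y v) x w = fderiv (\<lambda>z. \<omega> z (fderiv \<theta> x v)) a (fderiv \<theta> x w)
        + \<omega> a (fderiv (\<lambda>y. fderiv \<theta> y v) x w)" for v w
    proof -
      have eq: "\<omega> y v = \<omega> (\<theta> y) (fderiv \<theta> y v)" if "y \<in> ball a s" for y
        using invariant[OF x that, of v] Dth[OF that, of v] by (simp add: \<theta>_def)
      have "fderiv (\<lambda>y. \<omega> y v) x w = fderiv (\<lambda>y. \<omega> (\<theta> y) (fderiv \<theta> y v)) x w"
        by (rule fderiv_cong_at[OF eventually_ball_near[OF eq x]])
      also have "\<dots> = fderiv (\<lambda>z. \<omega> z (fderiv \<theta> x v)) (\<theta> x) (fderiv \<theta> x w)
          + \<omega> (\<theta> x) (fderiv (\<lambda>y. fderiv \<theta> y v) x w)"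
      proof (rule fderiv_linear_family[OF _ _ \<theta> smooth_near_deriv(2)[OF \<theta>]])
        show "\<forall>\<^sub>F y in nhds (\<theta> x). linear (\<omega> y)"
          unfolding \<theta>x by (rule eventually_ball_near[OF lin\<omega> a_ball(1)])
        show "smooth_near (\<lambda>y. \<omega> y u) (\<theta> x)" for u
          unfolding \<theta>x by (rule sm\<omega>[OF a_ball(1)])
      qed
      finally show ?thesis by (simp add: \<theta>x)
    qed
    show ?thesis
      unfolding main using K_sym[OF \<theta>V \<theta>V] fderiv_symmetric[OF \<theta>] by metis
  qed
  obtain f where f: "f a = 0" "\<And>x. x \<in> ball a s \<Longrightarrow> (f has_derivative \<omega> x) (at x)"
    using poincare_lemma[of a s \<omega>, OF lin\<omega>[OF sr] sm\<omega>[OF sr] closed] by blast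
  have smf: "smooth_near f x" if "x \<in> ball a s" for x
    by (rule smooth_near_of_deriv[OF open_ball f(2) sm\<omega>[OF sr] that])
  have hom: "f (divc (x, y)) = f y - f x" if x: "x \<in> ball a t" and y: "y \<in> ball a t" for x y
  proof -
    have der: "((\<lambda>y. f (divc (x, y)) - f y) has_derivative (\<lambda>v. 0)) (at y within ball a t)"
      if y: "y \<in> ball a t" for y
    proof -
      have sm1: "smooth_near divc (x, y)" by (rule smd[OF sr[OF ts[OF x]] sr[OF ts[OF y]]])
      have dd: "((\<lambda>y. divc (x, y)) has_derivative (\<lambda>v. D v (x, y))) (at y)"
        using smooth_near_deriv(1)[OF fderiv_partial_snd(1)[OF sm1]]
        by (simp add: D_def fderiv_partial_snd(2)[OF sm1, symmetric])
      have "((\<lambda>y. f (divc (x, y))) has_derivative (\<lambda>v. \<omega> (divc (x, y)) (D v (x, y)))) (at y)"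
        using dd f(2)[OF t(3)[OF x y]] by (rule has_derivative_compose)
      then have "((\<lambda>y. f (divc (x, y)) - f y) has_derivative
          (\<lambda>v. \<omega> (divc (x, y)) (D v (x, y)) - \<omega> y v)) (at y)"
        using f(2)[OF ts[OF y]] by (rule has_derivative_diff)
      then have "((\<lambda>y. f (divc (x, y)) - f y) has_derivative (\<lambda>v. 0)) (at y)"
        using invariant[OF ts[OF x] ts[OF y]] by simp
      then show ?thesis by (rule has_derivative_at_withinI)
    qed
    have "f (divc (x, y)) - f y = f (divc (x, x)) - f x"
      by (rule has_derivative_zero_unique[OF convex_ball der y x])
    then show ?thesis
      using divc_refl[OF r(2)[OF sr[OF ts[OF x]] sr[OF ts[OF x]]]] f(1) by (simp add: algebra_simps)
  qed
  define h where "h x = f (\<kappa> x)" for x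
  define W where "W = {q \<in> U. \<kappa> q \<in> ball a t}"
  have W: "openin (mtop M) W" unfolding W_def by (rule chart_preimage_open[OF M c open_ball])
  have hh: "h (inv x \<otimes> y) = h y - h x" if "x \<in> W" "y \<in> W" for x y
    using hom[of "\<kappa> x" "\<kappa> y"] that param_chart[OF M c] by (simp add: W_def h_def divc_def)
  have path: "\<exists>p. pathin (mtop M) p \<and> p 0 = \<one> \<and> p 1 = x \<and> p ` {0..1} \<subseteq> W" if x: "x \<in> W" for x
  proof -
    have xU: "x \<in> U" "\<kappa> x \<in> ball a t" using x by (auto simp: W_def)
    define q where "q \<tau> = a + \<tau> *\<^sub>R (\<kappa> x - a)" for \<tau> :: real
    have qV: "q \<tau> \<in> V" for \<tau>
      unfolding q_def using V a_V chart_in_model[OF M c xU(1)]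
      by (intro subspace_add subspace_scale subspace_diff)
    have qb: "q \<tau> \<in> ball a t" if "\<tau> \<in> {0..1}" for \<tau>
    proof -
      have "dist a (q \<tau>) = \<tau> * dist a (\<kappa> x)" using that by (simp add: q_def dist_norm norm_minus_commute)
      also have "\<dots> \<le> dist a (\<kappa> x)" using that by (intro mult_left_le_one_le) auto
      finally show ?thesis using xU(2) by simp
    qed
    have qU: "proj V (q \<tau>) \<in> \<kappa> ` U" if "\<tau> \<in> {0..1}" for \<tau>
      using r(2)[OF sr[OF ts[OF qb[OF that]]] sr[OF ts[OF qb[OF that]]]] by (simp add: quotient_in_chart_def)
    have "pathin (mtop M) (\<lambda>\<tau>. \<sigma> (q \<tau>))"
      unfolding pathin_def
    proof (rule continuous_map_of_cont_at)
      fix \<tau> :: real assume "\<tau> \<in> topspace (top_of_set {0..1})"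
      then have \<tau>: "\<tau> \<in> {0..1}" by simp
      have "cont_at euclidean (mtop M) \<sigma> (q \<tau>)"
        using smooth_at_cont[OF smooth_atlas_euclid M smooth_at_param[OF M c qU[OF \<tau>]]] by (simp add: flat_def)
      moreover have "continuous_map (top_of_set {0..1}) euclidean q"
        unfolding q_def by (auto intro!: continuous_intros)
      then have "cont_at (top_of_set {0..1}) euclidean q \<tau>"
        by (rule cont_at_of_continuous_map) (use \<tau> in simp)
      ultimately show "cont_at (top_of_set {0..1}) (mtop M) (\<lambda>\<tau>. \<sigma> (q \<tau>)) \<tau>"
        by (rule cont_at_compose[where f=q and g=\<sigma>, rotated])
    qed
    moreover have "\<sigma> (q 0) = \<one>" by (simp add: q_def \<sigma>_a)
    moreover have "\<sigma> (q 1) = x" using param_chart[OF M c xU(1)] by (simp add: q_def)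
    moreover have "\<sigma> (q \<tau>) \<in> W" if "\<tau> \<in> {0..1}" for \<tau>
      using chart_param[OF M c qU[OF that]] qb[OF that] by (simp add: W_def proj_id[OF V qV])
    ultimately show ?thesis by (intro exI[of _ "\<lambda>\<tau>. \<sigma> (q \<tau>)"]) auto
  qed
  have s\<sigma>: "smooth_near (\<lambda>y. \<kappa> (\<sigma> y)) a" by (rule transition_smooth[OF M c c one_U one_U])
  have smf': "smooth_near f (\<kappa> (\<sigma> a))" using smf[OF a_ball(2)] by (simp add: \<sigma>_a)
  have "smooth_near (\<lambda>y. h (\<sigma> y)) a"
    unfolding h_def by (rule smooth_near_compose[OF s\<sigma> smf'])
  then have "smooth_at M euclid h \<one>"
    unfolding smooth_at_to_euclid[OF M c one_U] .
  moreover have "\<forall>v. fderiv (\<lambda>y. h (\<sigma> y)) a v = l (proj V v)"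
  proof
    fix v
    have "fderiv (\<lambda>y. h (\<sigma> y)) a v = fderiv f a (proj V v)"
      unfolding h_def fderiv_compose[OF s\<sigma> smf'] fderiv_chart_param[OF M c one_U] \<sigma>_a ..
    also have "\<dots> = \<omega> a (proj V v)" using fderiv_eq[OF f(2)[OF a_ball(2)]] by simp
    also have "\<dots> = l (proj V v)"
      by (simp add: \<omega>_def D_def fderiv_divc_snd_a proj_id[OF V proj_in[OF V]])
    finally show "fderiv (\<lambda>y. h (\<sigma> y)) a v = l (proj V v)" .
  qed
  moreover have "\<one> \<in> W" using one_U a_ball(3) by (simp add: W_def)
  moreover have "\<forall>x\<in>W. \<forall>y\<in>W. h (inv x \<otimes> y) = h y - h x" by (intro ballI hh)
  moreover have "\<forall>x\<in>W. \<exists>p. pathin (mtop M) p \<and> p 0 = \<one> \<and> p 1 = x \<and> p ` {0..1} \<subseteq> W"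
    by (intro ballI path)
  ultimately show ?thesis
    using W by (intro exI[of _ h] exI[of _ W] conjI)
qed

end

section \<open>Homomorphisms of Lie skew braces to vector groups\<close>

text \<open>The differential of \<open>F\<close> vanishes at \<open>p\<close>.  Only directions in the model space represent
  tangent vectors.\<close>

definition stationary :: "('a, 'e::euclidean_space) mfd \<Rightarrow> ('a \<Rightarrow> 'f::euclidean_space) \<Rightarrow> 'a \<Rightarrow> bool" where
  "stationary M F p \<longleftrightarrow> smooth_at M euclid F p \<and>
     (\<forall>(U, \<kappa>)\<in>atlas M. p \<in> U \<longrightarrow> (\<forall>v\<in>model M. fderiv (\<lambda>y. F (param M U \<kappa> y)) (\<kappa> p) v = 0))"

lemma stationaryD:
  assumes "stationary M F p"
  shows "smooth_at M euclid F p"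
    and "(U, \<kappa>) \<in> atlas M \<Longrightarrow> p \<in> U \<Longrightarrow> v \<in> model M \<Longrightarrow> fderiv (\<lambda>y. F (param M U \<kappa> y)) (\<kappa> p) v = 0"
  using assms by (auto simp: stationary_def)

text \<open>One chart suffices, by the chain rule for the transition maps.\<close>

lemma stationaryI:
  assumes M: "smooth_atlas M" and c: "(U, \<kappa>) \<in> atlas M" "p \<in> U"
    and F: "smooth_near (\<lambda>y. F (param M U \<kappa> y)) (\<kappa> p)"
    and zero: "\<And>v. v \<in> model M \<Longrightarrow> fderiv (\<lambda>y. F (param M U \<kappa> y)) (\<kappa> p) v = 0"
  shows "stationary M F p"
proof -
  have "fderiv (\<lambda>y. F (param M U' \<kappa>' y)) (\<kappa>' p) v = 0"
    if c': "(U', \<kappa>') \<in> atlas M" "p \<in> U'" for U' \<kappa>' v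
  proof -
    have tr: "smooth_near (\<lambda>y. \<kappa> (param M U' \<kappa>' y)) (\<kappa>' p)"
      by (rule transition_smooth[OF M c'(1) c(1) c'(2) c(2)])
    have ev: "\<forall>\<^sub>F y in nhds (\<kappa>' p). param M U' \<kappa>' y \<in> U"
      using eventually_param_near[OF M c'(1) chart_open[OF M c(1)] c(2) c'(2)] by eventually_elim simp
    have "fderiv (\<lambda>y. F (param M U' \<kappa>' y)) (\<kappa>' p) v = fderiv (\<lambda>y. F (param M U \<kappa> (\<kappa> (param M U' \<kappa>' y)))) (\<kappa>' p) v"
      by (rule fderiv_cong_at) (use ev in eventually_elim, simp add: param_chart[OF M c(1)])
    also have "\<dots> = fderiv (\<lambda>y. F (param M U \<kappa> y)) (\<kappa> p) (fderiv (\<lambda>y. \<kappa> (param M U' \<kappa>' y)) (\<kappa>' p) v)"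
      using fderiv_compose[OF tr, of "\<lambda>y. F (param M U \<kappa> y)" v] F by (simp add: param_chart[OF M c'])
    also have "\<dots> = 0"
      by (rule zero, rule fderiv_in_subspace[OF model_subspace[OF M c(1)] tr])
        (use ev in eventually_elim, rule chart_in_model[OF M c(1)])
    finally show ?thesis .
  qed
  then show ?thesis
    using F unfolding stationary_def smooth_at_to_euclid[OF M c] by auto
qed

lemma stationary_compose:
  assumes N: "smooth_atlas N" and M: "smooth_atlas M"
    and g: "smooth_at N M g q" and F: "stationary M F (g q)"
  shows "stationary N (\<lambda>x. F (g x)) q"
proof -
  obtain W \<psi> where d: "(W, \<psi>) \<in> atlas M" "g q \<in> W"
    using point_in_chart[OF M smooth_at_points(2)[OF N M g]] by metis
  have F': "smooth_near (\<lambda>y. F (param M W \<psi> y)) (\<psi> (g q))"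
    using stationaryD(1)[OF F] unfolding smooth_at_to_euclid[OF M d] .
  have "fderiv (\<lambda>y. F (g (param N U \<kappa> y))) (\<kappa> q) v = 0"
    if c: "(U, \<kappa>) \<in> atlas N" "q \<in> U" and v: "v \<in> model N" for U \<kappa> v
  proof -
    have g': "cont_at (mtop N) (mtop M) g q" "smooth_near (\<lambda>y. \<psi> (g (param N U \<kappa> y))) (\<kappa> q)"
      using g smooth_at_charts[where f=g, OF N M c d] by auto
    obtain Q where Q: "openin (mtop N) Q" "q \<in> Q" "g ` Q \<subseteq> W"
      using cont_atD[OF g'(1) chart_open[OF M d(1)] d(2)] by metis
    have ev: "\<forall>\<^sub>F y in nhds (\<kappa> q). g (param N U \<kappa> y) \<in> W"
      using eventually_param_near[OF N c(1) Q(1,2) c(2)] by eventually_elim (use Q(3) in auto)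
    have "fderiv (\<lambda>y. F (g (param N U \<kappa> y))) (\<kappa> q) v = fderiv (\<lambda>y. F (param M W \<psi> (\<psi> (g (param N U \<kappa> y))))) (\<kappa> q) v"
      by (rule fderiv_cong_at) (use ev in eventually_elim, simp add: param_chart[OF M d(1)])
    also have "\<dots> = fderiv (\<lambda>y. F (param M W \<psi> y)) (\<psi> (g (param N U \<kappa> (\<kappa> q))))
        (fderiv (\<lambda>y. \<psi> (g (param N U \<kappa> y))) (\<kappa> q) v)"
      by (rule fderiv_compose[OF g'(2)]) (simp add: param_chart[OF N c] F')
    also have "fderiv (\<lambda>y. \<psi> (g (param N U \<kappa> y))) (\<kappa> q) v \<in> model M"
      by (rule fderiv_in_subspace[OF model_subspace[OF M d(1)] g'(2)])
        (use ev in eventually_elim, rule chart_in_model[OF M d(1)])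
    then have "fderiv (\<lambda>y. F (param M W \<psi> y)) (\<psi> (g (param N U \<kappa> (\<kappa> q))))
        (fderiv (\<lambda>y. \<psi> (g (param N U \<kappa> y))) (\<kappa> q) v) = 0"
      using stationaryD(2)[OF F d] by (simp add: param_chart[OF N c])
    finally show ?thesis .
  qed
  moreover have "smooth_at N euclid (\<lambda>x. F (g x)) q"
    by (rule smooth_at_compose[OF N M smooth_atlas_euclid g stationaryD(1)[OF F]])
  ultimately show ?thesis by (auto simp: stationary_def)
qed

lemma stationary_cong:
  assumes M: "smooth_atlas M" and F: "stationary M F p"
    and R: "openin (mtop M) R" "p \<in> R" "\<And>q. q \<in> R \<Longrightarrow> F q = F' q"
  shows "stationary M F' p"
proof -
  have "fderiv (\<lambda>y. F' (param M U \<kappa> y)) (\<kappa> p) v = 0"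
    if c: "(U, \<kappa>) \<in> atlas M" "p \<in> U" and v: "v \<in> model M" for U \<kappa> v
  proof -
    have "\<forall>\<^sub>F y in nhds (\<kappa> p). F' (param M U \<kappa> y) = F (param M U \<kappa> y)"
      using eventually_param_near[OF M c(1) R(1,2) c(2)] by eventually_elim (simp add: R(3))
    then show ?thesis using fderiv_cong_at stationaryD(2)[OF F c v] by metis
  qed
  with smooth_at_cong[OF M stationaryD(1)[OF F] R] show ?thesis by (auto simp: stationary_def)
qed

lemma stationary_add_const:
  assumes M: "smooth_atlas M" and F: "stationary M F p"
  shows "stationary M (\<lambda>x. k + F x) p"
proof -
  obtain U \<kappa> where c: "(U, \<kappa>) \<in> atlas M" "p \<in> U"
    using point_in_chart[OF M smooth_at_points(1)[OF M smooth_atlas_euclid stationaryD(1)[OF F]]] by metis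
  have sm: "smooth_near (\<lambda>y. F (param M U \<kappa> y)) (\<kappa> p)"
    using stationaryD(1)[OF F] unfolding smooth_at_to_euclid[OF M c] .
  show ?thesis
    by (rule stationaryI[OF M c smooth_near_add[OF smooth_near_const sm]])
      (simp add: fderiv_add[OF smooth_near_const sm] fderiv_const stationaryD(2)[OF F c])
qed

text \<open>As \<open>param\<close> factors through the projection onto the model space, derivatives at arbitrary
  points and in arbitrary directions reduce to those at points and in directions of the model space.\<close>

lemma fderiv_param_proj:
  assumes M: "smooth_atlas M" and c: "(U, \<kappa>) \<in> atlas M"
    and sm: "smooth_near (\<lambda>y. F (param M U \<kappa> y)) (proj (model M) y)"
  shows "smooth_near (\<lambda>y. F (param M U \<kappa> y)) y"
    and "fderiv (\<lambda>y. F (param M U \<kappa> y)) y v = fderiv (\<lambda>y. F (param M U \<kappa> y)) (proj (model M) y) (proj (model M) v)"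
proof -
  note V = model_subspace[OF M c]
  have eq: "(\<lambda>y. F (param M U \<kappa> (proj (model M) y))) = (\<lambda>y. F (param M U \<kappa> y))"
    by (simp add: param_proj[OF M c])
  show "smooth_near (\<lambda>y. F (param M U \<kappa> y)) y"
    using smooth_near_compose[OF smooth_near_proj[OF V] sm] unfolding eq .
  show "fderiv (\<lambda>y. F (param M U \<kappa> y)) y v = fderiv (\<lambda>y. F (param M U \<kappa> y)) (proj (model M) y) (proj (model M) v)"
    using fderiv_compose[OF smooth_near_proj[OF V] sm, of v] unfolding eq fderiv_linear[OF bounded_linear_proj[OF V]] .
qed

lemma stationary_imp_constant:
  assumes M: "smooth_atlas M" and conn: "connected_space (mtop M)"
    and st: "\<And>p. p \<in> points M \<Longrightarrow> stationary M F p" and pq: "p \<in> points M" "q \<in> points M"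
  shows "F p = F q"
proof (rule locally_constant_imp_constant[OF conn _ pq])
  fix p assume "p \<in> points M"
  then obtain U \<kappa> where c: "(U, \<kappa>) \<in> atlas M" "p \<in> U" using point_in_chart[OF M] by metis
  note V = model_subspace[OF M c(1)]
  have "\<forall>\<^sub>F z in nhds (\<kappa> p). proj (model M) z \<in> \<kappa> ` U"
    using eventually_param_near[OF M c(1) chart_open[OF M c(1)] c(2) c(2)] by eventually_elim simp
  then obtain r where r: "r > 0" "\<And>z. z \<in> ball (\<kappa> p) r \<Longrightarrow> proj (model M) z \<in> \<kappa> ` U"
    unfolding eventually_nhds_metric by (auto simp: dist_commute)
  have der: "((\<lambda>y. F (param M U \<kappa> y)) has_derivative (\<lambda>v. 0)) (at z within ball (\<kappa> p) r)"
    if z: "z \<in> ball (\<kappa> p) r" for z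
  proof -
    define q where "q = param M U \<kappa> z"
    have q: "q \<in> U" "\<kappa> q = proj (model M) z"
      using chart_param[OF M c(1) r(2)[OF z]] by (simp_all add: q_def)
    have S: "stationary M F q" by (rule st[OF chart_subset[OF M c(1) q(1)]])
    have sm: "smooth_near (\<lambda>y. F (param M U \<kappa> y)) (proj (model M) z)"
      using stationaryD(1)[OF S] unfolding smooth_at_to_euclid[OF M c(1) q(1)] q(2) .
    have "fderiv (\<lambda>y. F (param M U \<kappa> y)) z v = 0" for v
      unfolding fderiv_param_proj(2)[OF M c(1) sm]
      using stationaryD(2)[OF S c(1) q(1) proj_in[OF V]] unfolding q(2) .
    then have "fderiv (\<lambda>y. F (param M U \<kappa> y)) z = (\<lambda>v. 0)" by blast
    then show ?thesis
      using smooth_near_deriv(1)[OF fderiv_param_proj(1)[OF M c(1) sm]] has_derivative_at_withinI by metis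
  qed
  show "\<exists>Q. openin (mtop M) Q \<and> p \<in> Q \<and> (\<forall>y\<in>Q. F y = F p)"
  proof (intro exI[of _ "{q \<in> U. \<kappa> q \<in> ball (\<kappa> p) r}"] conjI ballI)
    show "openin (mtop M) {q \<in> U. \<kappa> q \<in> ball (\<kappa> p) r}" by (rule chart_preimage_open[OF M c(1) open_ball])
    show "p \<in> {q \<in> U. \<kappa> q \<in> ball (\<kappa> p) r}" using c r by simp
    fix q assume q: "q \<in> {q \<in> U. \<kappa> q \<in> ball (\<kappa> p) r}"
    have "F (param M U \<kappa> (\<kappa> q)) = F (param M U \<kappa> (\<kappa> p))"
      by (rule has_derivative_zero_unique[OF convex_ball der]) (use q r in auto)
    then show "F q = F p" using q c param_chart[OF M c(1)] by simp
  qed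
qed

context lie_group_chart
begin

lemma smooth_hom:
  fixes \<phi> :: "'a \<Rightarrow> 'f::euclidean_space"
  assumes hom: "\<And>x y. x \<in> carrier G \<Longrightarrow> y \<in> carrier G \<Longrightarrow> \<phi> (x \<otimes> y) = \<phi> x + \<phi> y"
    and sm: "smooth_at M euclid \<phi> \<one>" and p: "p \<in> carrier G"
  shows "smooth_at M euclid \<phi> p"
proof (rule smooth_at_cong[OF M _ openin_topspace])
  have "smooth_at M M (\<lambda>x. inv p \<otimes> x) p" using p by (intro smooth_at_translation) auto
  from smooth_at_compose[OF M M smooth_atlas_euclid this, of \<phi>] sm p
  have 1: "smooth_at M euclid (\<lambda>x. \<phi> (inv p \<otimes> x)) p" by simp
  have 2: "smooth_at euclid euclid (\<lambda>z. \<phi> p + z) (\<phi> (inv p \<otimes> p))"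
    unfolding smooth_at_euclid by (intro smooth_near_add smooth_near_const smooth_near_id)
  show "smooth_at M euclid (\<lambda>x. \<phi> p + \<phi> (inv p \<otimes> x)) p"
    by (rule smooth_at_compose[OF M smooth_atlas_euclid smooth_atlas_euclid 1 2])
  show "p \<in> points M" using p by (simp add: points_eq)
  fix q assume "q \<in> points M"
  then have q: "q \<in> carrier G" by (simp add: points_eq)
  have "\<phi> p + \<phi> (inv p \<otimes> q) = \<phi> (p \<otimes> (inv p \<otimes> q))" using p q by (simp add: hom)
  also have "p \<otimes> (inv p \<otimes> q) = q" using p q by (simp add: m_assoc[symmetric])
  finally show "\<phi> p + \<phi> (inv p \<otimes> q) = \<phi> q" .
qed

text \<open>By translation a homomorphism that is stationary at the identity is stationary everywhere.\<close>

lemma stationary_hom_zero: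
  fixes \<phi> :: "'a \<Rightarrow> 'f::euclidean_space"
  assumes hom: "\<And>x y. x \<in> carrier G \<Longrightarrow> y \<in> carrier G \<Longrightarrow> \<phi> (x \<otimes> y) = \<phi> x + \<phi> y"
    and st: "stationary M \<phi> \<one>" and conn: "connected_space (mtop M)" and x: "x \<in> carrier G"
  shows "\<phi> x = 0"
proof -
  have "stationary M \<phi> p" if "p \<in> points M" for p
  proof (rule stationary_cong[OF M _ openin_topspace that])
    have p: "p \<in> carrier G" using that by (simp add: points_eq)
    have "smooth_at M M (\<lambda>x. inv p \<otimes> x) p" using p by (intro smooth_at_translation) auto
    from stationary_compose[OF M M this, of \<phi>] st p
    show "stationary M (\<lambda>x. \<phi> p + \<phi> (inv p \<otimes> x)) p" by (intro stationary_add_const[OF M]) simp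
    fix q assume "q \<in> points M"
    then have q: "q \<in> carrier G" by (simp add: points_eq)
    have "\<phi> p + \<phi> (inv p \<otimes> q) = \<phi> (p \<otimes> (inv p \<otimes> q))" using p q by (simp add: hom)
    also have "p \<otimes> (inv p \<otimes> q) = q" using p q by (simp add: m_assoc[symmetric])
    finally show "\<phi> p + \<phi> (inv p \<otimes> q) = \<phi> q" .
  qed
  then have "\<phi> x = \<phi> \<one>"
    by (rule stationary_imp_constant[OF M conn]) (use x points_eq in auto)
  moreover have "\<phi> \<one> = 0" using hom[of \<one> \<one>] by simp
  ultimately show ?thesis by simp
qed

text \<open>The local homomorphism with differential \<open>l\<close> extends along paths, and its extension is
  smooth by translation.\<close>

theorem homomorphism_exists:
  fixes l :: "'e \<Rightarrow> 'e"
  assumes sc: "simply_connected_mfd M" and l: "bounded_linear l"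
    and sym: "\<And>u v. u \<in> V \<Longrightarrow> v \<in> V \<Longrightarrow> l (mixed_deriv mulc a u v) = l (mixed_deriv mulc a v u)"
  shows "\<exists>\<phi>. (\<forall>x\<in>carrier G. \<forall>y\<in>carrier G. \<phi> (x \<otimes> y) = \<phi> x + (\<phi> y :: 'e)) \<and>
    (\<forall>p\<in>carrier G. smooth_at M euclid \<phi> p) \<and> (\<forall>v. fderiv (\<lambda>y. \<phi> (\<sigma> y)) a v = l (proj V v))"
proof -
  have "\<exists>h W. openin (mtop M) W \<and> \<one> \<in> W \<and>
    (\<forall>x\<in>W. \<forall>y\<in>W. h (inv x \<otimes> y) = h y - (h x :: 'e)) \<and>
    (\<forall>x\<in>W. \<exists>p. pathin (mtop M) p \<and> p 0 = \<one> \<and> p 1 = x \<and> p ` {0..1} \<subseteq> W) \<and>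
    smooth_at M euclid h \<one> \<and> (\<forall>v. fderiv (\<lambda>y. h (\<sigma> y)) a v = l (proj V v))"
    by (rule local_homomorphism_exists[OF l]) (rule sym)
  then obtain h W where W: "openin (mtop M) W" "\<one> \<in> W"
    and hh: "\<forall>x\<in>W. \<forall>y\<in>W. h (inv x \<otimes> y) = h y - (h x :: 'e)"
    and path: "\<forall>x\<in>W. \<exists>p. pathin (mtop M) p \<and> p 0 = \<one> \<and> p 1 = x \<and> p ` {0..1} \<subseteq> W"
    and smh: "smooth_at M euclid h \<one>" and dh: "\<forall>v. fderiv (\<lambda>y. h (\<sigma> y)) a v = l (proj V v)"
    by (elim exE conjE) (rule that)
  interpret loc: local_homomorphism G "mtop M" W h
    by unfold_locales (use W hh in auto)
  have "path_connected_space (mtop M)"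
  proof (rule path_connected_of_local_paths[OF _ W])
    show "connected_space (mtop M)" using sc by (simp add: simply_connected_mfd_def)
    show "path_component_of (mtop M) \<one> x" if "x \<in> W" for x
      using bspec[OF path that] unfolding path_component_of_def by blast
  qed
  moreover have "simply_connected_space (mtop M)" using sc by (simp add: simply_connected_mfd_def)
  ultimately obtain \<phi> where \<phi>: "\<forall>x\<in>carrier G. \<forall>y\<in>carrier G. \<phi> (x \<otimes> y) = \<phi> x + \<phi> y"
      "\<forall>p. pathin (mtop M) p \<and> p 0 = \<one> \<and> p ` {0..1} \<subseteq> W \<longrightarrow> \<phi> (p 1) = h (p 1)"
    using loc.extend_local_homomorphism by metis
  have eq: "h x = \<phi> x" if xW: "x \<in> W" for x
  proof -
    obtain p where "pathin (mtop M) p" "p 0 = \<one>" "p 1 = x" "p ` {0..1} \<subseteq> W" using bspec[OF path xW] by blast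
    then show ?thesis using \<phi>(2) by metis
  qed
  have "smooth_at M euclid \<phi> \<one>" by (rule smooth_at_cong[OF M smh W eq])
  then have "smooth_at M euclid \<phi> p" if "p \<in> carrier G" for p
    using smooth_hom[of \<phi> p] \<phi>(1) that by blast
  moreover have "fderiv (\<lambda>y. \<phi> (\<sigma> y)) a v = l (proj V v)" for v
  proof -
    have "\<forall>\<^sub>F y in nhds a. \<phi> (\<sigma> y) = h (\<sigma> y)"
      using eventually_param_near[OF M c W one_U] by eventually_elim (simp add: eq)
    then have "fderiv (\<lambda>y. \<phi> (\<sigma> y)) a v = fderiv (\<lambda>y. h (\<sigma> y)) a v" by (rule fderiv_cong_at)
    then show ?thesis using dh by simp
  qed
  ultimately show ?thesis using \<phi>(1) by (intro exI[of _ \<phi>]) simp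
qed

lemma left_invariant_field_one:
  assumes "u \<in> V"
  shows "left_invariant_field M G (coord_vector M U \<kappa> \<one> u) \<one> = coord_vector M U \<kappa> \<one> u"
proof -
  have "\<forall>\<^sub>F y in nhds a. \<kappa> (\<one> \<otimes> \<sigma> y) = \<kappa> (\<sigma> y)"
    using eventually_param_near[OF M c chart_open[OF M c] one_U one_U]
    by eventually_elim (use chart_subset[OF M c] points_eq in simp)
  then have "fderiv (\<lambda>y. \<kappa> (\<one> \<otimes> \<sigma> y)) a u = u"
    using fderiv_chart_param[OF M c one_U, of u] fderiv_cong_at proj_id[OF V assms] by metis
  then show ?thesis
    using differential_coord_vector[OF M c one_U M smooth_at_translation(1)[of \<one> \<one>] c, of u] one_U
    by (simp add: left_invariant_field_def)
qed

text \<open>The bracket is the antisymmetrised mixed derivative of the multiplication in the chart.\<close>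

lemma lie_bracket_coords:
  assumes u: "u \<in> V" and v: "v \<in> V" and w: "w \<in> V"
    and br: "lie_bracket M G (coord_vector M U \<kappa> \<one> u) (coord_vector M U \<kappa> \<one> v) = coord_vector M U \<kappa> \<one> w"
  shows "w = mixed_deriv mulc a u v - mixed_deriv mulc a v u"
proof (subst euclidean_eq_iff, intro ballI)
  fix b :: 'e
  have *: "app (coord_vector M U \<kappa> \<one> u) (\<lambda>q. app (left_invariant_field M G (coord_vector M U \<kappa> \<one> v) q) (\<lambda>q. \<kappa> q \<bullet> b))
      = mixed_deriv mulc a u v \<bullet> b" for u v
    using iterated_derivative_component[OF M c one_U smooth_mult, of u v b]
    by (simp add: left_invariant_field_def mulc_def[abs_def])
  show "w \<bullet> b = (mixed_deriv mulc a u v - mixed_deriv mulc a v u) \<bullet> b"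
    unfolding coords_of_local_functional[OF M c one_U br[unfolded lie_bracket_def field_bracket_def] w]
    by (simp add: left_invariant_field_one[OF u] left_invariant_field_one[OF v] * inner_diff_left)
qed

end

subsection \<open>Lie skew braces\<close>

locale lie_brace_chart = lie_group_chart M G U \<kappa>
  for M :: "('a, 'e::euclidean_space) mfd" and G :: "'a monoid" (structure) and U \<kappa> +
  fixes H :: "'a monoid"
  assumes brace: "lie_skew_brace M G H"
begin

abbreviation "lam \<equiv> lambda_action G H"

lemma carrier_H: "carrier H = carrier G" and group_H: "group H"
  using brace points_eq by (auto simp: lie_skew_brace_def lie_group_def)

lemma H_closed [simp]: "x \<in> carrier G \<Longrightarrow> y \<in> carrier G \<Longrightarrow> x \<otimes>\<^bsub>H\<^esub> y \<in> carrier G"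
  using group.is_monoid[OF group_H] monoid.m_closed carrier_H by metis

lemma brace_eq:
  "\<lbrakk>g \<in> carrier G; h \<in> carrier G; k \<in> carrier G\<rbrakk> \<Longrightarrow>
    g \<otimes>\<^bsub>H\<^esub> (h \<otimes> k) = (g \<otimes>\<^bsub>H\<^esub> h) \<otimes> inv g \<otimes> (g \<otimes>\<^bsub>H\<^esub> k)"
  using brace by (simp add: lie_skew_brace_def points_eq)

lemma one_H: "\<one>\<^bsub>H\<^esub> = \<one>"
proof -
  interpret H: group H by (rule group_H)
  have e: "\<one>\<^bsub>H\<^esub> \<in> carrier G" using H.one_closed carrier_H by simp
  have "\<one>\<^bsub>H\<^esub> \<otimes>\<^bsub>H\<^esub> (\<one> \<otimes> \<one>) = (\<one>\<^bsub>H\<^esub> \<otimes>\<^bsub>H\<^esub> \<one>) \<otimes> inv \<one>\<^bsub>H\<^esub> \<otimes> (\<one>\<^bsub>H\<^esub> \<otimes>\<^bsub>H\<^esub> \<one>)"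
    by (rule brace_eq) (use e in auto)
  then have "\<one> = inv \<one>\<^bsub>H\<^esub>"
    using e carrier_H by simp
  then show ?thesis using e by (metis inv_inv inv_one)
qed

sublocale H: lie_group_chart M H U \<kappa>
  using brace c one_U one_H by unfold_locales (auto simp: lie_skew_brace_def)

lemma lam_closed [simp]: "g \<in> carrier G \<Longrightarrow> x \<in> carrier G \<Longrightarrow> lam g x \<in> carrier G"
  by (simp add: lambda_action_def)

lemma mult_H: "g \<in> carrier G \<Longrightarrow> x \<in> carrier G \<Longrightarrow> g \<otimes>\<^bsub>H\<^esub> x = g \<otimes> lam g x"
  by (simp add: lambda_action_def m_assoc[symmetric])

lemma lam_mult:
  assumes "g \<in> carrier G" "x \<in> carrier G" "y \<in> carrier G"
  shows "lam g (x \<otimes> y) = lam g x \<otimes> lam g y"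
  using assms by (simp add: lambda_action_def brace_eq m_assoc)

lemma lam_comp:
  assumes "g \<in> carrier G" "h \<in> carrier G" "x \<in> carrier G"
  shows "lam (g \<otimes>\<^bsub>H\<^esub> h) x = lam g (lam h x)"
proof -
  have "g \<otimes> lam g h \<otimes> lam g (lam h x) = g \<otimes> lam g (h \<otimes> lam h x)"
    using assms by (simp add: lam_mult m_assoc)
  also have "\<dots> = g \<otimes>\<^bsub>H\<^esub> (h \<otimes>\<^bsub>H\<^esub> x)" using assms by (simp add: mult_H)
  also have "\<dots> = (g \<otimes>\<^bsub>H\<^esub> h) \<otimes>\<^bsub>H\<^esub> x"
    using assms H.m_assoc[of g h x] carrier_H by simp
  also have "\<dots> = (g \<otimes>\<^bsub>H\<^esub> h) \<otimes> lam (g \<otimes>\<^bsub>H\<^esub> h) x" using assms by (simp add: mult_H)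
  also have "g \<otimes>\<^bsub>H\<^esub> h = g \<otimes> lam g h" using assms by (simp add: mult_H)
  finally have "(g \<otimes> lam g h) \<otimes> lam g (lam h x) = (g \<otimes> lam g h) \<otimes> lam (g \<otimes> lam g h) x" .
  moreover have "lam (g \<otimes> lam g h) x \<in> carrier G"
    using assms mult_H[of g h, symmetric] by simp
  ultimately have "lam g (lam h x) = lam (g \<otimes> lam g h) x"
    using assms by (simp add: Units_l_cancel[of "g \<otimes> lam g h"])
  then show ?thesis using assms by (simp add: mult_H)
qed

lemma lam_one: "x \<in> carrier G \<Longrightarrow> lam \<one> x = x"
  using H.l_one[of x, unfolded carrier_H one_H] by (simp add: lambda_action_def)

lemma lam_one_right: "g \<in> carrier G \<Longrightarrow> lam g \<one> = \<one>"
  using H.r_one[of g, unfolded carrier_H one_H] by (simp add: lambda_action_def)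

lemma smooth_lam:
  assumes K: "smooth_atlas K" and f: "smooth_at K M f x" and g: "smooth_at K M g x"
  shows "smooth_at K M (\<lambda>x. lam (f x) (g x)) x"
  unfolding lambda_action_def
  by (intro smooth_at_mult[OF K] smooth_at_inv[OF K] H.smooth_at_mult[OF K] f g)

lemma smooth_lam_right: "g \<in> carrier G \<Longrightarrow> x \<in> carrier G \<Longrightarrow> smooth_at M M (lam g) x"
  using smooth_lam[OF M smooth_at_const[OF M M] smooth_at_ident[OF M]] points_eq by simp

lemma smooth_lam_op: "smooth_at (prod_mfd M M) M (\<lambda>(g, x). lam g x) (\<one>, \<one>)"
proof -
  have P: "smooth_atlas (prod_mfd M M)" by (rule smooth_atlas_prod[OF M M])
  have "smooth_at (prod_mfd M M) M fst (\<one>, \<one>)" "smooth_at (prod_mfd M M) M snd (\<one>, \<one>)"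
    by (rule smooth_at_fst[OF M M]; simp add: points_eq)+
  from smooth_lam[OF P this] show ?thesis by (simp add: case_prod_unfold)
qed

definition lamc :: "'e \<times> 'e \<Rightarrow> 'e" where
  "lamc z = \<kappa> (lam (\<sigma> (fst z)) (\<sigma> (snd z)))"

lemma brace_tri_coords:
  assumes w: "w \<in> V"
    and tr: "brace_tri M G H (coord_vector M U \<kappa> \<one> u) (coord_vector M U \<kappa> \<one> v) = coord_vector M U \<kappa> \<one> w"
  shows "w = mixed_deriv lamc a u v"
proof (subst euclidean_eq_iff, intro ballI)
  fix b :: 'e
  show "w \<bullet> b = mixed_deriv lamc a u v \<bullet> b"
    unfolding coords_of_local_functional[OF M c one_U tr[unfolded brace_tri_def] w]
    using iterated_derivative_component[OF M c one_U smooth_lam_op, of u v b]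
    by (simp add: lamc_def[abs_def] lam_one)
qed

text \<open>A homomorphism whose differential kills \<open>x \<triangleright> y\<close> is invariant under the lambda-action: the
  differential of \<open>\<phi> \<circ> \<lambda>\<^sub>g\<close> at the identity is stationary in \<open>g\<close>, first at the identity and then,
  by right translation, everywhere.\<close>

theorem lam_invariant:
  fixes \<phi> :: "'a \<Rightarrow> 'e" and l :: "'e \<Rightarrow> 'e"
  assumes conn: "connected_space (mtop M)" and l: "bounded_linear l"
    and hom: "\<And>x y. x \<in> carrier G \<Longrightarrow> y \<in> carrier G \<Longrightarrow> \<phi> (x \<otimes> y) = \<phi> x + \<phi> y"
    and sm: "\<And>p. p \<in> carrier G \<Longrightarrow> smooth_at M euclid \<phi> p"
    and d\<phi>: "\<And>v. fderiv (\<lambda>y. \<phi> (\<sigma> y)) a v = l (proj V v)"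
    and tri: "\<And>u v. u \<in> V \<Longrightarrow> v \<in> V \<Longrightarrow> l (mixed_deriv lamc a u v) = 0"
    and g: "g \<in> carrier G" and x: "x \<in> carrier G"
  shows "\<phi> (lam g x) = \<phi> x"
proof -
  define \<Theta> where "\<Theta> v g = fderiv (\<lambda>y. \<phi> (lam g (\<sigma> y))) a v" for v g
  have sm_lam: "smooth_at M euclid (\<lambda>x. \<phi> (lam g x)) x" if "g \<in> carrier G" "x \<in> carrier G" for g x
    using smooth_at_compose[OF M M smooth_atlas_euclid smooth_lam_right[OF that], of \<phi>] sm that by simp
  have evU: "\<forall>\<^sub>F y in nhds a. \<sigma> y \<in> U"
    using eventually_param_near[OF M c chart_open[OF M c] one_U one_U] by eventually_elim simp
  have smLam: "smooth_near lamc (a, a)"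
    using smooth_near_op[OF M c one_U smooth_lam_op _ smooth_at_chart[OF M c one_U]]
    unfolding lamc_def by (simp add: lam_one)
  have D: "smooth_near (\<lambda>z. fderiv lamc z (0, v)) (a, a)" for v
    by (rule smooth_near_deriv(2)[OF smLam])
  have st1: "stationary M (\<Theta> v) \<one>" if v: "v \<in> V" for v
  proof -
    have ct: "cont_at euclidean (mtop M) (\<lambda>z. lam (\<sigma> (fst z)) (\<sigma> (snd z))) (a, a)"
      using smooth_at_cont[OF smooth_atlas_euclid M smooth_at_op_param[OF M c one_U smooth_lam_op]]
      by (simp add: flat_def lam_one)
    have "lam (\<sigma> (fst (a, a))) (\<sigma> (snd (a, a))) \<in> U" by (simp add: \<sigma>_a one_U lam_one)
    from cont_atD[OF ct chart_open[OF M c] this] obtain Q where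
      Q: "openin euclidean Q" "(a, a) \<in> Q" "(\<lambda>z. lam (\<sigma> (fst z)) (\<sigma> (snd z))) ` Q \<subseteq> U" by metis
    have "\<forall>\<^sub>F z in nhds (a, a). z \<in> Q" by (rule eventually_nhds_in_open) (use Q in simp_all)
    then have ev: "\<forall>\<^sub>F z in nhds (a, a). lam (\<sigma> (fst z)) (\<sigma> (snd z)) \<in> U \<and> smooth_near lamc z"
      using eventually_smooth_near[OF smLam]
      by eventually_elim (use Q(3) in blast)
    obtain r where r: "r > 0" "\<And>y z. y \<in> ball a r \<Longrightarrow> z \<in> ball a r \<Longrightarrow>
        lam (\<sigma> y) (\<sigma> z) \<in> U \<and> smooth_near lamc (y, z)"
      using nhds_prod_ball[OF ev] by (metis fst_conv snd_conv)
    have ab: "a \<in> ball a r" using r(1) by simp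
    have "\<forall>\<^sub>F y in nhds a. y \<in> ball a r" by (rule eventually_nhds_in_open) (use r(1) in auto)
    with evU have eq: "\<forall>\<^sub>F y in nhds a. l (fderiv lamc (y, a) (0, v)) = \<Theta> v (\<sigma> y)"
    proof eventually_elim
      case (elim y)
      have yc: "\<sigma> y \<in> carrier G" using elim chart_subset[OF M c] points_eq by blast
      have smy: "smooth_near lamc (y, a)" using r(2) elim ab by blast
      have la: "lamc (y, a) = a" using lam_one_right[OF yc] by (simp add: lamc_def \<sigma>_a)
      have inU: "\<forall>\<^sub>F z in nhds a. lam (\<sigma> y) (\<sigma> z) \<in> U"
        using eventually_ball_near[of a r "\<lambda>z. lam (\<sigma> y) (\<sigma> z) \<in> U" a] r(2) elim ab by blast
      have "\<Theta> v (\<sigma> y) = fderiv (\<lambda>z. \<phi> (\<sigma> (lamc (y, z)))) a v"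
        unfolding \<Theta>_def
        by (rule fderiv_cong_at) (use inU in eventually_elim, simp add: lamc_def param_chart[OF M c])
      also have "\<dots> = fderiv (\<lambda>y. \<phi> (\<sigma> y)) (lamc (y, a)) (fderiv (\<lambda>z. lamc (y, z)) a v)"
        using sm[of \<one>] la unfolding smooth_at_to_euclid[OF M c one_U]
        by (intro fderiv_compose[OF fderiv_partial_snd(1)[OF smy]]) simp
      also have "\<dots> = l (proj V (fderiv lamc (y, a) (0, v)))"
        unfolding la d\<phi> fderiv_partial_snd(2)[OF smy] ..
      also have "fderiv (\<lambda>z. lamc (y, z)) a v \<in> V"
        by (rule fderiv_in_subspace[OF V fderiv_partial_snd(1)[OF smy]])
          (use inU in eventually_elim, simp add: lamc_def chart_in_model[OF M c])
      then have "proj V (fderiv lamc (y, a) (0, v)) = fderiv lamc (y, a) (0, v)"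
        unfolding fderiv_partial_snd(2)[OF smy] by (rule proj_id[OF V])
      finally show ?case by simp
    qed
    have sml: "smooth_near (\<lambda>y. l (fderiv lamc (y, a) (0, v))) a"
      by (rule smooth_near_compose_linear[OF l fderiv_partial_fst(1)[OF D]])
    show ?thesis
    proof (rule stationaryI[OF M c one_U smooth_near_cong[OF sml eq]])
      fix u assume u: "u \<in> V"
      have "fderiv (\<lambda>y. \<Theta> v (\<sigma> y)) a u = fderiv (\<lambda>y. l (fderiv lamc (y, a) (0, v))) a u"
        using fderiv_cong_at[OF eq] by simp
      also have "\<dots> = l (mixed_deriv lamc a u v)"
        unfolding fderiv_compose_linear[OF l fderiv_partial_fst(1)[OF D]] fderiv_partial_fst(2)[OF D] mixed_deriv_def ..
      finally show "fderiv (\<lambda>y. \<Theta> v (\<sigma> y)) a u = 0" using tri[OF u v] by simp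
    qed
  qed
  have st: "stationary M (\<Theta> v) g1" if v: "v \<in> V" and g1: "g1 \<in> carrier G" for v g1
  proof -
    (* As \<lambda> is an action of (G,\<circ>), \<Theta> v is the right translate of \<Theta> v', with v' the image of v
       under the differential of lam g1. *)
    define v' where "v' = fderiv (\<lambda>y. \<kappa> (lam g1 (\<sigma> y))) a v"
    have l1: "cont_at (mtop M) (mtop M) (lam g1) \<one>" "smooth_near (\<lambda>y. \<kappa> (lam g1 (\<sigma> y))) a"
      using smooth_lam_right[OF g1 one_closed] smooth_at_charts[where f="lam g1", OF M M c one_U c] lam_one_right[OF g1] one_U
      by auto
    obtain Q where Q: "openin (mtop M) Q" "\<one> \<in> Q" "lam g1 ` Q \<subseteq> U"
      using cont_atD[OF l1(1) chart_open[OF M c]] lam_one_right[OF g1] one_U by metis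
    have inU: "\<forall>\<^sub>F y in nhds a. \<sigma> y \<in> U \<and> lam g1 (\<sigma> y) \<in> U"
      using eventually_param_near[OF M c Q(1,2) one_U] evU by eventually_elim (use Q(3) in auto)
    have v': "v' \<in> V" unfolding v'_def
      by (rule fderiv_in_subspace[OF V l1(2)]) (use inU in eventually_elim, simp add: chart_in_model[OF M c])
    have eq: "\<Theta> v' (g \<otimes>\<^bsub>H\<^esub> inv\<^bsub>H\<^esub> g1) = \<Theta> v g" if g: "g \<in> points M" for g
    proof -
      define k where "k = g \<otimes>\<^bsub>H\<^esub> inv\<^bsub>H\<^esub> g1"
      have gc: "g \<in> carrier G" using g by (simp add: points_eq)
      have kc: "k \<in> carrier G" using gc g1 H.inv_closed[of g1] carrier_H by (simp add: k_def)
      have kg: "k \<otimes>\<^bsub>H\<^esub> g1 = g" using gc g1 H.inv_closed[of g1] carrier_H by (simp add: k_def H.m_assoc)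
      have "\<Theta> v g = fderiv (\<lambda>y. \<phi> (lam k (\<sigma> (\<kappa> (lam g1 (\<sigma> y)))))) a v"
        unfolding \<Theta>_def
      proof (rule fderiv_cong_at)
        show "\<forall>\<^sub>F y in nhds a. \<phi> (lam g (\<sigma> y)) = \<phi> (lam k (\<sigma> (\<kappa> (lam g1 (\<sigma> y)))))"
          using inU
        proof eventually_elim
          case (elim y)
          then have "\<sigma> y \<in> carrier G" using chart_subset[OF M c] points_eq by blast
          then have "lam g (\<sigma> y) = lam k (lam g1 (\<sigma> y))" using lam_comp[OF kc g1] kg by simp
          then show ?case using elim by (simp add: param_chart[OF M c])
        qed
      qed
      also have "\<dots> = fderiv (\<lambda>y. \<phi> (lam k (\<sigma> y))) (\<kappa> (lam g1 (\<sigma> a))) v'"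
        unfolding v'_def using sm_lam[OF kc one_closed] unfolding smooth_at_to_euclid[OF M c one_U]
        by (intro fderiv_compose[OF l1(2)]) (simp add: \<sigma>_a lam_one_right[OF g1])
      also have "\<dots> = \<Theta> v' k" by (simp add: \<Theta>_def \<sigma>_a lam_one_right[OF g1])
      finally show ?thesis by (simp add: k_def)
    qed
    have g1p: "g1 \<in> points M" using g1 by (simp add: points_eq)
    have "smooth_at M M (\<lambda>g. g \<otimes>\<^bsub>H\<^esub> inv\<^bsub>H\<^esub> g1) g1"
      using H.inv_closed[of g1] g1 carrier_H by (intro H.smooth_at_translation(2)) auto
    moreover have "g1 \<otimes>\<^bsub>H\<^esub> inv\<^bsub>H\<^esub> g1 = \<one>" using H.r_inv[of g1, unfolded carrier_H one_H] g1 by simp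
    ultimately have "stationary M (\<lambda>g. \<Theta> v' (g \<otimes>\<^bsub>H\<^esub> inv\<^bsub>H\<^esub> g1)) g1"
      using stationary_compose[OF M M, of "\<lambda>g. g \<otimes>\<^bsub>H\<^esub> inv\<^bsub>H\<^esub> g1" g1 "\<Theta> v'"] st1[OF v'] by simp
    then show ?thesis by (rule stationary_cong[OF M _ openin_topspace g1p eq])
  qed
  have \<Theta>: "\<Theta> v g = fderiv (\<lambda>y. \<phi> (\<sigma> y)) a v" if "v \<in> V" for v
  proof -
    have "\<Theta> v g = \<Theta> v \<one>"
      by (rule stationary_imp_constant[OF M conn]) (use st[OF that] g points_eq in auto)
    also have "\<dots> = fderiv (\<lambda>y. \<phi> (\<sigma> y)) a v"
      unfolding \<Theta>_def
      by (rule fderiv_cong_at) (use evU in eventually_elim, use chart_subset[OF M c] points_eq in \<open>simp add: lam_one\<close>)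
    finally show ?thesis .
  qed
  have smc: "smooth_near (\<lambda>y. \<phi> (lam g (\<sigma> y))) a" "smooth_near (\<lambda>y. \<phi> (\<sigma> y)) a"
    using sm_lam[OF g one_closed] sm[OF one_closed] unfolding smooth_at_to_euclid[OF M c one_U] by simp_all
  have st0: "stationary M (\<lambda>x. \<phi> (lam g x) - \<phi> x) \<one>"
    by (rule stationaryI[OF M c one_U smooth_near_minus[OF smc]])
      (use \<Theta> in \<open>simp add: fderiv_minus[OF smc] \<Theta>_def\<close>)
  have "\<phi> (lam g x) - \<phi> x = 0"
    by (rule stationary_hom_zero[OF _ st0 conn x]) (use g in \<open>simp add: lam_mult hom\<close>)
  then show ?thesis by simp
qed

end

section \<open>The kernel as a submanifold\<close>

lemma proj_complement:
  assumes V: "subspace V" and W: "subspace W" "W \<subseteq> V"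
  defines "C \<equiv> {v \<in> V. \<forall>w\<in>W. v \<bullet> w = 0}"
  shows "subspace C" "proj C (proj V x) = proj C x" "proj V x = proj C x + proj W x"
    "v \<in> V \<Longrightarrow> proj C v = 0 \<longleftrightarrow> v \<in> W"
proof -
  show C: "subspace C"
    unfolding C_def subspace_def using V by (auto simp: subspace_0 subspace_add subspace_scale inner_add_left)
  have CV: "C \<subseteq> V" by (auto simp: C_def)
  have D: "proj V x - proj W x \<in> C" for x
  proof -
    have "proj V x - proj W x \<in> V" using proj_in[OF V] proj_in[OF W(1)] W(2) V by (meson subspace_diff subsetD)
    moreover have "(proj V x - proj W x) \<bullet> w = 0" if "w \<in> W" for w
    proof -
      have "(x - proj W x) \<bullet> w - (x - proj V x) \<bullet> w = 0"
        using proj_orth[OF W(1) that] proj_orth[OF V] that W(2) by auto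
      then show ?thesis by (simp add: inner_diff_left)
    qed
    ultimately show ?thesis by (simp add: C_def)
  qed
  have E: "proj C x = proj V x - proj W x" for x
  proof (rule proj_unique[OF C D])
    fix w assume w: "w \<in> C"
    have "(x - proj V x) \<bullet> w = 0" using proj_orth[OF V] w CV by blast
    moreover have "proj W x \<bullet> w = 0" using w proj_in[OF W(1)] by (auto simp: C_def inner_commute)
    ultimately show "(x - (proj V x - proj W x)) \<bullet> w = 0" by (simp add: inner_diff_left)
  qed
  show "proj V x = proj C x + proj W x" by (simp add: E)
  show "proj C (proj V x) = proj C x"
  proof (rule proj_unique[OF C proj_in[OF C]])
    fix w assume w: "w \<in> C"
    have "(x - proj V x) \<bullet> w = 0" using proj_orth[OF V] w CV by blast
    moreover have "(x - proj C x) \<bullet> w = 0" by (rule proj_orth[OF C w])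
    ultimately show "(proj V x - proj C x) \<bullet> w = 0" by (simp add: inner_diff_left)
  qed
  assume v: "v \<in> V"
  have "proj C v = v - proj W v" using E[of v] proj_id[OF V v] by simp
  then show "proj C v = 0 \<longleftrightarrow> v \<in> W" using proj_id[OF W(1)] proj_in[OF W(1)] by (metis eq_iff_diff_eq_0)
qed

text \<open>The situation after the construction of \<open>\<phi>\<close>: in the chart at the identity, \<open>Vi\<close> is the
  ideal, \<open>C\<close> its orthogonal complement, and \<open>\<phi>\<close> a homomorphism to \<open>C\<close> whose differential at
  the identity is the projection along \<open>Vi\<close>.\<close>

locale brace_hom_chart = lie_brace_chart M G U \<kappa> H
  for M :: "('a, 'e::euclidean_space) mfd" and G :: "'a monoid" (structure) and U \<kappa> H +
  fixes Vi :: "'e set" and C :: "'e set" and \<phi> :: "'a \<Rightarrow> 'e"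
  assumes Vi: "subspace Vi" "Vi \<subseteq> V"
    and C_def: "C = {v \<in> V. \<forall>w\<in>Vi. v \<bullet> w = 0}"
    and hom: "\<And>x y. x \<in> carrier G \<Longrightarrow> y \<in> carrier G \<Longrightarrow> \<phi> (x \<otimes> y) = \<phi> x + \<phi> y"
    and lam_inv: "\<And>g x. g \<in> carrier G \<Longrightarrow> x \<in> carrier G \<Longrightarrow> \<phi> (lam g x) = \<phi> x"
    and sm\<phi>: "\<And>p. p \<in> carrier G \<Longrightarrow> smooth_at M euclid \<phi> p"
    and \<phi>_C: "\<And>x. x \<in> carrier G \<Longrightarrow> \<phi> x \<in> C"
    and d\<phi>: "\<And>v. fderiv (\<lambda>y. \<phi> (\<sigma> y)) a v = proj C v"
begin

lemma C: "subspace C"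
  and proj_split: "proj V x = proj C x + proj Vi x"
  and proj_C_zero: "v \<in> V \<Longrightarrow> proj C v = 0 \<longleftrightarrow> v \<in> Vi"
  using proj_complement[OF V Vi] unfolding C_def[symmetric] by blast+

lemma hom_H: "x \<in> carrier G \<Longrightarrow> y \<in> carrier G \<Longrightarrow> \<phi> (x \<otimes>\<^bsub>H\<^esub> y) = \<phi> x + \<phi> y"
  by (simp add: mult_H hom lam_inv)

lemma \<phi>_one: "\<phi> \<one> = 0"
  using hom[of \<one> \<one>] by simp

lemma \<phi>_inv: "x \<in> carrier G \<Longrightarrow> \<phi> (inv x) = - \<phi> x"
  using hom[of x "inv x"] \<phi>_one by (simp add: eq_neg_iff_add_eq_0 add.commute)

lemma inv_H_closed: "x \<in> carrier G \<Longrightarrow> inv\<^bsub>H\<^esub> x \<in> carrier G"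
  using H.inv_closed carrier_H by simp

lemma \<phi>_inv_H: "x \<in> carrier G \<Longrightarrow> \<phi> (inv\<^bsub>H\<^esub> x) = - \<phi> x"
  using hom_H[of x "inv\<^bsub>H\<^esub> x"] inv_H_closed \<phi>_one H.r_inv[of x, unfolded carrier_H one_H]
  by (simp add: eq_neg_iff_add_eq_0 add.commute)

lemma continuous_map_from_euclid:
  assumes "\<And>y. y \<in> B \<Longrightarrow> smooth_at euclid M f y"
  shows "continuous_map (top_of_set B) (mtop M) f"
proof (rule continuous_map_of_cont_at)
  fix y assume "y \<in> topspace (top_of_set B)"
  then have y: "y \<in> B" by simp
  have "continuous_map (top_of_set B) euclidean (\<lambda>y. y)" by simp
  then have 1: "cont_at (top_of_set B) euclidean (\<lambda>y. y) y"
    by (rule cont_at_of_continuous_map) (simp add: y)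
  have "cont_at euclidean (mtop M) f y"
    using smooth_at_cont[OF smooth_atlas_euclid M assms[OF y]] by (simp add: flat_def)
  then show "cont_at (top_of_set B) (mtop M) f y" by (rule cont_at_compose[OF 1])
qed

definition "K = {x \<in> carrier G. \<phi> x = 0}"

definition "I = connected_component_of_set (subtopology (mtop M) K) \<one>"

lemma K_carrier: "K \<subseteq> carrier G" by (auto simp: K_def)

lemma one_K: "\<one> \<in> K" by (simp add: K_def \<phi>_one)

lemma topspace_K: "topspace (subtopology (mtop M) K) = K"
  using K_carrier points_eq by auto

lemma I_K: "I \<subseteq> K"
  unfolding I_def using connected_component_of_subset_topspace[of "subtopology (mtop M) K" \<one>] topspace_K by simp

lemma I_carrier: "x \<in> I \<Longrightarrow> x \<in> carrier G" using I_K K_carrier by blast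

lemma one_I: "\<one> \<in> I"
  unfolding I_def using connected_component_of_refl[of "subtopology (mtop M) K" \<one>] one_K topspace_K points_eq by simp

lemma connected_I: "connectedin (mtop M) I"
  using connectedin_connected_component_of[of "subtopology (mtop M) K" \<one>]
  unfolding I_def connectedin_subtopology by simp

lemma I_maximal:
  assumes "connectedin (mtop M) S" "S \<subseteq> K" "x \<in> S" "x \<in> I"
  shows "S \<subseteq> I"
proof -
  have "connectedin (subtopology (mtop M) K) S" using assms by (simp add: connectedin_subtopology)
  then have "S \<subseteq> connected_component_of_set (subtopology (mtop M) K) x"
    using assms(3) connected_component_of_maximal by metis
  moreover have "connected_component_of_set (subtopology (mtop M) K) x = I"
    using assms(4) unfolding I_def by (metis connected_component_of_equiv mem_Collect_eq)
  ultimately show ?thesis by simp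
qed

text \<open>Continuous self-maps of the kernel that do not move the identity out of its component
  preserve that component.\<close>

lemma I_image:
  assumes f: "continuous_map (mtop M) (mtop M) f" and fK: "\<And>x. x \<in> K \<Longrightarrow> f x \<in> K" and f1: "f \<one> \<in> I"
    and x: "x \<in> I"
  shows "f x \<in> I"
proof -
  have "f ` I \<subseteq> I"
  proof (rule I_maximal[OF _ _ _ f1])
    show "connectedin (mtop M) (f ` I)" by (rule connectedin_continuous_map_image[OF f connected_I])
    show "f ` I \<subseteq> K" using fK I_K by blast
    show "f \<one> \<in> f ` I" using one_I by blast
  qed
  then show ?thesis using x by blast
qed

lemma continuous_of_smooth: "(\<And>x. x \<in> carrier G \<Longrightarrow> smooth_at M M f x) \<Longrightarrow> continuous_map (mtop M) (mtop M) f"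
  by (rule continuous_map_of_cont_at) (use smooth_at_cont[OF M M] points_eq in auto)

lemma I_mult: "x \<in> I \<Longrightarrow> y \<in> I \<Longrightarrow> x \<otimes> y \<in> I"
  by (rule I_image[of "\<lambda>y. x \<otimes> y"])
    (use I_carrier I_K in \<open>auto intro!: continuous_of_smooth smooth_at_translation simp: K_def hom\<close>)

lemma I_mult_H: "x \<in> I \<Longrightarrow> y \<in> I \<Longrightarrow> x \<otimes>\<^bsub>H\<^esub> y \<in> I"
proof (rule I_image[of "\<lambda>y. x \<otimes>\<^bsub>H\<^esub> y"])
  assume x: "x \<in> I" and y: "y \<in> I"
  have xc: "x \<in> carrier G" "\<phi> x = 0" using x I_K by (auto simp: K_def)
  show "continuous_map (mtop M) (mtop M) (\<lambda>y. x \<otimes>\<^bsub>H\<^esub> y)"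
    using xc carrier_H by (intro continuous_of_smooth H.smooth_at_translation) auto
  show "x \<otimes>\<^bsub>H\<^esub> y \<in> K" if "y \<in> K" for y using that xc by (simp add: K_def hom_H)
  show "x \<otimes>\<^bsub>H\<^esub> \<one> \<in> I" using x xc H.r_one[of x, unfolded carrier_H one_H] by simp
qed

lemma I_inv: "x \<in> I \<Longrightarrow> inv x \<in> I"
proof (rule I_image[of "\<lambda>x. inv x"])
  show "continuous_map (mtop M) (mtop M) (\<lambda>x. inv x)" by (intro continuous_of_smooth smooth_inv)
qed (auto simp: K_def \<phi>_inv one_I)

lemma I_inv_H: "x \<in> I \<Longrightarrow> inv\<^bsub>H\<^esub> x \<in> I"
proof (rule I_image[of "\<lambda>x. inv\<^bsub>H\<^esub> x"])
  show "continuous_map (mtop M) (mtop M) (\<lambda>x. inv\<^bsub>H\<^esub> x)"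
    using carrier_H by (intro continuous_of_smooth H.smooth_inv) simp
  show "inv\<^bsub>H\<^esub> \<one> \<in> I" using H.inv_one[unfolded one_H] one_I by simp
qed (auto simp: K_def \<phi>_inv_H inv_H_closed)

lemma I_conj:
  assumes g: "g \<in> carrier G" and x: "x \<in> I" shows "g \<otimes> x \<otimes> inv g \<in> I"
proof (rule I_image[of "\<lambda>x. g \<otimes> x \<otimes> inv g", OF _ _ _ x])
  show "continuous_map (mtop M) (mtop M) (\<lambda>x. g \<otimes> x \<otimes> inv g)"
    using g points_eq
    by (intro continuous_of_smooth smooth_at_mult[OF M] smooth_at_const[OF M M] smooth_at_translation) auto
qed (use g in \<open>auto simp: K_def hom \<phi>_inv one_I\<close>)

lemma I_conj_H:
  assumes g: "g \<in> carrier G" and x: "x \<in> I" shows "g \<otimes>\<^bsub>H\<^esub> x \<otimes>\<^bsub>H\<^esub> inv\<^bsub>H\<^esub> g \<in> I"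
proof (rule I_image[of "\<lambda>x. g \<otimes>\<^bsub>H\<^esub> x \<otimes>\<^bsub>H\<^esub> inv\<^bsub>H\<^esub> g", OF _ _ _ x])
  show "continuous_map (mtop M) (mtop M) (\<lambda>x. g \<otimes>\<^bsub>H\<^esub> x \<otimes>\<^bsub>H\<^esub> inv\<^bsub>H\<^esub> g)"
    using g points_eq carrier_H inv_H_closed
    by (intro continuous_of_smooth H.smooth_at_mult[OF M] smooth_at_const[OF M M] H.smooth_at_translation) auto
  show "g \<otimes>\<^bsub>H\<^esub> x \<otimes>\<^bsub>H\<^esub> inv\<^bsub>H\<^esub> g \<in> K" if "x \<in> K" for x
    using that g inv_H_closed[OF g] by (simp add: K_def hom_H \<phi>_inv_H)
  show "g \<otimes>\<^bsub>H\<^esub> \<one> \<otimes>\<^bsub>H\<^esub> inv\<^bsub>H\<^esub> g \<in> I"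
    using g one_I H.r_one[of g, unfolded carrier_H one_H] H.r_inv[of g, unfolded carrier_H one_H] by simp
qed

lemma I_lam:
  assumes g: "g \<in> carrier G" and x: "x \<in> I" shows "lam g x \<in> I"
proof (rule I_image[of "lam g", OF _ _ _ x])
  show "continuous_map (mtop M) (mtop M) (lam g)" by (intro continuous_of_smooth smooth_lam_right g)
qed (use g in \<open>auto simp: K_def lam_inv lam_one_right one_I\<close>)

lemma lam_I: assumes g: "g \<in> carrier G" shows "lam g ` I = I"
proof
  show "lam g ` I \<subseteq> I" using I_lam[OF g] by blast
  show "I \<subseteq> lam g ` I"
  proof
    fix x assume x: "x \<in> I"
    have "lam g (lam (inv\<^bsub>H\<^esub> g) x) = lam (g \<otimes>\<^bsub>H\<^esub> inv\<^bsub>H\<^esub> g) x"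
      using lam_comp[OF g inv_H_closed[OF g] I_carrier[OF x]] by simp
    also have "\<dots> = x" using lam_one[OF I_carrier[OF x]] H.r_inv[of g, unfolded carrier_H one_H] g by simp
    finally show "x \<in> lam g ` I" using I_lam[OF inv_H_closed[OF g] x] by (metis image_eqI)
  qed
qed

lemma subgroup_I: "subgroup I G"
  by (rule subgroupI) (use I_carrier one_I I_inv I_mult in auto)

lemma subgroup_I_H: "subgroup I H"
  by (rule H.subgroupI) (use I_carrier one_I I_inv_H I_mult_H carrier_H in auto)

lemma normal_I: "normal I G"
  unfolding normal_inv_iff using subgroup_I I_conj by blast

lemma normal_I_H: "normal I H"
  unfolding H.normal_inv_iff using subgroup_I_H I_conj_H carrier_H by simp

lemma closed_I: "closedin (mtop M) I"
proof -
  have "continuous_map (mtop M) euclidean \<phi>"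
    by (rule continuous_map_of_cont_at)
      (use smooth_at_cont[OF M smooth_atlas_euclid sm\<phi>] points_eq in \<open>auto simp: flat_def\<close>)
  from closedin_continuous_map_preimage[OF this, of "{0}"]
  have "closedin (mtop M) {x \<in> topspace (mtop M). \<phi> x \<in> {0}}" by simp
  then have "closedin (mtop M) K" by (simp add: K_def points_eq)
  then show ?thesis
    using closedin_trans_full closedin_connected_component_of unfolding I_def by metis
qed

subsection \<open>A slice of the kernel at the identity\<close>

text \<open>The coordinates \<open>\<Phi>\<close> straighten \<open>\<phi>\<close>: their derivative at \<open>a\<close> is the identity, and a point of
  the chart lies in the kernel iff \<open>\<Phi>\<close> maps its coordinates into \<open>Vi\<close>.\<close>

definition \<Phi> :: "'e \<Rightarrow> 'e" where
  "\<Phi> x = \<phi> (\<sigma> x) + (proj Vi (x - a) + (x - proj V x))"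

lemma smooth_near_\<phi>: "smooth_near (\<lambda>y. \<phi> (\<sigma> y)) a"
  using sm\<phi>[OF one_closed] unfolding smooth_at_to_euclid[OF M c one_U] .

lemma smooth_near_\<Phi>: "smooth_near \<Phi> a" and fderiv_\<Phi>: "fderiv \<Phi> a v = v"
proof -
  have 1: "smooth_near (\<lambda>x. proj Vi (x - a)) a"
    by (intro smooth_near_compose_linear[OF bounded_linear_proj[OF Vi(1)]] smooth_near_minus smooth_near_id smooth_near_const)
  have 2: "smooth_near (\<lambda>x. x - proj V x) a"
    by (intro smooth_near_minus smooth_near_id smooth_near_proj[OF V])
  show "smooth_near \<Phi> a"
    unfolding \<Phi>_def[abs_def] by (intro smooth_near_add smooth_near_\<phi> 1 2)
  have d1: "fderiv (\<lambda>x. proj Vi (x - a)) a v = proj Vi v"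
    using fderiv_compose_linear[OF bounded_linear_proj[OF Vi(1)] smooth_near_minus[OF smooth_near_id smooth_near_const], of a a v]
    by (simp add: fderiv_minus[OF smooth_near_id smooth_near_const] fderiv_const fderiv_linear[OF bounded_linear_ident])
  have d2: "fderiv (\<lambda>x. x - proj V x) a v = v - proj V v"
    by (simp add: fderiv_minus[OF smooth_near_id smooth_near_proj[OF V]] fderiv_linear[OF bounded_linear_ident]
        fderiv_linear[OF bounded_linear_proj[OF V]])
  show "fderiv \<Phi> a v = v"
    unfolding \<Phi>_def[abs_def] fderiv_add[OF smooth_near_\<phi> smooth_near_add[OF 1 2]] fderiv_add[OF 1 2] d1 d2 d\<phi>
    using proj_split[of v] by simp
qed

lemma \<Phi>_a: "\<Phi> a = 0"
  by (simp add: \<Phi>_def \<sigma>_a \<phi>_one proj_zero[OF Vi(1)] proj_id[OF V a_V])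

lemma \<Phi>_in_Vi:
  assumes "proj V x \<in> \<kappa> ` U" "\<Phi> x \<in> Vi"
  shows "x \<in> V" "\<sigma> x \<in> K" "\<Phi> x = proj Vi (x - a)"
proof -
  have \<sigma>c: "\<sigma> x \<in> carrier G" using chart_subset[OF M c chart_param(1)[OF M c assms(1)]] points_eq by simp
  have \<phi>C: "\<phi> (\<sigma> x) \<in> C" by (rule \<phi>_C[OF \<sigma>c])
  have CV: "C \<subseteq> V" by (auto simp: C_def)
  define n where "n = x - proj V x"
  have "n = \<Phi> x - \<phi> (\<sigma> x) - proj Vi (x - a)" by (simp add: n_def \<Phi>_def)
  moreover have "\<Phi> x - \<phi> (\<sigma> x) - proj Vi (x - a) \<in> V"
    using assms(2) \<phi>C CV Vi proj_in[OF Vi(1)] V by (intro subspace_diff) auto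
  ultimately have "n \<in> V" by simp
  then have "n \<bullet> n = 0" unfolding n_def by (rule proj_orth[OF V])
  then have n: "n = 0" by simp
  then show "x \<in> V" using proj_in[OF V, of x] by (simp add: n_def)
  have "\<phi> (\<sigma> x) = \<Phi> x - proj Vi (x - a)" using n by (simp add: \<Phi>_def n_def)
  also have "\<dots> \<in> Vi" using assms(2) proj_in[OF Vi(1)] Vi(1) by (intro subspace_diff) auto
  finally have "\<phi> (\<sigma> x) \<bullet> \<phi> (\<sigma> x) = 0" using \<phi>C by (simp add: C_def)
  then have "\<phi> (\<sigma> x) = 0" by simp
  then show "\<sigma> x \<in> K" "\<Phi> x = proj Vi (x - a)" using \<sigma>c n by (simp_all add: K_def \<Phi>_def n_def)
qed

definition \<tau> :: "'a \<Rightarrow> 'e" where "\<tau> q = proj Vi (\<kappa> q - a)"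

lemma \<tau>_Vi: "\<tau> q \<in> Vi" by (simp add: \<tau>_def proj_in[OF Vi(1)])

lemma smooth_at_\<tau>: "q \<in> U \<Longrightarrow> smooth_at M euclid \<tau> q"
  unfolding \<tau>_def
  by (rule smooth_at_compose[OF M smooth_atlas_euclid smooth_atlas_euclid smooth_at_chart[OF M c], where g="\<lambda>x. proj Vi (x - a)"])
    (auto simp: smooth_at_euclid intro!: smooth_near_compose_linear[OF bounded_linear_proj[OF Vi(1)]] smooth_near_minus smooth_near_id smooth_near_const)

text \<open>The slice \<open>Y\<close> is the part of \<open>I\<close> in the chart on which \<open>\<Phi>\<close> is invertible; \<open>s\<close> is its
  parametrisation \<open>\<sigma> \<circ> \<Phi>\<inverse>\<close> by a ball \<open>B\<close> of \<open>Vi\<close>, with inverse \<open>\<tau>\<close>.  As \<open>B\<close> is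
  connected, so is its image; hence it lies in the identity component.\<close>

lemma slice_exists:
  "\<exists>s B Y A. openin (top_of_set Vi) B \<and> 0 \<in> B \<and> openin (mtop M) A \<and> A \<subseteq> U \<and> Y = I \<inter> A \<and>
     (\<forall>y\<in>B. s y \<in> Y \<and> \<tau> (s y) = y) \<and> (\<forall>q\<in>Y. \<tau> q \<in> B \<and> s (\<tau> q) = q) \<and> s 0 = \<one> \<and>
     (\<forall>y. proj Vi y \<in> B \<longrightarrow> smooth_at euclid M (\<lambda>y. s (proj Vi y)) y) \<and>
     (\<forall>v. fderiv (\<lambda>y. \<kappa> (s (proj Vi y))) 0 v = proj Vi v)"
proof -
  define N where "N = proj V -` (\<kappa> ` U)"
  have N: "open N" "a \<in> N"
    unfolding N_def using open_param_domain[OF M c] one_U by (auto simp: proj_chart[OF M c one_U])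
  obtain S T \<Psi> where inv: "open S" "a \<in> S" "S \<subseteq> N" "open T" "\<Phi> a \<in> T" "homeomorphism S T \<Phi> \<Psi>"
    "\<And>y. y \<in> T \<Longrightarrow> smooth_near \<Psi> y" "\<And>v. fderiv \<Psi> (\<Phi> a) v = v"
    using smooth_local_inverse[OF smooth_near_\<Phi> fderiv_\<Phi> N] by metis
  obtain \<rho> where \<rho>: "\<rho> > 0" "ball 0 \<rho> \<subseteq> T"
    using inv(4,5) \<Phi>_a open_contains_ball by metis
  define B where "B = Vi \<inter> ball 0 \<rho>"
  have B: "openin (top_of_set Vi) B" unfolding B_def by (simp add: openin_open_Int)
  have B0: "0 \<in> B" using subspace_0[OF Vi(1)] \<rho>(1) by (simp add: B_def)
  have BT: "y \<in> T" if "y \<in> B" for y using that \<rho>(2) by (auto simp: B_def)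
  define s where "s y = \<sigma> (\<Psi> y)" for y
  have \<Psi>: "\<Psi> y \<in> S" "\<Phi> (\<Psi> y) = y" if "y \<in> T" for y
    using inv(6) that by (auto simp: homeomorphism_def)
  have \<Psi>\<Phi>: "\<Psi> (\<Phi> x) = x" if "x \<in> S" for x using inv(6) that by (auto simp: homeomorphism_def)
  have SN: "proj V x \<in> \<kappa> ` U" if "x \<in> S" for x using inv(3) that by (auto simp: N_def)
  have sB: "\<Psi> y \<in> V" "s y \<in> K" "s y \<in> U" "\<kappa> (s y) = \<Psi> y" "\<tau> (s y) = y" if y: "y \<in> B" for y
  proof -
    note p = \<Psi>[OF BT[OF y]]
    have "\<Phi> (\<Psi> y) \<in> Vi" using p(2) y by (simp add: B_def)
    note * = \<Phi>_in_Vi[OF SN[OF p(1)] this] chart_param[OF M c SN[OF p(1)]]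
    show "\<Psi> y \<in> V" "s y \<in> K" "s y \<in> U" using * by (simp_all add: s_def)
    show "\<kappa> (s y) = \<Psi> y" using *(5) proj_id[OF V *(1)] by (simp add: s_def)
    then show "\<tau> (s y) = y" using *(3) p(2) by (simp add: \<tau>_def)
  qed
  have s0: "s 0 = \<one>" using \<Psi>\<Phi>[OF inv(2)] \<Phi>_a by (simp add: s_def \<sigma>_a)
  have sms: "smooth_at euclid M (\<lambda>y. s (proj Vi y)) y" if y: "proj Vi y \<in> B" for y
    unfolding s_def
  proof (rule smooth_at_compose[OF smooth_atlas_euclid smooth_atlas_euclid M, where f="\<lambda>y. \<Psi> (proj Vi y)"])
    show "smooth_at euclid euclid (\<lambda>y. \<Psi> (proj Vi y)) y"
      unfolding smooth_at_euclid
      by (rule smooth_near_compose[OF smooth_near_proj[OF Vi(1)] inv(7)[OF BT[OF y]]])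
    show "smooth_at euclid M \<sigma> (\<Psi> (proj Vi y))"
      by (rule smooth_at_param[OF M c SN[OF \<Psi>(1)[OF BT[OF y]]]])
  qed
  have sI: "s ` B \<subseteq> I"
  proof (rule I_maximal[where x = \<one>])
    have pB: "proj Vi y = y" if "y \<in> B" for y using that proj_id[OF Vi(1)] by (simp add: B_def)
    have cs: "continuous_map (top_of_set B) (mtop M) (\<lambda>y. s (proj Vi y))"
      using sms pB by (intro continuous_map_from_euclid) auto
    have "convex B" unfolding B_def by (intro convex_Int subspace_imp_convex Vi(1) convex_ball)
    then have "connectedin (top_of_set B) B" by (simp add: connectedin_subtopology convex_connected)
    from connectedin_continuous_map_image[OF cs this]
    show "connectedin (mtop M) (s ` B)" using pB by (simp cong: image_cong)
    show "s ` B \<subseteq> K" using sB(2) by blast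
    show "\<one> \<in> s ` B" using s0 B0 by force
  qed (rule one_I)
  define A where "A = {q \<in> U. \<kappa> q \<in> S \<inter> \<Phi> -` ball 0 \<rho>}"
  have A: "openin (mtop M) A"
  proof -
    have "continuous_on S \<Phi>" using inv(6) by (simp add: homeomorphism_def)
    then have "open (S \<inter> \<Phi> -` ball 0 \<rho>)" by (intro continuous_open_preimage inv(1)) auto
    then show ?thesis unfolding A_def by (rule chart_preimage_open[OF M c])
  qed
  have sY: "s y \<in> I \<inter> A" if y: "y \<in> B" for y
    using sI sB[OF y] \<Psi>[OF BT[OF y]] y by (auto simp: A_def B_def)
  have Ys: "\<tau> q \<in> B \<and> s (\<tau> q) = q" if q: "q \<in> I \<inter> A" for q
  proof -
    have q': "q \<in> U" "\<kappa> q \<in> S" "\<Phi> (\<kappa> q) \<in> ball 0 \<rho>" "\<phi> q = 0" using q I_K by (auto simp: A_def K_def)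
    have "\<Phi> (\<kappa> q) = \<tau> q"
      using q' param_chart[OF M c q'(1)] proj_chart[OF M c q'(1)] by (simp add: \<Phi>_def \<tau>_def)
    then have "\<tau> q \<in> B" "s (\<tau> q) = q"
      using q' \<tau>_Vi \<Psi>\<Phi>[OF q'(2)] param_chart[OF M c q'(1)] by (auto simp: B_def s_def)
    then show ?thesis by simp
  qed
  have ds: "fderiv (\<lambda>y. \<kappa> (s (proj Vi y))) 0 v = proj Vi v" for v
  proof -
    have "\<forall>\<^sub>F y in nhds 0. proj Vi y \<in> B"
    proof -
      have "open (proj Vi -` B)" by (rule open_vimage_proj[OF Vi(1) B])
      from eventually_nhds_in_open[OF this, of 0] show ?thesis using B0 proj_zero[OF Vi(1)] by simp
    qed
    then have "\<forall>\<^sub>F y in nhds 0. \<kappa> (s (proj Vi y)) = \<Psi> (proj Vi y)"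
      by eventually_elim (rule sB(4))
    then have "fderiv (\<lambda>y. \<kappa> (s (proj Vi y))) 0 v = fderiv (\<lambda>y. \<Psi> (proj Vi y)) 0 v" by (rule fderiv_cong_at)
    also have "\<dots> = fderiv \<Psi> (proj Vi 0) (fderiv (proj Vi) 0 v)"
      by (rule fderiv_compose[OF smooth_near_proj[OF Vi(1)]]) (simp add: proj_zero[OF Vi(1)] inv(7)[OF BT[OF B0]])
    also have "\<dots> = proj Vi v"
      using inv(8) \<Phi>_a by (simp add: proj_zero[OF Vi(1)] fderiv_linear[OF bounded_linear_proj[OF Vi(1)]])
    finally show ?thesis .
  qed
  show ?thesis
    by (intro exI[of _ s] exI[of _ B] exI[of _ "I \<inter> A"] exI[of _ A] conjI ballI allI impI)
      (use B B0 A sY Ys s0 sms ds sB in \<open>auto simp: A_def\<close>)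
qed

end

subsection \<open>The Lie subgroup structure\<close>

locale brace_slice = brace_hom_chart M G U \<kappa> H Vi C \<phi>
  for M :: "('a, 'e::euclidean_space) mfd" and G :: "'a monoid" (structure) and U \<kappa> H Vi C \<phi> +
  fixes s :: "'e \<Rightarrow> 'a" and B :: "'e set" and Y A :: "'a set"
  assumes B: "openin (top_of_set Vi) B" "0 \<in> B"
    and A: "openin (mtop M) A" "A \<subseteq> U" and Y: "Y = I \<inter> A"
    and s_B: "\<And>y. y \<in> B \<Longrightarrow> s y \<in> Y" "\<And>y. y \<in> B \<Longrightarrow> \<tau> (s y) = y"
    and s_Y: "\<And>q. q \<in> Y \<Longrightarrow> \<tau> q \<in> B" "\<And>q. q \<in> Y \<Longrightarrow> s (\<tau> q) = q"
    and s_zero: "s 0 = \<one>"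
    and smooth_s: "\<And>y. proj Vi y \<in> B \<Longrightarrow> smooth_at euclid M (\<lambda>y. s (proj Vi y)) y"
    and fderiv_s: "\<And>v. fderiv (\<lambda>y. \<kappa> (s (proj Vi y))) 0 v = proj Vi v"
begin

text \<open>The charts are the left translates of the slice at the identity.\<close>

definition "Z p = {q \<in> I. inv p \<otimes> q \<in> Y}"

definition "\<tau>' p q = \<tau> (inv p \<otimes> q)"

definition L :: "('a, 'e) mfd" where
  "L = \<lparr>mtop = subtopology (mtop M) I, model = Vi, atlas = {(Z p, \<tau>' p) | p. p \<in> I}\<rparr>"

lemma L_simps: "mtop L = subtopology (mtop M) I" "model L = Vi" "p \<in> I \<Longrightarrow> (Z p, \<tau>' p) \<in> atlas L"
  by (auto simp: L_def)

lemma B_Vi: "y \<in> B \<Longrightarrow> proj Vi y = y"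
  using openin_imp_subset[OF B(1)] proj_id[OF Vi(1)] by blast

lemma points_L: "points L = I"
  using I_carrier points_eq by (auto simp: L_def)

lemma Y_iff: "q \<in> Y \<longleftrightarrow> q \<in> I \<and> q \<in> A" by (simp add: Y)

lemma YU: "q \<in> Y \<Longrightarrow> q \<in> U" using Y_iff A(2) by blast

lemma Z_iff: "p \<in> I \<Longrightarrow> q \<in> Z p \<longleftrightarrow> q \<in> I \<and> inv p \<otimes> q \<in> A"
  using I_mult[OF I_inv] by (auto simp: Z_def Y_iff)

lemma Z_self: "p \<in> I \<Longrightarrow> p \<in> Z p"
  using s_B(1)[OF B(2)] I_carrier by (simp add: Z_def s_zero)

lemma translate_s: "p \<in> I \<Longrightarrow> y \<in> B \<Longrightarrow> p \<otimes> s y \<in> Z p \<and> \<tau>' p (p \<otimes> s y) = y"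
proof -
  assume p: "p \<in> I" and y: "y \<in> B"
  have sI: "s y \<in> I" using s_B(1)[OF y] Y_iff by blast
  have "inv p \<otimes> (p \<otimes> s y) = s y" using I_carrier[OF p] I_carrier[OF sI] by (simp add: m_assoc[symmetric])
  then show ?thesis using s_B[OF y] I_mult[OF p sI] by (simp add: Z_def \<tau>'_def)
qed

lemma s_translate: "p \<in> I \<Longrightarrow> q \<in> Z p \<Longrightarrow> \<tau>' p q \<in> B \<and> p \<otimes> s (\<tau>' p q) = q"
  using s_Y I_carrier by (auto simp: Z_def \<tau>'_def m_assoc[symmetric])

lemma smooth_at_\<tau>': "p \<in> I \<Longrightarrow> q \<in> Z p \<Longrightarrow> smooth_at M euclid (\<tau>' p) q"
  unfolding \<tau>'_def
  by (rule smooth_at_compose[OF M M smooth_atlas_euclid, where f="\<lambda>q. inv p \<otimes> q"])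
    (auto intro!: smooth_at_translation smooth_at_\<tau> YU dest: I_carrier simp: Z_def)

lemma smooth_translate_s:
  assumes "p \<in> I" "proj Vi y \<in> B"
  shows "smooth_at euclid M (\<lambda>y. p \<otimes> s (proj Vi y)) y"
proof (rule smooth_at_mult[OF smooth_atlas_euclid])
  show "smooth_at euclid M (\<lambda>y. p) y"
    using assms I_carrier points_eq by (intro smooth_at_const[OF smooth_atlas_euclid M]) (auto simp: flat_def)
qed (rule smooth_s[OF assms(2)])

lemma eventually_B: "proj Vi y \<in> B \<Longrightarrow> \<forall>\<^sub>F z in nhds y. proj Vi z \<in> B"
  using eventually_nhds_in_open[OF open_vimage_proj[OF Vi(1) B(1)], of y] by simp

lemma inv_into_\<tau>': 
  assumes "p \<in> I" "y \<in> B"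
  shows "inv_into (Z p) (\<tau>' p) y = p \<otimes> s y"
proof -
  have "inj_on (\<tau>' p) (Z p)" using s_translate[OF assms(1)] by (metis inj_onI)
  then show ?thesis using translate_s[OF assms] inv_into_f_f by metis
qed

lemma image_\<tau>':
  assumes p: "p \<in> I" and Q: "openin (subtopology (mtop M) I) Q" "Q \<subseteq> Z p"
  shows "openin (top_of_set Vi) (\<tau>' p ` Q)"
proof -
  obtain Q' where Q': "openin (mtop M) Q'" "Q = Q' \<inter> I" using Q(1) by (auto simp: openin_subtopology)
  have cs: "continuous_map (top_of_set B) (mtop M) (\<lambda>y. p \<otimes> s (proj Vi y))"
    by (rule continuous_map_from_euclid[OF smooth_translate_s[OF p]]) (simp add: B_Vi)
  have "openin (top_of_set B) {y \<in> topspace (top_of_set B). p \<otimes> s (proj Vi y) \<in> Q'}"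
    by (rule openin_continuous_map_preimage[OF cs Q'(1)])
  moreover have "{y \<in> topspace (top_of_set B). p \<otimes> s (proj Vi y) \<in> Q'} = \<tau>' p ` Q"
  proof (intro equalityI subsetI)
    fix y assume "y \<in> {y \<in> topspace (top_of_set B). p \<otimes> s (proj Vi y) \<in> Q'}"
    then have y: "y \<in> B" "p \<otimes> s y \<in> Q'" by (auto simp: B_Vi)
    then have "p \<otimes> s y \<in> Q" "\<tau>' p (p \<otimes> s y) = y" using translate_s[OF p y(1)] Q' by (auto simp: Z_def)
    then show "y \<in> \<tau>' p ` Q" by (metis image_eqI)
  next
    fix y assume "y \<in> \<tau>' p ` Q"
    then obtain q where q: "q \<in> Q" "y = \<tau>' p q" by blast
    then have "q \<in> Z p" "q \<in> Q'" using Q Q' by auto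
    then show "y \<in> {y \<in> topspace (top_of_set B). p \<otimes> s (proj Vi y) \<in> Q'}"
      using s_translate[OF p, of q] q by (simp add: B_Vi)
  qed
  ultimately show ?thesis using B(1) openin_trans by metis
qed

lemma chart_L:
  assumes p: "p \<in> I" shows "chart (subtopology (mtop M) I) Vi (Z p) (\<tau>' p)"
proof (rule chartI)
  have pc: "inv p \<in> carrier G" using p I_carrier by simp
  have pre: "openin (subtopology (mtop M) I) {q \<in> I. inv p \<otimes> q \<in> W}" if "openin (mtop M) W" for W
  proof -
    have "openin (mtop M) {y \<in> topspace (mtop M). inv p \<otimes> y \<in> W}"
      using openin_translate[OF that I_carrier[OF p]] .
    moreover have "{q \<in> I. inv p \<otimes> q \<in> W} = {y \<in> topspace (mtop M). inv p \<otimes> y \<in> W} \<inter> I"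
      using I_carrier points_eq by auto
    ultimately show ?thesis by (auto simp: openin_subtopology)
  qed
  have "Z p = {q \<in> I. inv p \<otimes> q \<in> A}" using Z_iff[OF p] by blast
  then show Zo: "openin (subtopology (mtop M) I) (Z p)" using pre[OF A(1)] by simp
  show "inj_on (\<tau>' p) (Z p)" using s_translate[OF p] by (metis inj_onI)
  show "openin (top_of_set Vi) (\<tau>' p ` Q)" if "openin (subtopology (mtop M) I) Q" "Q \<subseteq> Z p" for Q
    by (rule image_\<tau>'[OF p that])
  show "openin (subtopology (mtop M) I) {q \<in> Z p. \<tau>' p q \<in> S}" if S: "open S" for S
  proof -
    have "open ((\<lambda>x. proj Vi (x - a)) -` S)"
      by (rule open_vimage[OF S]) (auto intro!: continuous_on_compose2[OF continuous_on_proj[OF Vi(1)]] continuous_intros)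
    from chart_preimage_open[OF M c this]
    have "openin (mtop M) {q \<in> U. \<tau> q \<in> S}" by (simp add: \<tau>_def)
    from openin_Int[OF Zo pre[OF this]]
    have "openin (subtopology (mtop M) I) (Z p \<inter> {q \<in> I. inv p \<otimes> q \<in> {q \<in> U. \<tau> q \<in> S}})" .
    moreover have "Z p \<inter> {q \<in> I. inv p \<otimes> q \<in> {q \<in> U. \<tau> q \<in> S}} = {q \<in> Z p. \<tau>' p q \<in> S}"
      using YU by (auto simp: Z_def \<tau>'_def)
    ultimately show ?thesis by simp
  qed
qed

lemma transition_L:
  assumes p: "p \<in> I" and q: "q \<in> I"
  shows "smooth_on Vi (\<tau>' p ` (Z p \<inter> Z q)) (\<tau>' q \<circ> inv_into (Z p) (\<tau>' p))"
proof -
  have op: "openin (top_of_set Vi) (\<tau>' p ` (Z p \<inter> Z q))"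
    by (rule image_\<tau>'[OF p]) (use chart_imp(1)[OF chart_L[OF p]] chart_imp(1)[OF chart_L[OF q]] in auto)
  have "smooth_near (\<lambda>y. (\<tau>' q \<circ> inv_into (Z p) (\<tau>' p)) (proj Vi y)) (\<tau>' p x)"
    if x: "x \<in> Z p \<inter> Z q" for x
  proof -
    have t: "\<tau>' p x \<in> B" "p \<otimes> s (\<tau>' p x) = x" using s_translate[OF p] x by auto
    have tB: "proj Vi (\<tau>' p x) \<in> B" using t by (simp add: B_Vi)
    have "smooth_at euclid euclid (\<lambda>y. \<tau>' q (p \<otimes> s (proj Vi y))) (\<tau>' p x)"
      by (rule smooth_at_compose[OF smooth_atlas_euclid M smooth_atlas_euclid smooth_translate_s[OF p tB]])
        (use smooth_at_\<tau>'[OF q, of x] x t in \<open>simp add: B_Vi\<close>)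
    then have sm: "smooth_near (\<lambda>y. \<tau>' q (p \<otimes> s (proj Vi y))) (\<tau>' p x)" by (simp add: smooth_at_euclid)
    show ?thesis
      by (rule smooth_near_cong[OF sm])
        (use eventually_B[OF tB] in eventually_elim, simp add: inv_into_\<tau>'[OF p])
  qed
  then show ?thesis unfolding smooth_on_iff_near_proj[OF Vi(1) op] by blast
qed

lemma smooth_manifold_L: "smooth_manifold L"
  unfolding smooth_manifold_def
proof (intro conjI)
  have "smooth_manifold M" using lie by (simp add: lie_group_def)
  then have MM: "Hausdorff_space (mtop M)" "second_countable (mtop M)" by (auto simp: smooth_manifold_def)
  show "subspace (model L)" by (simp add: L_simps Vi(1))
  show "Hausdorff_space (mtop L)" by (simp add: L_simps Hausdorff_space_subtopology MM)
  show "second_countable (mtop L)" by (simp add: L_simps second_countable_subtopology MM)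
  show "\<forall>(U, \<kappa>)\<in>atlas L. chart (mtop L) (model L) U \<kappa>" using chart_L by (auto simp: L_def)
  have "(\<Union>(U, \<kappa>)\<in>atlas L. U) = I"
  proof (intro equalityI subsetI)
    fix x assume x: "x \<in> I"
    show "x \<in> (\<Union>(U, \<kappa>)\<in>atlas L. U)" by (rule UN_I[OF L_simps(3)[OF x]]) (simp add: Z_self[OF x])
  qed (auto simp: L_def Z_def)
  then show "(\<Union>(U, \<kappa>)\<in>atlas L. U) = points L" by (simp add: points_L)
  show "\<forall>(U, \<kappa>)\<in>atlas L. \<forall>(W, \<psi>)\<in>atlas L. smooth_on (model L) (\<kappa> ` (U \<inter> W)) (\<psi> \<circ> inv_into U \<kappa>)"
    using transition_L by (auto simp: L_def)
qed

lemma L: "smooth_atlas L" by (rule smooth_manifold_imp_atlas[OF smooth_manifold_L])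

lemma param_L: "p \<in> I \<Longrightarrow> proj Vi y \<in> B \<Longrightarrow> param L (Z p) (\<tau>' p) y = p \<otimes> s (proj Vi y)"
  by (simp add: param_def L_simps inv_into_\<tau>')

lemma \<tau>'_self: "p \<in> I \<Longrightarrow> \<tau>' p p = 0"
  using I_carrier s_B(2)[OF B(2)] s_zero by (simp add: \<tau>'_def)

lemma proj_zero_B: "proj Vi 0 \<in> B" by (simp add: proj_zero[OF Vi(1)] B(2))

lemma smooth_near_inclusion:
  assumes x: "x \<in> I" and F: "smooth_at M N F x" and N: "smooth_atlas N" and d: "(W, \<psi>) \<in> atlas N" "F x \<in> W"
  shows "smooth_near (\<lambda>y. \<psi> (F (param L (Z x) (\<tau>' x) y))) 0"
    and "\<forall>\<^sub>F y in nhds 0. param L (Z x) (\<tau>' x) y = x \<otimes> s (proj Vi y)"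
proof -
  show ev: "\<forall>\<^sub>F y in nhds 0. param L (Z x) (\<tau>' x) y = x \<otimes> s (proj Vi y)"
    using eventually_B[OF proj_zero_B] by eventually_elim (rule param_L[OF x])
  have x0: "x \<otimes> s (proj Vi 0) = x" using I_carrier[OF x] by (simp add: proj_zero[OF Vi(1)] s_zero)
  have "smooth_at euclid N (\<lambda>y. F (x \<otimes> s (proj Vi y))) 0"
    by (rule smooth_at_compose[OF smooth_atlas_euclid M N smooth_translate_s[OF x proj_zero_B]]) (simp add: x0 F)
  then have "smooth_near (\<lambda>y. \<psi> (F (x \<otimes> s (proj Vi y)))) 0"
    using smooth_at_from_euclid[where g="\<lambda>y. F (x \<otimes> s (proj Vi y))" and x=0, OF N d(1)] d(2) x0 by simp
  then show "smooth_near (\<lambda>y. \<psi> (F (param L (Z x) (\<tau>' x) y))) 0"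
    by (rule smooth_near_cong) (use ev in eventually_elim, simp)
qed

lemma smooth_inclusion: assumes x: "x \<in> I" shows "smooth_at L M (\<lambda>x. x) x"
proof -
  have xp: "x \<in> points M" using I_carrier[OF x] points_eq by simp
  obtain W \<psi> where d: "(W, \<psi>) \<in> atlas M" "x \<in> W" using point_in_chart[OF M xp] by metis
  have "continuous_map (mtop L) (mtop M) (\<lambda>x. x)"
    by (simp add: L_simps continuous_map_from_subtopology)
  then have "cont_at (mtop L) (mtop M) (\<lambda>x. x) x"
    by (rule cont_at_of_continuous_map) (simp add: points_L x)
  then show ?thesis
    using smooth_at_charts[where f="\<lambda>x. x", OF L M L_simps(3)[OF x] Z_self[OF x] d]
      smooth_near_inclusion(1)[OF x smooth_at_ident[OF M xp] M d] by (simp add: \<tau>'_self[OF x])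
qed

text \<open>The charts of \<open>L\<close> extend to smooth maps on open sets of \<open>M\<close> and \<open>L\<close> has the subspace
  topology, so smoothness into \<open>L\<close> is smoothness into \<open>M\<close>.  Hence all smooth operations of \<open>M\<close>
  that preserve \<open>I\<close> restrict.\<close>

lemma smooth_into_L:
  assumes N: "smooth_atlas N" and f: "smooth_at N M f q" and R: "openin (mtop N) R" "q \<in> R" "f ` R \<subseteq> I"
  shows "smooth_at N L f q"
proof -
  have fq: "f q \<in> I" using R by auto
  obtain W \<psi> where d: "(W, \<psi>) \<in> atlas N" "q \<in> W"
    using point_in_chart[OF N smooth_at_points(1)[OF N M f]] by metis
  have cf: "cont_at (mtop N) (mtop M) f q" by (rule smooth_at_cont[OF N M f])
  have "cont_at (mtop N) (mtop L) f q"
    unfolding cont_at_def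
  proof (intro conjI allI impI)
    show "q \<in> points N" by (rule smooth_at_points(1)[OF N M f])
    show "f q \<in> points L" by (simp add: points_L fq)
    fix E assume "openin (mtop L) E \<and> f q \<in> E"
    then obtain E' where E': "openin (mtop M) E'" "E = E' \<inter> I" "f q \<in> E'"
      by (auto simp: L_simps openin_subtopology)
    obtain Q where "openin (mtop N) Q" "q \<in> Q" "f ` Q \<subseteq> E'" using cont_atD[OF cf E'(1,3)] by metis
    then show "\<exists>Q. openin (mtop N) Q \<and> q \<in> Q \<and> f ` Q \<subseteq> E"
      using R E' by (intro exI[of _ "Q \<inter> R"]) auto
  qed
  moreover have "smooth_at N euclid (\<lambda>x. \<tau>' (f q) (f x)) q"
    by (rule smooth_at_compose[OF N M smooth_atlas_euclid f smooth_at_\<tau>'[OF fq Z_self[OF fq]]])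
  then have "smooth_near (\<lambda>y. \<tau>' (f q) (f (param N W \<psi> y))) (\<psi> q)"
    unfolding smooth_at_to_euclid[OF N d] .
  ultimately show ?thesis
    using smooth_at_charts[where f=f, OF N L d L_simps(3)[OF fq] Z_self[OF fq]] by simp
qed

text \<open>Both group structures of the brace are covered by the parameter \<open>J\<close>, although the charts of
  \<open>L\<close> are translates for the first one.\<close>

lemma lie_subgroup_L:
  assumes J: "lie_group_chart M J U \<kappa>" and sub: "subgroup I J"
  shows "lie_subgroup M J L"
proof -
  interpret J: lie_group_chart M J U \<kappa> by (rule J)
  have grp: "group (J\<lparr>carrier := I\<rparr>)" by (rule J.subgroup_imp_group[OF sub])
  have inv: "inv\<^bsub>J\<lparr>carrier := I\<rparr>\<^esub> x = inv\<^bsub>J\<^esub> x" if "x \<in> I" for x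
    using J.m_inv_consistent[OF sub that] .
  have mem: "x \<otimes>\<^bsub>J\<^esub> y \<in> I" "inv\<^bsub>J\<^esub> x \<in> I" if "x \<in> I" "y \<in> I" for x y
    using subgroup.m_closed[OF sub] subgroup.m_inv_closed[OF sub] that by auto
  have P: "smooth_atlas (prod_mfd L L)" by (rule smooth_atlas_prod[OF L L])
  have pP: "points (prod_mfd L L) = I \<times> I" using points_L by (simp add: prod_mfd_def)
  have mult: "smooth_map (prod_mfd L L) L (\<lambda>(x, y). x \<otimes>\<^bsub>J\<lparr>carrier := I\<rparr>\<^esub> y)"
    unfolding smooth_map_def
  proof (intro conjI ballI)
    show "(\<lambda>(x, y). x \<otimes>\<^bsub>J\<lparr>carrier := I\<rparr>\<^esub> y) ` points (prod_mfd L L) \<subseteq> points L"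
      unfolding pP points_L using mem by auto
    fix z assume "z \<in> points (prod_mfd L L)"
    then obtain x y where z: "z = (x, y)" "x \<in> I" "y \<in> I" unfolding pP by auto
    have "smooth_at (prod_mfd L L) M (\<lambda>z. fst z) z" "smooth_at (prod_mfd L L) M (\<lambda>z. snd z) z"
      using smooth_at_compose[OF P L M smooth_at_fst(1)[OF L L, of x y]] smooth_inclusion[of x]
        smooth_at_compose[OF P L M smooth_at_fst(2)[OF L L, of x y]] smooth_inclusion[of y]
      by (auto simp: z points_L)
    from J.smooth_at_mult[OF P this]
    have "smooth_at (prod_mfd L L) M (\<lambda>(x, y). x \<otimes>\<^bsub>J\<^esub> y) z" by (simp add: case_prod_unfold)
    moreover have "z \<in> points (prod_mfd L L)" using z pP by simp
    moreover have "(\<lambda>(x, y). x \<otimes>\<^bsub>J\<^esub> y) ` points (prod_mfd L L) \<subseteq> I"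
      unfolding pP using mem by auto
    ultimately have "smooth_at (prod_mfd L L) L (\<lambda>(x, y). x \<otimes>\<^bsub>J\<^esub> y) z"
      by (intro smooth_into_L[OF P _ openin_topspace])
    then show "smooth_at (prod_mfd L L) L (\<lambda>(x, y). x \<otimes>\<^bsub>J\<lparr>carrier := I\<rparr>\<^esub> y) z" by simp
  qed
  have invs: "smooth_map L L (\<lambda>x. inv\<^bsub>J\<lparr>carrier := I\<rparr>\<^esub> x)"
    unfolding smooth_map_def points_L
  proof (intro conjI ballI)
    show "(\<lambda>x. inv\<^bsub>J\<lparr>carrier := I\<rparr>\<^esub> x) ` I \<subseteq> I" using inv mem by auto
    fix x assume x: "x \<in> I"
    have "smooth_at L L (\<lambda>x. inv\<^bsub>J\<^esub> x) x"
      by (rule smooth_into_L[OF L J.smooth_at_inv[OF L smooth_inclusion[OF x]] openin_topspace])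
        (use x mem points_L in auto)
    then show "smooth_at L L (\<lambda>x. inv\<^bsub>J\<lparr>carrier := I\<rparr>\<^esub> x) x"
      by (rule smooth_at_cong[OF L _ openin_topspace]) (use x inv points_L in auto)
  qed
  have incl: "smooth_map L M (\<lambda>g. g)"
    unfolding smooth_map_def points_L using smooth_inclusion I_carrier points_eq by auto
  have imm: "inj_on (differential L M (\<lambda>g. g) p) (tangent_space L p)" if p: "p \<in> I" for p
  proof (rule inj_onI)
    fix x y assume x: "x \<in> tangent_space L p" and y: "y \<in> tangent_space L p"
      and eq: "differential L M (\<lambda>g. g) p x = differential L M (\<lambda>g. g) p y"
    note ch = L L_simps(3)[OF p] Z_self[OF p]
    obtain v w where vw: "v \<in> Vi" "w \<in> Vi" "x = coord_vector L (Z p) (\<tau>' p) p v" "y = coord_vector L (Z p) (\<tau>' p) p w"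
      using x y unfolding tangent_space_eq[OF ch] L_simps by auto
    have "v \<bullet> b = w \<bullet> b" for b
    proof -
      have "smooth_at M euclid (\<lambda>q. \<tau>' p q \<bullet> b) p"
        by (rule smooth_at_compose[OF M smooth_atlas_euclid smooth_atlas_euclid smooth_at_\<tau>'[OF p Z_self[OF p]], of "\<lambda>x. x \<bullet> b"])
          (simp add: smooth_at_euclid smooth_near_linear bounded_linear_inner_left)
      then have "smooth_at M real_line (\<lambda>q. \<tau>' p q \<bullet> b) p" by (simp add: real_line_flat)
      then have d: "app (differential L M (\<lambda>g. g) p x) (\<lambda>q. \<tau>' p q \<bullet> b) = app x (\<lambda>q. \<tau>' p q \<bullet> b)" for x
        by (simp add: differential_def app_local_functional o_def)
      have "app x (\<lambda>q. \<tau>' p q \<bullet> b) = app y (\<lambda>q. \<tau>' p q \<bullet> b)"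
        using d[of x] d[of y] eq by simp
      then show ?thesis
        using app_chart_component[OF ch, of v b] app_chart_component[OF ch, of w b] vw by (simp add: L_simps)
    qed
    then have "v = w" by (subst euclidean_eq_iff) blast
    then show "x = y" using vw by simp
  qed
  show ?thesis
    unfolding lie_subgroup_def lie_group_def points_L
    using sub smooth_manifold_L grp mult invs incl imm by simp
qed

lemma lie_of_subgroup_L: "lie_of_subgroup M G L = coord_vector M U \<kappa> \<one> ` Vi"
proof -
  note ch = L L_simps(3)[OF one_I] Z_self[OF one_I]
  have "fderiv (\<lambda>y. \<kappa> (param L (Z \<one>) (\<tau>' \<one>) y)) (\<tau>' \<one> \<one>) v = v" if v: "v \<in> Vi" for v
  proof -
    have one: "\<one> \<otimes> s (proj Vi y) = s (proj Vi y)" if "proj Vi y \<in> B" for y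
      using s_B(1)[OF that] Y_iff I_carrier by simp
    have "\<forall>\<^sub>F y in nhds 0. \<kappa> (param L (Z \<one>) (\<tau>' \<one>) y) = \<kappa> (s (proj Vi y))"
      using eventually_B[OF proj_zero_B] by eventually_elim (simp add: param_L[OF one_I] one)
    then have "fderiv (\<lambda>y. \<kappa> (param L (Z \<one>) (\<tau>' \<one>) y)) 0 v = fderiv (\<lambda>y. \<kappa> (s (proj Vi y))) 0 v" by (rule fderiv_cong_at)
    then show ?thesis using fderiv_s proj_id[OF Vi(1) v] \<tau>'_self[OF one_I] by simp
  qed
  then have "differential L M (\<lambda>g. g) \<one> (coord_vector L (Z \<one>) (\<tau>' \<one>) \<one> v) = coord_vector M U \<kappa> \<one> v" if "v \<in> Vi" for v
    using differential_coord_vector[OF ch M smooth_inclusion[OF one_I] c one_U, of v] that by simp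
  then show ?thesis
    unfolding lie_of_subgroup_def tangent_space_eq[OF ch] L_simps image_image by (rule image_cong[OF refl])
qed

theorem ideal_L: "lie_skew_brace_ideal_mfd M G H L"
  unfolding lie_skew_brace_ideal_mfd_def points_L
proof (intro conjI ballI)
  show "lie_subgroup M G L" by (rule lie_subgroup_L[OF lie_group_chart_axioms subgroup_I])
  show "lie_subgroup M H L" by (rule lie_subgroup_L[OF H.lie_group_chart_axioms subgroup_I_H])
  show "connected_space (mtop L)" using connected_I by (simp add: L_simps connectedin_def)
qed (use closed_I normal_I normal_I_H lam_I points_eq in auto)

text \<open>If \<open>I\<close> is a point, so is the open subset \<open>B\<close> of \<open>Vi\<close> that parametrises a part of it.\<close>

lemma Vi_zero_of_trivial: assumes "I = {\<one>}" shows "Vi = {0}"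
proof -
  have "y = 0" if "y \<in> B" for y
    using s_B[OF that] s_B[OF B(2)] assms Y_iff by (metis singletonD)
  then have B0: "B = {0}" using B(2) by blast
  show ?thesis
  proof (rule ccontr)
    assume "Vi \<noteq> {0}"
    then obtain v where v: "v \<in> Vi" "v \<noteq> 0" using subspace_0[OF Vi(1)] by auto
    obtain T where T: "open T" "B = Vi \<inter> T" using B(1) by (auto simp: openin_open)
    then have "0 \<in> T" using B(2) by blast
    then obtain e where e: "e > 0" "ball 0 e \<subseteq> T" using openE[OF T(1)] by metis
    define w where "w = (e / (2 * norm v)) *\<^sub>R v"
    have "norm w = e / 2" using v e by (simp add: w_def)
    then have "w \<in> T" "w \<noteq> 0" using e by auto
    moreover have "w \<in> Vi" unfolding w_def by (rule subspace_scale[OF Vi(1) v(1)])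
    ultimately show False using T B0 by blast
  qed
qed

end

section \<open>Vector groups\<close>

definition vector_group :: "'e::real_vector set \<Rightarrow> 'e monoid" where
  "vector_group C = \<lparr>carrier = C, monoid.mult = (+), one = 0\<rparr>"

context
  fixes C :: "'e::euclidean_space set" assumes C: "subspace C"
begin

lemma comm_group_vector_group: "comm_group (vector_group C)"
proof (rule comm_groupI)
  show "\<exists>y\<in>carrier (vector_group C). y \<otimes>\<^bsub>vector_group C\<^esub> x = \<one>\<^bsub>vector_group C\<^esub>"
    if "x \<in> carrier (vector_group C)" for x
    using that subspace_neg[OF C] by (intro bexI[of _ "- x"]) (auto simp: vector_group_def)
qed (use C in \<open>auto simp: vector_group_def subspace_add subspace_0\<close>)

lemma inv_vector_group: "x \<in> C \<Longrightarrow> inv\<^bsub>vector_group C\<^esub> x = - x"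
proof -
  assume x: "x \<in> C"
  interpret comm_group "vector_group C" by (rule comm_group_vector_group)
  show ?thesis
    by (rule inv_equality) (use x subspace_neg[OF C] in \<open>auto simp: vector_group_def\<close>)
qed

lemma lie_group_flat: "lie_group (flat C) (vector_group C)"
proof -
  note fl = smooth_atlas_flat[OF C] flat_simps(3)[OF C]
  have pts: "points (flat C) = C" by (simp add: flat_def)
  have P: "smooth_atlas (prod_mfd (flat C) (flat C))" by (rule smooth_atlas_prod[OF fl(1) fl(1)])
  have pP: "points (prod_mfd (flat C) (flat C)) = C \<times> C" by (simp add: prod_mfd_def pts)
  have "smooth_at (prod_mfd (flat C) (flat C)) (flat C) (\<lambda>(x, y). x + y) (x, y)" if xy: "x \<in> C" "y \<in> C" for x y
  proof -
    have "smooth_near (\<lambda>z. proj C (fst z) + proj C (snd z)) (x, y)"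
      by (intro smooth_near_add smooth_near_compose_linear[OF bounded_linear_proj[OF C]]
          smooth_near_fst smooth_near_snd smooth_near_id)
    moreover have "\<forall>\<^sub>F z in nhds (x, y). proj C (fst z) + proj C (snd z) =
        (case param (prod_mfd (flat C) (flat C)) (C \<times> C) (map_prod (\<lambda>x. x) (\<lambda>x. x)) z of (x, y) \<Rightarrow> x + y)"
      using eventually_param_prod[OF fl(1) fl(1) fl(2) xy(1) fl(2) xy(2)]
      by eventually_elim (simp add: param_flat[OF C])
    ultimately have sm: "smooth_near (\<lambda>z. case param (prod_mfd (flat C) (flat C)) (C \<times> C) (map_prod (\<lambda>x. x) (\<lambda>x. x)) z of (x, y) \<Rightarrow> x + y)
       (map_prod (\<lambda>x. x) (\<lambda>x. x) (x, y))"
      using smooth_near_cong by fastforce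
    show ?thesis
      by (rule smooth_at_to_flat[OF C P atlas_prodI[OF fl(2) fl(2)] _ openin_topspace, THEN iffD2, OF _ _ _ sm])
        (use xy pP subspace_add[OF C] in auto)
  qed
  then have mult: "smooth_map (prod_mfd (flat C) (flat C)) (flat C) (\<lambda>(x, y). x \<otimes>\<^bsub>vector_group C\<^esub> y)"
    unfolding smooth_map_def pP pts using subspace_add[OF C] by (auto simp: vector_group_def)
  have inv: "smooth_map (flat C) (flat C) (\<lambda>x. inv\<^bsub>vector_group C\<^esub> x)"
    unfolding smooth_map_def pts
  proof (intro conjI ballI)
    show "(\<lambda>x. inv\<^bsub>vector_group C\<^esub> x) ` C \<subseteq> C" using subspace_neg[OF C] by (auto simp: inv_vector_group)
    fix x assume x: "x \<in> C"
    have "smooth_near (\<lambda>y. - proj C y) x"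
      by (rule smooth_near_compose_linear[OF bounded_linear_minus[OF bounded_linear_ident] smooth_near_proj[OF C]])
    then have sm: "smooth_near (\<lambda>y. inv\<^bsub>vector_group C\<^esub> (param (flat C) C (\<lambda>x. x) y)) ((\<lambda>x. x) x)"
      by (simp add: param_flat[OF C] inv_vector_group proj_in[OF C])
    show "smooth_at (flat C) (flat C) (\<lambda>x. inv\<^bsub>vector_group C\<^esub> x) x"
      by (rule smooth_at_to_flat[OF C fl x openin_topspace, THEN iffD2, OF _ _ sm])
        (use x pts subspace_neg[OF C] in \<open>auto simp: inv_vector_group\<close>)
  qed
  have "group (vector_group C)" using comm_group_vector_group by (simp add: comm_group_def)
  then show ?thesis
    unfolding lie_group_def using smooth_manifold_flat[OF C] mult inv by (simp add: pts vector_group_def)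
qed

lemma simply_connected_flat: "simply_connected_mfd (flat C)"
proof -
  have cv: "convex C" by (rule subspace_imp_convex[OF C])
  have "simply_connected C" by (rule convex_imp_simply_connected[OF cv])
  then have "simply_connected_space (top_of_set C)"
    unfolding simply_connected_space_def
  proof (intro allI impI)
    fix p q assume pq: "pathin (top_of_set C) p \<and> p 1 = p 0 \<and> pathin (top_of_set C) q \<and> q 1 = q 0"
    then have "path p" "pathfinish p = pathstart p" "path_image p \<subseteq> C"
      "path q" "pathfinish q = pathstart q" "path_image q \<subseteq> C"
      by (auto simp: pathin_canon_iff path_image_def pathstart_def pathfinish_def)
    then have "homotopic_loops C p q"
      using \<open>simply_connected C\<close> unfolding simply_connected_def by blast
    then show "homotopic_with (\<lambda>r. r 1 = r 0) (top_of_set {0..1}) (top_of_set C) p q"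
      unfolding homotopic_loops_def pathfinish_def pathstart_def .
  qed
  moreover have "connected_space (top_of_set C)"
    using convex_connected[OF cv] by (simp add: connected_space_subtopology)
  ultimately show ?thesis by (simp add: simply_connected_mfd_def flat_def)
qed

end

section \<open>Homomorphisms from ideals with trivial quotient\<close>

text \<open>The product of \<open>x\<close> and \<open>y\<close> lies in the product of their cosets, and this is the zero
  \<open>\<ii>\<close> of the quotient.\<close>

lemma trivial_quotient_products:
  assumes id: "post_lie_ideal P \<ii>" and tr: "trivial_post_lie \<ii> (quotient_post_lie P \<ii>)"
    and x: "x \<in> space P" and y: "y \<in> space P"
  shows "dot_bracket P x y \<in> \<ii>" "tri P x y \<in> \<ii>"
proof -
  have z: "0 \<in> \<ii>" using id subspace_0 by (auto simp: post_lie_ideal_def)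
  have mem: "m x y \<in> \<ii>" if "quotient_op m \<ii> ((+) x ` \<ii>) ((+) y ` \<ii>) = \<ii>" for m
  proof -
    have "x \<in> (+) x ` \<ii>" "y \<in> (+) y ` \<ii>" using z by force+
    moreover have "m x y \<in> (+) (m x y) ` \<ii>" using z by force
    ultimately have "m x y \<in> quotient_op m \<ii> ((+) x ` \<ii>) ((+) y ` \<ii>)" unfolding quotient_op_def by blast
    then show ?thesis using that by simp
  qed
  have "(+) x ` \<ii> \<in> space (quotient_post_lie P \<ii>)" "(+) y ` \<ii> \<in> space (quotient_post_lie P \<ii>)"
    using x y by (auto simp: quotient_post_lie_def)
  then have "dot_bracket (quotient_post_lie P \<ii>) ((+) x ` \<ii>) ((+) y ` \<ii>) = \<ii>"
    "tri (quotient_post_lie P \<ii>) ((+) x ` \<ii>) ((+) y ` \<ii>) = \<ii>"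
    using tr unfolding trivial_post_lie_def by blast+
  then show "dot_bracket P x y \<in> \<ii>" "tri P x y \<in> \<ii>"
    using mem by (simp_all add: quotient_post_lie_def)
qed

context lie_brace_chart
begin

abbreviation "cv \<equiv> coord_vector M U \<kappa> \<one>"

text \<open>The projection \<open>l\<close> onto \<open>C\<close> kills \<open>\<ii>\<close>, so it kills brackets and all \<open>x \<triangleright> y\<close>: the first
  makes it the differential of a homomorphism \<open>\<psi>\<close>, the second makes this invariant under the
  lambda-action.  Composing \<open>\<psi>\<close> with \<open>l\<close> forces its values into \<open>C\<close>.\<close>

theorem brace_hom_of_ideal:
  fixes \<ii> :: "'a functional set"
  assumes sc: "simply_connected_mfd M"
    and id: "post_lie_ideal (associated_post_lie M G H) \<ii>"
    and tr: "trivial_post_lie \<ii> (quotient_post_lie (associated_post_lie M G H) \<ii>)"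
  defines "Vi \<equiv> {v \<in> V. cv v \<in> \<ii>}"
  defines "C \<equiv> {v \<in> V. \<forall>w\<in>Vi. v \<bullet> w = 0}"
  shows "\<ii> = cv ` Vi" "\<exists>\<phi>. brace_hom_chart M G U \<kappa> H Vi C \<phi>"
proof -
  note T = tangent_space_eq[OF M c one_U]
  have sub: "subspace \<ii>" "\<ii> \<subseteq> cv ` V"
    using id T by (auto simp: post_lie_ideal_def associated_post_lie_def)
  then show \<ii>: "\<ii> = cv ` Vi" by (auto simp: Vi_def)
  have Vi: "subspace Vi" "Vi \<subseteq> V"
  proof -
    show "subspace Vi"
      unfolding subspace_def Vi_def using V sub(1)
      by (auto simp: subspace_0 subspace_add subspace_scale coord_vector_add[OF M c one_U]
          coord_vector_scaleR[OF M c one_U] coord_vector_zero[OF M c one_U])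
  qed (auto simp: Vi_def)
  note pc = proj_complement[OF V Vi, folded C_def]
  have prods: "lie_bracket M G (cv u) (cv v) \<in> \<ii>" "brace_tri M G H (cv u) (cv v) \<in> \<ii>"
    if "u \<in> V" "v \<in> V" for u v
    using trivial_quotient_products[OF id tr, of "cv u" "cv v"] that
    by (simp_all add: associated_post_lie_def T)
  have l: "bounded_linear (proj C)" by (rule bounded_linear_proj[OF pc(1)])
  have br: "proj C (mixed_deriv mulc a u v) = proj C (mixed_deriv mulc a v u)" if uv: "u \<in> V" "v \<in> V" for u v
  proof -
    obtain w where w: "w \<in> Vi" "lie_bracket M G (cv u) (cv v) = cv w" using prods(1)[OF uv] \<ii> by blast
    have wV: "w \<in> V" using w(1) Vi by blast
    have "w = mixed_deriv mulc a u v - mixed_deriv mulc a v u" by (rule lie_bracket_coords[OF uv wV w(2)])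
    moreover have "proj C w = 0" using pc(4)[OF wV] w(1) by simp
    ultimately show ?thesis by (simp add: proj_diff[OF pc(1)])
  qed
  have tri: "proj C (mixed_deriv lamc a u v) = 0" if uv: "u \<in> V" "v \<in> V" for u v
  proof -
    obtain w where w: "w \<in> Vi" "brace_tri M G H (cv u) (cv v) = cv w" using prods(2)[OF uv] \<ii> by blast
    have wV: "w \<in> V" using w(1) Vi by blast
    have "w = mixed_deriv lamc a u v" by (rule brace_tri_coords[OF wV w(2)])
    then show ?thesis using pc(4)[OF wV] w(1) by simp
  qed
  have "\<exists>\<psi>. (\<forall>x\<in>carrier G. \<forall>y\<in>carrier G. \<psi> (x \<otimes> y) = \<psi> x + (\<psi> y :: 'e)) \<and>
    (\<forall>p\<in>carrier G. smooth_at M euclid \<psi> p) \<and> (\<forall>v. fderiv (\<lambda>y. \<psi> (\<sigma> y)) a v = proj C (proj V v))"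
    by (rule homomorphism_exists[OF sc l]) (rule br)
  then obtain \<psi> :: "'a \<Rightarrow> 'e" where \<psi>: "\<forall>x\<in>carrier G. \<forall>y\<in>carrier G. \<psi> (x \<otimes> y) = \<psi> x + \<psi> y"
    "\<forall>p\<in>carrier G. smooth_at M euclid \<psi> p" "\<forall>v. fderiv (\<lambda>y. \<psi> (\<sigma> y)) a v = proj C (proj V v)"
    by (elim exE conjE) (rule that)
  define \<phi> where "\<phi> x = proj C (\<psi> x)" for x
  have hom: "\<phi> (x \<otimes> y) = \<phi> x + \<phi> y" if "x \<in> carrier G" "y \<in> carrier G" for x y
    using \<psi>(1) that by (simp add: \<phi>_def proj_add[OF pc(1)])
  have sm: "smooth_at M euclid \<phi> p" if p: "p \<in> carrier G" for p
    unfolding \<phi>_def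
    by (rule smooth_at_compose[OF M smooth_atlas_euclid smooth_atlas_euclid bspec[OF \<psi>(2) p], of "proj C"])
      (simp add: smooth_at_euclid smooth_near_proj[OF pc(1)])
  have d: "fderiv (\<lambda>y. \<phi> (\<sigma> y)) a v = proj C (proj V v)" for v
  proof -
    have "smooth_near (\<lambda>y. \<psi> (\<sigma> y)) a"
      using bspec[OF \<psi>(2) one_closed] unfolding smooth_at_to_euclid[OF M c one_U] .
    from fderiv_compose_linear[OF l this] \<psi>(3) show ?thesis
      by (simp add: \<phi>_def proj_id[OF pc(1) proj_in[OF pc(1)]])
  qed
  have conn: "connected_space (mtop M)" using sc by (simp add: simply_connected_mfd_def)
  have lam: "\<phi> (lam g x) = \<phi> x" if "g \<in> carrier G" "x \<in> carrier G" for g x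
    by (rule lam_invariant[OF conn l hom sm d tri that])
  have "brace_hom_chart M G U \<kappa> H Vi C \<phi>"
  proof unfold_locales
    show "C = {v \<in> V. \<forall>w\<in>Vi. v \<bullet> w = 0}" by (simp add: C_def)
    show "fderiv (\<lambda>y. \<phi> (\<sigma> y)) a v = proj C v" for v using d pc(2) by simp
    show "\<phi> x \<in> C" for x unfolding \<phi>_def by (rule proj_in[OF pc(1)])
  qed (use Vi hom lam sm in auto)
  then show "\<exists>\<phi>. brace_hom_chart M G U \<kappa> H Vi C \<phi>" by blast
qed

end

context brace_hom_chart
begin

lemma smooth_map_\<phi>: "smooth_map M (flat C) \<phi>"
  unfolding smooth_map_def
proof (intro conjI ballI)
  show "\<phi> ` points M \<subseteq> points (flat C)" using \<phi>_C points_eq by (auto simp: flat_def)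
  fix p assume p: "p \<in> points M"
  obtain W \<psi> where d: "(W, \<psi>) \<in> atlas M" "p \<in> W" using point_in_chart[OF M p] by metis
  have "smooth_near (\<lambda>y. \<phi> (param M W \<psi> y)) (\<psi> p)"
    using sm\<phi>[of p] p points_eq unfolding smooth_at_to_euclid[OF M d] by simp
  then show "smooth_at M (flat C) \<phi> p"
    by (rule smooth_at_to_flat[OF C M d openin_topspace p, THEN iffD2, rotated]) (use \<phi>_C points_eq in auto)
qed

lemma brace_hom_\<phi>: "lie_skew_brace_hom M G H (flat C) (vector_group C) (vector_group C) \<phi>"
  unfolding lie_skew_brace_hom_def using smooth_map_\<phi> \<phi>_C hom hom_H carrier_H
  by (auto intro!: homI simp: vector_group_def)

lemma kernel_differential:
  "{x \<in> tangent_space M \<one>. differential M (flat C) \<phi> \<one> x = 0} = coord_vector M U \<kappa> \<one> ` Vi"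
proof -
  note fl = smooth_atlas_flat[OF C] flat_simps(3)[OF C]
  have \<phi>1: "\<phi> \<one> \<in> C" by (rule \<phi>_C) simp
  have s\<phi>: "smooth_at M (flat C) \<phi> \<one>" using smooth_map_\<phi> points_eq by (simp add: smooth_map_def)
  have D: "differential M (flat C) \<phi> \<one> (coord_vector M U \<kappa> \<one> v) = coord_vector (flat C) C (\<lambda>x. x) (\<phi> \<one>) (proj C v)" for v
    using differential_coord_vector[where f=\<phi>, OF M c one_U fl(1) s\<phi> fl(2) \<phi>1, of v] d\<phi> by simp
  have zero: "coord_vector (flat C) C (\<lambda>x. x) (\<phi> \<one>) (proj C v) = 0 \<longleftrightarrow> proj C v = 0" for v
    using inj_onD[OF inj_on_coord_vector[OF fl \<phi>1], of "proj C v" 0] coord_vector_zero[OF fl \<phi>1]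
      proj_in[OF C] subspace_0[OF C] by (auto simp: flat_simps[OF C])
  show ?thesis
    unfolding tangent_space_eq[OF M c one_U] using D zero proj_C_zero Vi(2) by auto
qed

lemma kernel_eq: "kernel G (vector_group C) \<phi> = K"
  by (simp add: kernel_def K_def vector_group_def)

end

theorem proposition2p8:
  fixes M :: "('a, 'e::euclidean_space) mfd"
    and G H :: "'a monoid"
    and \<ii> :: "'a functional set"
  assumes "lie_skew_brace M G H"
    and "simply_connected_mfd M"
    and "post_lie_ideal (associated_post_lie M G H) \<ii>"
    and "trivial_post_lie \<ii> (quotient_post_lie (associated_post_lie M G H) \<ii>)"
  shows "\<exists>(N :: ('e, 'e) mfd) (A :: 'e monoid) (\<phi> :: 'a \<Rightarrow> 'e).
      lie_group N A \<and> comm_group A \<and> simply_connected_mfd N \<and>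
      lie_skew_brace_hom M G H N A A \<phi> \<and>
      {x \<in> tangent_space M \<one>\<^bsub>G\<^esub>. differential M N \<phi> \<one>\<^bsub>G\<^esub> x = 0} = \<ii> \<and>
      (let K = kernel G A \<phi>;
           I = connected_component_of_set (subtopology (mtop M) K) \<one>\<^bsub>G\<^esub>
       in lie_skew_brace_ideal M G H I \<and>
          (\<exists>L. points L = I \<and> lie_skew_brace_ideal_mfd M G H L \<and> lie_of_subgroup M G L = \<ii>)) \<and>
      (\<ii> \<noteq> {0} \<and> \<ii> \<noteq> tangent_space M \<one>\<^bsub>G\<^esub> \<longrightarrow> \<not> simple_lie_skew_brace M G H)"
proof -
  have lie: "lie_group M G" using assms(1) by (simp add: lie_skew_brace_def)
  then have atl: "smooth_atlas M" and "\<one>\<^bsub>G\<^esub> \<in> points M"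
    using smooth_manifold_imp_atlas group.is_monoid monoid.one_closed by (auto simp: lie_group_def)
  then obtain U \<kappa> where c: "(U, \<kappa>) \<in> atlas M" "\<one>\<^bsub>G\<^esub> \<in> U" using point_in_chart by metis
  interpret lie_brace_chart M G U \<kappa> H
    by unfold_locales (use lie c assms(1) in auto)
  define Vi where "Vi = {v \<in> V. cv v \<in> \<ii>}"
  define C where "C = {v \<in> V. \<forall>w\<in>Vi. v \<bullet> w = 0}"
  note * = brace_hom_of_ideal[OF assms(2-4), folded Vi_def, folded C_def]
  obtain \<phi> where "brace_hom_chart M G U \<kappa> H Vi C \<phi>" using *(2) by blast
  then interpret hom: brace_hom_chart M G U \<kappa> H Vi C \<phi> .
  obtain s B Y A where "openin (top_of_set Vi) B \<and> 0 \<in> B \<and> openin (mtop M) A \<and> A \<subseteq> U \<and> Y = hom.I \<inter> A \<and>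
     (\<forall>y\<in>B. s y \<in> Y \<and> hom.\<tau> (s y) = y) \<and> (\<forall>q\<in>Y. hom.\<tau> q \<in> B \<and> s (hom.\<tau> q) = q) \<and> s 0 = \<one>\<^bsub>G\<^esub> \<and>
     (\<forall>y. proj Vi y \<in> B \<longrightarrow> smooth_at euclid M (\<lambda>y. s (proj Vi y)) y) \<and>
     (\<forall>v. fderiv (\<lambda>y. \<kappa> (s (proj Vi y))) 0 v = proj Vi v)"
    using hom.slice_exists by (elim exE)
  then interpret slice: brace_slice M G U \<kappa> H Vi C \<phi> s B Y A
    by unfold_locales auto
  let ?I = "connected_component_of_set (subtopology (mtop M) (kernel G (vector_group C) \<phi>)) \<one>\<^bsub>G\<^esub>"
  have I: "?I = hom.I" by (simp add: hom.kernel_eq hom.I_def)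
  have ideal: "lie_skew_brace_ideal M G H hom.I"
    unfolding lie_skew_brace_ideal_def using slice.points_L slice.ideal_L by blast
  have L: "\<exists>L. points L = hom.I \<and> lie_skew_brace_ideal_mfd M G H L \<and> lie_of_subgroup M G L = \<ii>"
    using slice.points_L slice.ideal_L slice.lie_of_subgroup_L *(1) by blast
  have ker: "{x \<in> tangent_space M \<one>\<^bsub>G\<^esub>. differential M (flat C) \<phi> \<one>\<^bsub>G\<^esub> x = 0} = \<ii>"
    using hom.kernel_differential *(1) by simp
  have nonsimple: "\<not> simple_lie_skew_brace M G H" if ne: "\<ii> \<noteq> {0}" "\<ii> \<noteq> tangent_space M \<one>\<^bsub>G\<^esub>"
  proof
    assume "simple_lie_skew_brace M G H"
    then have "hom.I = {\<one>\<^bsub>G\<^esub>} \<or> hom.I = points M" using ideal by (simp add: simple_lie_skew_brace_def)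
    then show False
    proof
      assume "hom.I = {\<one>\<^bsub>G\<^esub>}"
      then have "Vi = {0}" by (rule slice.Vi_zero_of_trivial)
      then show False using *(1) ne(1) coord_vector_zero[OF M c(1) one_U] by simp
    next
      assume "hom.I = points M"
      then have z: "\<phi> x = 0" if "x \<in> points M" for x using hom.I_K that by (auto simp: hom.K_def)
      have "\<forall>\<^sub>F y in nhds a. \<phi> (\<sigma> y) = 0"
        using eventually_param_near[OF M c(1) openin_topspace chart_subset[OF M c(1) one_U] one_U]
        by eventually_elim (simp add: z)
      then have "fderiv (\<lambda>y. \<phi> (\<sigma> y)) a v = fderiv (\<lambda>y. 0) a v" for v by (rule fderiv_cong_at)
      then have "proj C v = 0" for v using hom.d\<phi>[of v] by (simp add: fderiv_const)
      then have "Vi = V" using hom.proj_C_zero hom.Vi(2) by blast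
      then show False using *(1) ne(2) tangent_space_eq[OF M c(1) one_U] by simp
    qed
  qed
  show ?thesis
    unfolding Let_def
    using lie_group_flat[OF hom.C] comm_group_vector_group[OF hom.C] simply_connected_flat[OF hom.C]
      hom.brace_hom_\<phi> ker ideal L nonsimple
    by (intro exI[of _ "flat C"] exI[of _ "vector_group C"] exI[of _ \<phi>] conjI impI) (simp_all only: I simp_thms, blast?)
qed

end
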